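(* Let $h>0$ and $\beta>0$, and let $q$, $\rho_k$, $\gamma_k$, $\mathbf m^{(k)}$, $\boldsymbol\phi^{(k)}$ and the relation $\simeq$ be as defined in the context. For all $k\in\mathbb N$, $$\left\|\mathbf m^{(k)}\right\|^2\simeq q,$$ and for $1\le j<k$, $$\left\langle\mathbf m^{(j)},\mathbf m^{(k)}\right\rangle\simeq\rho_j,\qquad \left\langle\boldsymbol\phi^{(j)},\mathbf m^{(k)}\right\rangle\simeq\gamma_j .$$
   Context: For $h>0$, $\beta>0$, $q=q(\beta,h)>0$ denotes the unique solution of $q=E\tanh^2(h+\beta\sqrt q\,Z)$. Here $Z,Z',Z''$ are independent standard Gaussians, with expectation $E$. Write $\mathrm{Th}(x)=\tanh(h+\beta x)$; a function $\mathbb R\to\mathbb R$ applied to a vector is applied coordinatewise. Constants: $\alpha=E\,\mathrm{Th}(\sqrt q Z)$; $\psi:[0,q]\to\mathbb R$, $\psi(t)=E\,\mathrm{Th}(\sqrt t Z+\sqrt{q-t}Z')\,\mathrm{Th}(\sqrt t Z+\sqrt{q-t}Z'')$; $\gamma_1=\alpha$, $\rho_1=\gamma_1\sqrt q$, and for $k\ge2$, $\rho_k=\psi(\rho_{k-1})$, $\gamma_k=\dfrac{\rho_k-\Gamma_{k-1}^2}{\sqrt{q-\Gamma_{k-1}^2}}$, where $\Gamma_m^2=\sum_{j=1}^m\gamma_j^2$, $\Gamma_0^2=0$. For each $N\in\mathbb N$, $\mathbf g=(g_{ij})_{1\le i,j\le N}$ is a random matrix on a probability space $(\Omega,\mathcal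 F,\mathbb P)$: the $g_{ij}$, $i<j$, are independent centered Gaussians with variance $1/N$, $g_{ij}=g_{ji}$, $g_{ii}=0$. The dependence on $N$ is suppressed in the notation. For $\mathbf x,\mathbf y\in\mathbb R^N$: $\langle\mathbf x,\mathbf y\rangle=\frac1N\sum_{i=1}^N x_iy_i$, $\|\mathbf x\|=\sqrt{\langle\mathbf x,\mathbf x\rangle}$. Iterates: $\mathbf m^{(0)}=0$, $\mathbf m^{(1)}=\sqrt q\,\mathbf 1$ ($\mathbf 1$ the all-ones vector), $\mathbf m^{(k+1)}=\mathrm{Th}(\mathbf g\,\mathbf m^{(k)}-\beta(1-q)\mathbf m^{(k-1)})$, $k\ge1$. Let $\Pi_j$ be the orthogonal projection in $\mathbb R^N$ (with respect to $\langle\cdot,\cdot\rangle$) onto $\mathrm{span}(\mathbf m^{(1)},\dots,\mathbf m^{(j)})$ ($\Pi_0=0$), $\mathbf M^{(k)}=\mathbf m^{(k)}-\Pi_{k-1}(\mathbf m^{(k)})$, and $\boldsymbol\phi^{(k)}=\mathbf M^{(k)}/\|\mathbf M^{(k)}\|$ if $\|\mathbf M^{(k)}\|\ne0$, $\boldsymbol\phi^{(k)}=\mathbf 1$ otherwise. For two sequences of real random variables $X_N$, $Y_N$, $X_N\simeq Y_N$ means: there is a constant $C>0$ (possibly depending on $\beta,h$ and the levels $k,j$, but not on $N,t$) such that $\mathbb P(|X_N-Y_N|\ge t)\le C\exp[-t^2N/C]$ for all $N\in\mathbb N$ and $0<t\le1$. *)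

theory Defs
  imports "HOL-Probability.Probability"
begin

definition Th :: "real \<Rightarrow> real \<Rightarrow> real \<Rightarrow> real" where
  "Th \<beta> h x = tanh (h + \<beta> * x)"

definition sk_fixed_point :: "real \<Rightarrow> real \<Rightarrow> real \<Rightarrow> bool" where
  "sk_fixed_point \<beta> h q \<longleftrightarrow>
     0 < q \<and> q = (\<integral>z. (tanh (h + \<beta> * sqrt q * z))\<^sup>2 \<partial>std_normal_distribution)"

definition sk_alpha :: "real \<Rightarrow> real \<Rightarrow> real \<Rightarrow> real" where
  "sk_alpha \<beta> h q = (\<integral>z. Th \<beta> h (sqrt q * z) \<partial>std_normal_distribution)"

text \<open>The product measure is the joint law of the independent triple \<open>Z\<close>, \<open>Z'\<close>, \<open>Z''\<close>.
  Only the values for \<open>0 \<le> t \<le> q\<close> are meaningful.\<close>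

definition sk_psi :: "real \<Rightarrow> real \<Rightarrow> real \<Rightarrow> real \<Rightarrow> real" where
  "sk_psi \<beta> h q t =
     (\<integral>(z, z', z''). Th \<beta> h (sqrt t * z + sqrt (q - t) * z') * Th \<beta> h (sqrt t * z + sqrt (q - t) * z'')
        \<partial>(std_normal_distribution \<Otimes>\<^sub>M (std_normal_distribution \<Otimes>\<^sub>M std_normal_distribution)))"

text \<open>The sequences \<open>\<rho>\<^sub>k\<close> and \<open>\<gamma>\<^sub>k\<close> start at \<open>k = 1\<close>; the values at index \<open>0\<close> are dummies.\<close>

fun sk_rho :: "real \<Rightarrow> real \<Rightarrow> real \<Rightarrow> nat \<Rightarrow> real" where
  "sk_rho \<beta> h q 0 = 0"
| "sk_rho \<beta> h q (Suc 0) = sk_alpha \<beta> h q * sqrt q"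
| "sk_rho \<beta> h q (Suc (Suc k)) = sk_psi \<beta> h q (sk_rho \<beta> h q (Suc k))"

text \<open>The sum \<open>\<Sum>j=1..k-1. \<gamma>\<^sub>j\<^sup>2\<close> occurring twice below is \<open>\<Gamma>\<^sub>k\<^sub>-\<^sub>1\<^sup>2\<close>.\<close>

fun sk_gamma :: "real \<Rightarrow> real \<Rightarrow> real \<Rightarrow> nat \<Rightarrow> real" where
  "sk_gamma \<beta> h q k =
     (if k = 0 then 0
      else if k = 1 then sk_alpha \<beta> h q
      else (sk_rho \<beta> h q k - (\<Sum>j=1..k-1. (sk_gamma \<beta> h q j)\<^sup>2))
             / sqrt (q - (\<Sum>j=1..k-1. (sk_gamma \<beta> h q j)\<^sup>2)))"

declare sk_gamma.simps [simp del]

text \<open>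
  As \<open>N\<close> varies, vectors of \<open>\<real>\<^sup>N\<close> are functions \<^typ>\<open>nat \<Rightarrow> real\<close> vanishing outside the
  coordinates \<open>{1..N}\<close>, and matrices are functions of which only the entries with both indices
  in \<open>{1..N}\<close> are used.
\<close>

definition vec_of :: "nat \<Rightarrow> (nat \<Rightarrow> real) \<Rightarrow> nat \<Rightarrow> real" where
  "vec_of N f = (\<lambda>i. if i \<in> {1..N} then f i else 0)"

definition ninner :: "nat \<Rightarrow> (nat \<Rightarrow> real) \<Rightarrow> (nat \<Rightarrow> real) \<Rightarrow> real" where
  "ninner N x y = (1 / real N) * (\<Sum>i=1..N. x i * y i)"

definition nnorm :: "nat \<Rightarrow> (nat \<Rightarrow> real) \<Rightarrow> real" where
  "nnorm N x = sqrt (ninner N x x)"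

definition fam_span :: "nat \<Rightarrow> (nat \<Rightarrow> nat \<Rightarrow> real) \<Rightarrow> (nat \<Rightarrow> real) set" where
  "fam_span j v = {(\<lambda>i. \<Sum>l=1..j. c l * v l i) | c. True}"

text \<open>If all elements of the subspace \<open>S\<close> vanish outside \<open>{1..N}\<close>, then \<open>p\<close> exists and is unique.\<close>

definition orth_proj :: "nat \<Rightarrow> (nat \<Rightarrow> real) set \<Rightarrow> (nat \<Rightarrow> real) \<Rightarrow> nat \<Rightarrow> real" where
  "orth_proj N S x = (THE p. p \<in> S \<and> (\<forall>v\<in>S. ninner N (\<lambda>i. x i - p i) v = 0))"

definition sk_disorder :: "nat \<Rightarrow> 'a measure \<Rightarrow> ('a \<Rightarrow> nat \<Rightarrow> nat \<Rightarrow> real) \<Rightarrow> bool" where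
  "sk_disorder N P g \<longleftrightarrow>
     prob_space P \<and>
     prob_space.indep_vars P (\<lambda>_. borel) (\<lambda>(i, j) \<omega>. g \<omega> i j)
       {(i, j). 1 \<le> i \<and> i < j \<and> j \<le> N} \<and>
     (\<forall>i j. 1 \<le> i \<and> i < j \<and> j \<le> N \<longrightarrow>
        distributed P lborel (\<lambda>\<omega>. g \<omega> i j) (normal_density 0 (sqrt (1 / real N)))) \<and>
     (\<forall>\<omega>\<in>space P. \<forall>i\<in>{1..N}. \<forall>j\<in>{1..N}. g \<omega> i j = g \<omega> j i) \<and>
     (\<forall>\<omega>\<in>space P. \<forall>i\<in>{1..N}. g \<omega> i i = 0)"

fun sk_m :: "real \<Rightarrow> real \<Rightarrow> real \<Rightarrow> nat \<Rightarrow> (nat \<Rightarrow> nat \<Rightarrow> real) \<Rightarrow> nat \<Rightarrow> nat \<Rightarrow> real" where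
  "sk_m \<beta> h q N G 0 = (\<lambda>i. 0)"
| "sk_m \<beta> h q N G (Suc 0) = vec_of N (\<lambda>i. sqrt q)"
| "sk_m \<beta> h q N G (Suc (Suc k)) =
     vec_of N (\<lambda>i. Th \<beta> h ((\<Sum>j=1..N. G i j * sk_m \<beta> h q N G (Suc k) j)
                            - \<beta> * (1 - q) * sk_m \<beta> h q N G k i))"

definition sk_M :: "real \<Rightarrow> real \<Rightarrow> real \<Rightarrow> nat \<Rightarrow> (nat \<Rightarrow> nat \<Rightarrow> real) \<Rightarrow> nat \<Rightarrow> nat \<Rightarrow> real" where
  "sk_M \<beta> h q N G k =
     (\<lambda>i. sk_m \<beta> h q N G k i
          - orth_proj N (fam_span (k - 1) (sk_m \<beta> h q N G)) (sk_m \<beta> h q N G k) i)"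

definition sk_phi :: "real \<Rightarrow> real \<Rightarrow> real \<Rightarrow> nat \<Rightarrow> (nat \<Rightarrow> nat \<Rightarrow> real) \<Rightarrow> nat \<Rightarrow> nat \<Rightarrow> real" where
  "sk_phi \<beta> h q N G k =
     (if nnorm N (sk_M \<beta> h q N G k) \<noteq> 0
      then (\<lambda>i. sk_M \<beta> h q N G k i / nnorm N (sk_M \<beta> h q N G k))
      else vec_of N (\<lambda>i. 1))"

text \<open>
  The \<open>N\<close>-th variables live on the probability space \<open>P N\<close> (a constant family \<open>P\<close> is allowed).
  Measurability is part of the relation, which is one between sequences of random variables;
  otherwise \<^const>\<open>measure\<close> would be zero on a non-measurable deviation set.
\<close>

definition exp_equiv ::
  "(nat \<Rightarrow> 'a measure) \<Rightarrow> (nat \<Rightarrow> 'a \<Rightarrow> real) \<Rightarrow> (nat \<Rightarrow> 'a \<Rightarrow> real) \<Rightarrow> bool" where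
  "exp_equiv P X Y \<longleftrightarrow>
     (\<forall>N\<ge>1. X N \<in> borel_measurable (P N) \<and> Y N \<in> borel_measurable (P N)) \<and>
     (\<exists>C>0. \<forall>N\<ge>1. \<forall>t. 0 < t \<and> t \<le> 1 \<longrightarrow>
        measure (P N) {\<omega> \<in> space (P N). \<bar>X N \<omega> - Y N \<omega>\<bar> \<ge> t} \<le> C * exp (- (t\<^sup>2 * real N / C)))"

end

theory Submission
  imports Defs
begin

text \<open>
  Bolthausen's conditioning argument is turned into an exact identity in law. First give the disorder
  a diagonal, so that it becomes a rotation invariant Gaussian matrix \<open>G\<close>. For a unit vector \<open>\<phi>\<close>
  the compression of \<open>G\<close> to the orthogonal complement of \<open>\<phi>\<close> is independent of \<open>G \<phi>\<close>, hence \<open>G \<phi>\<close>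
  can be replaced by an expression in a fresh standard Gaussian vector \<open>z\<close> without changing the law.
  Doing this successively along \<open>\<phi>\<^sup>1, \<phi>\<^sup>2, \<dots>\<close> yields a matrix with the law of \<open>G\<close> for which
  \<open>G \<phi>\<^sup>j = z\<^sup>j\<close> up to small corrections. Writing \<open>m\<^sup>k = \<Sum>j\<le>k. \<langle>\<phi>\<^sup>j, m\<^sup>k\<rangle> \<phi>\<^sup>j\<close>, the vector
  \<open>G m\<^sup>k - \<beta> (1 - q) m\<^sup>k\<^sup>-\<^sup>1\<close> is close in norm to \<open>\<Sum>j<k. \<gamma>\<^sub>j z\<^sup>j + (q - \<Gamma>\<^sub>k\<^sub>-\<^sub>1\<^sup>2)\<^sup>1\<^sup>/\<^sup>2 z\<^sup>k\<close>: the Onsager term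
  cancels the correction coming from the symmetry of \<open>G\<close>, by Gaussian integration by parts. So inner products of
  iterates become averages over independent columns, which concentrate. The strict inequality
  \<open>\<Gamma>\<^sub>k\<^sup>2 < q\<close> is Bessel's inequality combined with \<open>\<psi> t < q\<close> for \<open>t < q\<close>. Finally
  the diagonal is removed again, using that the operator norm of \<open>G\<close> is bounded.
\<close>

section \<open>Negligible sequences of random variables\<close>


text \<open>In the usual conditioning argument \<open>\<phi>\<close> is a random direction depending
  on \<open>G\<close>, and conditional laws along a filtration have to be handled. Here each
  direction is a function of the earlier fresh vectors alone. Fubini's theorem then freezes it, and
  the replacement of \<open>G \<phi>\<close> concerns a fixed unit vector, where it is a comparison
  of two finite covariance matrices. The diagonal must get variance 2 / N, against 1 / N elsewhere:
  this makes the covariance rotation invariant and produces the factors \<open>sqrt 2\<close>.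

  The induction looks circular: Gram-Schmidt at the next step divides by a norm whose limit must be
  positive, and this positivity is only accessible through limits of inner products with the
  iterates. The way out is to test the iterates known so far against vectors built from fresh
  Gaussians only. For this the number \<open>K\<close> of fresh vectors is fixed beforehand and may
  exceed the current step.

  Tails are claimed only for \<open>t \<le> 1\<close>, so an event of probability
  \<open>exp (- N / C)\<close> costs no more than a change of the constant. Degenerate Gram-Schmidt
  steps and large operator norms are discarded in this way.\<close>

lemma exp_tail_add:
  fixes a C C' :: real
  assumes "0 < C" "0 < C'" "0 \<le> a"
  shows "C * exp (- (a / C)) + C' * exp (- (a / C')) \<le> (C + C') * exp (- (a / (C + C')))"
proof -
  have "a / (C + C') \<le> a / C" "a / (C + C') \<le> a / C'" using assms by (auto simp: frac_le)
  then have "C * exp (- (a / C)) \<le> C * exp (- (a / (C + C')))"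
    "C' * exp (- (a / C')) \<le> C' * exp (- (a / (C + C')))" using assms by auto
  then show ?thesis by (simp add: algebra_simps)
qed

text \<open>
  Holding with overwhelming probability. The exceptional set need not be measurable, it only has to be
  covered by a measurable set of exponentially small measure.
\<close>

definition wop :: "(nat \<Rightarrow> 'a measure) \<Rightarrow> (nat \<Rightarrow> 'a \<Rightarrow> bool) \<Rightarrow> bool" where
  "wop M A \<longleftrightarrow> (\<exists>C>0. \<forall>N\<ge>1. \<exists>B\<in>sets (M N).
     measure (M N) B \<le> C * exp (- (real N / C)) \<and> {\<omega> \<in> space (M N). \<not> A N \<omega>} \<subseteq> B)"

definition rvs :: "(nat \<Rightarrow> 'a measure) \<Rightarrow> (nat \<Rightarrow> 'a \<Rightarrow> real) \<Rightarrow> bool" where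
  "rvs M X \<longleftrightarrow> (\<forall>N\<ge>1. X N \<in> borel_measurable (M N))"

text \<open>Only levels \<open>t \<le> 1\<close> are required. Then
  \<open>t\<^sup>2 * N \<le> N\<close>, so an event of probability \<open>exp (- N / C)\<close>
  obeys the same bound, which \<open>negl_dom\<close> exploits.\<close>

definition negl :: "(nat \<Rightarrow> 'a measure) \<Rightarrow> (nat \<Rightarrow> 'a \<Rightarrow> real) \<Rightarrow> bool" where
  "negl M X \<longleftrightarrow> rvs M X \<and> (\<exists>C>0. \<forall>N\<ge>1. \<forall>t. 0 < t \<and> t \<le> 1 \<longrightarrow>
     measure (M N) {\<omega> \<in> space (M N). t \<le> \<bar>X N \<omega>\<bar>} \<le> C * exp (- (t\<^sup>2 * real N / C)))"

abbreviation conv :: "(nat \<Rightarrow> 'a measure) \<Rightarrow> (nat \<Rightarrow> 'a \<Rightarrow> real) \<Rightarrow> real \<Rightarrow> bool" where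
  "conv M X a \<equiv> negl M (\<lambda>N \<omega>. X N \<omega> - a)"

lemma rvs_const [simp]: "rvs M (\<lambda>N \<omega>. c N)"
  and rvs_add: "rvs M X \<Longrightarrow> rvs M Y \<Longrightarrow> rvs M (\<lambda>N \<omega>. X N \<omega> + Y N \<omega>)"
  and rvs_diff: "rvs M X \<Longrightarrow> rvs M Y \<Longrightarrow> rvs M (\<lambda>N \<omega>. X N \<omega> - Y N \<omega>)"
  and rvs_mult: "rvs M X \<Longrightarrow> rvs M Y \<Longrightarrow> rvs M (\<lambda>N \<omega>. X N \<omega> * Y N \<omega>)"
  and rvs_divide: "rvs M X \<Longrightarrow> rvs M Y \<Longrightarrow> rvs M (\<lambda>N \<omega>. X N \<omega> / Y N \<omega>)"
  and rvs_sqrt: "rvs M X \<Longrightarrow> rvs M (\<lambda>N \<omega>. sqrt (X N \<omega>))"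
  and rvs_abs: "rvs M X \<Longrightarrow> rvs M (\<lambda>N \<omega>. \<bar>X N \<omega>\<bar>)"
  unfolding rvs_def by (auto intro!: borel_measurable_add borel_measurable_diff borel_measurable_times
    borel_measurable_divide borel_measurable_sqrt borel_measurable_abs borel_measurable_uminus)

lemma negl_rvs: "negl M X \<Longrightarrow> rvs M X" by (simp add: negl_def)

lemma conv_rvs: "conv M X a \<Longrightarrow> rvs M X"
  using rvs_add[of M "\<lambda>N \<omega>. X N \<omega> - a" "\<lambda>_ _. a"] by (simp add: negl_rvs)

lemma exp_equiv_iff_negl:
  assumes "rvs M X" "rvs M Y"
  shows "exp_equiv M X Y \<longleftrightarrow> negl M (\<lambda>N \<omega>. X N \<omega> - Y N \<omega>)"
  using assms rvs_diff[OF assms] unfolding exp_equiv_def negl_def rvs_def by simp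

lemma wop_mono:
  assumes "wop M A" "\<And>N \<omega>. N \<ge> 1 \<Longrightarrow> \<omega> \<in> space (M N) \<Longrightarrow> A N \<omega> \<Longrightarrow> B N \<omega>"
  shows "wop M B"
proof -
  obtain C where C: "C > 0" "\<And>N. N \<ge> 1 \<Longrightarrow> \<exists>B\<in>sets (M N). measure (M N) B \<le> C * exp (- (real N / C))
     \<and> {\<omega> \<in> space (M N). \<not> A N \<omega>} \<subseteq> B" using assms(1) unfolding wop_def by blast
  show ?thesis unfolding wop_def
    apply (rule exI[of _ C]) using C assms(2) by (smt (verit) mem_Collect_eq subset_iff)
qed

locale prob_family =
  fixes M :: "nat \<Rightarrow> 'a measure"
  assumes prob_family: "N \<ge> 1 \<Longrightarrow> prob_space (M N)"
begin

lemma wop_True: "(\<And>N \<omega>. N \<ge> 1 \<Longrightarrow> \<omega> \<in> space (M N) \<Longrightarrow> A N \<omega>) \<Longrightarrow> wop M A"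
  unfolding wop_def by (intro exI[of _ 1] conjI allI impI bexI[of _ "{}"]) auto

lemma wop_conj:
  assumes "wop M A" "wop M B"
  shows "wop M (\<lambda>N \<omega>. A N \<omega> \<and> B N \<omega>)"
proof -
  obtain C where C: "C > 0" "\<And>N. N \<ge> 1 \<Longrightarrow> \<exists>S\<in>sets (M N). measure (M N) S \<le> C * exp (- (real N / C))
     \<and> {\<omega> \<in> space (M N). \<not> A N \<omega>} \<subseteq> S" using assms(1) unfolding wop_def by blast
  obtain D where D: "D > 0" "\<And>N. N \<ge> 1 \<Longrightarrow> \<exists>S\<in>sets (M N). measure (M N) S \<le> D * exp (- (real N / D))
     \<and> {\<omega> \<in> space (M N). \<not> B N \<omega>} \<subseteq> S" using assms(2) unfolding wop_def by blast
  show ?thesis unfolding wop_def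
  proof (intro exI[of _ "C + D"] conjI allI impI)
    fix N :: nat assume N: "N \<ge> 1"
    interpret prob_space "M N" by (rule prob_family[OF N])
    obtain S where S: "S\<in>sets (M N)" "measure (M N) S \<le> C * exp (- (real N / C))"
     "{\<omega> \<in> space (M N). \<not> A N \<omega>} \<subseteq> S" using C(2)[OF N] by auto
    obtain T where T: "T\<in>sets (M N)" "measure (M N) T \<le> D * exp (- (real N / D))"
     "{\<omega> \<in> space (M N). \<not> B N \<omega>} \<subseteq> T" using D(2)[OF N] by auto
    have "measure (M N) (S \<union> T) \<le> measure (M N) S + measure (M N) T"
      using S T by (intro measure_Un_le) auto
    also have "\<dots> \<le> (C + D) * exp (- (real N / (C + D)))"
      using exp_tail_add[OF C(1) D(1), of "real N"] S(2) T(2) by simp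
    finally show "\<exists>B'\<in>sets (M N). measure (M N) B' \<le> (C + D) * exp (- (real N / (C + D))) \<and>
       {\<omega> \<in> space (M N). \<not> (A N \<omega> \<and> B N \<omega>)} \<subseteq> B'"
      using S T by (intro bexI[of _ "S \<union> T"]) auto
  qed (use C D in auto)
qed

lemma wop_ball:
  assumes "finite I" "\<And>i. i \<in> I \<Longrightarrow> wop M (A i)"
  shows "wop M (\<lambda>N \<omega>. \<forall>i\<in>I. A i N \<omega>)"
  using assms
proof (induction I)
  case empty then show ?case by (simp add: wop_True)
next
  case (insert i I)
  then have "wop M (\<lambda>N \<omega>. A i N \<omega> \<and> (\<forall>i\<in>I. A i N \<omega>))" by (intro wop_conj) auto
  then show ?case by (rule wop_mono) auto
qed

text \<open>The bound \<open>C * exp (- (N / C))\<close> drops below 1 once \<open>N\<close> exceeds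
  \<open>C * C\<close>, because \<open>C < exp C\<close>; the covering set is then not the whole
  space. Sample points found in this way serve to compare limits in \<open>conv_le\<close>.\<close>

lemma wop_exists:
  assumes "wop M A"
  shows "\<exists>N\<ge>1. \<exists>\<omega>\<in>space (M N). A N \<omega>"
proof -
  obtain C where C: "C > 0" "\<And>N. N \<ge> 1 \<Longrightarrow> \<exists>S\<in>sets (M N). measure (M N) S \<le> C * exp (- (real N / C))
     \<and> {\<omega> \<in> space (M N). \<not> A N \<omega>} \<subseteq> S" using assms(1) unfolding wop_def by blast
  obtain N :: nat where N: "real N > C * C + 1" using reals_Archimedean2 by blast
  have N1: "N \<ge> 1" using N C by (smt (verit) less_one linorder_not_le mult_pos_pos of_nat_0)
  interpret prob_space "M N" by (rule prob_family[OF N1])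
  obtain S where S: "S\<in>sets (M N)" "measure (M N) S \<le> C * exp (- (real N / C))"
     "{\<omega> \<in> space (M N). \<not> A N \<omega>} \<subseteq> S" using C(2)[OF N1] by auto
  have "C < exp C" using exp_ge_add_one_self[of C] by linarith
  also have "exp C \<le> exp (real N / C)" using N C by (simp add: field_simps)
  finally have "C * exp (- (real N / C)) < 1" by (simp add: exp_minus field_simps)
  then have "measure (M N) S < 1" using S by linarith
  then have "S \<noteq> space (M N)" using prob_space by auto
  then obtain \<omega> where "\<omega> \<in> space (M N)" "\<omega> \<notin> S" using S(1) sets.sets_into_space by blast
  then show ?thesis using S(3) N1 by auto
qed

lemma negl_wop:
  assumes "negl M X" "\<epsilon> > 0"
  shows "wop M (\<lambda>N \<omega>. \<bar>X N \<omega>\<bar> < \<epsilon>)"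
proof -
  obtain C where C: "C > 0" "\<And>N t. N \<ge> 1 \<Longrightarrow> 0 < t \<Longrightarrow> t \<le> 1 \<Longrightarrow>
     measure (M N) {\<omega> \<in> space (M N). t \<le> \<bar>X N \<omega>\<bar>} \<le> C * exp (- (t\<^sup>2 * real N / C))"
    using assms(1) unfolding negl_def by blast
  \<comment> \<open>The level is frozen at an admissible value, and its square moves into the
    constant \<open>C / t\<^sup>2\<close>.\<close>
  define t where "t = min 1 \<epsilon>"
  have t: "0 < t" "t \<le> 1" "t \<le> \<epsilon>" using assms by (auto simp: t_def)
  have t2: "0 < t\<^sup>2" "t\<^sup>2 \<le> 1" using t by (auto simp: power_le_one)
  show ?thesis unfolding wop_def
  proof (intro exI[of _ "C / t\<^sup>2"] conjI allI impI)
    fix N :: nat assume N: "N \<ge> 1"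
    interpret prob_space "M N" by (rule prob_family[OF N])
    have [measurable]: "X N \<in> borel_measurable (M N)"
      using assms(1) N unfolding negl_def rvs_def by simp
    have m: "{\<omega> \<in> space (M N). t \<le> \<bar>X N \<omega>\<bar>} \<in> sets (M N)" by measurable
    have "C \<le> C / t\<^sup>2" using t2 C by (simp add: field_simps)
    then have "C * exp (- (t\<^sup>2 * real N / C)) \<le> C / t\<^sup>2 * exp (- (real N / (C / t\<^sup>2)))"
      by (simp only: divide_divide_eq_right mult.commute[of "real N"]) (intro mult_right_mono, auto)
    then show "\<exists>B\<in>sets (M N). measure (M N) B \<le> C / t\<^sup>2 * exp (- (real N / (C / t\<^sup>2))) \<and>
       {\<omega> \<in> space (M N). \<not> \<bar>X N \<omega>\<bar> < \<epsilon>} \<subseteq> B"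
      using C(2)[OF N t(1,2)] m t(3) by (intro bexI[OF _ m]) (auto intro: order_trans)
  qed (use C t2 in auto)
qed

text \<open>A deviation of \<open>X\<close> at level \<open>t\<close> lies in the exceptional set or
  forces a deviation of \<open>Y\<close> at level \<open>t / d\<close>. The first alternative has
  probability of order \<open>exp (- N / D)\<close>, which is within the required bound as
  \<open>t \<le> 1\<close>; the second rescales the constant by \<open>d\<^sup>2\<close>. Most
  estimates below are reduced to this lemma.\<close>

lemma negl_dom:
  assumes "rvs M X" "negl M Y" "wop M (\<lambda>N \<omega>. \<bar>X N \<omega>\<bar> \<le> c * \<bar>Y N \<omega>\<bar>)"
  shows "negl M X"
proof -
  obtain C where C: "C > 0" "\<And>N t. N \<ge> 1 \<Longrightarrow> 0 < t \<Longrightarrow> t \<le> 1 \<Longrightarrow>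
     measure (M N) {\<omega> \<in> space (M N). t \<le> \<bar>Y N \<omega>\<bar>} \<le> C * exp (- (t\<^sup>2 * real N / C))"
    using assms(2) unfolding negl_def by blast
  obtain D where D: "D > 0" "\<And>N. N \<ge> 1 \<Longrightarrow> \<exists>S\<in>sets (M N). measure (M N) S \<le> D * exp (- (real N / D))
     \<and> {\<omega> \<in> space (M N). \<not> \<bar>X N \<omega>\<bar> \<le> c * \<bar>Y N \<omega>\<bar>} \<subseteq> S" using assms(3) unfolding wop_def by blast
  \<comment> \<open>A value of at least 1 keeps the level \<open>t / d\<close> in the admissible
    range.\<close>
  define d where "d = max c 1"
  have d: "d \<ge> 1" "c \<le> d" by (auto simp: d_def)
  define C' where "C' = d\<^sup>2 * C"
  have C': "0 < C'" "C \<le> C'" using d C by (auto simp: C'_def)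
  have "negl M X \<longleftrightarrow> (\<exists>C>0. \<forall>N\<ge>1. \<forall>t. 0 < t \<and> t \<le> 1 \<longrightarrow>
     measure (M N) {\<omega> \<in> space (M N). t \<le> \<bar>X N \<omega>\<bar>} \<le> C * exp (- (t\<^sup>2 * real N / C)))"
    using assms(1) by (simp add: negl_def)
  moreover have "\<dots>"
  proof (intro exI[of _ "C' + D"] conjI allI impI)
    fix N t assume N: "N \<ge> (1::nat)" and t: "0 < t \<and> t \<le> (1::real)"
    interpret prob_space "M N" by (rule prob_family[OF N])
    have t2: "0 < t\<^sup>2" "t\<^sup>2 \<le> 1" using t by (auto simp: power_le_one)
    obtain S where S: "S\<in>sets (M N)" "measure (M N) S \<le> D * exp (- (real N / D))"
     "{\<omega> \<in> space (M N). \<not> \<bar>X N \<omega>\<bar> \<le> c * \<bar>Y N \<omega>\<bar>} \<subseteq> S" using D(2)[OF N] by auto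
    have [measurable]: "Y N \<in> borel_measurable (M N)"
      using assms(2) N unfolding negl_def rvs_def by simp
    have m: "{\<omega> \<in> space (M N). t / d \<le> \<bar>Y N \<omega>\<bar>} \<in> sets (M N)" (is "?T \<in> _") by measurable
    have "{\<omega> \<in> space (M N). t \<le> \<bar>X N \<omega>\<bar>} \<subseteq> S \<union> ?T"
    proof
      fix \<omega> assume "\<omega> \<in> {\<omega> \<in> space (M N). t \<le> \<bar>X N \<omega>\<bar>}"
      then have \<omega>: "\<omega> \<in> space (M N)" "t \<le> \<bar>X N \<omega>\<bar>" by auto
      show "\<omega> \<in> S \<union> ?T"
      proof (cases "t / d \<le> \<bar>Y N \<omega>\<bar>")
        case True then show ?thesis using \<omega> by simp
      next
      case False
      then have "d * \<bar>Y N \<omega>\<bar> < t" using d by (simp add: field_simps)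
      moreover have "c * \<bar>Y N \<omega>\<bar> \<le> d * \<bar>Y N \<omega>\<bar>" using d by (simp add: mult_right_mono)
      ultimately have "\<not> \<bar>X N \<omega>\<bar> \<le> c * \<bar>Y N \<omega>\<bar>" using \<omega> by linarith
      then show ?thesis using S(3) \<omega> by auto
      qed
    qed
    then have "measure (M N) {\<omega> \<in> space (M N). t \<le> \<bar>X N \<omega>\<bar>} \<le> measure (M N) (S \<union> ?T)"
      using S m by (intro finite_measure_mono) auto
    also have "\<dots> \<le> measure (M N) S + measure (M N) ?T"
      using S m by (intro measure_Un_le) auto
    also have "measure (M N) ?T \<le> C * exp (- ((t / d)\<^sup>2 * real N / C))"
      using C(2)[OF N, of "t / d"] t d by (simp add: divide_le_eq)
    also have "(t / d)\<^sup>2 * real N / C = t\<^sup>2 * real N / C'" using d by (simp add: C'_def power_divide)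
    also have "measure (M N) S \<le> D * exp (- (real N / D))" by (rule S)
    also have "D * exp (- (real N / D)) \<le> D * exp (- (t\<^sup>2 * real N / D))"
      using D t2 by (simp add: divide_right_mono mult_left_le_one_le)
    also have "C * exp (- (t\<^sup>2 * real N / C')) \<le> C' * exp (- (t\<^sup>2 * real N / C'))" using C' by simp
    finally have "measure (M N) {\<omega> \<in> space (M N). t \<le> \<bar>X N \<omega>\<bar>} \<le>
      D * exp (- (t\<^sup>2 * real N / D)) + C' * exp (- (t\<^sup>2 * real N / C'))" by simp
    also have "\<dots> \<le> (C' + D) * exp (- (t\<^sup>2 * real N / (C' + D)))"
      using exp_tail_add[of D C' "t\<^sup>2 * real N"] C' D t2 by (simp add: add.commute)
    finally show "measure (M N) {\<omega> \<in> space (M N). t \<le> \<bar>X N \<omega>\<bar>} \<le>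
       (C' + D) * exp (- (t\<^sup>2 * real N / (C' + D)))" .
  qed (use C' D in auto)
  ultimately show ?thesis by simp
qed

lemma negl_dom':
  assumes "rvs M X" "negl M Y" "\<And>N \<omega>. N \<ge> 1 \<Longrightarrow> \<omega> \<in> space (M N) \<Longrightarrow> \<bar>X N \<omega>\<bar> \<le> c * \<bar>Y N \<omega>\<bar>"
  shows "negl M X"
  by (rule negl_dom[OF assms(1,2) wop_True]) (use assms(3) in auto)

lemma negl_cong_wop:
  assumes "rvs M X" "negl M Y" "wop M (\<lambda>N \<omega>. X N \<omega> = Y N \<omega>)"
  shows "negl M X"
  by (rule negl_dom[OF assms(1,2), of 1]) (rule wop_mono[OF assms(3)], auto)

lemma negl_zero: "negl M (\<lambda>N \<omega>. 0)"
  unfolding negl_def by (auto intro!: exI[of _ 1])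

lemma negl_add:
  assumes "negl M X" "negl M Y"
  shows "negl M (\<lambda>N \<omega>. X N \<omega> + Y N \<omega>)"
proof -
  obtain C where C: "C > 0" "\<And>N t. N \<ge> 1 \<Longrightarrow> 0 < t \<Longrightarrow> t \<le> 1 \<Longrightarrow>
     measure (M N) {\<omega> \<in> space (M N). t \<le> \<bar>X N \<omega>\<bar>} \<le> C * exp (- (t\<^sup>2 * real N / C))"
    using assms(1) unfolding negl_def by blast
  obtain D where D: "D > 0" "\<And>N t. N \<ge> 1 \<Longrightarrow> 0 < t \<Longrightarrow> t \<le> 1 \<Longrightarrow>
     measure (M N) {\<omega> \<in> space (M N). t \<le> \<bar>Y N \<omega>\<bar>} \<le> D * exp (- (t\<^sup>2 * real N / D))"
    using assms(2) unfolding negl_def by blast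
  have rv: "rvs M (\<lambda>N \<omega>. X N \<omega> + Y N \<omega>)" using assms by (intro rvs_add negl_rvs)
  moreover have "\<exists>C>0. \<forall>N\<ge>1. \<forall>t. 0 < t \<and> t \<le> 1 \<longrightarrow>
     measure (M N) {\<omega> \<in> space (M N). t \<le> \<bar>X N \<omega> + Y N \<omega>\<bar>} \<le> C * exp (- (t\<^sup>2 * real N / C))"
  \<comment> \<open>Each summand gets half of the level, which costs a factor 4 in its
    constant.\<close>
  proof (intro exI[of _ "4 * C + 4 * D"] conjI allI impI)
    fix N :: nat and t :: real assume N: "N \<ge> 1" and t: "0 < t \<and> t \<le> 1"
    interpret prob_space "M N" by (rule prob_family[OF N])
    have [measurable]: "X N \<in> borel_measurable (M N)" "Y N \<in> borel_measurable (M N)"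
      using assms N unfolding negl_def rvs_def by auto
    let ?S = "{\<omega> \<in> space (M N). t / 2 \<le> \<bar>X N \<omega>\<bar>}"
    let ?T = "{\<omega> \<in> space (M N). t / 2 \<le> \<bar>Y N \<omega>\<bar>}"
    have "{\<omega> \<in> space (M N). t \<le> \<bar>X N \<omega> + Y N \<omega>\<bar>} \<subseteq> ?S \<union> ?T" by auto
    then have "measure (M N) {\<omega> \<in> space (M N). t \<le> \<bar>X N \<omega> + Y N \<omega>\<bar>} \<le> measure (M N) (?S \<union> ?T)"
      by (intro finite_measure_mono) auto
    also have "\<dots> \<le> measure (M N) ?S + measure (M N) ?T"
      by (intro measure_Un_le) auto
    also have "measure (M N) ?S \<le> C * exp (- ((t / 2)\<^sup>2 * real N / C))"
      using C(2)[OF N, of "t / 2"] t by simp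
    also have "measure (M N) ?T \<le> D * exp (- ((t / 2)\<^sup>2 * real N / D))"
      using D(2)[OF N, of "t / 2"] t by simp
    also have "(t / 2)\<^sup>2 * real N / C = t\<^sup>2 * real N / (4 * C)" by (simp add: power_divide)
    also have "(t / 2)\<^sup>2 * real N / D = t\<^sup>2 * real N / (4 * D)" by (simp add: power_divide)
    also have "C * exp (- (t\<^sup>2 * real N / (4 * C))) \<le> (4 * C) * exp (- (t\<^sup>2 * real N / (4 * C)))"
      using C by simp
    also have "D * exp (- (t\<^sup>2 * real N / (4 * D))) \<le> (4 * D) * exp (- (t\<^sup>2 * real N / (4 * D)))"
      using D by simp
    also have "(4 * C) * exp (- (t\<^sup>2 * real N / (4 * C))) + (4 * D) * exp (- (t\<^sup>2 * real N / (4 * D)))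
      \<le> (4 * C + 4 * D) * exp (- (t\<^sup>2 * real N / (4 * C + 4 * D)))"
      using exp_tail_add[of "4 * C" "4 * D" "t\<^sup>2 * real N"] C D by simp
    finally show "measure (M N) {\<omega> \<in> space (M N). t \<le> \<bar>X N \<omega> + Y N \<omega>\<bar>} \<le>
       (4 * C + 4 * D) * exp (- (t\<^sup>2 * real N / (4 * C + 4 * D)))" by simp
  qed (use C D in auto)
  ultimately show ?thesis by (simp add: negl_def)
qed

lemma negl_cmult: "negl M X \<Longrightarrow> negl M (\<lambda>N \<omega>. c * X N \<omega>)"
  by (rule negl_dom'[of _ X "\<bar>c\<bar>"]) (auto simp: abs_mult intro: rvs_mult negl_rvs)

lemma negl_uminus: "negl M X \<Longrightarrow> negl M (\<lambda>N \<omega>. - X N \<omega>)"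
  using negl_cmult[of X "-1"] by simp

lemma negl_abs: "negl M X \<Longrightarrow> negl M (\<lambda>N \<omega>. \<bar>X N \<omega>\<bar>)"
  by (rule negl_dom'[of _ X 1]) (auto intro: rvs_abs negl_rvs)

lemma negl_diff: "negl M X \<Longrightarrow> negl M Y \<Longrightarrow> negl M (\<lambda>N \<omega>. X N \<omega> - Y N \<omega>)"
  using negl_add[of X "\<lambda>N \<omega>. - Y N \<omega>"] by (simp add: negl_uminus)

lemma negl_sum:
  assumes "finite I" "\<And>i. i \<in> I \<Longrightarrow> negl M (X i)"
  shows "negl M (\<lambda>N \<omega>. \<Sum>i\<in>I. X i N \<omega>)"
  using assms by (induction I) (auto simp: negl_zero intro!: negl_add)

lemma negl_mult_bdd:
  assumes "negl M X" "rvs M Y" "wop M (\<lambda>N \<omega>. \<bar>Y N \<omega>\<bar> \<le> b)"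
  shows "negl M (\<lambda>N \<omega>. X N \<omega> * Y N \<omega>)"
proof (rule negl_dom[OF _ assms(1)])
  show "rvs M (\<lambda>N \<omega>. X N \<omega> * Y N \<omega>)" by (rule rvs_mult[OF negl_rvs[OF assms(1)] assms(2)])
  show "wop M (\<lambda>N \<omega>. \<bar>X N \<omega> * Y N \<omega>\<bar> \<le> b * \<bar>X N \<omega>\<bar>)"
    by (rule wop_mono[OF assms(3)]) (metis abs_mult abs_ge_zero mult.commute mult_left_mono)
qed

lemma negl_bdd: "negl M X \<Longrightarrow> wop M (\<lambda>N \<omega>. \<bar>X N \<omega>\<bar> \<le> 1)"
  by (rule wop_mono[OF negl_wop[of X 1]]) auto

text \<open>For \<open>t\<close> above \<open>1 / sqrt N\<close> the deviation event of
  \<open>1 / sqrt N\<close> is empty; below it \<open>t\<^sup>2 * N \<le> 1\<close>, and the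
  constant 3 makes the required bound at least 1. Errors of order \<open>1 / sqrt N\<close> thus fit
  the scheme.\<close>

lemma negl_rate:
  assumes "rvs M X" "wop M (\<lambda>N \<omega>. \<bar>X N \<omega>\<bar> \<le> c / sqrt (real N))"
  shows "negl M X"
proof (rule negl_dom[OF assms(1)])
  show "negl M (\<lambda>N \<omega>. 1 / sqrt (real N))"
    unfolding negl_def
  proof (intro conjI exI[of _ 3] allI impI)
    fix N :: nat and t :: real assume N: "N \<ge> 1" and t: "0 < t \<and> t \<le> 1"
    interpret prob_space "M N" by (rule prob_family[OF N])
    show "measure (M N) {\<omega> \<in> space (M N). t \<le> \<bar>1 / sqrt (real N)\<bar>} \<le> 3 * exp (- (t\<^sup>2 * real N / 3))"
    proof (cases "t \<le> 1 / sqrt (real N)")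
      case True
      then have "t\<^sup>2 \<le> (1 / sqrt (real N))\<^sup>2" using t by (intro power_mono) auto
      then have "t\<^sup>2 * real N \<le> 1" using N by (simp add: power_divide field_simps)
      then have "1 + (- (t\<^sup>2 * real N / 3)) \<ge> 1/3" by simp
      then have "exp (- (t\<^sup>2 * real N / 3)) \<ge> 1/3" using exp_ge_add_one_self order_trans by blast
      then show ?thesis using prob_le_1[of "{\<omega> \<in> space (M N). t \<le> \<bar>1 / sqrt (real N)\<bar>}"] by linarith
    qed simp
  qed auto
  show "wop M (\<lambda>N \<omega>. \<bar>X N \<omega>\<bar> \<le> c * \<bar>1 / sqrt (real N)\<bar>)"
    by (rule wop_mono[OF assms(2)]) auto
qed

section \<open>Arithmetic of sequences converging to constants\<close>

lemma conv_const: "conv M (\<lambda>N \<omega>. a) a" by (simp add: negl_zero)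

lemma conv_add: "conv M X a \<Longrightarrow> conv M Y b \<Longrightarrow> conv M (\<lambda>N \<omega>. X N \<omega> + Y N \<omega>) (a + b)"
  using negl_add[of "\<lambda>N \<omega>. X N \<omega> - a" "\<lambda>N \<omega>. Y N \<omega> - b"] by (simp add: algebra_simps)

lemma conv_diff: "conv M X a \<Longrightarrow> conv M Y b \<Longrightarrow> conv M (\<lambda>N \<omega>. X N \<omega> - Y N \<omega>) (a - b)"
  using negl_diff[of "\<lambda>N \<omega>. X N \<omega> - a" "\<lambda>N \<omega>. Y N \<omega> - b"] by (simp add: algebra_simps)

lemma conv_cmult: "conv M X a \<Longrightarrow> conv M (\<lambda>N \<omega>. c * X N \<omega>) (c * a)"
  using negl_cmult[of "\<lambda>N \<omega>. X N \<omega> - a" c] by (simp add: algebra_simps)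

lemma conv_sum:
  assumes "finite I" "\<And>i. i \<in> I \<Longrightarrow> conv M (X i) (a i)"
  shows "conv M (\<lambda>N \<omega>. \<Sum>i\<in>I. X i N \<omega>) (\<Sum>i\<in>I. a i)"
  using negl_sum[of I "\<lambda>i N \<omega>. X i N \<omega> - a i"] assms by (simp add: sum_subtractf)

lemma conv_cong_wop:
  assumes "rvs M X" "conv M Y a" "wop M (\<lambda>N \<omega>. X N \<omega> = Y N \<omega>)"
  shows "conv M X a"
  using assms by (intro negl_cong_wop[OF _ assms(2)] rvs_diff) (auto intro: wop_mono)

lemma conv_negl_diff:
  assumes "conv M X a" "negl M (\<lambda>N \<omega>. Y N \<omega> - X N \<omega>)"
  shows "conv M Y a"
  using negl_add[OF assms] by simp

lemma conv_close:
  assumes "conv M X a" "\<epsilon> > 0" shows "wop M (\<lambda>N \<omega>. \<bar>X N \<omega> - a\<bar> < \<epsilon>)"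
  using negl_wop[OF assms] .

lemma conv_bdd: "conv M X a \<Longrightarrow> wop M (\<lambda>N \<omega>. \<bar>X N \<omega>\<bar> \<le> \<bar>a\<bar> + 1)"
  by (rule wop_mono[OF negl_bdd]) auto

lemma conv_gt: "conv M X a \<Longrightarrow> c < a \<Longrightarrow> wop M (\<lambda>N \<omega>. c < X N \<omega>)"
  by (rule wop_mono[OF conv_close[of X a "a - c"]]) auto

lemma conv_mult:
  assumes "conv M X a" "conv M Y b"
  shows "conv M (\<lambda>N \<omega>. X N \<omega> * Y N \<omega>) (a * b)"
proof -
  have "negl M (\<lambda>N \<omega>. (X N \<omega> - a) * Y N \<omega> + a * (Y N \<omega> - b))"
    by (rule negl_add[OF negl_mult_bdd[OF assms(1) conv_rvs[OF assms(2)] conv_bdd[OF assms(2)]] negl_cmult[OF assms(2)]])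
  then show ?thesis by (simp add: algebra_simps)
qed

lemma conv_power2: "conv M X a \<Longrightarrow> conv M (\<lambda>N \<omega>. (X N \<omega>)\<^sup>2) (a\<^sup>2)"
  by (simp add: power2_eq_square conv_mult)

text \<open>A positive limit keeps \<open>X\<close> above \<open>a / 2\<close> with overwhelming
  probability, and there inversion has Lipschitz constant \<open>2 / a\<^sup>2\<close>.
  \<open>conv_sqrt\<close> works in the same way with the constant
  \<open>1 / sqrt a\<close>.\<close>

lemma conv_inverse:
  assumes "conv M X a" "a > 0"
  shows "conv M (\<lambda>N \<omega>. 1 / X N \<omega>) (1 / a)"
proof (rule negl_dom[OF _ assms(1)])
  show "rvs M (\<lambda>N \<omega>. 1 / X N \<omega> - 1 / a)" by (rule rvs_diff[OF rvs_divide[OF _ conv_rvs[OF assms(1)]]]) auto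
  show "wop M (\<lambda>N \<omega>. \<bar>1 / X N \<omega> - 1 / a\<bar> \<le> (2 / a\<^sup>2) * \<bar>X N \<omega> - a\<bar>)"
  proof (rule wop_mono[OF conv_gt[OF assms(1), of "a/2"]])
    fix N \<omega> assume x: "a / 2 < X N \<omega>"
    then have xp: "0 < X N \<omega>" using assms(2) by linarith
    have "1 / X N \<omega> - 1 / a = (a - X N \<omega>) / (a * X N \<omega>)" using xp assms(2) by (simp add: field_simps)
    then have "\<bar>1 / X N \<omega> - 1 / a\<bar> = \<bar>X N \<omega> - a\<bar> * (1 / (a * X N \<omega>))"
      using xp assms(2) by (simp add: abs_mult abs_minus_commute)
    also have "\<dots> \<le> \<bar>X N \<omega> - a\<bar> * (2 / a\<^sup>2)"
      using xp x assms(2) by (intro mult_left_mono) (auto simp: field_simps power2_eq_square)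
    finally show "\<bar>1 / X N \<omega> - 1 / a\<bar> \<le> (2 / a\<^sup>2) * \<bar>X N \<omega> - a\<bar>" by (simp add: mult.commute)
  qed (use assms in auto)
qed

lemma conv_divide:
  assumes "conv M X a" "conv M Y b" "b > 0"
  shows "conv M (\<lambda>N \<omega>. X N \<omega> / Y N \<omega>) (a / b)"
  using conv_mult[OF assms(1) conv_inverse[OF assms(2,3)]] by simp

lemma conv_sqrt:
  assumes "conv M X a" "a > 0"
  shows "conv M (\<lambda>N \<omega>. sqrt (X N \<omega>)) (sqrt a)"
proof (rule negl_dom[OF _ assms(1)])
  show "rvs M (\<lambda>N \<omega>. sqrt (X N \<omega>) - sqrt a)" by (rule rvs_diff[OF rvs_sqrt[OF conv_rvs[OF assms(1)]]]) auto
  show "wop M (\<lambda>N \<omega>. \<bar>sqrt (X N \<omega>) - sqrt a\<bar> \<le> (1 / sqrt a) * \<bar>X N \<omega> - a\<bar>)"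
  proof (rule wop_mono[OF conv_gt[OF assms]])
    fix N \<omega> assume x: "0 < X N \<omega>"
    have "X N \<omega> - a = (sqrt (X N \<omega>) - sqrt a) * (sqrt (X N \<omega>) + sqrt a)"
      using x assms(2) by (simp add: algebra_simps)
    then have "\<bar>X N \<omega> - a\<bar> = \<bar>sqrt (X N \<omega>) - sqrt a\<bar> * (sqrt (X N \<omega>) + sqrt a)"
      using x assms(2) by (simp add: abs_mult)
    also have "\<dots> \<ge> \<bar>sqrt (X N \<omega>) - sqrt a\<bar> * sqrt a"
      using x by (intro mult_left_mono) auto
    finally show "\<bar>sqrt (X N \<omega>) - sqrt a\<bar> \<le> (1 / sqrt a) * \<bar>X N \<omega> - a\<bar>"
      using assms(2) by (simp add: field_simps)
  qed
qed

text \<open>If the limits were in the wrong order, one sample point at which both sequences are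
  close to them and the inequality holds would give a contradiction. This turns Bessel's inequality
  into an inequality between constants.\<close>

lemma conv_le:
  assumes "conv M X a" "conv M Y b" "wop M (\<lambda>N \<omega>. X N \<omega> \<le> Y N \<omega>)"
  shows "a \<le> b"
proof (rule ccontr)
  assume "\<not> a \<le> b"
  then have d: "(a - b) / 2 > 0" by simp
  have "wop M (\<lambda>N \<omega>. \<bar>X N \<omega> - a\<bar> < (a - b) / 2 \<and> \<bar>Y N \<omega> - b\<bar> < (a - b) / 2 \<and> X N \<omega> \<le> Y N \<omega>)"
    using assms d by (intro wop_conj conv_close) auto
  from wop_exists[OF this] obtain N \<omega> where "\<bar>X N \<omega> - a\<bar> < (a - b) / 2" "\<bar>Y N \<omega> - b\<bar> < (a - b) / 2" "X N \<omega> \<le> Y N \<omega>"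
    by auto
  then show False by argo
qed

end

section \<open>Gaussian vectors\<close>

text \<open>The uniqueness theorem for characteristic functions, applied to the measures with
  densities \<open>w\<close> and \<open>w'\<close> after normalisation. The total masses agree by
  taking \<open>r = 0\<close>; if they vanish, so do both weights almost everywhere.\<close>

lemma weighted_char_unique:
  fixes X w :: "'a \<Rightarrow> real" and X' w' :: "'b \<Rightarrow> real"
  assumes "prob_space M" "prob_space M'"
    and [measurable]: "X \<in> borel_measurable M" "X' \<in> borel_measurable M'"
      "w \<in> borel_measurable M" "w' \<in> borel_measurable M'" "A \<in> sets borel"
    and w: "\<And>x. 0 \<le> w x" "\<And>x. w x \<le> (B::real)" and w': "\<And>x. 0 \<le> w' x" "\<And>x. w' x \<le> B"
    and eq: "\<And>r. (CLINT x|M. w x * iexp (r * X x)) = (CLINT x|M'. w' x * iexp (r * X' x))"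
  shows "(\<integral>x. w x * indicator A (X x) \<partial>M) = (\<integral>x. w' x * indicator A (X' x) \<partial>M')"
proof -
  interpret M: prob_space M by fact
  interpret M': prob_space M' by fact
  have int: "integrable M w" "integrable M' w'"
    using w w' by (auto intro!: M.integrable_const_bound[where B=B] M'.integrable_const_bound[where B=B])
  define m where "m = (\<integral>x. w x \<partial>M)"
  have m': "m = (\<integral>x. w' x \<partial>M')"
    using eq[of 0] by (simp add: m_def)
  have m0: "m \<ge> 0" using w by (simp add: m_def)
  show ?thesis
  proof (cases "m = 0")
    case True
    have "AE x in M. w x = 0" using integral_nonneg_eq_0_iff_AE[OF int(1)] w True by (simp add: m_def)
    moreover have "AE x in M'. w' x = 0" using integral_nonneg_eq_0_iff_AE[OF int(2)] w' True m' by simp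
    ultimately have "(\<integral>x. w x * indicator A (X x) \<partial>M) = 0" "(\<integral>x. w' x * indicator A (X' x) \<partial>M') = 0"
      by (auto intro!: integral_eq_zero_AE)
    then show ?thesis by simp
  next
    case False
    then have mp: "m > 0" using m0 by simp
    \<comment> \<open>Both sides need the same facts about the normalised measure, hence the
      formulation for a general space.\<close>
    have key: "real_distribution (distr (density N (\<lambda>x. v x / m)) borel Y) \<and>
       (\<forall>t. char (distr (density N (\<lambda>x. v x / m)) borel Y) t = (CLINT x|N. v x * iexp (t * Y x)) / m) \<and>
       (\<integral>x. v x * indicator A (Y x) \<partial>N) = m * measure (distr (density N (\<lambda>x. v x / m)) borel Y) A"
      if [measurable]: "Y \<in> borel_measurable N" "v \<in> borel_measurable N" and N: "prob_space N"
        "\<And>x. 0 \<le> v x" "integrable N v" "(\<integral>x. v x \<partial>N) = m" for N and Y v :: "'c \<Rightarrow> real"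
    proof (intro conjI allI)
      interpret N: prob_space N by fact
      have 1: "emeasure (density N (\<lambda>x. v x / m)) (space N) = 1"
        using N mp by (simp add: emeasure_density divide_ennreal[symmetric] nn_integral_eq_integral
           nn_integral_divide ennreal_divide_self cong: nn_integral_cong_simp)
      interpret D: prob_space "density N (\<lambda>x. v x / m)" by (rule prob_spaceI) (use 1 in simp)
      interpret E: prob_space "distr (density N (\<lambda>x. v x / m)) borel Y" by (rule D.prob_space_distr) simp
      show "real_distribution (distr (density N (\<lambda>x. v x / m)) borel Y)" by standard simp
      show "char (distr (density N (\<lambda>x. v x / m)) borel Y) t = (CLINT x|N. v x * iexp (t * Y x)) / m" for t
        unfolding char_def using N(2) mp
        by (subst integral_distr, simp, simp, subst integral_density)
           (auto simp: scaleR_conv_of_real)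
      have "measure (distr (density N (\<lambda>x. v x / m)) borel Y) A = (\<integral>x. indicator A x \<partial>distr (density N (\<lambda>x. v x / m)) borel Y)"
        by simp
      also have "\<dots> = (\<integral>x. (v x / m) * indicator A (Y x) \<partial>N)"
        using N(2) mp by (subst integral_distr, simp, simp, subst integral_density) auto
      also have "\<dots> = (\<integral>x. v x * indicator A (Y x) \<partial>N) / m" by simp
      finally show "(\<integral>x. v x * indicator A (Y x) \<partial>N) = m * measure (distr (density N (\<lambda>x. v x / m)) borel Y) A"
        using mp by simp
    qed
    note k1 = key[of X M w, OF assms(3) assms(5) assms(1) w(1) int(1) m_def[symmetric]]
    note k2 = key[of X' M' w', OF assms(4) assms(6) assms(2) w'(1) int(2) m'[symmetric]]
    have "distr (density M (\<lambda>x. w x / m)) borel X = distr (density M' (\<lambda>x. w' x / m)) borel X'"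
      by (rule Levy_uniqueness) (use k1 k2 eq in \<open>auto simp: fun_eq_iff\<close>)
    then show ?thesis using k1 k2 by simp
  qed
qed

text \<open>Multiplication by the nonnegative weight \<open>1 + cos t\<close> only adds frequencies
  shifted by \<open>t\<close> and \<open>- t\<close>, so integrals of the left side are determined
  by plain characters. \<open>iexp_sin\<close> does the same for \<open>1 + sin t\<close>.\<close>

lemma iexp_cos: "complex_of_real (w * (1 + cos t)) * iexp r
    = w * iexp r + (w * iexp (r + t) + w * iexp (r + (-t))) / 2"
proof -
  have "2 * complex_of_real (cos t) = iexp t + iexp (-t)" by (simp add: cos_of_real[symmetric] cos_exp_eq)
  moreover have "iexp (r + t) = iexp r * iexp t" "iexp (r + (-t)) = iexp r * iexp (-t)"
    by (simp_all add: exp_add[symmetric] algebra_simps)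
  ultimately have "2 * complex_of_real (cos t) * w * iexp r = w * iexp (r + t) + w * iexp (r + (-t))" 
    by (simp only:) (simp add: algebra_simps)
  then have "complex_of_real (cos t) * w * iexp r = (w * iexp (r + t) + w * iexp (r + (-t))) / 2"
    by (simp add: field_simps)
  then show ?thesis by (simp add: algebra_simps)
qed

lemma iexp_sin: "complex_of_real (w * (1 + sin t)) * iexp r
    = w * iexp r + (w * iexp (r + t) - w * iexp (r + (-t))) / (2 * \<i>)"
proof -
  have "2 * \<i> * complex_of_real (sin t) = iexp t - iexp (-t)" by (simp add: sin_of_real[symmetric] sin_exp_eq)
  moreover have "iexp (r + t) = iexp r * iexp t" "iexp (r + (-t)) = iexp r * iexp (-t)"
    by (simp_all add: exp_add[symmetric] algebra_simps)
  ultimately have "2 * \<i> * complex_of_real (sin t) * w * iexp r = w * iexp (r + t) - w * iexp (r + (-t))" 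
   by (simp only:) (simp add: algebra_simps)
  then have "complex_of_real (sin t) * w * iexp r = (w * iexp (r + t) - w * iexp (r + (-t))) / (2 * \<i>)"
    by (simp add: field_simps)
  then show ?thesis by (simp add: algebra_simps)
qed

text \<open>
  The coordinates are turned from characters into indicators one at a time. The weights \<open>1 + cos\<close> and
  \<open>1 + sin\<close> are nonnegative, so the one-dimensional uniqueness theorem applies to the weighted measures.
\<close>

lemma char_PiM_unique:
  fixes \<mu> \<nu> :: "('i \<Rightarrow> real) measure"
  assumes fin: "finite A" and "prob_space \<mu>" "prob_space \<nu>"
    and sets[measurable_cong]: "sets \<mu> = sets (PiM A (\<lambda>_. borel))" "sets \<nu> = sets (PiM A (\<lambda>_. borel))"
    and eq: "\<And>s. (CLINT x|\<mu>. iexp (\<Sum>a\<in>A. s a * x a)) = (CLINT x|\<nu>. iexp (\<Sum>a\<in>A. s a * x a))"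
  shows "\<mu> = \<nu>"
proof -
  interpret P: prob_space \<mu> by fact
  interpret Q: prob_space \<nu> by fact
  have mc: "(\<lambda>x. x a) \<in> borel_measurable \<mu>" "(\<lambda>x. x a) \<in> borel_measurable \<nu>" if "a \<in> A" for a
    unfolding measurable_cong_sets[OF sets(1) refl] measurable_cong_sets[OF sets(2) refl]
    using that by (auto intro: measurable_component_singleton)
  \<comment> \<open>\<open>B\<close> holds the coordinates already tested by indicators; those in
    \<open>A - B\<close> still carry characters with free frequencies \<open>s\<close>.\<close>
  have main: "(CLINT x|\<mu>. (\<Prod>a\<in>B. indicator (E a) (x a) :: real) * iexp (\<Sum>a\<in>A-B. s a * x a))
     = (CLINT x|\<nu>. (\<Prod>a\<in>B. indicator (E a) (x a) :: real) * iexp (\<Sum>a\<in>A-B. s a * x a))"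
    if E: "\<And>a. a \<in> A \<Longrightarrow> E a \<in> sets borel" and B: "B \<subseteq> A" for E B s
    using finite_subset[OF B fin] B
  proof (induction B arbitrary: s rule: finite_induct)
    case empty then show ?case using eq by simp
  next
    case (insert b B)
    define W where "W x = (\<Prod>a\<in>B. indicator (E a) (x a) :: real)" for x
    define \<theta> where "\<theta> s x = (\<Sum>a\<in>A - insert b B. s a * x a :: real)" for s x
    have W01: "W x \<in> {0..1}" for x unfolding W_def
      by (auto intro!: prod_nonneg prod_le_1 simp: indicator_def)
    have [measurable]: "b \<in> A" "E b \<in> sets borel" using insert E by auto
    have mW[measurable]: "W \<in> borel_measurable \<mu>" "W \<in> borel_measurable \<nu>"
      unfolding W_def using insert.prems E
      by (auto intro!: borel_measurable_prod measurable_compose[OF mc(1) borel_measurable_indicator]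
          measurable_compose[OF mc(2) borel_measurable_indicator])
    have m\<theta>[measurable]: "\<theta> s \<in> borel_measurable \<mu>" "\<theta> s \<in> borel_measurable \<nu>" for s
      unfolding \<theta>_def by (auto intro!: borel_measurable_sum borel_measurable_times mc)
    have mb[measurable]: "(\<lambda>x. x b) \<in> borel_measurable \<mu>" "(\<lambda>x. x b) \<in> borel_measurable \<nu>" 
      by (auto intro!: mc)
    have IH: "(CLINT x|\<mu>. W x * iexp (r * x b + \<theta> s x)) = (CLINT x|\<nu>. W x * iexp (r * x b + \<theta> s x))" for r s
    proof -
      have "(\<Sum>a\<in>A - B. (s(b := r)) a * x a) = r * x b + \<theta> s x" for x
      proof -
        have "A - B = insert b (A - insert b B)" using insert by auto
        then have "(\<Sum>a\<in>A - B. (s(b := r)) a * x a) = (\<Sum>a\<in>insert b (A - insert b B). (s(b := r)) a * x a)"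
          by (rule arg_cong)
        also have "\<dots> = (s(b := r)) b * x b + (\<Sum>a\<in>A - insert b B. (s(b := r)) a * x a)"
          using fin by (intro sum.insert) auto
        also have "(\<Sum>a\<in>A - insert b B. (s(b := r)) a * x a) = \<theta> s x" unfolding \<theta>_def
          by (intro sum.cong) auto
        finally show ?thesis by simp
      qed
      then show ?thesis using insert.IH[of "s(b := r)"] insert.prems by (simp add: W_def)
    qed
    have \<theta>m: "\<theta> (\<lambda>a. - s a) x = - \<theta> s x" "\<theta> (\<lambda>a. 0) x = 0" for x s by (auto simp: \<theta>_def sum_negf)
    have intg: "integrable \<mu> (\<lambda>x. W x * iexp (f x))" if [measurable]: "f \<in> borel_measurable \<mu>" for f
      using W01 by (intro P.integrable_const_bound[where B=1]) (auto simp: norm_mult)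
    have intg': "integrable \<nu> (\<lambda>x. W x * iexp (f x))" if [measurable]: "f \<in> borel_measurable \<nu>" for f
      using W01 by (intro Q.integrable_const_bound[where B=1]) (auto simp: norm_mult)
    have lin: "(CLINT x|N. a x + (b x + c x) / 2) = integral\<^sup>L N a + (integral\<^sup>L N b + integral\<^sup>L N c) / 2"
        "(CLINT x|N. a x + (b x - c x) / (2 * \<i>)) = integral\<^sup>L N a + (integral\<^sup>L N b - integral\<^sup>L N c) / (2 * \<i>)"
      if "integrable N a" "integrable N b" "integrable N c" for N :: "('i \<Rightarrow> real) measure" and a b c :: "_ \<Rightarrow> complex"
      using that by simp_all
    have m1: "(\<lambda>x. r * x b) \<in> borel_measurable \<mu>" "(\<lambda>x. r * x b + \<theta> s x) \<in> borel_measurable \<mu>"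
      "(\<lambda>x. r * x b + - \<theta> s x) \<in> borel_measurable \<mu>" for r s
      by (intro borel_measurable_add borel_measurable_times borel_measurable_uminus m\<theta> mb borel_measurable_const)+
    have m2: "(\<lambda>x. r * x b) \<in> borel_measurable \<nu>" "(\<lambda>x. r * x b + \<theta> s x) \<in> borel_measurable \<nu>"
      "(\<lambda>x. r * x b + - \<theta> s x) \<in> borel_measurable \<nu>" for r s
      by (intro borel_measurable_add borel_measurable_times borel_measurable_uminus m\<theta> mb borel_measurable_const)+
    note ii = m1[THEN intg] and ii' = m2[THEN intg']
    \<comment> \<open>The frequencies \<open>- s\<close> and 0 supply the other two terms of
      \<open>iexp_cos\<close> and \<open>iexp_sin\<close>.\<close>
    have im: "(CLINT x|\<mu>. W x * iexp (r * x b + - \<theta> s x)) = (CLINT x|\<nu>. W x * iexp (r * x b + - \<theta> s x))"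
       "(CLINT x|\<mu>. W x * iexp (r * x b)) = (CLINT x|\<nu>. W x * iexp (r * x b))" for r s
      using IH[of r "\<lambda>a. - s a"] IH[of r "\<lambda>a. 0"] by (simp_all only: \<theta>m add_0_right)
    have c: "(CLINT x|\<mu>. complex_of_real (W x * (1 + cos (\<theta> s x))) * iexp (r * x b)) =
        (CLINT x|\<nu>. complex_of_real (W x * (1 + cos (\<theta> s x))) * iexp (r * x b))" for r
      unfolding iexp_cos lin(1)[OF ii] lin(1)[OF ii'] IH im ..
    have si: "(CLINT x|\<mu>. complex_of_real (W x * (1 + sin (\<theta> s x))) * iexp (r * x b)) =
        (CLINT x|\<nu>. complex_of_real (W x * (1 + sin (\<theta> s x))) * iexp (r * x b))" for r
      unfolding iexp_sin lin(2)[OF ii] lin(2)[OF ii'] IH im ..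
    have bd: "0 \<le> W x * (1 + cos y)" "0 \<le> W x * (1 + sin y)" "W x * (1 + cos y) \<le> 2" "W x * (1 + sin y) \<le> 2" for x y
    proof -
      have "0 \<le> 1 + cos y" "1 + cos y \<le> 2" "0 \<le> 1 + sin y" "1 + sin y \<le> 2" 
        using cos_ge_minus_one[of y] cos_le_one[of y] sin_ge_minus_one[of y] sin_le_one[of y] by linarith+
      then show "0 \<le> W x * (1 + cos y)" "0 \<le> W x * (1 + sin y)" "W x * (1 + cos y) \<le> 2" "W x * (1 + sin y) \<le> 2"
        using W01[of x] mult_mono[of "W x" 1 "1 + cos y" 2] mult_mono[of "W x" 1 "1 + sin y" 2] by auto
    qed
    have c': "(\<integral>x. W x * (1 + cos (\<theta> s x)) * indicator (E b) (x b) \<partial>\<mu>) = (\<integral>x. W x * (1 + cos (\<theta> s x)) * indicator (E b) (x b) \<partial>\<nu>)"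
      by (rule weighted_char_unique[OF P.prob_space_axioms Q.prob_space_axioms, where B=2]) (use c bd in auto)
    have si': "(\<integral>x. W x * (1 + sin (\<theta> s x)) * indicator (E b) (x b) \<partial>\<mu>) = (\<integral>x. W x * (1 + sin (\<theta> s x)) * indicator (E b) (x b) \<partial>\<nu>)"
      by (rule weighted_char_unique[OF P.prob_space_axioms Q.prob_space_axioms, where B=2]) (use si bd in auto)
    have w': "(\<integral>x. W x * indicator (E b) (x b) \<partial>\<mu>) = (\<integral>x. W x * indicator (E b) (x b) \<partial>\<nu>)"
      by (rule weighted_char_unique[OF P.prob_space_axioms Q.prob_space_axioms, where B=1])
         (use IH[of _ "\<lambda>_. 0"] W01 in \<open>auto simp: \<theta>m\<close>)
    \<comment> \<open>Subtracting the weight \<open>W\<close> alone turns \<open>1 + cos\<close> and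
      \<open>1 + sin\<close> back into the real and imaginary part of the remaining
      character.\<close>
    have eq3: "complex_of_real (\<Prod>a\<in>insert b B. indicator (E a) (x a)) * iexp (\<Sum>a\<in>A - insert b B. s a * x a)
      = complex_of_real (W x * (1 + cos (\<theta> s x)) * indicator (E b) (x b) - W x * indicator (E b) (x b)) +
        \<i> * complex_of_real (W x * (1 + sin (\<theta> s x)) * indicator (E b) (x b) - W x * indicator (E b) (x b))" for x
      using insert.hyps by (simp add: W_def \<theta>_def[symmetric] exp_Euler cos_of_real sin_of_real algebra_simps)
    have W2: "0 \<le> W x" "W x \<le> 2" for x using W01[of x] by auto
    have i1: "integrable \<mu> (\<lambda>x. W x * (1 + cos (\<theta> s x)) * indicator (E b) (x b))"
       "integrable \<mu> (\<lambda>x. W x * (1 + sin (\<theta> s x)) * indicator (E b) (x b))"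
       "integrable \<mu> (\<lambda>x. W x * indicator (E b) (x b))"
      using bd W2 by (auto intro!: P.integrable_const_bound[where B=2] simp: indicator_def)
    have i2: "integrable \<nu> (\<lambda>x. W x * (1 + cos (\<theta> s x)) * indicator (E b) (x b))"
       "integrable \<nu> (\<lambda>x. W x * (1 + sin (\<theta> s x)) * indicator (E b) (x b))"
       "integrable \<nu> (\<lambda>x. W x * indicator (E b) (x b))"
      using bd W2 by (auto intro!: Q.integrable_const_bound[where B=2] simp: indicator_def)
    have fin_eq: "(CLINT x|N. complex_of_real (a x - c x) + \<i> * complex_of_real (d x - c x))
         = complex_of_real (integral\<^sup>L N a - integral\<^sup>L N c) + \<i> * complex_of_real (integral\<^sup>L N d - integral\<^sup>L N c)"
      if "integrable N a" "integrable N c" "integrable N d" for N :: "('i \<Rightarrow> real) measure" and a c d using that by simp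
    show ?case unfolding eq3 fin_eq[OF i1(1,3,2)] fin_eq[OF i2(1,3,2)] c' si' w' ..
  qed
  show ?thesis
  proof (rule measure_eqI_PiM_finite[OF fin sets])
    fix E assume E: "\<And>i. i \<in> A \<Longrightarrow> E i \<in> sets (borel :: real measure)"
    have ind: "(\<Prod>a\<in>A. indicator (E a) (x a) :: real) = indicator (Pi\<^sub>E A E) x" if "x \<in> extensional A" for x :: "'i \<Rightarrow> real"
      using fin that by (auto simp: indicator_def PiE_def Pi_def prod_zero_iff)
    have [measurable]: "Pi\<^sub>E A E \<in> sets \<mu>" "Pi\<^sub>E A E \<in> sets \<nu>" using E fin by (auto simp: sets intro!: sets_PiM_I_finite)
    have sp: "x \<in> extensional A" if "x \<in> space \<mu> \<or> x \<in> space \<nu>" for x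
      using that sets_eq_imp_space_eq[OF sets(1)] sets_eq_imp_space_eq[OF sets(2)] by (auto simp: space_PiM PiE_def)
    have "measure \<mu> (Pi\<^sub>E A E) = (\<integral>x. indicator (Pi\<^sub>E A E) x \<partial>\<mu>)" by simp
    also have "\<dots> = (\<integral>x. (\<Prod>a\<in>A. indicator (E a) (x a) :: real) \<partial>\<mu>)"
      by (intro Bochner_Integration.integral_cong) (auto simp: ind sp)
    also have "\<dots> = (\<integral>x. (\<Prod>a\<in>A. indicator (E a) (x a) :: real) \<partial>\<nu>)"
      using main[of E A "\<lambda>_. 0"] E by (simp del: of_real_prod)
    also have "\<dots> = (\<integral>x. indicator (Pi\<^sub>E A E) x \<partial>\<nu>)"
      by (intro Bochner_Integration.integral_cong) (auto simp: ind sp)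
    also have "\<dots> = measure \<nu> (Pi\<^sub>E A E)" by simp
    finally show "emeasure \<mu> (Pi\<^sub>E A E) = emeasure \<nu> (Pi\<^sub>E A E)"
      by (simp add: P.emeasure_eq_measure Q.emeasure_eq_measure)
  next
    show "range (\<lambda>_::nat. Pi\<^sub>E A (\<lambda>_. UNIV)) \<subseteq> prod_algebra A (\<lambda>_. borel :: real measure)"
      using fin by (auto intro!: prod_algebraI_finite)
  qed (auto simp: space_PiM)
qed

section \<open>Standard Gaussian product measures and their linear images\<close>

definition gauss :: "'i set \<Rightarrow> ('i \<Rightarrow> real) measure" where
  "gauss I = PiM I (\<lambda>_. std_normal_distribution)"

lemma prob_space_std_normal: "prob_space std_normal_distribution"
  by (rule prob_space_normal_density) simp

lemma product_prob_space_std_normal: "product_prob_space (\<lambda>_::'i. std_normal_distribution)"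
  by (intro product_prob_spaceI prob_space_std_normal)

lemma product_sigma_finite_std_normal: "product_sigma_finite (\<lambda>_::'i. std_normal_distribution)"
  using product_prob_space_std_normal by (rule product_prob_space.axioms)

lemma prob_space_gauss: "prob_space (gauss I)"
  unfolding gauss_def by (intro prob_space_PiM prob_space_std_normal)

lemma sets_gauss [measurable_cong]: "sets (gauss I) = sets (PiM I (\<lambda>_. borel))"
  unfolding gauss_def by (intro sets_PiM_cong) auto

lemma measurable_gauss_component [measurable]: "i \<in> I \<Longrightarrow> (\<lambda>x. x i) \<in> borel_measurable (gauss I)"
  by (auto intro!: measurable_component_singleton simp: measurable_cong_sets[OF sets_gauss refl])

lemma integral_gauss_prod:
  fixes f :: "'i \<Rightarrow> real \<Rightarrow> 'b::{real_normed_field,banach,second_countable_topology}"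
  assumes "finite I" "\<And>i. i \<in> I \<Longrightarrow> integrable std_normal_distribution (f i)"
  shows "(\<integral>x. (\<Prod>i\<in>I. f i (x i)) \<partial>gauss I) = (\<Prod>i\<in>I. integral\<^sup>L std_normal_distribution (f i))"
  unfolding gauss_def
  by (rule product_sigma_finite.product_integral_prod[OF product_sigma_finite_std_normal assms])

lemma char_gauss:
  assumes "finite I"
  shows "(CLINT x|gauss I. iexp (\<Sum>i\<in>I. c i * x i)) = exp (- (\<Sum>i\<in>I. (c i)\<^sup>2) / 2)"
proof -
  interpret prob_space std_normal_distribution by (rule prob_space_std_normal)
  have "(CLINT x|gauss I. iexp (\<Sum>i\<in>I. c i * x i)) = (CLINT x|gauss I. (\<Prod>i\<in>I. iexp (c i * x i)))"
    using assms by (simp add: exp_sum sum_distrib_left)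
  also have "\<dots> = (\<Prod>i\<in>I. char std_normal_distribution (c i))"
    unfolding char_def using assms by (intro integral_gauss_prod integrable_iexp) auto
  also have "\<dots> = exp (- (\<Sum>i\<in>I. (c i)\<^sup>2) / 2)"
    using assms by (simp add: char_std_normal_distribution exp_of_real[symmetric] exp_sum[symmetric] sum_divide_distrib sum_negf)
  finally show ?thesis .
qed

lemma measurable_linear_gauss:
  assumes "finite I"
  shows "(\<lambda>x. \<lambda>a\<in>A. \<Sum>i\<in>I. L a i * x i) \<in> measurable (gauss I) (PiM A (\<lambda>_. borel))"
  by (intro measurable_restrict borel_measurable_sum borel_measurable_times borel_measurable_const measurable_gauss_component)

lemma sum_square_quadratic:
  fixes s :: "'i \<Rightarrow> real"
  assumes "finite A" "finite I"
  shows "(\<Sum>i\<in>I. (\<Sum>a\<in>A. s a * L a i)\<^sup>2) = (\<Sum>a\<in>A. \<Sum>b\<in>A. s a * s b * (\<Sum>i\<in>I. L a i * L b i))"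
proof -
  have "(\<Sum>i\<in>I. (\<Sum>a\<in>A. s a * L a i)\<^sup>2) = (\<Sum>i\<in>I. \<Sum>a\<in>A. \<Sum>b\<in>A. s a * s b * (L a i * L b i))"
    by (simp add: power2_eq_square sum_product algebra_simps)
  also have "\<dots> = (\<Sum>a\<in>A. \<Sum>i\<in>I. \<Sum>b\<in>A. s a * s b * (L a i * L b i))" by (rule sum.swap)
  also have "\<dots> = (\<Sum>a\<in>A. \<Sum>b\<in>A. \<Sum>i\<in>I. s a * s b * (L a i * L b i))"
    by (intro sum.cong refl sum.swap)
  finally show ?thesis by (simp add: sum_distrib_left)
qed

lemma char_linear_gauss:
  assumes "finite I" "finite A"
  shows "(CLINT y|distr (gauss I) (PiM A (\<lambda>_. borel)) (\<lambda>x. \<lambda>a\<in>A. \<Sum>i\<in>I. L a i * x i). iexp (\<Sum>a\<in>A. s a * y a))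
    = exp (- (\<Sum>a\<in>A. \<Sum>b\<in>A. s a * s b * (\<Sum>i\<in>I. L a i * L b i)) / 2)"
proof -
  have "(\<Sum>a\<in>A. s a * (\<lambda>a\<in>A. \<Sum>i\<in>I. L a i * x i) a) = (\<Sum>i\<in>I. (\<Sum>a\<in>A. s a * L a i) * x i)" for x
    by (simp add: sum_distrib_left sum_distrib_right mult.assoc) (rule sum.swap)
  then show ?thesis using assms
    by (subst integral_distr[OF measurable_linear_gauss[OF assms(1)]])
       (simp_all add: char_gauss sum_square_quadratic del: of_real_sum of_real_mult)
qed

text \<open>The characteristic function of a linear image involves the coefficients only through the
  covariance. The index sets may differ, so fresh randomness can be added or removed; identities in
  law below are reduced to matching covariances.\<close>

lemma distr_linear_gauss_eq:
  fixes L :: "'a \<Rightarrow> 'i \<Rightarrow> real" and K :: "'a \<Rightarrow> 'j \<Rightarrow> real"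
  assumes "finite A" "finite I" "finite J"
    and cov: "\<And>a b. a \<in> A \<Longrightarrow> b \<in> A \<Longrightarrow> (\<Sum>i\<in>I. L a i * L b i) = (\<Sum>j\<in>J. K a j * K b j)"
  shows "distr (gauss I) (PiM A (\<lambda>_. borel)) (\<lambda>x. \<lambda>a\<in>A. \<Sum>i\<in>I. L a i * x i)
    = distr (gauss J) (PiM A (\<lambda>_. borel)) (\<lambda>x. \<lambda>a\<in>A. \<Sum>j\<in>J. K a j * x j)"
proof (rule char_PiM_unique[OF assms(1)])
  show "prob_space (distr (gauss I) (PiM A (\<lambda>_. borel)) (\<lambda>x. \<lambda>a\<in>A. \<Sum>i\<in>I. L a i * x i))"
    by (rule prob_space.prob_space_distr[OF prob_space_gauss measurable_linear_gauss]) fact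
  show "prob_space (distr (gauss J) (PiM A (\<lambda>_. borel)) (\<lambda>x. \<lambda>a\<in>A. \<Sum>i\<in>J. K a i * x i))"
    by (rule prob_space.prob_space_distr[OF prob_space_gauss measurable_linear_gauss]) fact
  fix s
  show "(CLINT y|distr (gauss I) (PiM A (\<lambda>_. borel)) (\<lambda>x. \<lambda>a\<in>A. \<Sum>i\<in>I. L a i * x i). iexp (\<Sum>a\<in>A. s a * y a))
   = (CLINT y|distr (gauss J) (PiM A (\<lambda>_. borel)) (\<lambda>x. \<lambda>a\<in>A. \<Sum>i\<in>J. K a i * x i). iexp (\<Sum>a\<in>A. s a * y a))"
    using assms by (simp add: char_linear_gauss cong: sum.cong del: of_real_sum of_real_mult)
qed simp_all

section \<open>Concentration\<close>

lemma has_integral_mgf_std_normal: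
  "has_bochner_integral std_normal_distribution (\<lambda>x. exp (c * x)) (exp (c\<^sup>2 / 2))"
proof -
  have eq: "std_normal_density x * exp (c * x) = exp (c\<^sup>2 / 2) * normal_density c 1 x" for x
    by (simp add: normal_density_def exp_add[symmetric] power2_eq_square field_simps flip: exp_add)
  have "has_bochner_integral lborel (\<lambda>x. exp (c\<^sup>2 / 2) * normal_density c 1 x) (exp (c\<^sup>2 / 2) * 1)"
    by (intro has_bochner_integral_mult_right) (simp add: has_bochner_integral_iff)
  then show ?thesis by (intro has_bochner_integral_density) (auto simp: eq)
qed

lemma integrable_exp_square_std_normal:
  "integrable std_normal_distribution (\<lambda>x. exp (x\<^sup>2 / 4))"
proof -
  have eq: "std_normal_density x * exp (x\<^sup>2 / 4) = sqrt 2 * normal_density 0 (sqrt 2) x" for x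
    by (simp add: normal_density_def real_sqrt_mult field_simps flip: exp_add)
  have "integrable lborel (\<lambda>x. sqrt 2 * normal_density 0 (sqrt 2) x)" by simp
  then show ?thesis by (subst integrable_density) (auto simp: eq)
qed

lemma has_integral_mgf_gauss:
  assumes "finite I"
  shows "has_bochner_integral (gauss I) (\<lambda>x. exp (\<Sum>i\<in>I. c i * x i)) (exp ((\<Sum>i\<in>I. (c i)\<^sup>2) / 2))"
proof -
  have int: "integrable std_normal_distribution (\<lambda>x. exp (c i * x))" for i
    using has_integral_mgf_std_normal by (simp add: has_bochner_integral_iff)
  have "integrable (gauss I) (\<lambda>x. \<Prod>i\<in>I. exp (c i * x i))"
    unfolding gauss_def
    by (rule product_sigma_finite.product_integrable_prod[OF product_sigma_finite_std_normal assms int])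
  moreover have "(\<integral>x. (\<Prod>i\<in>I. exp (c i * x i)) \<partial>gauss I) = (\<Prod>i\<in>I. exp ((c i)\<^sup>2 / 2))"
    using integral_gauss_prod[OF assms, of "\<lambda>i x. exp (c i * x)"] int
      has_bochner_integral_integral_eq[OF has_integral_mgf_std_normal] by simp
  ultimately show ?thesis
    using assms by (simp add: has_bochner_integral_iff exp_sum sum_divide_distrib)
qed

lemma (in prob_space) exp_markov:
  assumes "s > 0" "integrable M (\<lambda>x. exp (s * X x))"
  shows "prob {x \<in> space M. a \<le> X x} \<le> exp (- s * a) * expectation (\<lambda>x. exp (s * X x))"
proof -
  have "integrable M (\<lambda>x. indicat_real (space M) x * exp (s * X x)) \<longleftrightarrow> integrable M (\<lambda>x. exp (s * X x))"
    by (intro Bochner_Integration.integrable_cong) auto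
  then show ?thesis
    using Chernoff_ineq_ge[of s "space M" X a] assms by (simp add: set_integrable_def set_integral_space)
qed

lemma gauss_linear_tail:
  assumes "finite I" "(\<Sum>i\<in>I. (c i)\<^sup>2) \<le> v" "v > 0" "t > 0"
  shows "measure (gauss I) {x \<in> space (gauss I). t \<le> \<bar>\<Sum>i\<in>I. c i * x i\<bar>} \<le> 2 * exp (- (t\<^sup>2 / (2 * v)))"
proof -
  interpret prob_space "gauss I" by (rule prob_space_gauss)
  have lm[measurable]: "(\<lambda>x. \<Sum>i\<in>I. d i * x i) \<in> borel_measurable (gauss I)" for d
    by (intro borel_measurable_sum borel_measurable_times borel_measurable_const measurable_gauss_component)
  have one: "prob {x \<in> space (gauss I). t \<le> (\<Sum>i\<in>I. d i * x i)} \<le> exp (- (t\<^sup>2 / (2 * v)))"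
    if d: "(\<Sum>i\<in>I. (d i)\<^sup>2) \<le> v" for d
  proof -
    \<comment> \<open>The minimiser of \<open>s\<^sup>2 * v / 2 - s * t\<close>, the exponent in the
      exponential Markov inequality.\<close>
    define s where "s = t / v"
    have s: "s > 0" using assms by (simp add: s_def)
    have h: "has_bochner_integral (gauss I) (\<lambda>x. exp (s * (\<Sum>i\<in>I. d i * x i))) (exp (s\<^sup>2 * (\<Sum>i\<in>I. (d i)\<^sup>2) / 2))"
      using has_integral_mgf_gauss[OF assms(1), of "\<lambda>i. s * d i"]
      by (simp add: sum_distrib_left mult.assoc power_mult_distrib)
    have "prob {x \<in> space (gauss I). t \<le> (\<Sum>i\<in>I. d i * x i)} \<le> exp (- s * t) * exp (s\<^sup>2 * (\<Sum>i\<in>I. (d i)\<^sup>2) / 2)"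
      using exp_markov[OF s, of "\<lambda>x. \<Sum>i\<in>I. d i * x i" t] h by (simp add: has_bochner_integral_iff)
    also have "\<dots> \<le> exp (- s * t) * exp (s\<^sup>2 * v / 2)"
      using d by (intro mult_left_mono) (auto intro!: mult_left_mono divide_right_mono)
    also have "\<dots> = exp (- (t\<^sup>2 / (2 * v)))"
      using assms(3) by (simp add: s_def power2_eq_square field_simps flip: exp_add)
    finally show ?thesis .
  qed
  have "{x \<in> space (gauss I). t \<le> \<bar>\<Sum>i\<in>I. c i * x i\<bar>} =
     {x \<in> space (gauss I). t \<le> (\<Sum>i\<in>I. c i * x i)} \<union> {x \<in> space (gauss I). t \<le> (\<Sum>i\<in>I. (- c i) * x i)}"
    by (auto simp: sum_negf)
  also have "prob \<dots> \<le> prob {x \<in> space (gauss I). t \<le> (\<Sum>i\<in>I. c i * x i)} + prob {x \<in> space (gauss I). t \<le> (\<Sum>i\<in>I. (- c i) * x i)}"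
    by (intro measure_Un_le borel_measurable_le lm borel_measurable_const)
  also have "\<dots> \<le> exp (- (t\<^sup>2 / (2 * v))) + exp (- (t\<^sup>2 / (2 * v)))"
    by (intro add_mono one) (simp_all add: assms(2))
  finally show ?thesis by (simp only: mult_2)
qed

text \<open>The Taylor remainder carries \<open>exp t * x\<^sup>2\<close> with
  \<open>\<bar>t\<bar> \<le> a * \<bar>x\<bar> / 2\<close>. Half of the exponent
  \<open>a * \<bar>x\<bar>\<close> pays for \<open>exp t\<close>, the other half for
  \<open>x\<^sup>2\<close>, so only the exponential moment assumed in \<open>iid_mean_tail\<close>
  remains.\<close>

lemma exp_le_quadratic:
  fixes a l x :: real
  assumes "a > 0" "\<bar>l\<bar> \<le> a / 2"
  shows "exp (l * x) \<le> 1 + l * x + l\<^sup>2 * (8 / a\<^sup>2 * exp (a * \<bar>x\<bar>))"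
proof -
  obtain t where t: "\<bar>t\<bar> \<le> \<bar>l * x\<bar>" "exp (l * x) = (\<Sum>m<2. (l * x) ^ m / fact m) + exp t / fact 2 * (l * x) ^ 2"
    using Maclaurin_exp_le[of "l * x" 2] by blast
  define u where "u = a * \<bar>x\<bar> / 2"
  have u: "0 \<le> u" using assms by (simp add: u_def)
  have "t \<le> u" using t(1) assms mult_right_mono[OF assms(2), of "\<bar>x\<bar>"] by (simp add: u_def abs_mult)
  moreover have "u\<^sup>2 / 2 \<le> exp u" using exp_lower_Taylor_quadratic[OF u] u by linarith
  ultimately have "exp t * (u\<^sup>2 / 2) \<le> exp u * exp u" by (intro mult_mono) auto
  also have "\<dots> = exp (a * \<bar>x\<bar>)" by (simp add: u_def flip: exp_add)
  also have "u\<^sup>2 / 2 = a\<^sup>2 / 8 * x\<^sup>2" by (simp add: u_def power_divide power_mult_distrib)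
  finally have "exp t * x\<^sup>2 \<le> 8 / a\<^sup>2 * exp (a * \<bar>x\<bar>)" using assms(1) by (simp add: field_simps)
  then have "l\<^sup>2 * (exp t * x\<^sup>2) \<le> l\<^sup>2 * (8 / a\<^sup>2 * exp (a * \<bar>x\<bar>))" by (intro mult_left_mono) auto
  moreover have "exp t / 2 * (l * x)\<^sup>2 \<le> l\<^sup>2 * (exp t * x\<^sup>2)" by (simp add: power_mult_distrib)
  moreover have "exp (l * x) = 1 + l * x + exp t / 2 * (l * x)\<^sup>2" using t(2) by (simp add: numeral_2_eq_2)
  ultimately show ?thesis by linarith
qed

text \<open>A Chernoff bound in which the quadratic term of \<open>exp_le_quadratic\<close> makes
  the moment generating function Gaussian near 0. The constant depends on \<open>D\<close> and
  \<open>a\<close> alone: it is chosen before \<open>N\<close>, the probability space and the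
  variables.\<close>

lemma iid_mean_tail:
  fixes D :: "real measure" and a :: real
  assumes "real_distribution D" and a: "a > 0" and int: "integrable D (\<lambda>x. exp (a * \<bar>x\<bar>))"
  shows "\<exists>C>0. \<forall>N\<ge>1. \<forall>(M::'b measure) Y. prob_space M \<longrightarrow> prob_space.indep_vars M (\<lambda>_. borel) Y {1..N} \<longrightarrow>
     (\<forall>i\<in>{1..N}. distr M borel (Y i) = D) \<longrightarrow> (\<forall>t. 0 < t \<and> t \<le> 1 \<longrightarrow>
       measure M {\<omega> \<in> space M. t \<le> \<bar>1 / real N * (\<Sum>i=1..N. Y i \<omega>) - (\<integral>x. x \<partial>D)\<bar>} \<le> C * exp (- (t\<^sup>2 * real N / C)))"
proof -
  interpret D: real_distribution D by fact
  have md: "borel_measurable D = borel_measurable borel" by (rule measurable_cong_sets) simp_all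
  define \<mu> where "\<mu> = (\<integral>x. x \<partial>D)"
  define B where "B = 8 / a\<^sup>2 * (\<integral>x. exp (a * \<bar>x\<bar>) \<partial>D)"
  have B0: "B \<ge> 0" by (simp add: B_def)
  have intx: "integrable D (\<lambda>x. x)"
  proof (rule Bochner_Integration.integrable_bound[OF integrable_mult_right[OF int, of "1 / a"]])
    have "\<bar>x\<bar> \<le> 1 / a * exp (a * \<bar>x\<bar>)" for x
    proof -
      have "a * \<bar>x\<bar> \<le> exp (a * \<bar>x\<bar>)" using exp_ge_add_one_self[of "a * \<bar>x\<bar>"] by linarith
      then show ?thesis using a by (simp add: field_simps)
    qed
    then show "AE x in D. norm x \<le> norm (1 / a * exp (a * \<bar>x\<bar>))" using a by simp
  qed (simp add: md)
  have intl: "integrable D (\<lambda>x. exp (l * x))" if "\<bar>l\<bar> \<le> a / 2" for l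
  proof (rule Bochner_Integration.integrable_bound[OF int])
    have "l * x \<le> a * \<bar>x\<bar>" for x
    proof -
      have "l * x \<le> \<bar>l\<bar> * \<bar>x\<bar>" by (metis abs_ge_self abs_mult)
      also have "\<dots> \<le> a * \<bar>x\<bar>" using that a by (intro mult_right_mono) auto
      finally show ?thesis .
    qed
    then show "AE x in D. norm (exp (l * x)) \<le> norm (exp (a * \<bar>x\<bar>))" by simp
  qed (simp add: md)
  have mgf: "(\<integral>x. exp (l * x) \<partial>D) * exp (- (l * \<mu>)) \<le> exp (l\<^sup>2 * B)" if l: "\<bar>l\<bar> \<le> a / 2" for l
  proof -
    have "(\<integral>x. exp (l * x) \<partial>D) \<le> (\<integral>x. 1 + l * x + l\<^sup>2 * (8 / a\<^sup>2 * exp (a * \<bar>x\<bar>)) \<partial>D)"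
      using intl[OF l] intx int exp_le_quadratic[OF a l] by (intro integral_mono) auto
    also have "\<dots> = 1 + l * \<mu> + l\<^sup>2 * B"
      using intx int D.prob_space by (simp add: \<mu>_def B_def)
    also have "\<dots> \<le> exp (l * \<mu> + l\<^sup>2 * B)" using exp_ge_add_one_self[of "l * \<mu> + l\<^sup>2 * B"] by linarith
    finally show ?thesis by (simp add: exp_add exp_minus field_simps)
  qed
  \<comment> \<open>The tilt will be \<open>\<delta> * t\<close> up to sign:
    \<open>\<delta> \<le> a / 2\<close> keeps it in the range of \<open>mgf\<close> since
    \<open>t \<le> 1\<close>, and \<open>\<delta> * B \<le> 1 / 2\<close> loses at most half of the
    linear gain.\<close>
  define \<delta> where "\<delta> = min (a / 2) (1 / (2 * B + 1))"
  have \<delta>: "\<delta> > 0" "\<delta> \<le> a / 2" "\<delta> * B \<le> 1 / 2"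
  proof -
    show "\<delta> > 0" "\<delta> \<le> a / 2" using a B0 by (auto simp: \<delta>_def)
    have "\<delta> * B \<le> 1 / (2 * B + 1) * B" using B0 by (intro mult_right_mono) (auto simp: \<delta>_def)
    also have "\<dots> \<le> 1 / 2" using B0 by (simp add: field_simps)
    finally show "\<delta> * B \<le> 1 / 2" .
  qed
  \<comment> \<open>The summand 2 covers the prefactor from the two tails, the summand
    \<open>2 / \<delta>\<close> the rate.\<close>
  define C where "C = 2 + 2 / \<delta>"
  show ?thesis
  proof (intro exI[of _ C] conjI allI impI)
    show "C > 0" using \<delta> by (simp add: C_def add_pos_pos)
    fix N :: nat and M :: "'b measure" and Y and t :: real
    assume N: "N \<ge> 1" and M: "prob_space M" and ind: "prob_space.indep_vars M (\<lambda>_. borel) Y {1..N}"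
      and dist: "\<forall>i\<in>{1..N}. distr M borel (Y i) = D" and t: "0 < t \<and> t \<le> 1"
    interpret prob_space M by fact
    have Ym[measurable]: "Y i \<in> borel_measurable M" if "i \<in> {1..N}" for i
      using ind that unfolding indep_vars_def2 by blast
    have Zm: "(\<lambda>\<omega>. 1 / real N * (\<Sum>i=1..N. Y i \<omega>) - \<mu>) \<in> borel_measurable M"
      by (intro borel_measurable_diff borel_measurable_times borel_measurable_sum borel_measurable_const Ym)
    have one: "prob {\<omega> \<in> space M. t \<le> e * (1 / real N * (\<Sum>i=1..N. Y i \<omega>) - \<mu>)} \<le> exp (- (\<delta> * t\<^sup>2 * real N / 2))"
      if e: "e = 1 \<or> e = -1" for e :: real
    proof -
      define l where "l = e * \<delta> * t"
      have l: "\<bar>l\<bar> \<le> a / 2" "l\<^sup>2 = (\<delta> * t)\<^sup>2" using e t \<delta> mult_mono[of \<delta> "a/2" t 1] by (auto simp: l_def abs_mult)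
      define s where "s = \<delta> * t * real N"
      have s: "s > 0" using \<delta> t N by (simp add: s_def)
      define X where "X = (\<lambda>\<omega>. e * (1 / real N * (\<Sum>i=1..N. Y i \<omega>) - \<mu>))"
      have sX: "exp (s * X \<omega>) = (\<Prod>i\<in>{1..N}. exp (l * Y i \<omega>) * exp (- (l * \<mu>)))" for \<omega>
      proof -
        have "s * X \<omega> = (\<Sum>i=1..N. l * Y i \<omega> - l * \<mu>)"
          using N by (simp add: s_def X_def l_def sum_subtractf sum_distrib_left[symmetric] field_simps)
        then show ?thesis by (simp add: exp_sum exp_diff exp_minus divide_inverse)
      qed
      have ind2: "indep_vars (\<lambda>_. borel) (\<lambda>i \<omega>. exp (l * Y i \<omega>) * exp (- (l * \<mu>))) {1..N}"
        by (rule indep_vars_compose2[OF ind]) measurable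
      have intY: "integrable M (\<lambda>\<omega>. exp (l * Y i \<omega>))" and eY: "(\<integral>\<omega>. exp (l * Y i \<omega>) \<partial>M) = (\<integral>x. exp (l * x) \<partial>D)"
        if i: "i \<in> {1..N}" for i
      proof -
        have d: "distr M borel (Y i) = D" using dist i by blast
        show "integrable M (\<lambda>\<omega>. exp (l * Y i \<omega>))"
          by (rule integrable_distr[OF Ym[OF i]]) (simp only: d intl[OF l(1)])
        show "(\<integral>\<omega>. exp (l * Y i \<omega>) \<partial>M) = (\<integral>x. exp (l * x) \<partial>D)"
          using integral_distr[OF Ym[OF i], of "\<lambda>x. exp (l * x)"] by (simp add: d)
      qed
      have intp: "integrable M (\<lambda>\<omega>. exp (s * X \<omega>))"
        unfolding sX using intY by (intro indep_vars_integrable ind2) auto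
      have "expectation (\<lambda>\<omega>. exp (s * X \<omega>)) = (\<Prod>i\<in>{1..N}. expectation (\<lambda>\<omega>. exp (l * Y i \<omega>) * exp (- (l * \<mu>))))"
        unfolding sX using intY by (intro indep_vars_lebesgue_integral ind2) auto
      also have "\<dots> \<le> (\<Prod>i\<in>{1..N}. exp (l\<^sup>2 * B))"
        using mgf[OF l(1)] by (intro prod_mono) (auto simp: eY)
      also have "\<dots> = exp (real N * (l\<^sup>2 * B))" by (simp add: exp_of_nat_mult)
      finally have E: "expectation (\<lambda>\<omega>. exp (s * X \<omega>)) \<le> exp (real N * (l\<^sup>2 * B))" .
      have "prob {\<omega> \<in> space M. t \<le> X \<omega>} \<le> exp (- s * t) * exp (real N * (l\<^sup>2 * B))"
        by (rule order_trans[OF exp_markov[OF s intp]]) (intro mult_left_mono E, simp)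
      also have "\<dots> = exp (- (\<delta> * t\<^sup>2 * real N) * (1 - \<delta> * B))"
        unfolding l(2) s_def by (simp add: power2_eq_square algebra_simps flip: exp_add)
      also have "\<dots> \<le> exp (- (\<delta> * t\<^sup>2 * real N / 2))"
      proof -
        have "\<delta> * t\<^sup>2 * real N * (1 / 2) \<le> \<delta> * t\<^sup>2 * real N * (1 - \<delta> * B)"
          using \<delta> by (intro mult_left_mono) auto
        then show ?thesis by simp
      qed
      finally show ?thesis by (simp add: X_def)
    qed
    define W where "W \<omega> = 1 / real N * (\<Sum>i=1..N. Y i \<omega>) - \<mu>" for \<omega>
    have Wm: "W \<in> borel_measurable M" unfolding W_def by (rule Zm)
    note p1 = one[OF disjI1[OF refl], folded W_def] and p2 = one[OF disjI2[OF refl], folded W_def]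
    have "{\<omega> \<in> space M. t \<le> \<bar>1 / real N * (\<Sum>i=1..N. Y i \<omega>) - (\<integral>x. x \<partial>D)\<bar>} =
      {\<omega> \<in> space M. t \<le> 1 * W \<omega>} \<union> {\<omega> \<in> space M. t \<le> -1 * W \<omega>}"
      unfolding \<mu>_def[symmetric] W_def[symmetric] by auto
    then have "prob {\<omega> \<in> space M. t \<le> \<bar>1 / real N * (\<Sum>i=1..N. Y i \<omega>) - (\<integral>x. x \<partial>D)\<bar>} =
      prob ({\<omega> \<in> space M. t \<le> 1 * W \<omega>} \<union> {\<omega> \<in> space M. t \<le> -1 * W \<omega>})"
      by (rule arg_cong)
    also have "\<dots> \<le> prob {\<omega> \<in> space M. t \<le> 1 * W \<omega>} + prob {\<omega> \<in> space M. t \<le> -1 * W \<omega>}"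
      by (intro measure_Un_le borel_measurable_le borel_measurable_times[OF _ Wm] borel_measurable_const)
    also have "\<dots> \<le> exp (- (\<delta> * t\<^sup>2 * real N / 2)) + exp (- (\<delta> * t\<^sup>2 * real N / 2))"
      by (rule add_mono[OF p1 p2])
    also have "\<dots> = 2 * exp (- (\<delta> * t\<^sup>2 * real N / 2))" by (rule mult_2[symmetric])
    also have "\<dots> \<le> C * exp (- (t\<^sup>2 * real N / C))"
    proof (rule mult_mono)
      have "t\<^sup>2 * real N / C \<le> t\<^sup>2 * real N / (2 / \<delta>)" using \<delta> by (intro divide_left_mono) (auto simp: C_def add_pos_pos)
      then show "exp (- (\<delta> * t\<^sup>2 * real N / 2)) \<le> exp (- (t\<^sup>2 * real N / C))" by (simp add: mult_ac)
    qed (use \<delta> in \<open>auto simp: C_def\<close>)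
    finally show "prob {\<omega> \<in> space M. t \<le> \<bar>1 / real N * (\<Sum>i=1..N. Y i \<omega>) - (\<integral>x. x \<partial>D)\<bar>} \<le> C * exp (- (t\<^sup>2 * real N / C))" .
  qed
qed

lemma distr_gauss_reindex:
  assumes "inj_on f K" "f ` K \<subseteq> J"
  shows "distr (gauss J) (PiM K (\<lambda>_. borel)) (\<lambda>\<omega>. \<lambda>k\<in>K. \<omega> (f k)) = gauss K"
proof -
  have "distr (gauss J) (PiM K (\<lambda>_. borel)) (\<lambda>\<omega>. \<lambda>k\<in>K. \<omega> (f k)) =
    distr (gauss J) (PiM K (\<lambda>_. std_normal_distribution)) (\<lambda>\<omega>. \<lambda>k\<in>K. \<omega> (f k))"
    by (intro distr_cong refl sets_PiM_cong) auto
  also have "\<dots> = gauss K" unfolding gauss_def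
    using assms by (intro distr_PiM_reindex prob_space_std_normal) auto
  finally show ?thesis .
qed

lemma distr_gauss_component:
  assumes "j \<in> J" shows "distr (gauss J) borel (\<lambda>\<omega>. \<omega> j) = std_normal_distribution"
proof -
  have "distr (gauss J) borel (\<lambda>\<omega>. \<omega> j) = distr (gauss J) std_normal_distribution (\<lambda>\<omega>. \<omega> j)"
    by (intro distr_cong) auto
  also have "\<dots> = std_normal_distribution" unfolding gauss_def
    by (rule product_prob_space.PiM_component[OF product_prob_space_std_normal assms])
  finally show ?thesis .
qed

lemma indep_vars_gauss: "prob_space.indep_vars (gauss J) (\<lambda>_. borel) (\<lambda>j \<omega>. \<omega> j) J"
proof (cases "J = {}")
  case True
  interpret prob_space "gauss J" by (rule prob_space_gauss)
  show ?thesis unfolding indep_vars_def2 indep_sets_def using True by simp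
next
  case False
  interpret prob_space "gauss J" by (rule prob_space_gauss)
  have "distr (gauss J) (PiM J (\<lambda>_. borel)) (\<lambda>\<omega>. \<lambda>j\<in>J. \<omega> j) = gauss J"
    using distr_gauss_reindex[of id J J] by simp
  also have "\<dots> = PiM J (\<lambda>j. distr (gauss J) borel (\<lambda>\<omega>. \<omega> j))"
    by (subst gauss_def, intro PiM_cong) (simp_all only: distr_gauss_component)
  finally have e: "distr (gauss J) (PiM J (\<lambda>_. borel)) (\<lambda>\<omega>. \<lambda>j\<in>J. \<omega> j) = PiM J (\<lambda>j. distr (gauss J) borel (\<lambda>\<omega>. \<omega> j))" .
  show ?thesis
    by (rule iffD2[OF indep_vars_iff_distr_eq_PiM'[OF False] e]) (rule measurable_gauss_component)
qed

text \<open>Injectivity of \<open>idx\<close> makes the columns disjoint sets of coordinates, so the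
  summands are independent with the law of \<open>f\<close> under \<open>gauss {1..n}\<close>.
  Growth at most quadratic in one coordinate gives them an exponential moment of order 1 / 4, as
  \<open>iid_mean_tail\<close> asks.\<close>

lemma conv_column_average:
  fixes idx :: "nat \<Rightarrow> nat \<Rightarrow> 'j" and J :: "nat \<Rightarrow> 'j set"
  assumes inj: "\<And>N. N \<ge> 1 \<Longrightarrow> inj_on (\<lambda>(k, i). idx k i) ({1..n} \<times> {1..N})"
    and idx: "\<And>N k i. N \<ge> 1 \<Longrightarrow> k \<in> {1..n} \<Longrightarrow> i \<in> {1..N} \<Longrightarrow> idx k i \<in> J N"
    and f: "f \<in> borel_measurable (PiM {1..n} (\<lambda>_. borel))" and l: "l \<in> {1..n}"
    and bd: "\<And>x. \<bar>f x\<bar> \<le> 1 + (x l)\<^sup>2"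
  shows "conv (\<lambda>N. gauss (J N)) (\<lambda>N \<omega>. 1 / real N * (\<Sum>i=1..N. f (\<lambda>k\<in>{1..n}. \<omega> (idx k i)))) (\<integral>x. f x \<partial>gauss {1..n})"
proof -
  have f'[measurable]: "f \<in> borel_measurable (gauss {1..n})"
    using f unfolding measurable_cong_sets[OF sets_gauss refl] .
  define D where "D = distr (gauss {1..n}) borel f"
  interpret G: prob_space "gauss {1..n}" by (rule prob_space_gauss)
  have rd: "real_distribution D" unfolding D_def by (rule G.real_distribution_distr[OF f'])
  have int: "integrable D (\<lambda>x. exp (1 / 4 * \<bar>x\<bar>))"
  proof -
    have "integrable (distr (gauss {1..n}) borel (\<lambda>\<omega>. \<omega> l)) (\<lambda>x. exp (x\<^sup>2 / 4))"
      using integrable_exp_square_std_normal distr_gauss_component[OF l] by simp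
    then have "integrable (gauss {1..n}) (\<lambda>\<omega>. exp ((\<omega> l)\<^sup>2 / 4))"
      by (rule integrable_distr[OF measurable_gauss_component[OF l]])
    then have i1: "integrable (gauss {1..n}) (\<lambda>\<omega>. exp (1 / 4) * exp ((\<omega> l)\<^sup>2 / 4))" by simp
    have "integrable (gauss {1..n}) (\<lambda>\<omega>. exp (1 / 4 * \<bar>f \<omega>\<bar>))"
    proof (rule Bochner_Integration.integrable_bound[OF i1])
      show "AE x in gauss {1..n}. norm (exp (1 / 4 * \<bar>f x\<bar>)) \<le> norm (exp (1 / 4) * exp ((x l)\<^sup>2 / 4))"
      proof (rule AE_I2)
        fix x
        have "1 / 4 * \<bar>f x\<bar> \<le> 1 / 4 + (x l)\<^sup>2 / 4" using bd[of x] by linarith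
        then show "norm (exp (1 / 4 * \<bar>f x\<bar>)) \<le> norm (exp (1 / 4) * exp ((x l)\<^sup>2 / 4))"
          by (simp only: norm_exp real_norm_def abs_exp_cancel exp_le_cancel_iff mult_exp_exp)
      qed
      show "(\<lambda>\<omega>. exp (1 / 4 * \<bar>f \<omega>\<bar>)) \<in> borel_measurable (gauss {1..n})"
        by (rule measurable_compose[OF f']) measurable
    qed
    then show ?thesis unfolding D_def by (subst integrable_distr_eq[OF f']) simp_all
  qed
  have mean: "(\<integral>x. x \<partial>D) = (\<integral>x. f x \<partial>gauss {1..n})" unfolding D_def by (subst integral_distr[OF f']) simp_all
  define Y where "Y i \<omega> = f (\<lambda>k\<in>{1..n}. \<omega> (idx k i))" for i \<omega>
  have mr: "(\<lambda>\<omega>. \<lambda>k\<in>{1..n}. \<omega> (idx k i)) \<in> measurable (gauss (J N)) (PiM {1..n} (\<lambda>_. borel))"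
    if "N \<ge> 1" "i \<in> {1..N}" for N i
    using idx that by (intro measurable_restrict measurable_gauss_component) auto
  have mY: "Y i \<in> borel_measurable (gauss (J N))" if "N \<ge> 1" "i \<in> {1..N}" for N i
    unfolding Y_def by (rule measurable_compose[OF mr[OF that] f])
  have dY: "distr (gauss (J N)) borel (Y i) = D" if "N \<ge> 1" "i \<in> {1..N}" for N i
  proof -
    have "distr (gauss (J N)) borel (Y i) = distr (distr (gauss (J N)) (PiM {1..n} (\<lambda>_. borel)) (\<lambda>\<omega>. \<lambda>k\<in>{1..n}. \<omega> (idx k i))) borel f"
      unfolding distr_distr[OF f mr[OF that]] by (rule arg_cong[of _ _ "distr _ _"]) (rule ext, simp only: Y_def comp_def)
    also have "distr (gauss (J N)) (PiM {1..n} (\<lambda>_. borel)) (\<lambda>\<omega>. \<lambda>k\<in>{1..n}. \<omega> (idx k i)) = gauss {1..n}"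
    proof (rule distr_gauss_reindex)
      show "inj_on (\<lambda>k. idx k i) {1..n}"
      proof (rule inj_onI)
        fix k k' assume "k \<in> {1..n}" "k' \<in> {1..n}" "idx k i = idx k' i"
        then show "k = k'" using inj_onD[OF inj[OF that(1)], of "(k, i)" "(k', i)"] that(2) by simp
      qed
      show "(\<lambda>k. idx k i) ` {1..n} \<subseteq> J N" using idx[OF that(1) _ that(2)] by blast
    qed
    finally show ?thesis by (simp add: D_def)
  qed
  have iY: "prob_space.indep_vars (gauss (J N)) (\<lambda>_. borel) Y {1..N}" if N: "N \<ge> 1" for N
  proof -
    interpret prob_space "gauss (J N)" by (rule prob_space_gauss)
    define K where "K i = (\<lambda>k. idx k i) ` {1..n}" for i
    have "indep_vars (\<lambda>i. PiM (K i) (\<lambda>_. borel)) (\<lambda>i \<omega>. restrict (\<lambda>j. \<omega> j) (K i)) {1..N}"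
    proof (rule indep_vars_restrict[OF indep_vars_gauss])
      show "K i \<subseteq> J N" if "i \<in> {1..N}" for i using idx[OF N] that by (auto simp: K_def)
      show "disjoint_family_on K {1..N}"
      proof (unfold disjoint_family_on_def, intro ballI impI)
        fix i i' assume i: "i \<in> {1..N}" "i' \<in> {1..N}" "i \<noteq> i'"
        have "idx k i \<noteq> idx k' i'" if "k \<in> {1..n}" "k' \<in> {1..n}" for k k'
          using inj_onD[OF inj[OF N], of "(k, i)" "(k', i')"] i that by auto
        then show "K i \<inter> K i' = {}" by (auto simp: K_def)
      qed
    qed
    then have "indep_vars (\<lambda>_. borel) (\<lambda>i \<omega>. f (\<lambda>k\<in>{1..n}. restrict (\<lambda>j. \<omega> j) (K i) (idx k i))) {1..N}"
      by (rule indep_vars_compose2)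
         (rule measurable_compose[OF measurable_restrict f], rule measurable_component_singleton, simp add: K_def)
    moreover have "f (\<lambda>k\<in>{1..n}. restrict (\<lambda>j. \<omega> j) (K i) (idx k i)) = Y i \<omega>" for i \<omega>
      unfolding Y_def by (intro arg_cong[of _ _ f] restrict_ext) (auto simp: K_def)
    ultimately show ?thesis by (simp only:)
  qed
  obtain C where C: "C > 0" "\<forall>N\<ge>1. \<forall>(M::('j \<Rightarrow> real) measure) Y. prob_space M \<longrightarrow> prob_space.indep_vars M (\<lambda>_. borel) Y {1..N} \<longrightarrow>
     (\<forall>i\<in>{1..N}. distr M borel (Y i) = D) \<longrightarrow> (\<forall>t. 0 < t \<and> t \<le> 1 \<longrightarrow>
       measure M {\<omega> \<in> space M. t \<le> \<bar>1 / real N * (\<Sum>i=1..N. Y i \<omega>) - (\<integral>x. x \<partial>D)\<bar>} \<le> C * exp (- (t\<^sup>2 * real N / C)))"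
    using iid_mean_tail[OF rd divide_pos_pos[OF zero_less_one zero_less_numeral] int, where ?'b = "'j \<Rightarrow> real"]
    by (elim exE conjE) (rule that)
  have "negl (\<lambda>N. gauss (J N)) (\<lambda>N \<omega>. 1 / real N * (\<Sum>i=1..N. Y i \<omega>) - (\<integral>x. x \<partial>D))"
    unfolding negl_def
  proof (intro conjI exI[of _ C] C(1))
    show "rvs (\<lambda>N. gauss (J N)) (\<lambda>N \<omega>. 1 / real N * (\<Sum>i=1..N. Y i \<omega>) - (\<integral>x. x \<partial>D))"
      unfolding rvs_def by (intro allI impI borel_measurable_diff borel_measurable_times borel_measurable_sum borel_measurable_const mY)
    show "\<forall>N\<ge>1. \<forall>t. 0 < t \<and> t \<le> 1 \<longrightarrow> measure (gauss (J N)) {\<omega> \<in> space (gauss (J N)). t \<le> \<bar>1 / real N * (\<Sum>i=1..N. Y i \<omega>) - (\<integral>x. x \<partial>D)\<bar>}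
       \<le> C * exp (- (t\<^sup>2 * real N / C))"
    proof (intro allI impI)
      fix N :: nat and t :: real assume N: "N \<ge> 1" and t: "0 < t \<and> t \<le> 1"
      have "\<forall>i\<in>{1..N}. distr (gauss (J N)) borel (Y i) = D" using dY[OF N] by blast
      from C(2)[rule_format, OF N prob_space_gauss iY[OF N] this[rule_format] t]
      show "measure (gauss (J N)) {\<omega> \<in> space (gauss (J N)). t \<le> \<bar>1 / real N * (\<Sum>i=1..N. Y i \<omega>) - (\<integral>x. x \<partial>D)\<bar>}
       \<le> C * exp (- (t\<^sup>2 * real N / C))" .
    qed
  qed
  then show ?thesis by (simp only: Y_def mean)
qed

section \<open>Normalised inner product and Gram-Schmidt orthogonalisation\<close>

lemma sum_mult_delta:
  fixes f :: "'a \<Rightarrow> real"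
  assumes "finite A" "a \<in> A"
  shows "(\<Sum>l\<in>A. f l * (if l = a then 1 else 0)) = f a" "(\<Sum>l\<in>A. f l * (if a = l then 1 else 0)) = f a"
  using assms by (simp_all add: if_distrib[of "\<lambda>c. _ * c"] cong: if_cong)

lemma ninner_commute: "ninner N x y = ninner N y x"
  by (simp add: ninner_def mult.commute)

lemma ninner_add_left: "ninner N (\<lambda>i. x i + y i) z = ninner N x z + ninner N y z"
  by (simp add: ninner_def algebra_simps sum.distrib sum_distrib_left)

lemma ninner_diff_left: "ninner N (\<lambda>i. x i - y i) z = ninner N x z - ninner N y z"
  by (simp add: ninner_def algebra_simps sum_subtractf sum_distrib_left)

lemma ninner_cmult_left: "ninner N (\<lambda>i. c * x i) z = c * ninner N x z"
  by (simp add: ninner_def algebra_simps sum_distrib_left)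

lemma ninner_divide_left: "ninner N (\<lambda>i. x i / c) z = ninner N x z / c"
  using ninner_cmult_left[of N "1 / c" x z] by simp

lemma ninner_zero_left [simp]: "ninner N (\<lambda>i. 0) z = 0"
  by (simp add: ninner_def)

lemma ninner_sum_left: "ninner N (\<lambda>i. \<Sum>l\<in>A. x l i) z = (\<Sum>l\<in>A. ninner N (x l) z)"
  unfolding ninner_def by (simp add: sum_distrib_left sum_distrib_right) (rule sum.swap)

lemma ninner_add_right: "ninner N z (\<lambda>i. x i + y i) = ninner N z x + ninner N z y"
  and ninner_diff_right: "ninner N z (\<lambda>i. x i - y i) = ninner N z x - ninner N z y"
  and ninner_cmult_right: "ninner N z (\<lambda>i. c * x i) = c * ninner N z x"
  and ninner_divide_right: "ninner N z (\<lambda>i. x i / c) = ninner N z x / c"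
  and ninner_zero_right [simp]: "ninner N z (\<lambda>i. 0) = 0"
  and ninner_sum_right: "ninner N z (\<lambda>i. \<Sum>l\<in>A. w l i) = (\<Sum>l\<in>A. ninner N z (w l))"
  by (simp_all add: ninner_commute[of N z] ninner_add_left ninner_diff_left ninner_cmult_left
      ninner_divide_left ninner_sum_left)

lemmas ninner_linear = ninner_add_left ninner_diff_left ninner_cmult_left ninner_divide_left ninner_sum_left
  ninner_add_right ninner_diff_right ninner_cmult_right ninner_divide_right ninner_sum_right

lemma ninner_cong:
  assumes "\<And>i. i \<in> {1..N} \<Longrightarrow> x i = x' i" "\<And>i. i \<in> {1..N} \<Longrightarrow> y i = y' i"
  shows "ninner N x y = ninner N x' y'"
  using assms by (simp add: ninner_def)

lemma ninner_nonneg: "0 \<le> ninner N x x"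
  unfolding ninner_def by (rule mult_nonneg_nonneg, simp, rule sum_nonneg, rule zero_le_square)

lemma nnorm_nonneg: "0 \<le> nnorm N x"
  by (simp add: nnorm_def ninner_nonneg)

lemma nnorm_square: "(nnorm N x)\<^sup>2 = ninner N x x"
  by (simp add: nnorm_def ninner_nonneg)

lemma nnorm_L2: "nnorm N x = L2_set x {1..N} / sqrt (real N)"
  by (simp add: nnorm_def ninner_def L2_set_def power2_eq_square real_sqrt_divide)

lemma nnorm_cong: "(\<And>i. i \<in> {1..N} \<Longrightarrow> x i = x' i) \<Longrightarrow> nnorm N x = nnorm N x'"
  unfolding nnorm_def by (intro arg_cong[of _ _ sqrt] ninner_cong)

lemma nnorm_mono:
  assumes "\<And>i. i \<in> {1..N} \<Longrightarrow> \<bar>x i\<bar> \<le> \<bar>y i\<bar>" shows "nnorm N x \<le> nnorm N y"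
  unfolding nnorm_def ninner_def
  using assms by (intro real_sqrt_le_mono mult_left_mono sum_mono)
    (auto simp: power2_eq_square[symmetric] abs_le_square_iff)

lemma nnorm_triangle: "nnorm N (\<lambda>i. x i + y i) \<le> nnorm N x + nnorm N y"
  unfolding nnorm_L2 add_divide_distrib[symmetric]
  by (intro divide_right_mono L2_set_triangle_ineq) auto

lemma nnorm_cmult: "nnorm N (\<lambda>i. c * x i) = \<bar>c\<bar> * nnorm N x"
proof -
  have "nnorm N (\<lambda>i. c * x i) = sqrt (c\<^sup>2 * ninner N x x)"
    unfolding nnorm_def by (simp add: ninner_linear power2_eq_square mult.assoc)
  then show ?thesis by (simp add: real_sqrt_mult nnorm_def)
qed

lemma nnorm_zero [simp]: "nnorm N (\<lambda>i. 0) = 0"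
  by (simp add: nnorm_def)

lemma nnorm_diff: "nnorm N (\<lambda>i. x i - y i) \<le> nnorm N x + nnorm N y"
  using nnorm_triangle[of N x "\<lambda>i. (-1) * y i"] unfolding nnorm_cmult by simp

lemma nnorm_sum: "finite A \<Longrightarrow> nnorm N (\<lambda>i. \<Sum>l\<in>A. x l i) \<le> (\<Sum>l\<in>A. nnorm N (x l))"
proof (induction A rule: finite_induct)
  case (insert a A)
  then show ?case using nnorm_triangle[of N "x a" "\<lambda>i. \<Sum>l\<in>A. x l i"] by simp
qed simp

lemma ninner_cauchy_schwarz: "\<bar>ninner N x y\<bar> \<le> nnorm N x * nnorm N y"
proof -
  have "\<bar>\<Sum>i=1..N. x i * y i\<bar> \<le> (\<Sum>i=1..N. \<bar>x i\<bar> * \<bar>y i\<bar>)"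
    by (rule order_trans[OF sum_abs]) (simp add: abs_mult)
  also have "\<dots> \<le> L2_set x {1..N} * L2_set y {1..N}" by (rule L2_set_mult_ineq)
  finally have "\<bar>\<Sum>i=1..N. x i * y i\<bar> / real N \<le> L2_set x {1..N} * L2_set y {1..N} / real N"
    by (intro divide_right_mono) auto
  moreover have "\<bar>ninner N x y\<bar> = \<bar>\<Sum>i=1..N. x i * y i\<bar> / real N" by (simp add: ninner_def abs_mult)
  moreover have "nnorm N x * nnorm N y = L2_set x {1..N} * L2_set y {1..N} / real N"
    by (simp add: nnorm_L2)
  ultimately show ?thesis by simp
qed

lemma nnorm_le_const:
  assumes "\<And>i. i \<in> {1..N} \<Longrightarrow> \<bar>x i\<bar> \<le> c" "c \<ge> 0"
  shows "nnorm N x \<le> c"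
proof (cases "N = 0")
  case True then show ?thesis using assms(2) by (simp add: nnorm_def ninner_def)
next
  case False
  have "nnorm N x \<le> nnorm N (\<lambda>i. c)" using assms by (intro nnorm_mono) (auto intro: order_trans)
  also have "\<dots> = sqrt (c\<^sup>2)" using False by (simp add: nnorm_def ninner_def power2_eq_square)
  finally show ?thesis using assms(2) by simp
qed

lemma nnorm_eq_0_iff: "N \<ge> 1 \<Longrightarrow> nnorm N x = 0 \<longleftrightarrow> (\<forall>i\<in>{1..N}. x i = 0)"
  by (simp add: nnorm_L2 L2_set_eq_0_iff)

text \<open>Among functions vanishing outside \<open>{1..N}\<close>, only the zero function has norm
  zero; the uniqueness of \<open>orth_proj\<close> rests on this.\<close>

definition supp :: "nat \<Rightarrow> (nat \<Rightarrow> real) \<Rightarrow> bool" where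
  "supp N x \<longleftrightarrow> (\<forall>i. i \<notin> {1..N} \<longrightarrow> x i = 0)"

lemma supp_eq_0: "N \<ge> 1 \<Longrightarrow> supp N x \<Longrightarrow> nnorm N x = 0 \<Longrightarrow> x = (\<lambda>i. 0)"
  unfolding nnorm_eq_0_iff supp_def by (intro ext) blast

section \<open>Spans, orthogonal projections and Gram-Schmidt for an arbitrary family\<close>

lemma fam_span_lincomb: "(\<lambda>i. \<Sum>l=1..j. c l * v l i) \<in> fam_span j v"
  by (auto simp: fam_span_def)

lemma fam_span_add: "x \<in> fam_span j v \<Longrightarrow> y \<in> fam_span j v \<Longrightarrow> (\<lambda>i. x i + y i) \<in> fam_span j v"
  unfolding fam_span_def
  by clarsimp (rename_tac c d, rule_tac x="\<lambda>l. c l + d l" in exI, simp add: algebra_simps sum.distrib)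

lemma fam_span_cmult: "x \<in> fam_span j v \<Longrightarrow> (\<lambda>i. a * x i) \<in> fam_span j v"
  unfolding fam_span_def
  by clarsimp (rename_tac c, rule_tac x="\<lambda>l. a * c l" in exI, simp add: sum_distrib_left mult.assoc)

lemma fam_span_diff: "x \<in> fam_span j v \<Longrightarrow> y \<in> fam_span j v \<Longrightarrow> (\<lambda>i. x i - y i) \<in> fam_span j v"
  using fam_span_add[of x j v "\<lambda>i. (-1) * y i"] fam_span_cmult[of y j v "-1"] by simp

lemma fam_span_zero: "(\<lambda>i. 0) \<in> fam_span j v"
  using fam_span_lincomb[of "\<lambda>_. 0" v j] by simp

lemma fam_span_base: "l \<in> {1..j} \<Longrightarrow> v l \<in> fam_span j v"
  using fam_span_lincomb[of "\<lambda>l'. if l' = l then 1 else 0" v j]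
  by (simp add: if_distrib[of "\<lambda>c. c * _"] cong: if_cong)

lemma fam_span_sum: "(\<And>l. l \<in> A \<Longrightarrow> x l \<in> fam_span j v) \<Longrightarrow> (\<lambda>i. \<Sum>l\<in>A. x l i) \<in> fam_span j v"
  by (induction A rule: infinite_finite_induct) (auto intro: fam_span_zero fam_span_add)

lemma fam_span_subset:
  assumes "\<And>l. l \<in> {1..j} \<Longrightarrow> v l \<in> fam_span k w"
  shows "fam_span j v \<subseteq> fam_span k w"
proof
  fix x assume "x \<in> fam_span j v"
  then obtain c where "x = (\<lambda>i. \<Sum>l=1..j. c l * v l i)" by (auto simp: fam_span_def)
  then show "x \<in> fam_span k w" using assms by (auto intro!: fam_span_sum fam_span_cmult)
qed

lemma supp_fam_span:
  assumes "\<And>l. l \<in> {1..j} \<Longrightarrow> supp N (v l)" "x \<in> fam_span j v" shows "supp N x"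
  using assms by (auto simp: fam_span_def supp_def)

text \<open>Two candidates differ by an element \<open>d\<close> of the span that is orthogonal to
  the span, hence to itself, and its support in \<open>{1..N}\<close> then gives
  \<open>d = 0\<close>. Orthogonality has to be checked only against the generators.\<close>

lemma orth_proj_eqI:
  assumes N: "N \<ge> 1" and v: "\<And>l. l \<in> {1..j} \<Longrightarrow> supp N (v l)"
    and p: "p \<in> fam_span j v" and orth: "\<And>l. l \<in> {1..j} \<Longrightarrow> ninner N (\<lambda>i. x i - p i) (v l) = 0"
  shows "orth_proj N (fam_span j v) x = p"
  unfolding orth_proj_def
proof (rule the_equality)
  have o: "ninner N (\<lambda>i. x i - p i) w = 0" if w: "w \<in> fam_span j v" for w
  proof -
    obtain c where "w = (\<lambda>i. \<Sum>l=1..j. c l * v l i)" using w by (auto simp: fam_span_def)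
    then show ?thesis using orth by (simp add: ninner_linear)
  qed
  then show "p \<in> fam_span j v \<and> (\<forall>w\<in>fam_span j v. ninner N (\<lambda>i. x i - p i) w = 0)" using p by blast
  fix p' assume p': "p' \<in> fam_span j v \<and> (\<forall>w\<in>fam_span j v. ninner N (\<lambda>i. x i - p' i) w = 0)"
  define d where "d = (\<lambda>i. p' i - p i)"
  have d: "d \<in> fam_span j v" unfolding d_def using p p' by (intro fam_span_diff) auto
  have "ninner N d d = ninner N (\<lambda>i. x i - p i) d - ninner N (\<lambda>i. x i - p' i) d"
    unfolding ninner_diff_left[symmetric] by (simp add: d_def)
  also have "\<dots> = 0" using o[OF d] p' d by simp
  finally have "nnorm N d = 0" by (simp add: nnorm_def)
  then have "d = (\<lambda>i. 0)" using supp_eq_0[OF N supp_fam_span[OF v d]] by simp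
  then show "p' = p" by (simp add: d_def fun_eq_iff)
qed

text \<open>The construction of \<open>sk_M\<close> for an arbitrary family \<open>v\<close>, and
  likewise \<open>gs_phi\<close> for \<open>sk_phi\<close>: both are applied to the iterates of the
  disorder and to those of the refreshed matrix.\<close>

definition gs_M :: "nat \<Rightarrow> (nat \<Rightarrow> nat \<Rightarrow> real) \<Rightarrow> nat \<Rightarrow> nat \<Rightarrow> real" where
  "gs_M N v k = (\<lambda>i. v k i - orth_proj N (fam_span (k - 1) v) (v k) i)"

definition gs_phi :: "nat \<Rightarrow> (nat \<Rightarrow> nat \<Rightarrow> real) \<Rightarrow> nat \<Rightarrow> nat \<Rightarrow> real" where
  "gs_phi N v k = (if nnorm N (gs_M N v k) \<noteq> 0 then (\<lambda>i. gs_M N v k i / nnorm N (gs_M N v k))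
     else vec_of N (\<lambda>i. 1))"

text \<open>
  In degenerate steps the zero vector replaces the fallback of \<^const>\<open>sk_phi\<close>; the family then stays
  orthogonal and spans the same subspaces in all cases.
\<close>

definition gs_b :: "nat \<Rightarrow> (nat \<Rightarrow> nat \<Rightarrow> real) \<Rightarrow> nat \<Rightarrow> nat \<Rightarrow> real" where
  "gs_b N v k = (if nnorm N (gs_M N v k) \<noteq> 0 then gs_phi N v k else (\<lambda>i. 0))"

lemma gs_phi_cong:
  assumes "\<And>j. j \<in> {1..k} \<Longrightarrow> v j = w j" "k \<ge> 1"
  shows "gs_phi N v k = gs_phi N w k"
proof -
  have "fam_span (k - 1) v = fam_span (k - 1) w"
  proof -
    have "(\<lambda>i. \<Sum>l=1..k - 1. c l * v l i) = (\<lambda>i. \<Sum>l=1..k - 1. c l * w l i)" for c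
      using assms by (intro ext sum.cong refl arg_cong2[of _ _ _ _ "(*)"]) auto
    then show ?thesis by (simp add: fam_span_def)
  qed
  then show ?thesis using assms by (simp add: gs_phi_def gs_M_def)
qed

text \<open>The four claims need each other: the projection formula at \<open>k\<close> gives
  \<open>gs_M\<close> at \<open>k + 1\<close>, whose orthogonality gives the next basis vector, and
  equality of the spans turns the expansion in this basis into the next projection.\<close>

lemma gs_main:
  assumes N: "N \<ge> 1" and v: "\<And>l. l \<in> {1..k} \<Longrightarrow> supp N (v l)"
  shows "(\<forall>i\<in>{1..k}. \<forall>j\<in>{1..k}. ninner N (gs_b N v i) (gs_b N v j)
      = (if i = j \<and> nnorm N (gs_M N v i) \<noteq> 0 then 1 else 0))
    \<and> fam_span k v = fam_span k (gs_b N v) \<and> (\<forall>l\<in>{1..k}. supp N (gs_b N v l))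
    \<and> (\<forall>x. orth_proj N (fam_span k v) x = (\<lambda>i. \<Sum>l=1..k. ninner N (gs_b N v l) x * gs_b N v l i))"
  using v
proof (induction k)
  case 0
  have "orth_proj N (fam_span 0 v) x = (\<lambda>i. 0)" for x
    by (rule orth_proj_eqI[OF N]) (auto intro: fam_span_zero)
  then show ?case by (auto simp: fam_span_def)
next
  case (Suc k)
  let ?b = "gs_b N v" and ?M = "gs_M N v" let ?n = "\<lambda>j. nnorm N (gs_M N v j)"
  have IH: "\<And>i j. i \<in> {1..k} \<Longrightarrow> j \<in> {1..k} \<Longrightarrow> ninner N (?b i) (?b j) = (if i = j \<and> ?n i \<noteq> 0 then 1 else 0)"
    and sp: "fam_span k v = fam_span k ?b" and su: "\<And>l. l \<in> {1..k} \<Longrightarrow> supp N (?b l)"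
    and pr: "\<And>x. orth_proj N (fam_span k v) x = (\<lambda>i. \<Sum>l=1..k. ninner N (?b l) x * ?b l i)"
  proof -
    have "supp N (v l)" if "l \<in> {1..k}" for l using Suc.prems that by simp
    note I = Suc.IH[OF this]
    show "\<And>i j. i \<in> {1..k} \<Longrightarrow> j \<in> {1..k} \<Longrightarrow> ninner N (?b i) (?b j) = (if i = j \<and> ?n i \<noteq> 0 then 1 else 0)"
      using I by blast
    show "fam_span k v = fam_span k ?b" "\<And>l. l \<in> {1..k} \<Longrightarrow> supp N (?b l)"
      "\<And>x. orth_proj N (fam_span k v) x = (\<lambda>i. \<Sum>l=1..k. ninner N (?b l) x * ?b l i)"
      using I by blast+
  qed
  let ?w = "v (Suc k)"
  define p where "p = (\<lambda>i. \<Sum>l=1..k. ninner N (?b l) ?w * ?b l i)"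
  have Meq: "?M (Suc k) = (\<lambda>i. ?w i - p i)" by (simp add: gs_M_def pr p_def)
  have p_span: "p \<in> fam_span k ?b" unfolding p_def by (rule fam_span_lincomb)
  have bz: "?b l = (\<lambda>i. 0)" if "?n l = 0" for l using that by (simp add: gs_b_def)
  have Mb: "ninner N (?M (Suc k)) (?b l) = 0" if l: "l \<in> {1..k}" for l
  proof (cases "?n l = 0")
    case True then show ?thesis by (simp add: bz)
  next
    case False
    have "ninner N p (?b l) = (\<Sum>l'=1..k. ninner N (?b l') ?w * (if l' = l then 1 else 0))"
      unfolding p_def ninner_linear using IH l False by (intro sum.cong) auto
    also have "\<dots> = ninner N ?w (?b l)" using l by (simp add: sum_mult_delta ninner_commute)
    finally show ?thesis by (simp add: Meq ninner_linear)
  qed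
  have suM: "supp N (?M (Suc k))"
    unfolding Meq supp_def using Suc.prems[of "Suc k"] supp_fam_span[OF su p_span] by (auto simp: supp_def)
  have su': "supp N (?b l)" if "l \<in> {1..Suc k}" for l
  proof (cases "l = Suc k")
    case True
    then show ?thesis using suM by (auto simp: gs_b_def gs_phi_def supp_def)
  qed (use that su in auto)
  \<comment> \<open>Division by zero returns zero, so the formula also covers the degenerate
    step.\<close>
  have bS: "?b (Suc k) = (\<lambda>i. (1 / ?n (Suc k)) * ?M (Suc k) i)"
    by (auto simp: gs_b_def gs_phi_def)
  have orth: "ninner N (?b i) (?b j) = (if i = j \<and> ?n i \<noteq> 0 then 1 else 0)" if ij: "i \<in> {1..Suc k}" "j \<in> {1..Suc k}" for i j
  proof -
    have 1: "ninner N (?b (Suc k)) (?b l) = 0" "ninner N (?b l) (?b (Suc k)) = 0" if "l \<in> {1..k}" for l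
      using Mb[OF that] ninner_commute[of N "?b l"] unfolding bS ninner_linear by auto
    have 2: "ninner N (?b (Suc k)) (?b (Suc k)) = (if ?n (Suc k) \<noteq> 0 then 1 else 0)"
      unfolding bS ninner_linear nnorm_square[symmetric] by (simp add: power2_eq_square)
    show ?thesis
      using ij IH[of i j] 1[of i] 1[of j] 2 by (cases "i = Suc k"; cases "j = Suc k") auto
  qed
  have le: "fam_span k w \<subseteq> fam_span (Suc k) w" for w
    by (rule fam_span_subset) (auto intro!: fam_span_base)
  have "fam_span (Suc k) v = fam_span (Suc k) ?b"
  proof (rule equalityI; rule fam_span_subset)
    fix l assume l: "l \<in> {1..Suc k}"
    show "v l \<in> fam_span (Suc k) ?b"
    proof (cases "l = Suc k")
      case True
      have w: "?w = (\<lambda>i. p i + ?n (Suc k) * ?b (Suc k) i)"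
      proof (cases "?n (Suc k) = 0")
        case True then have "?M (Suc k) = (\<lambda>i. 0)" using supp_eq_0[OF N suM] by simp
        then show ?thesis using True by (simp add: Meq fun_eq_iff)
      next
        case False then show ?thesis by (auto simp: bS Meq fun_eq_iff)
      qed
      have "?b (Suc k) \<in> fam_span (Suc k) ?b" by (rule fam_span_base) auto
      then show ?thesis unfolding True by (subst w) (use p_span le in \<open>auto intro!: fam_span_add fam_span_cmult\<close>)
    next
      case False
      then have "v l \<in> fam_span k v" using l by (intro fam_span_base) auto
      then show ?thesis using sp le by auto
    qed
    show "?b l \<in> fam_span (Suc k) v"
    proof (cases "l = Suc k")
      case True
      have "?w \<in> fam_span (Suc k) v" by (rule fam_span_base) auto
      moreover have "p \<in> fam_span (Suc k) v" using p_span sp le by auto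
      ultimately show ?thesis unfolding True bS Meq by (intro fam_span_cmult fam_span_diff)
    next
      case False
      then have "?b l \<in> fam_span k ?b" using l by (intro fam_span_base) auto
      then show ?thesis using sp le by auto
    qed
  qed
  note sp' = this
  have "orth_proj N (fam_span (Suc k) v) x = (\<lambda>i. \<Sum>l=1..Suc k. ninner N (?b l) x * ?b l i)" for x
    unfolding sp'
  proof (rule orth_proj_eqI[OF N su' fam_span_lincomb])
    fix l assume l: "l \<in> {1..Suc k}"
    show "ninner N (\<lambda>i. x i - (\<Sum>l=1..Suc k. ninner N (?b l) x * ?b l i)) (?b l) = 0"
    proof (cases "?n l = 0")
      case True then show ?thesis by (simp add: bz)
    next
      case False
      have "ninner N (\<lambda>i. \<Sum>l=1..Suc k. ninner N (?b l) x * ?b l i) (?b l) = (\<Sum>l'=1..Suc k. ninner N (?b l') x * (if l' = l then 1 else 0))"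
        unfolding ninner_linear using orth l False by (intro sum.cong) auto
      also have "\<dots> = ninner N x (?b l)" using l by (simp add: sum_mult_delta ninner_commute del: sum.cl_ivl_Suc)
      finally show ?thesis by (simp add: ninner_diff_left)
    qed
  qed
  then show ?case using orth sp' su' by blast
qed

context
  fixes N :: nat and v :: "nat \<Rightarrow> nat \<Rightarrow> real" and k :: nat
  assumes N: "N \<ge> 1" and v: "\<And>l. l \<in> {1..k} \<Longrightarrow> supp N (v l)"
begin

lemma gs_b_orth: "i \<in> {1..k} \<Longrightarrow> j \<in> {1..k} \<Longrightarrow>
    ninner N (gs_b N v i) (gs_b N v j) = (if i = j \<and> nnorm N (gs_M N v i) \<noteq> 0 then 1 else 0)"
  using gs_main[of N k v, OF N v] by blast

lemma gs_M_eq: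
  assumes "j \<in> {1..k}"
  shows "gs_M N v j = (\<lambda>i. v j i - (\<Sum>l=1..j - 1. ninner N (gs_b N v l) (v j) * gs_b N v l i))"
proof -
  have "supp N (v l)" if "l \<in> {1..j - 1}" for l using that assms v by auto
  from gs_main[of N "j - 1" v, OF N this]
  have "orth_proj N (fam_span (j - 1) v) (v j) = (\<lambda>i. \<Sum>l=1..j - 1. ninner N (gs_b N v l) (v j) * gs_b N v l i)" by blast
  then show ?thesis by (simp add: gs_M_def)
qed

lemma nnorm_gs_phi: "nnorm N (gs_phi N v j) = 1"
proof (cases "nnorm N (gs_M N v j) = 0")
  case True
  have "nnorm N (vec_of N (\<lambda>i. 1)) = nnorm N (\<lambda>i. 1)" by (rule nnorm_cong) (simp add: vec_of_def)
  then show ?thesis using True N by (simp add: gs_phi_def nnorm_def ninner_def)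
next
  case False
  then show ?thesis using nnorm_cmult[of N "1 / nnorm N (gs_M N v j)" "gs_M N v j"] nnorm_nonneg[of N "gs_M N v j"]
    by (simp add: gs_phi_def)
qed

lemma gs_M_inner: 
  assumes "j \<in> {1..k}"
  shows "ninner N (gs_M N v j) u = ninner N (v j) u - (\<Sum>l=1..j - 1. ninner N (gs_b N v l) (v j) * ninner N (gs_b N v l) u)"
  unfolding gs_M_eq[OF assms] ninner_linear ..

text \<open>Pythagoras, valid in degenerate cases too, where \<open>gs_b\<close> is the zero vector
  and contributes nothing.\<close>

lemma gs_M_norm:
  assumes "j \<in> {1..k}"
  shows "(nnorm N (gs_M N v j))\<^sup>2 = ninner N (v j) (v j) - (\<Sum>l=1..j - 1. (ninner N (gs_b N v l) (v j))\<^sup>2)"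
proof -
  have z: "ninner N (gs_b N v l) (gs_M N v j) = 0" if l: "l \<in> {1..j - 1}" for l
  proof -
    have lk: "l \<in> {1..k}" using l assms by auto
    have e: "(\<Sum>l'=1..j - 1. ninner N (gs_b N v l') (v j) * ninner N (gs_b N v l') (gs_b N v l)) 
      = (\<Sum>l'=1..j - 1. ninner N (gs_b N v l') (v j) * (if l' = l \<and> nnorm N (gs_M N v l) \<noteq> 0 then 1 else 0))"
      using lk assms by (intro sum.cong refl arg_cong2[of _ _ _ _ "(*)"]) (subst gs_b_orth, auto)
    show ?thesis
    proof (cases "nnorm N (gs_M N v l) = 0")
      case True then show ?thesis by (simp add: gs_b_def)
    next
      case False
      then have "(\<Sum>l'=1..j - 1. ninner N (gs_b N v l') (v j) * ninner N (gs_b N v l') (gs_b N v l)) = ninner N (gs_b N v l) (v j)"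
        unfolding e by (simp only: not_False_eq_True simp_thms) (rule sum_mult_delta(1)[OF finite_atLeastAtMost l])
      then have "ninner N (gs_M N v j) (gs_b N v l) = 0"
        unfolding gs_M_inner[OF assms] by (simp add: ninner_commute[of N "v j" "gs_b N v l"])
      then show ?thesis by (simp add: ninner_commute[of N "gs_b N v l" "gs_M N v j"])
    qed
  qed
  have "(nnorm N (gs_M N v j))\<^sup>2 = ninner N (v j) (gs_M N v j)"
    unfolding nnorm_square gs_M_inner[OF assms, of "gs_M N v j"] using z by simp
  also have "\<dots> = ninner N (gs_M N v j) (v j)" by (rule ninner_commute)
  also have "\<dots> = ninner N (v j) (v j) - (\<Sum>l=1..j - 1. (ninner N (gs_b N v l) (v j))\<^sup>2)"
    unfolding gs_M_inner[OF assms] by (simp add: power2_eq_square)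
  finally show ?thesis .
qed

context
  assumes good: "\<And>j. j \<in> {1..k} \<Longrightarrow> nnorm N (gs_M N v j) \<noteq> 0"
begin

lemma gs_b_good: "j \<in> {1..k} \<Longrightarrow> gs_b N v j = gs_phi N v j"
  using good by (simp add: gs_b_def)

lemma gs_phi_orth: "i \<in> {1..k} \<Longrightarrow> j \<in> {1..k} \<Longrightarrow> ninner N (gs_phi N v i) (gs_phi N v j) = (if i = j then 1 else 0)"
  using gs_b_orth[of i j] good by (auto simp: gs_b_good)

text \<open>For \<open>u\<close> a later iterate, replacing the inner products and the norm by their
  limits gives the recursion that defines \<open>sk_gamma\<close>.\<close>

lemma gs_phi_inner:
  assumes "j \<in> {1..k}"
  shows "ninner N (gs_phi N v j) u = (ninner N (v j) u - (\<Sum>l=1..j - 1. ninner N (gs_phi N v l) (v j) * ninner N (gs_phi N v l) u))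
     / nnorm N (gs_M N v j)"
proof -
  have "ninner N (gs_phi N v j) u = ninner N (gs_M N v j) u / nnorm N (gs_M N v j)"
    using good[OF assms] by (simp add: gs_phi_def ninner_linear)
  also have "(\<Sum>l=1..j - 1. ninner N (gs_b N v l) (v j) * ninner N (gs_b N v l) u)
      = (\<Sum>l=1..j - 1. ninner N (gs_phi N v l) (v j) * ninner N (gs_phi N v l) u)"
    using assms by (intro sum.cong) (auto simp: gs_b_good)
  ultimately show ?thesis by (simp add: gs_M_inner[OF assms])
qed

lemma gs_M_norm_good:
  assumes "j \<in> {1..k}"
  shows "(nnorm N (gs_M N v j))\<^sup>2 = ninner N (v j) (v j) - (\<Sum>l=1..j - 1. (ninner N (gs_phi N v l) (v j))\<^sup>2)"
  unfolding gs_M_norm[OF assms] using assms by (auto simp: gs_b_good intro!: sum.cong)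

lemma gs_phi_self:
  assumes "j \<in> {1..k}"
  shows "ninner N (gs_phi N v j) (v j) = nnorm N (gs_M N v j)"
  unfolding gs_phi_inner[OF assms] using good[OF assms] gs_M_norm_good[OF assms]
  by (simp add: power2_eq_square field_simps)

lemma gs_expand:
  assumes j: "j \<in> {1..k}"
  shows "v j = (\<lambda>i. \<Sum>l=1..j. ninner N (gs_phi N v l) (v j) * gs_phi N v l i)"
proof
  fix i
  have "{1..j} = insert j {1..j - 1}" using j by auto
  then have "(\<Sum>l=1..j. ninner N (gs_phi N v l) (v j) * gs_phi N v l i) =
    ninner N (gs_phi N v j) (v j) * gs_phi N v j i + (\<Sum>l=1..j - 1. ninner N (gs_phi N v l) (v j) * gs_phi N v l i)"
    using j by (subst \<open>{1..j} = insert j {1..j - 1}\<close>, subst sum.insert) auto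
  also have "ninner N (gs_phi N v j) (v j) * gs_phi N v j i = gs_M N v j i"
    using good[OF j] unfolding gs_phi_self[OF j] by (simp add: gs_phi_def)
  also have "(\<Sum>l=1..j - 1. ninner N (gs_phi N v l) (v j) * gs_phi N v l i) = (\<Sum>l=1..j - 1. ninner N (gs_b N v l) (v j) * gs_b N v l i)"
    using j by (intro sum.cong) (auto simp: gs_b_good)
  also have "gs_M N v j i + \<dots> = v j i" using gs_M_eq[OF j] by simp
  finally show "v j i = (\<Sum>l=1..j. ninner N (gs_phi N v l) (v j) * gs_phi N v l i)" by simp
qed

lemma gs_bessel: "(\<Sum>l=1..k. (ninner N (gs_phi N v l) u)\<^sup>2) \<le> ninner N u u"
proof -
  define p where "p = (\<lambda>i. \<Sum>l=1..k. ninner N (gs_phi N v l) u * gs_phi N v l i)"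
  have up: "ninner N u p = (\<Sum>l=1..k. (ninner N (gs_phi N v l) u)\<^sup>2)"
    by (simp add: p_def ninner_linear power2_eq_square ninner_commute[of N u])
  have "ninner N (gs_phi N v l) p = ninner N (gs_phi N v l) u" if "l \<in> {1..k}" for l
  proof -
    have "ninner N (gs_phi N v l) p = (\<Sum>l'=1..k. ninner N (gs_phi N v l') u * (if l = l' then 1 else 0))"
      unfolding p_def ninner_linear using that by (intro sum.cong) (auto simp: gs_phi_orth)
    then show ?thesis using that by (simp add: sum_mult_delta)
  qed
  then have "ninner N p p = (\<Sum>l=1..k. (ninner N (gs_phi N v l) u)\<^sup>2)"
    by (subst (1) p_def) (simp add: ninner_linear power2_eq_square)
  then have "ninner N (\<lambda>i. u i - p i) (\<lambda>i. u i - p i) = ninner N u u - (\<Sum>l=1..k. (ninner N (gs_phi N v l) u)\<^sup>2)"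
    using up ninner_commute[of N p u] by (simp add: ninner_linear)
  then show ?thesis using ninner_nonneg[of N "\<lambda>i. u i - p i"] by linarith
qed

end

end

lemma sk_M_gs: "sk_M \<beta> h q N G = gs_M N (sk_m \<beta> h q N G)"
  by (intro ext) (simp add: sk_M_def gs_M_def)

lemma sk_phi_gs: "sk_phi \<beta> h q N G = gs_phi N (sk_m \<beta> h q N G)"
  by (intro ext) (simp add: sk_phi_def gs_phi_def sk_M_gs)

lemma borel_measurable_ninner:
  assumes "\<And>i. i \<in> {1..N} \<Longrightarrow> (\<lambda>\<omega>. x \<omega> i) \<in> borel_measurable M" "\<And>i. i \<in> {1..N} \<Longrightarrow> (\<lambda>\<omega>. y \<omega> i) \<in> borel_measurable M"
  shows "(\<lambda>\<omega>. ninner N (x \<omega>) (y \<omega>)) \<in> borel_measurable M"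
  unfolding ninner_def by (intro borel_measurable_times borel_measurable_const borel_measurable_sum assms)

lemma borel_measurable_nnorm:
  assumes "\<And>i. i \<in> {1..N} \<Longrightarrow> (\<lambda>\<omega>. x \<omega> i) \<in> borel_measurable M"
  shows "(\<lambda>\<omega>. nnorm N (x \<omega>)) \<in> borel_measurable M"
  unfolding nnorm_def by (rule measurable_compose[OF borel_measurable_ninner[OF assms assms] borel_measurable_sqrt])

text \<open>Projections are definite descriptions, so measurability is read off the explicit
  expansion \<open>gs_M_eq\<close>, by induction along the family.\<close>

lemma borel_measurable_gs:
  assumes N: "N \<ge> 1" and supp: "\<And>\<omega> l. l \<in> {1..k} \<Longrightarrow> supp N (v \<omega> l)"
    and v: "\<And>l i. l \<in> {1..k} \<Longrightarrow> i \<in> {1..N} \<Longrightarrow> (\<lambda>\<omega>. v \<omega> l i) \<in> borel_measurable M"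
    and j: "j \<in> {1..k}"
  shows "\<forall>i\<in>{1..N}. (\<lambda>\<omega>. gs_M N (v \<omega>) j i) \<in> borel_measurable M \<and> (\<lambda>\<omega>. gs_phi N (v \<omega>) j i) \<in> borel_measurable M
      \<and> (\<lambda>\<omega>. gs_b N (v \<omega>) j i) \<in> borel_measurable M"
  using j
proof (induction j rule: less_induct)
  case (less j)
  have IH: "(\<lambda>\<omega>. gs_b N (v \<omega>) l i) \<in> borel_measurable M" if "l \<in> {1..j - 1}" "i \<in> {1..N}" for l i
  proof -
    have "l < j" "l \<in> {1..k}" using less.prems that by auto
    from less.IH[OF this] show ?thesis using that(2) by blast
  qed
  have e: "gs_M N (v \<omega>) j = (\<lambda>i. v \<omega> j i - (\<Sum>l=1..j - 1. ninner N (gs_b N (v \<omega>) l) (v \<omega> j) * gs_b N (v \<omega>) l i))" for \<omega>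
    by (rule gs_M_eq[of N k "v \<omega>", OF N supp less.prems])
  have mM: "(\<lambda>\<omega>. gs_M N (v \<omega>) j i) \<in> borel_measurable M" if i: "i \<in> {1..N}" for i
    unfolding e
    by (intro borel_measurable_diff v[OF less.prems] i borel_measurable_sum borel_measurable_times borel_measurable_ninner IH)
  have mn: "(\<lambda>\<omega>. nnorm N (gs_M N (v \<omega>) j)) \<in> borel_measurable M" by (intro borel_measurable_nnorm mM)
  have S: "{\<omega> \<in> space M. nnorm N (gs_M N (v \<omega>) j) \<noteq> 0} \<in> sets M" 
    using borel_measurable_neq[OF mn borel_measurable_const] .
  have mp: "(\<lambda>\<omega>. gs_phi N (v \<omega>) j i) \<in> borel_measurable M" if i: "i \<in> {1..N}" for i
  proof -
    have "(\<lambda>\<omega>. if nnorm N (gs_M N (v \<omega>) j) \<noteq> 0 then gs_M N (v \<omega>) j i / nnorm N (gs_M N (v \<omega>) j) else 1) \<in> borel_measurable M"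
      by (intro measurable_If borel_measurable_divide mM i mn borel_measurable_const S)
    also have "(\<lambda>\<omega>. if nnorm N (gs_M N (v \<omega>) j) \<noteq> 0 then gs_M N (v \<omega>) j i / nnorm N (gs_M N (v \<omega>) j) else 1) = (\<lambda>\<omega>. gs_phi N (v \<omega>) j i)"
      using i by (intro ext) (simp add: gs_phi_def vec_of_def)
    finally show ?thesis .
  qed
  have mb: "(\<lambda>\<omega>. gs_b N (v \<omega>) j i) \<in> borel_measurable M" if i: "i \<in> {1..N}" for i
  proof -
    have "(\<lambda>\<omega>. if nnorm N (gs_M N (v \<omega>) j) \<noteq> 0 then gs_phi N (v \<omega>) j i else 0) \<in> borel_measurable M"
      by (intro measurable_If mp i borel_measurable_const S)
    also have "(\<lambda>\<omega>. if nnorm N (gs_M N (v \<omega>) j) \<noteq> 0 then gs_phi N (v \<omega>) j i else 0) = (\<lambda>\<omega>. gs_b N (v \<omega>) j i)"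
      by (intro ext) (simp add: gs_b_def)
    finally show ?thesis .
  qed
  show ?case using mM mp mb by blast
qed

section \<open>Replacing directions of a Gaussian matrix\<close>

text \<open>
  \<open>Inl (k, i)\<close> indexes the coordinate \<open>i\<close> of the \<open>k\<close>-th fresh vector, \<open>Inr (i, j)\<close> the entries of a matrix
  with independent entries whose symmetrisation is \<open>goe\<close> (with diagonal entries of variance \<open>2 / N\<close>).
\<close>

type_synonym gidx = "(nat \<times> nat) + (nat \<times> nat)"

definition Zidx :: "nat \<Rightarrow> nat \<Rightarrow> gidx set" where "Zidx K N = Inl ` ({1..K} \<times> {1..N})"

definition Xidx :: "nat \<Rightarrow> gidx set" where "Xidx N = Inr ` ({1..N} \<times> {1..N})"

definition zvec :: "(gidx \<Rightarrow> real) \<Rightarrow> nat \<Rightarrow> nat \<Rightarrow> real" where "zvec x k i = x (Inl (k, i))"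

definition goe :: "nat \<Rightarrow> (gidx \<Rightarrow> real) \<Rightarrow> nat \<Rightarrow> nat \<Rightarrow> real" where
  "goe N x i j = (x (Inr (i, j)) + x (Inr (j, i))) / sqrt (2 * real N)"

text \<open>For a unit vector \<open>\<phi>\<close> this is the matrix of the orthogonal projection
  onto its complement, and \<open>pvec\<close> applies it. The division by \<open>N\<close> appears
  because \<open>\<phi>\<close> has Euclidean norm \<open>sqrt N\<close>.\<close>

definition pmat :: "nat \<Rightarrow> (nat \<Rightarrow> real) \<Rightarrow> nat \<Rightarrow> nat \<Rightarrow> real" where
  "pmat N \<phi> a b = (if a = b then 1 else 0) - \<phi> a * \<phi> b / real N"

definition pvec :: "nat \<Rightarrow> (nat \<Rightarrow> real) \<Rightarrow> (nat \<Rightarrow> real) \<Rightarrow> nat \<Rightarrow> real" where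
  "pvec N \<phi> x = (\<lambda>i. x i - ninner N \<phi> x * \<phi> i)"

text \<open>
  Keeps the compression of \<open>G\<close> to the orthogonal complement of \<open>\<phi>\<close> and replaces \<open>G \<phi>\<close> by its
  equivalent built from \<open>z\<close>; the factor \<open>sqrt 2\<close> is the standard deviation on the diagonal.
\<close>

definition refresh :: "nat \<Rightarrow> (nat \<Rightarrow> real) \<Rightarrow> (nat \<Rightarrow> real) \<Rightarrow> (nat \<Rightarrow> nat \<Rightarrow> real) \<Rightarrow> nat \<Rightarrow> nat \<Rightarrow> real" where
  "refresh N \<phi> z G a b = (\<Sum>c=1..N. \<Sum>d=1..N. pmat N \<phi> a c * G c d * pmat N \<phi> b d)
     + (\<phi> a * pvec N \<phi> z b + pvec N \<phi> z a * \<phi> b + sqrt 2 * ninner N \<phi> z * \<phi> a * \<phi> b) / real N"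

lemma finite_Zidx [simp]: "finite (Zidx K N)" and finite_Xidx [simp]: "finite (Xidx N)"
  by (simp_all add: Zidx_def Xidx_def)

lemma sum_Xidx: "(\<Sum>i\<in>Xidx N. f i) = (\<Sum>c=1..N. \<Sum>d=1..N. f (Inr (c, d)))"
  unfolding Xidx_def by (simp add: sum.reindex sum.cartesian_product)

lemma sum_row: "(\<Sum>i\<in>Inl ` ({k} \<times> {1..N}). f i) = (\<Sum>c=1..N. f (Inl (k, c)))"
proof -
  have "(\<Sum>i\<in>Inl ` ({k} \<times> {1..N}). f i) = (\<Sum>p\<in>{k} \<times> {1..N}. f (Inl p))" by (simp add: sum.reindex)
  also have "\<dots> = (\<Sum>(x, y)\<in>{k} \<times> {1..N}. f (Inl (x, y)))" by (intro sum.cong) auto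
  also have "\<dots> = (\<Sum>c=1..N. f (Inl (k, c)))" unfolding sum.cartesian_product[symmetric] by simp
  finally show ?thesis .
qed

lemma pmat_sym: "pmat N \<phi> a b = pmat N \<phi> b a"
  by (simp add: pmat_def mult.commute)

context
  fixes N :: nat and \<phi> :: "nat \<Rightarrow> real"
  assumes N: "N \<ge> 1" and unit: "nnorm N \<phi> = 1"
begin

lemma unit_sum: "(\<Sum>c=1..N. \<phi> c * \<phi> c) = real N"
proof -
  have "ninner N \<phi> \<phi> = 1" using unit nnorm_square[of N \<phi>] by simp
  then show ?thesis using N by (simp add: ninner_def field_simps)
qed

lemma pmat_phi: "b \<in> {1..N} \<Longrightarrow> (\<Sum>c=1..N. pmat N \<phi> b c * \<phi> c) = 0"
proof -
  assume b: "b \<in> {1..N}"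
  have "(\<Sum>c=1..N. pmat N \<phi> b c * \<phi> c) = (\<Sum>c=1..N. \<phi> c * (if b = c then 1 else 0)) - \<phi> b / real N * (\<Sum>c=1..N. \<phi> c * \<phi> c)"
    unfolding sum_distrib_left sum_subtractf[symmetric] by (intro sum.cong refl) (simp add: pmat_def algebra_simps)
  also have "\<dots> = 0" unfolding sum_mult_delta(2)[OF finite_atLeastAtMost b] unit_sum using N by simp
  finally show ?thesis .
qed

lemma pmat_idem:
  assumes a: "a \<in> {1..N}" and e: "e \<in> {1..N}"
  shows "(\<Sum>c=1..N. pmat N \<phi> a c * pmat N \<phi> e c) = pmat N \<phi> a e"
proof -
  have "(\<Sum>c=1..N. pmat N \<phi> a c * pmat N \<phi> e c) = (\<Sum>c=1..N. pmat N \<phi> a c * (if e = c then 1 else 0)) - \<phi> e / real N * (\<Sum>c=1..N. pmat N \<phi> a c * \<phi> c)"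
    unfolding sum_distrib_left sum_subtractf[symmetric] by (intro sum.cong refl) (simp add: pmat_def[of N \<phi> e] algebra_simps)
  also have "\<dots> = pmat N \<phi> a e" unfolding sum_mult_delta(2)[OF finite_atLeastAtMost e] pmat_phi[OF a] by simp
  finally show ?thesis .
qed

lemma pvec_pmat: "a \<in> {1..N} \<Longrightarrow> pvec N \<phi> z a = (\<Sum>c=1..N. pmat N \<phi> a c * z c)"
proof -
  assume a: "a \<in> {1..N}"
  have "(\<Sum>c=1..N. pmat N \<phi> a c * z c) = (\<Sum>c=1..N. z c * (if a = c then 1 else 0)) - \<phi> a / real N * (\<Sum>c=1..N. \<phi> c * z c)"
    unfolding sum_distrib_left sum_subtractf[symmetric] by (intro sum.cong refl) (simp add: pmat_def algebra_simps)
  then show ?thesis unfolding sum_mult_delta(2)[OF finite_atLeastAtMost a] by (simp add: pvec_def ninner_def)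
qed

end

lemma sum_product_quartic:
  fixes p :: "nat \<Rightarrow> nat \<Rightarrow> real"
  shows "(\<Sum>c=1..N. \<Sum>d=1..N. (p a c * p b d + p a d * p b c) * (p e c * p f d + p e d * p f c))
    = 2 * ((\<Sum>c=1..N. p a c * p e c) * (\<Sum>d=1..N. p b d * p f d) + (\<Sum>c=1..N. p a c * p f c) * (\<Sum>d=1..N. p b d * p e d))"
proof -
  have "(\<Sum>c=1..N. \<Sum>d=1..N. (p a c * p b d + p a d * p b c) * (p e c * p f d + p e d * p f c)) =
     (\<Sum>c=1..N. \<Sum>d=1..N. (p a c * p e c) * (p b d * p f d)) + (\<Sum>c=1..N. \<Sum>d=1..N. (p a c * p f c) * (p b d * p e d))
   + (\<Sum>c=1..N. \<Sum>d=1..N. (p b c * p e c) * (p a d * p f d)) + (\<Sum>c=1..N. \<Sum>d=1..N. (p b c * p f c) * (p a d * p e d))"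
    unfolding sum.distrib[symmetric] by (intro sum.cong refl) (simp add: algebra_simps)
  moreover have "s * t + u * v + v * u + t * s = 2 * (s * t + u * v)" for s t u v :: real by (simp add: algebra_simps)
  ultimately show ?thesis unfolding sum_product[symmetric] by (simp only:)
qed

text \<open>The coefficients of entry \<open>ab\<close> of \<open>p G p\<^sup>T\<close>, with
  \<open>G = goe N x\<close>, as a linear form in the independent Gaussians \<open>x\<close>. The
  identity for \<open>p\<close> gives \<open>G\<close> itself, \<open>pmat N \<phi>\<close> the
  compression kept by \<open>refresh\<close>.\<close>

definition goe_coef :: "nat \<Rightarrow> (nat \<Rightarrow> nat \<Rightarrow> real) \<Rightarrow> nat \<times> nat \<Rightarrow> gidx \<Rightarrow> real" where
  "goe_coef N p ab i = (case i of Inl _ \<Rightarrow> 0 | Inr (c, d) \<Rightarrow>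
     (p (fst ab) c * p (snd ab) d + p (fst ab) d * p (snd ab) c) / sqrt (2 * real N))"

text \<open>Likewise for the second part of \<open>refresh\<close>, which is linear in the fresh
  vector.\<close>

definition row_coef :: "nat \<Rightarrow> (nat \<Rightarrow> real) \<Rightarrow> nat \<times> nat \<Rightarrow> gidx \<Rightarrow> real" where
  "row_coef N \<phi> ab i = (case i of Inr _ \<Rightarrow> 0 | Inl (k, c) \<Rightarrow>
     (\<phi> (fst ab) * pmat N \<phi> (snd ab) c + pmat N \<phi> (fst ab) c * \<phi> (snd ab)
       + sqrt 2 * \<phi> (fst ab) * \<phi> (snd ab) * \<phi> c / real N) / real N)"

lemma goe_coef_sum:
  "(\<Sum>i\<in>Xidx N. goe_coef N p ab i * x i)
    = (\<Sum>c=1..N. \<Sum>d=1..N. p (fst ab) c * goe N x c d * p (snd ab) d)"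
proof -
  let ?a = "fst ab" and ?b = "snd ab"
  have "(\<Sum>i\<in>Xidx N. goe_coef N p ab i * x i)
    = (\<Sum>c=1..N. \<Sum>d=1..N. p ?a c * p ?b d * x (Inr (c, d)) / sqrt (2 * real N)) + (\<Sum>c=1..N. \<Sum>d=1..N. p ?a d * p ?b c * x (Inr (c, d)) / sqrt (2 * real N))"
    unfolding sum_Xidx sum.distrib[symmetric] by (intro sum.cong refl) (simp add: goe_coef_def field_simps)
  also have "(\<Sum>c=1..N. \<Sum>d=1..N. p ?a d * p ?b c * x (Inr (c, d)) / sqrt (2 * real N)) =
     (\<Sum>d=1..N. \<Sum>c=1..N. p ?a d * p ?b c * x (Inr (c, d)) / sqrt (2 * real N))" by (rule sum.swap)
  finally show ?thesis unfolding sum.distrib[symmetric]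
    by (rule trans) (intro sum.cong refl, simp add: goe_def field_simps)
qed

lemma goe_coef_delta:
  assumes "a \<in> {1..N}" "b \<in> {1..N}"
  shows "(\<Sum>i\<in>Xidx N. goe_coef N (\<lambda>a c. if a = c then 1 else 0) (a, b) i * x i) = goe N x a b"
proof -
  have "(\<Sum>d=1..N. (if a = c then 1 else 0) * goe N x c d * (if b = d then 1 else 0)) = (if a = c then 1 else 0) * goe N x c b" for c
    using sum_mult_delta(2)[OF finite_atLeastAtMost assms(2), of "\<lambda>d. (if a = c then 1 else 0) * goe N x c d"] .
  then have "(\<Sum>i\<in>Xidx N. goe_coef N (\<lambda>a c. if a = c then 1 else 0) (a, b) i * x i) = (\<Sum>c=1..N. goe N x c b * (if a = c then 1 else 0))"
    unfolding goe_coef_sum by (simp add: mult.commute)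
  then show ?thesis using sum_mult_delta(2)[OF finite_atLeastAtMost assms(1)] by simp
qed

text \<open>For the identity \<open>p\<close> this is the covariance
  \<open>(\<delta>\<^sub>a\<^sub>e \<delta>\<^sub>b\<^sub>f + \<delta>\<^sub>a\<^sub>f
  \<delta>\<^sub>b\<^sub>e) / N\<close>; for a projection it is the same expression with the
  projection in place of the unit matrix.\<close>

lemma goe_coef_cov:
  assumes "N \<ge> 1"
  shows "(\<Sum>i\<in>Xidx N. goe_coef N p ab i * goe_coef N p ef i) =
    ((\<Sum>c=1..N. p (fst ab) c * p (fst ef) c) * (\<Sum>d=1..N. p (snd ab) d * p (snd ef) d)
      + (\<Sum>c=1..N. p (fst ab) c * p (snd ef) c) * (\<Sum>d=1..N. p (snd ab) d * p (fst ef) d)) / real N"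
proof -
  let ?a = "fst ab" and ?b = "snd ab" and ?e = "fst ef" and ?f = "snd ef"
  have "(\<Sum>i\<in>Xidx N. goe_coef N p ab i * goe_coef N p ef i) =
     (\<Sum>c=1..N. \<Sum>d=1..N. (p ?a c * p ?b d + p ?a d * p ?b c) * (p ?e c * p ?f d + p ?e d * p ?f c)) / (2 * real N)"
    unfolding sum_Xidx sum_divide_distrib using assms
    by (intro sum.cong refl) (simp add: goe_coef_def)
  then show ?thesis unfolding sum_product_quartic by (subst (asm) mult_divide_mult_cancel_left) simp_all
qed

lemma row_coef_sum:
  assumes "N \<ge> 1" "nnorm N \<phi> = 1" "a \<in> {1..N}" "b \<in> {1..N}"
  shows "(\<Sum>i\<in>Inl ` ({k} \<times> {1..N}). row_coef N \<phi> (a, b) i * x i)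
    = (\<phi> a * pvec N \<phi> (zvec x k) b + pvec N \<phi> (zvec x k) a * \<phi> b + sqrt 2 * ninner N \<phi> (zvec x k) * \<phi> a * \<phi> b) / real N"
proof -
  have "(\<Sum>i\<in>Inl ` ({k} \<times> {1..N}). row_coef N \<phi> (a, b) i * x i)
    = (\<phi> a * (\<Sum>c=1..N. pmat N \<phi> b c * zvec x k c) + (\<Sum>c=1..N. pmat N \<phi> a c * zvec x k c) * \<phi> b
      + sqrt 2 * (1 / real N * (\<Sum>c=1..N. \<phi> c * zvec x k c)) * \<phi> a * \<phi> b) / real N"
    unfolding sum_row by (simp add: row_coef_def zvec_def sum_distrib_left sum_distrib_right sum_divide_distrib
        sum.distrib[symmetric] add_divide_distrib[symmetric] algebra_simps)
  then show ?thesis using assms by (simp add: pvec_pmat ninner_def)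
qed

text \<open>\<open>pmat\<close> annihilates \<open>\<phi>\<close> and is idempotent, so only the
  pairings of projection with projection and of \<open>\<phi>\<close> with \<open>\<phi>\<close>
  survive. The factor 2 is the square of \<open>sqrt 2\<close>.\<close>

lemma row_coef_cov:
  assumes N: "N \<ge> 1" and u: "nnorm N \<phi> = 1" and abef: "a \<in> {1..N}" "b \<in> {1..N}" "e \<in> {1..N}" "f \<in> {1..N}"
  shows "(\<Sum>i\<in>Inl ` ({k} \<times> {1..N}). row_coef N \<phi> (a, b) i * row_coef N \<phi> (e, f) i)
    = (\<phi> a * \<phi> e * pmat N \<phi> b f + \<phi> a * \<phi> f * pmat N \<phi> b e + \<phi> b * \<phi> e * pmat N \<phi> a f + \<phi> b * \<phi> f * pmat N \<phi> a e
       + 2 * \<phi> a * \<phi> b * \<phi> e * \<phi> f / real N) / (real N)\<^sup>2"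
proof -
  let ?p = "pmat N \<phi>"
  let ?S = "\<lambda>a b. \<Sum>c=1..N. ?p a c * ?p b c" and ?T = "\<lambda>a. \<Sum>c=1..N. ?p a c * \<phi> c"
  have "(\<Sum>i\<in>Inl ` ({k} \<times> {1..N}). row_coef N \<phi> (a, b) i * row_coef N \<phi> (e, f) i)
    = (\<phi> a * \<phi> e * ?S b f + \<phi> a * \<phi> f * ?S b e + \<phi> b * \<phi> e * ?S a f + \<phi> b * \<phi> f * ?S a e
       + sqrt 2 * \<phi> e * \<phi> f / real N * (\<phi> a * ?T b + \<phi> b * ?T a)
       + sqrt 2 * \<phi> a * \<phi> b / real N * (\<phi> e * ?T f + \<phi> f * ?T e)
       + 2 * \<phi> a * \<phi> b * \<phi> e * \<phi> f / (real N)\<^sup>2 * (\<Sum>c=1..N. \<phi> c * \<phi> c)) / (real N)\<^sup>2"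
    unfolding sum_row sum_distrib_left sum.distrib[symmetric] sum_divide_distrib
    using N by (intro sum.cong refl) (simp add: row_coef_def field_simps power2_eq_square)
  also have "\<dots> = (\<phi> a * \<phi> e * pmat N \<phi> b f + \<phi> a * \<phi> f * pmat N \<phi> b e + \<phi> b * \<phi> e * pmat N \<phi> a f + \<phi> b * \<phi> f * pmat N \<phi> a e
       + 2 * \<phi> a * \<phi> b * \<phi> e * \<phi> f / (real N)\<^sup>2 * real N) / (real N)\<^sup>2"
    by (simp only: abef pmat_phi[OF N u] pmat_idem[OF N u] unit_sum[OF N u] mult_zero_right add_0_right)
  finally show ?thesis using N by (simp add: power2_eq_square)
qed


text \<open>Both matrices are linear in independent standard Gaussians, so covariances decide.
  Inserting \<open>\<delta> = P + \<phi> \<phi>\<^sup>T / N\<close> into the covariance of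
  \<open>goe\<close> splits it into the terms quadratic in \<open>P\<close>, which belong to the
  compression, and the mixed and pure \<open>\<phi>\<close> terms, which belong to the fresh vector.
  Here \<open>\<phi>\<close> is a fixed vector.\<close>

lemma refresh_law:
  fixes \<phi> :: "nat \<Rightarrow> real"
  assumes N: "N \<ge> 1" and u: "nnorm N \<phi> = 1"
    and H: "H \<in> borel_measurable (PiM ({1..N} \<times> {1..N}) (\<lambda>_. borel))"
  shows "(\<integral>\<^sup>+y. H (\<lambda>(a, b)\<in>{1..N} \<times> {1..N}. refresh N \<phi> (zvec y k) (goe N y) a b) \<partial>gauss (Inl ` ({k} \<times> {1..N}) \<union> Xidx N))
    = (\<integral>\<^sup>+x. H (\<lambda>(a, b)\<in>{1..N} \<times> {1..N}. goe N x a b) \<partial>gauss (Xidx N))"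
proof -
  let ?S = "{1..N} \<times> {1..N}" and ?R = "Inl ` ({k} \<times> {1..N}) :: gidx set"
  let ?J = "?R \<union> Xidx N" and ?\<delta> = "\<lambda>a c::nat. if a = c then 1 else 0 :: real"
  have dis: "?R \<inter> Xidx N = {}" by (auto simp: Xidx_def)
  define L where "L ab i = goe_coef N (pmat N \<phi>) ab i + row_coef N \<phi> ab i" for ab i
  have r0: "row_coef N \<phi> ab i = 0" if "i \<in> Xidx N" for ab i using that by (auto simp: row_coef_def Xidx_def)
  have g0: "goe_coef N p ab i = 0" if "i \<in> ?R" for p ab i using that by (auto simp: goe_coef_def)
  have split: "(\<Sum>i\<in>?J. L ab i * y i) = (\<Sum>i\<in>?R. row_coef N \<phi> ab i * y i) + (\<Sum>i\<in>Xidx N. goe_coef N (pmat N \<phi>) ab i * y i)" for ab y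
    using dis by (subst sum.union_disjoint) (auto simp: L_def r0 g0 intro!: arg_cong2[of _ _ _ _ "(+)"] sum.cong)
  have splitc: "(\<Sum>i\<in>?J. L ab i * L ef i) = (\<Sum>i\<in>?R. row_coef N \<phi> ab i * row_coef N \<phi> ef i) + (\<Sum>i\<in>Xidx N. goe_coef N (pmat N \<phi>) ab i * goe_coef N (pmat N \<phi>) ef i)" for ab ef
    using dis by (subst sum.union_disjoint) (auto simp: L_def r0 g0 intro!: arg_cong2[of _ _ _ _ "(+)"] sum.cong)
  have lin: "(\<lambda>(a, b)\<in>?S. refresh N \<phi> (zvec y k) (goe N y) a b) = (\<lambda>ab\<in>?S. \<Sum>i\<in>?J. L ab i * y i)" for y
  proof (rule restrict_ext)
    fix ab assume ab: "ab \<in> ?S"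
    obtain a b where [simp]: "ab = (a, b)" by (cases ab)
    have m: "a \<in> {1..N}" "b \<in> {1..N}" using ab by auto
    show "(case ab of (a, b) \<Rightarrow> refresh N \<phi> (zvec y k) (goe N y) a b) = (\<Sum>i\<in>?J. L ab i * y i)"
      unfolding split by (simp add: row_coef_sum[OF N u m, simplified] goe_coef_sum refresh_def)
  qed
  have lin2: "(\<lambda>(a, b)\<in>?S. goe N x a b) = (\<lambda>ab\<in>?S. \<Sum>i\<in>Xidx N. goe_coef N ?\<delta> ab i * x i)" for x
  proof (rule restrict_ext)
    fix ab assume ab: "ab \<in> ?S"
    then show "(case ab of (a, b) \<Rightarrow> goe N x a b) = (\<Sum>i\<in>Xidx N. goe_coef N ?\<delta> ab i * x i)"
      using goe_coef_delta[of "fst ab" N "snd ab" x] by (cases ab) simp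
  qed
  have cov: "(\<Sum>i\<in>?J. L ab i * L ef i) = (\<Sum>i\<in>Xidx N. goe_coef N ?\<delta> ab i * goe_coef N ?\<delta> ef i)"
    if "ab \<in> ?S" "ef \<in> ?S" for ab ef
  proof -
    obtain a b e f where [simp]: "ab = (a, b)" "ef = (e, f)" by (cases ab, cases ef)
    have m: "a \<in> {1..N}" "b \<in> {1..N}" "e \<in> {1..N}" "f \<in> {1..N}" using that by auto
    have d: "(\<Sum>c=1..N. ?\<delta> x c * ?\<delta> y c) = ?\<delta> x y" if "y \<in> {1..N}" for x y
      using sum_mult_delta(2)[OF finite_atLeastAtMost that, of "?\<delta> x"] .
    let ?p = "pmat N \<phi>" let ?f = "\<lambda>a b. \<phi> a * \<phi> b / real N"
    have pf: "?\<delta> x y = ?p x y + ?f x y" for x y by (simp add: pmat_def)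
    have "(\<Sum>i\<in>?J. L ab i * L ef i) = (?p a e * ?p b f + ?p a f * ?p b e) / real N +
       (\<phi> a * \<phi> e * ?p b f + \<phi> a * \<phi> f * ?p b e + \<phi> b * \<phi> e * ?p a f + \<phi> b * \<phi> f * ?p a e + 2 * \<phi> a * \<phi> b * \<phi> e * \<phi> f / real N) / (real N)\<^sup>2"
      unfolding splitc using m by (simp only: \<open>ab = (a, b)\<close> \<open>ef = (e, f)\<close> row_coef_cov[OF N u] goe_coef_cov[OF N] pmat_idem[OF N u] fst_conv snd_conv)
    also have "\<dots> = ((?p a e + ?f a e) * (?p b f + ?f b f) + (?p a f + ?f a f) * (?p b e + ?f b e)) / real N"
      using N by (simp add: field_simps power2_eq_square)
    also have "\<dots> = (?\<delta> a e * ?\<delta> b f + ?\<delta> a f * ?\<delta> b e) / real N" unfolding pf ..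
    also have "\<dots> = (\<Sum>i\<in>Xidx N. goe_coef N ?\<delta> ab i * goe_coef N ?\<delta> ef i)"
      using m by (simp only: goe_coef_cov[OF N] \<open>ab = (a, b)\<close> \<open>ef = (e, f)\<close> fst_conv snd_conv d)
    finally show ?thesis .
  qed
  have fJ: "finite ?J" by simp
  have "distr (gauss ?J) (PiM ?S (\<lambda>_. borel)) (\<lambda>y. \<lambda>ab\<in>?S. \<Sum>i\<in>?J. L ab i * y i)
    = distr (gauss (Xidx N)) (PiM ?S (\<lambda>_. borel)) (\<lambda>x. \<lambda>ab\<in>?S. \<Sum>i\<in>Xidx N. goe_coef N ?\<delta> ab i * x i)"
    by (rule distr_linear_gauss_eq[OF _ fJ finite_Xidx cov]) simp
  then have "(\<integral>\<^sup>+y. H y \<partial>distr (gauss ?J) (PiM ?S (\<lambda>_. borel)) (\<lambda>y. \<lambda>ab\<in>?S. \<Sum>i\<in>?J. L ab i * y i))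
    = (\<integral>\<^sup>+y. H y \<partial>distr (gauss (Xidx N)) (PiM ?S (\<lambda>_. borel)) (\<lambda>x. \<lambda>ab\<in>?S. \<Sum>i\<in>Xidx N. goe_coef N ?\<delta> ab i * x i))"
    by (rule arg_cong)
  then show ?thesis
    unfolding lin lin2 nn_integral_distr[OF measurable_linear_gauss[OF fJ], unfolded measurable_distr_eq1, OF H]
      nn_integral_distr[OF measurable_linear_gauss[OF finite_Xidx], unfolded measurable_distr_eq1, OF H] .
qed


section \<open>Congruence and measurability of the iterates and directions\<close>

definition mat_eq :: "nat \<Rightarrow> (nat \<Rightarrow> nat \<Rightarrow> real) \<Rightarrow> (nat \<Rightarrow> nat \<Rightarrow> real) \<Rightarrow> bool" where
  "mat_eq N G G' \<longleftrightarrow> (\<forall>a\<in>{1..N}. \<forall>b\<in>{1..N}. G a b = G' a b)"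

lemma sk_m_cong:
  assumes "mat_eq N G G'" shows "sk_m \<beta> h q N G k = sk_m \<beta> h q N G' k"
  using assms
proof (induction \<beta> h q N G k rule: sk_m.induct)
  case (3 \<beta> h q N G k)
  have s: "(\<Sum>j=1..N. G i j * sk_m \<beta> h q N G (Suc k) j) = (\<Sum>j=1..N. G' i j * sk_m \<beta> h q N G' (Suc k) j)" if "i \<in> {1..N}" for i
    using 3 that by (intro sum.cong) (auto simp: mat_eq_def)
  show ?case
  proof
    fix i show "sk_m \<beta> h q N G (Suc (Suc k)) i = sk_m \<beta> h q N G' (Suc (Suc k)) i"
      using s[of i] 3 by (simp add: vec_of_def)
  qed
qed simp_all

lemma sk_phi_cong:
  assumes "mat_eq N G G'" shows "sk_phi \<beta> h q N G k = sk_phi \<beta> h q N G' k"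
proof -
  have "sk_m \<beta> h q N G = sk_m \<beta> h q N G'" by (rule ext) (rule sk_m_cong[OF assms])
  then show ?thesis by (simp only: sk_phi_gs)
qed

lemma supp_sk_m: "supp N (sk_m \<beta> h q N G k)"
  by (cases "(\<beta>, h, q, N, G, k)" rule: sk_m.cases) (auto simp: supp_def vec_of_def)

lemma borel_measurable_tanh: "(tanh :: real \<Rightarrow> real) \<in> borel_measurable borel"
  by (rule borel_measurable_continuous_onI) (intro continuous_intros, simp)

lemma borel_measurable_Th:
  assumes "f \<in> borel_measurable M" shows "(\<lambda>\<omega>. Th \<beta> h (f \<omega>)) \<in> borel_measurable M"
  unfolding Th_def
  by (rule measurable_compose[OF _ borel_measurable_tanh])
     (intro borel_measurable_add borel_measurable_times borel_measurable_const assms)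

lemma borel_measurable_sk_m:
  assumes G: "\<And>a b. a \<in> {1..N} \<Longrightarrow> b \<in> {1..N} \<Longrightarrow> (\<lambda>\<omega>. G \<omega> a b) \<in> borel_measurable M" and i: "i \<in> {1..N}"
  shows "(\<lambda>\<omega>. sk_m \<beta> h q N (G \<omega>) k i) \<in> borel_measurable M"
  using i
proof (induction k arbitrary: i rule: less_induct)
  case (less k)
  consider "k = 0" | "k = 1" | k' where "k = Suc (Suc k')" by (metis One_nat_def not0_implies_Suc)
  then show ?case
  proof cases
    case 3
    have e: "sk_m \<beta> h q N (G \<omega>) k i = Th \<beta> h ((\<Sum>j=1..N. G \<omega> i j * sk_m \<beta> h q N (G \<omega>) (Suc k') j) - \<beta> * (1 - q) * sk_m \<beta> h q N (G \<omega>) k' i)" for \<omega>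
      using less.prems 3 by (simp add: vec_of_def)
    have l: "Suc k' < k" "k' < k" using 3 by auto
    show ?thesis unfolding e
      by (intro borel_measurable_Th borel_measurable_diff borel_measurable_sum borel_measurable_times borel_measurable_const
          G less.prems less.IH[OF l(1)] less.IH[OF l(2)])
  qed (use less.prems in \<open>simp_all only: sk_m.simps One_nat_def vec_of_def borel_measurable_const\<close>)
qed

lemma borel_measurable_sk_phi:
  assumes N: "N \<ge> 1" and G: "\<And>a b. a \<in> {1..N} \<Longrightarrow> b \<in> {1..N} \<Longrightarrow> (\<lambda>\<omega>. G \<omega> a b) \<in> borel_measurable M"
    and i: "i \<in> {1..N}" and k: "k \<ge> 1"
  shows "(\<lambda>\<omega>. sk_phi \<beta> h q N (G \<omega>) k i) \<in> borel_measurable M"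
proof -
  have k': "k \<in> {1..k}" using k by simp
  have "\<forall>i\<in>{1..N}. (\<lambda>\<omega>. gs_M N (sk_m \<beta> h q N (G \<omega>)) k i) \<in> borel_measurable M \<and> (\<lambda>\<omega>. gs_phi N (sk_m \<beta> h q N (G \<omega>)) k i) \<in> borel_measurable M
      \<and> (\<lambda>\<omega>. gs_b N (sk_m \<beta> h q N (G \<omega>)) k i) \<in> borel_measurable M"
    by (rule borel_measurable_gs[OF N supp_sk_m borel_measurable_sk_m[OF G] k'])
  then show ?thesis using i unfolding sk_phi_gs by blast
qed

lemma nnorm_sk_phi: "N \<ge> 1 \<Longrightarrow> nnorm N (sk_phi \<beta> h q N G k) = 1"
  unfolding sk_phi_gs by (rule nnorm_gs_phi[where k=0]) auto

text \<open>
  The direction \<open>\<phi>\<^sup>k\<^sup>+\<^sup>1\<close> only depends on the action of the matrix on the first \<open>k\<close> directions, where it has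
  been replaced already. So it may be computed with \<open>G = 0\<close>, and is a function of the fresh vectors alone.
\<close>

primrec Tmat :: "real \<Rightarrow> real \<Rightarrow> real \<Rightarrow> nat \<Rightarrow> (nat \<Rightarrow> nat \<Rightarrow> real) \<Rightarrow> nat \<Rightarrow> (nat \<Rightarrow> nat \<Rightarrow> real) \<Rightarrow> nat \<Rightarrow> nat \<Rightarrow> real" where
  "Tmat \<beta> h q N z 0 = (\<lambda>G. G)"
| "Tmat \<beta> h q N z (Suc k) =
     (\<lambda>G. Tmat \<beta> h q N z k (refresh N (sk_phi \<beta> h q N (Tmat \<beta> h q N z k (\<lambda>_ _. 0)) (Suc k)) (z (Suc k)) G))"

definition zphi :: "real \<Rightarrow> real \<Rightarrow> real \<Rightarrow> nat \<Rightarrow> (nat \<Rightarrow> nat \<Rightarrow> real) \<Rightarrow> nat \<Rightarrow> nat \<Rightarrow> real" where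
  "zphi \<beta> h q N z k = sk_phi \<beta> h q N (Tmat \<beta> h q N z (k - 1) (\<lambda>_ _. 0)) k"

lemma Tmat_Suc: "Tmat \<beta> h q N z (Suc k) G = Tmat \<beta> h q N z k (refresh N (zphi \<beta> h q N z (Suc k)) (z (Suc k)) G)"
  by (simp add: zphi_def)

lemma refresh_cong:
  assumes "mat_eq N G G'" "\<And>i. i \<in> {1..N} \<Longrightarrow> z i = z' i"
  shows "mat_eq N (refresh N \<phi> z G) (refresh N \<phi> z' G')"
  unfolding mat_eq_def
proof (intro ballI)
  fix a b assume ab: "a \<in> {1..N}" "b \<in> {1..N}"
  have i: "ninner N \<phi> z = ninner N \<phi> z'" using assms by (intro ninner_cong) auto
  have "(\<Sum>c=1..N. \<Sum>d=1..N. pmat N \<phi> a c * G c d * pmat N \<phi> b d) = (\<Sum>c=1..N. \<Sum>d=1..N. pmat N \<phi> a c * G' c d * pmat N \<phi> b d)"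
    using assms(1) by (intro sum.cong refl) (simp add: mat_eq_def)
  then show "refresh N \<phi> z G a b = refresh N \<phi> z' G' a b"
    using i ab assms(2) by (simp add: refresh_def pvec_def)
qed

lemma Tmat_cong:
  assumes "\<And>l i. l \<in> {1..k} \<Longrightarrow> i \<in> {1..N} \<Longrightarrow> z l i = z' l i" "mat_eq N G G'"
  shows "mat_eq N (Tmat \<beta> h q N z k G) (Tmat \<beta> h q N z' k G')"
  using assms
proof (induction k arbitrary: G G')
  case (Suc k)
  have T: "mat_eq N (Tmat \<beta> h q N z k G) (Tmat \<beta> h q N z' k G')" if "mat_eq N G G'" for G G'
    by (rule Suc.IH) (use Suc.prems(1) that in auto)
  have "zphi \<beta> h q N z (Suc k) = zphi \<beta> h q N z' (Suc k)"
    unfolding zphi_def by (rule sk_phi_cong) (use T in \<open>simp add: mat_eq_def\<close>)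
  then show ?case unfolding Tmat_Suc by (intro T) (use Suc.prems in \<open>auto intro!: refresh_cong\<close>)
qed simp

text \<open>This predictability makes the \<open>k\<close>-th direction independent of the
  \<open>k\<close>-th fresh vector; \<open>Tmat_law\<close> and \<open>zphi_zvec_tail\<close> rely
  on it.\<close>

lemma zphi_cong:
  assumes "\<And>l i. l \<in> {1..k - 1} \<Longrightarrow> i \<in> {1..N} \<Longrightarrow> z l i = z' l i"
  shows "zphi \<beta> h q N z k = zphi \<beta> h q N z' k"
  unfolding zphi_def by (intro sk_phi_cong Tmat_cong assms) (simp_all add: mat_eq_def)

lemma nnorm_zphi: "N \<ge> 1 \<Longrightarrow> nnorm N (zphi \<beta> h q N z k) = 1"
  unfolding zphi_def by (rule nnorm_sk_phi)

lemma borel_measurable_refresh: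
  assumes \<phi>: "\<And>i. i \<in> {1..N} \<Longrightarrow> (\<lambda>\<omega>. \<phi> \<omega> i) \<in> borel_measurable M" and z: "\<And>i. i \<in> {1..N} \<Longrightarrow> (\<lambda>\<omega>. z \<omega> i) \<in> borel_measurable M"
    and G: "\<And>a b. a \<in> {1..N} \<Longrightarrow> b \<in> {1..N} \<Longrightarrow> (\<lambda>\<omega>. G \<omega> a b) \<in> borel_measurable M"
    and ab: "a \<in> {1..N}" "b \<in> {1..N}"
  shows "(\<lambda>\<omega>. refresh N (\<phi> \<omega>) (z \<omega>) (G \<omega>) a b) \<in> borel_measurable M"
  unfolding refresh_def pmat_def pvec_def
  by (intro borel_measurable_add borel_measurable_diff borel_measurable_times borel_measurable_divide borel_measurable_sum
      borel_measurable_const borel_measurable_ninner \<phi> z G ab)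

lemma borel_measurable_Tmat:
  assumes N: "N \<ge> 1" and z: "\<And>l i. l \<in> {1..k} \<Longrightarrow> i \<in> {1..N} \<Longrightarrow> (\<lambda>\<omega>. z \<omega> l i) \<in> borel_measurable M"
    and G: "\<And>a b. a \<in> {1..N} \<Longrightarrow> b \<in> {1..N} \<Longrightarrow> (\<lambda>\<omega>. G \<omega> a b) \<in> borel_measurable M"
    and ab: "a \<in> {1..N}" "b \<in> {1..N}"
  shows "(\<lambda>\<omega>. Tmat \<beta> h q N (z \<omega>) k (G \<omega>) a b) \<in> borel_measurable M"
  using z G ab
proof (induction k arbitrary: G a b)
  case 0 then show ?case by (simp only: Tmat.simps)
next
  case (Suc k)
  have z': "(\<lambda>\<omega>. z \<omega> l i) \<in> borel_measurable M" if "l \<in> {1..k}" "i \<in> {1..N}" for l i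
  proof (rule Suc.prems(1)[OF _ that(2)])
    show "l \<in> {1..Suc k}" using that by simp
  qed
  have zS: "(\<lambda>\<omega>. z \<omega> (Suc k) i) \<in> borel_measurable M" if "i \<in> {1..N}" for i
  proof (rule Suc.prems(1)[OF _ that])
    show "Suc k \<in> {1..Suc k}" by simp
  qed
  have T: "(\<lambda>\<omega>. Tmat \<beta> h q N (z \<omega>) k (\<lambda>_ _. 0) a b) \<in> borel_measurable M" if "a \<in> {1..N}" "b \<in> {1..N}" for a b
    by (rule Suc.IH[OF z' borel_measurable_const that])
  have \<phi>: "(\<lambda>\<omega>. zphi \<beta> h q N (z \<omega>) (Suc k) i) \<in> borel_measurable M" if "i \<in> {1..N}" for i
    unfolding zphi_def diff_Suc_1 by (rule borel_measurable_sk_phi[OF N T that Suc_le_mono[THEN iffD2, OF le0, folded One_nat_def]])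
  show ?case unfolding Tmat_Suc
    by (rule Suc.IH[OF z' borel_measurable_refresh[OF \<phi> zS Suc.prems(2)] Suc.prems(3,4)])
qed

lemma borel_measurable_zphi:
  assumes N: "N \<ge> 1" and k: "k \<ge> 1" and z: "\<And>l i. l \<in> {1..k - 1} \<Longrightarrow> i \<in> {1..N} \<Longrightarrow> (\<lambda>\<omega>. z \<omega> l i) \<in> borel_measurable M"
    and i: "i \<in> {1..N}"
  shows "(\<lambda>\<omega>. zphi \<beta> h q N (z \<omega>) k i) \<in> borel_measurable M"
  unfolding zphi_def by (rule borel_measurable_sk_phi[OF N borel_measurable_Tmat[OF N z borel_measurable_const] i k])

lemma borel_measurable_goe:
  assumes "a \<in> {1..N}" "b \<in> {1..N}" "Xidx N \<subseteq> J"
  shows "(\<lambda>\<omega>. goe N \<omega> a b) \<in> borel_measurable (gauss J)"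
proof -
  have m: "Inr (a, b) \<in> J" "Inr (b, a) \<in> J" using assms by (auto simp: Xidx_def)
  show ?thesis unfolding goe_def
    by (intro borel_measurable_divide borel_measurable_add borel_measurable_const measurable_gauss_component m)
qed

lemma borel_measurable_zvec:
  assumes "l \<in> {1..K}" "i \<in> {1..N}" "Zidx K N \<subseteq> J"
  shows "(\<lambda>\<omega>. zvec \<omega> l i) \<in> borel_measurable (gauss J)"
proof -
  have "Inl (l, i) \<in> J" using assms by (auto simp: Zidx_def)
  then show ?thesis unfolding zvec_def by (rule measurable_gauss_component)
qed

abbreviation mat_of :: "(nat \<times> nat \<Rightarrow> real) \<Rightarrow> nat \<Rightarrow> nat \<Rightarrow> real" where "mat_of y \<equiv> \<lambda>a b. y (a, b)"

lemma nn_integral_gauss_fold: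
  assumes "I \<inter> J = {}" "finite I" "finite J" "f \<in> borel_measurable (gauss (I \<union> J))"
  shows "integral\<^sup>N (gauss (I \<union> J)) f = (\<integral>\<^sup>+x. \<integral>\<^sup>+y. f (merge I J (x, y)) \<partial>gauss J \<partial>gauss I)"
  using assms unfolding gauss_def
  by (intro product_sigma_finite.product_nn_integral_fold[OF product_sigma_finite_std_normal])

text \<open>Functionals \<open>F\<close> are defined on infinite matrices but read only the entries
  in \<open>{1..N}\<close>, as \<open>cong\<close> states. They therefore factor through the finite
  product space on which the laws are compared.\<close>

lemma measurable_mat_fun:
  assumes F: "(\<lambda>y. F (mat_of y)) \<in> borel_measurable (PiM ({1..N} \<times> {1..N}) (\<lambda>_. borel))"
    and cong: "\<And>G G'. mat_eq N G G' \<Longrightarrow> F G = F G'"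
    and G: "\<And>a b. a \<in> {1..N} \<Longrightarrow> b \<in> {1..N} \<Longrightarrow> (\<lambda>\<omega>. G \<omega> a b) \<in> borel_measurable M"
  shows "(\<lambda>\<omega>. F (G \<omega>)) \<in> borel_measurable M"
proof -
  have "(\<lambda>\<omega>. \<lambda>(a, b)\<in>{1..N} \<times> {1..N}. G \<omega> a b) \<in> measurable M (PiM ({1..N} \<times> {1..N}) (\<lambda>_. borel))"
  proof (rule measurable_restrict)
    fix p assume "p \<in> {1..N} \<times> {1..N}"
    then show "(\<lambda>\<omega>. case p of (a, b) \<Rightarrow> G \<omega> a b) \<in> borel_measurable M"
      using G[of "fst p" "snd p"] by (cases p) (simp only: prod.case fst_conv snd_conv mem_Times_iff)
  qed
  from measurable_compose[OF this F]
  have "(\<lambda>\<omega>. F (mat_of (\<lambda>(a, b)\<in>{1..N} \<times> {1..N}. G \<omega> a b))) \<in> borel_measurable M" .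
  moreover have "F (mat_of (\<lambda>(a, b)\<in>{1..N} \<times> {1..N}. G \<omega> a b)) = F (G \<omega>)" for \<omega>
    by (rule cong) (simp add: mat_eq_def)
  ultimately show ?thesis by (simp only:)
qed

text \<open>Fubini separates the first \<open>k\<close> fresh vectors from the last one and the
  matrix. With the former frozen, the last direction is a constant unit vector, and
  \<open>refresh_law\<close>, applied to \<open>F\<close> composed with the first \<open>k\<close>
  replacements, restores the original matrix.\<close>

lemma Tmat_law:
  fixes F :: "(nat \<Rightarrow> nat \<Rightarrow> real) \<Rightarrow> ennreal"
  assumes N: "N \<ge> 1" and F: "(\<lambda>y. F (mat_of y)) \<in> borel_measurable (PiM ({1..N} \<times> {1..N}) (\<lambda>_. borel))"
    and cong: "\<And>G G'. mat_eq N G G' \<Longrightarrow> F G = F G'"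
  shows "(\<integral>\<^sup>+\<omega>. F (Tmat \<beta> h q N (zvec \<omega>) k (goe N \<omega>)) \<partial>gauss (Zidx k N \<union> Xidx N)) = (\<integral>\<^sup>+x. F (goe N x) \<partial>gauss (Xidx N))"
proof (induction k)
  case 0 show ?case by (simp add: Zidx_def)
next
  case (Suc k)
  let ?T = "Tmat \<beta> h q N" and ?R = "Inl ` ({Suc k} \<times> {1..N}) :: gidx set" and ?S = "{1..N} \<times> {1..N}"
  have Z: "Zidx (Suc k) N \<union> Xidx N = Zidx k N \<union> (?R \<union> Xidx N)"
  proof -
    have "{1..Suc k} \<times> {1..N} = {1..k} \<times> {1..N} \<union> {Suc k} \<times> {1..N}" by auto
    then show ?thesis by (simp only: Zidx_def image_Un Un_assoc)
  qed
  have dis: "Zidx k N \<inter> (?R \<union> Xidx N) = {}" "Zidx k N \<inter> Xidx N = {}" by (auto simp: Zidx_def Xidx_def)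
  have mT: "(\<lambda>\<omega>. F (?T (zvec \<omega>) l (goe N \<omega>))) \<in> borel_measurable (gauss (Zidx l N \<union> Xidx N))" for l
    by (rule measurable_mat_fun[OF F cong borel_measurable_Tmat[OF N borel_measurable_zvec borel_measurable_goe]]) auto
  have e1: "F (?T (zvec (merge (Zidx k N) (?R \<union> Xidx N) (x, y))) (Suc k) (goe N (merge (Zidx k N) (?R \<union> Xidx N) (x, y))))
     = F (?T (zvec x) k (mat_of (\<lambda>(a, b)\<in>?S. refresh N (zphi \<beta> h q N (zvec x) (Suc k)) (zvec y (Suc k)) (goe N y) a b)))" for x y
  proof (rule cong)
    let ?w = "merge (Zidx k N) (?R \<union> Xidx N) (x, y)"
    have zk: "zvec ?w l i = zvec x l i" if "l \<in> {1..k}" "i \<in> {1..N}" for l i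
      using that by (simp add: zvec_def merge_def Zidx_def image_iff)
    have zS: "zvec ?w (Suc k) i = zvec y (Suc k) i" if "i \<in> {1..N}" for i
      using that by (simp add: zvec_def merge_def Zidx_def image_iff)
    have g: "mat_eq N (goe N ?w) (goe N y)"
      by (simp add: mat_eq_def goe_def merge_def Zidx_def Xidx_def image_iff)
    have p: "zphi \<beta> h q N (zvec ?w) (Suc k) = zphi \<beta> h q N (zvec x) (Suc k)"
      by (rule zphi_cong) (use zk in auto)
    have r: "mat_eq N (refresh N (zphi \<beta> h q N (zvec x) (Suc k)) (zvec ?w (Suc k)) (goe N ?w))
       (mat_of (\<lambda>(a, b)\<in>?S. refresh N (zphi \<beta> h q N (zvec x) (Suc k)) (zvec y (Suc k)) (goe N y) a b))"
      using refresh_cong[OF g zS] by (simp add: mat_eq_def)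
    show "mat_eq N (?T (zvec ?w) (Suc k) (goe N ?w)) (?T (zvec x) k (mat_of (\<lambda>(a, b)\<in>?S. refresh N (zphi \<beta> h q N (zvec x) (Suc k)) (zvec y (Suc k)) (goe N y) a b)))"
      unfolding Tmat_Suc p by (intro Tmat_cong zk r)
  qed
  have e2: "F (?T (zvec (merge (Zidx k N) (Xidx N) (x, y))) k (goe N (merge (Zidx k N) (Xidx N) (x, y))))
     = F (?T (zvec x) k (mat_of (\<lambda>(a, b)\<in>?S. goe N y a b)))" for x y
  proof (rule cong)
    let ?w = "merge (Zidx k N) (Xidx N) (x, y)"
    have zk: "zvec ?w l i = zvec x l i" if "l \<in> {1..k}" "i \<in> {1..N}" for l i
      using that by (simp add: zvec_def merge_def Zidx_def image_iff)
    have g: "mat_eq N (goe N ?w) (mat_of (\<lambda>(a, b)\<in>?S. goe N y a b))"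
      by (simp add: mat_eq_def goe_def merge_def Zidx_def Xidx_def image_iff)
    show "mat_eq N (?T (zvec ?w) k (goe N ?w)) (?T (zvec x) k (mat_of (\<lambda>(a, b)\<in>?S. goe N y a b)))"
      by (intro Tmat_cong zk g)
  qed
  have H: "(\<lambda>y. F (?T z k (mat_of y))) \<in> borel_measurable (PiM ?S (\<lambda>_. borel))" for z
  proof (rule measurable_mat_fun[OF F cong])
    fix a b assume ab: "a \<in> {1..N}" "b \<in> {1..N}"
    show "(\<lambda>y. ?T z k (mat_of y) a b) \<in> borel_measurable (PiM ?S (\<lambda>_. borel))"
    proof (rule borel_measurable_Tmat[OF N borel_measurable_const _ ab])
      fix a b assume "a \<in> {1..N}" "b \<in> {1..N}"
      then show "(\<lambda>y. mat_of y a b) \<in> borel_measurable (PiM ?S (\<lambda>_. borel))"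
        by (intro measurable_component_singleton SigmaI)
    qed
  qed
  have "(\<integral>\<^sup>+\<omega>. F (?T (zvec \<omega>) (Suc k) (goe N \<omega>)) \<partial>gauss (Zidx (Suc k) N \<union> Xidx N)) =
     (\<integral>\<^sup>+x. \<integral>\<^sup>+y. F (?T (zvec x) k (mat_of (\<lambda>(a, b)\<in>?S. refresh N (zphi \<beta> h q N (zvec x) (Suc k)) (zvec y (Suc k)) (goe N y) a b))) \<partial>gauss (?R \<union> Xidx N) \<partial>gauss (Zidx k N))"
    unfolding e1[symmetric] Z by (rule nn_integral_gauss_fold[OF dis(1)]) (use mT[of "Suc k"] in \<open>simp_all only: Z, simp_all\<close>)
  also have "\<dots> = (\<integral>\<^sup>+x. \<integral>\<^sup>+y. F (?T (zvec x) k (mat_of (\<lambda>(a, b)\<in>?S. goe N y a b))) \<partial>gauss (Xidx N) \<partial>gauss (Zidx k N))"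
    by (intro nn_integral_cong refresh_law[OF N nnorm_zphi[OF N] H])
  also have "\<dots> = (\<integral>\<^sup>+\<omega>. F (?T (zvec \<omega>) k (goe N \<omega>)) \<partial>gauss (Zidx k N \<union> Xidx N))"
    unfolding e2[symmetric] by (rule nn_integral_gauss_fold[OF dis(2) finite_Zidx finite_Xidx mT, symmetric])
  also have "\<dots> = (\<integral>\<^sup>+x. F (goe N x) \<partial>gauss (Xidx N))" by (rule Suc.IH)
  finally show ?case .
qed

section \<open>The error of one iteration step\<close>

definition mv :: "nat \<Rightarrow> (nat \<Rightarrow> nat \<Rightarrow> real) \<Rightarrow> (nat \<Rightarrow> real) \<Rightarrow> nat \<Rightarrow> real" where
  "mv N G v i = (\<Sum>j=1..N. G i j * v j)"

lemma mv_lincomb: "mv N G (\<lambda>i. \<Sum>l\<in>A. c l * v l i) i = (\<Sum>l\<in>A. c l * mv N G (v l) i)"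
  unfolding mv_def sum_distrib_left by (subst sum.swap) (simp add: mult.left_commute)

lemma sk_m_Suc: "sk_m \<beta> h q N G (Suc (Suc k)) =
    vec_of N (\<lambda>i. Th \<beta> h (mv N G (sk_m \<beta> h q N G (Suc k)) i - \<beta> * (1 - q) * sk_m \<beta> h q N G k i))"
  by (simp add: mv_def)

lemma sum_triangle_swap:
  fixes f :: "nat \<Rightarrow> nat \<Rightarrow> real"
  shows "(\<Sum>j=1..k. \<Sum>l=1..j - 1. f j l) = (\<Sum>l=1..k - 1. \<Sum>j=Suc l..k. f j l)"
proof -
  have "(\<Sum>j=1..k. \<Sum>l=1..j - 1. f j l) = (\<Sum>j=1..k. \<Sum>l=1..k - 1. if l < j then f j l else 0)"
    by (intro sum.cong refl sum.mono_neutral_cong_left) auto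
  also have "\<dots> = (\<Sum>l=1..k - 1. \<Sum>j=1..k. if l < j then f j l else 0)" by (rule sum.swap)
  also have "\<dots> = (\<Sum>l=1..k - 1. \<Sum>j=Suc l..k. f j l)"
    by (intro sum.cong refl sum.mono_neutral_cong_right) auto
  finally show ?thesis .
qed

lemma refresh_mv:
  assumes N: "N \<ge> 1" and u: "nnorm N \<phi> = 1" and i: "i \<in> {1..N}"
  shows "mv N (refresh N \<phi> z G) v i = pvec N \<phi> (mv N G (pvec N \<phi> v)) i
     + ninner N \<phi> v * (pvec N \<phi> z i + sqrt 2 * ninner N \<phi> z * \<phi> i) + \<phi> i * ninner N (pvec N \<phi> z) v"
proof -
  let ?p = "pmat N \<phi>"
  have 1: "(\<Sum>j=1..N. (\<Sum>c=1..N. \<Sum>d=1..N. ?p i c * G c d * ?p j d) * v j) = pvec N \<phi> (mv N G (pvec N \<phi> v)) i"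
  proof -
    have "(\<Sum>j=1..N. (\<Sum>c=1..N. \<Sum>d=1..N. ?p i c * G c d * ?p j d) * v j)
      = (\<Sum>j=1..N. \<Sum>c=1..N. \<Sum>d=1..N. ?p i c * G c d * (?p d j * v j))"
      unfolding sum_distrib_right by (intro sum.cong refl) (metis mult.assoc pmat_sym)
    also have "\<dots> = (\<Sum>c=1..N. \<Sum>j=1..N. \<Sum>d=1..N. ?p i c * G c d * (?p d j * v j))" by (rule sum.swap)
    also have "\<dots> = (\<Sum>c=1..N. \<Sum>d=1..N. \<Sum>j=1..N. ?p i c * G c d * (?p d j * v j))"
      by (intro sum.cong refl sum.swap)
    also have "\<dots> = (\<Sum>c=1..N. \<Sum>d=1..N. ?p i c * G c d * pvec N \<phi> v d)"
      by (intro sum.cong refl) (simp only: sum_distrib_left[symmetric] pvec_pmat[OF N u])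
    also have "\<dots> = (\<Sum>c=1..N. ?p i c * mv N G (pvec N \<phi> v) c)"
      by (simp add: mv_def sum_distrib_left mult.assoc)
    finally show ?thesis by (simp only: pvec_pmat[OF N u i])
  qed
  have 2: "(\<Sum>j=1..N. (\<phi> i * pvec N \<phi> z j + pvec N \<phi> z i * \<phi> j + sqrt 2 * ninner N \<phi> z * \<phi> i * \<phi> j) / real N * v j)
    = ninner N \<phi> v * (pvec N \<phi> z i + sqrt 2 * ninner N \<phi> z * \<phi> i) + \<phi> i * ninner N (pvec N \<phi> z) v"
  proof -
    have "(\<Sum>j=1..N. (\<phi> i * pvec N \<phi> z j + pvec N \<phi> z i * \<phi> j + sqrt 2 * ninner N \<phi> z * \<phi> i * \<phi> j) / real N * v j)
      = (\<Sum>j=1..N. (pvec N \<phi> z i + sqrt 2 * ninner N \<phi> z * \<phi> i) * (\<phi> j * v j) / real N + \<phi> i * (pvec N \<phi> z j * v j) / real N)"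
      by (intro sum.cong refl) (simp add: field_simps)
    also have "\<dots> = (pvec N \<phi> z i + sqrt 2 * ninner N \<phi> z * \<phi> i) * (\<Sum>j=1..N. \<phi> j * v j) / real N + \<phi> i * (\<Sum>j=1..N. pvec N \<phi> z j * v j) / real N"
      by (simp only: sum.distrib sum_distrib_left sum_divide_distrib)
    finally show ?thesis by (simp add: ninner_def mult.commute)
  qed
  show ?thesis unfolding mv_def[of N "refresh N \<phi> z G"] refresh_def distrib_right sum.distrib 1 2 by simp
qed

lemma mv_pvec_orth:
  assumes "ninner N \<phi> v = 0" shows "mv N G (pvec N \<phi> v) = mv N G v"
  using assms by (simp add: pvec_def)

context
  fixes \<beta> h q :: real and N :: nat and z :: "nat \<Rightarrow> nat \<Rightarrow> real"
  assumes N: "N \<ge> 1"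
begin

abbreviation "T \<equiv> Tmat \<beta> h q N z"
abbreviation "\<Phi> \<equiv> zphi \<beta> h q N z"

lemma Phi_norm: "nnorm N (\<Phi> j) = 1" "ninner N (\<Phi> j) (\<Phi> j) = 1"
  using nnorm_zphi[OF N, of \<beta> h q z j] nnorm_square[of N "\<Phi> j"] by simp_all

text \<open>On vectors orthogonal to the first \<open>k\<close> directions the matrix
  \<open>G\<close> survives except along these directions. There symmetry dictates the component
  \<open>ninner N (z l) v\<close>, since \<open>\<Phi> l\<close> itself is mapped to
  \<open>z l\<close> up to corrections.\<close>

lemma Tmat_perp:
  assumes "\<And>i j. i \<in> {1..k} \<Longrightarrow> j \<in> {1..k} \<Longrightarrow> i \<noteq> j \<Longrightarrow> ninner N (\<Phi> i) (\<Phi> j) = 0"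
    and "\<And>l. l \<in> {1..k} \<Longrightarrow> ninner N (\<Phi> l) v = 0" and "i \<in> {1..N}"
  shows "mv N (T k G) v i = (\<Sum>l=1..k. ninner N (z l) v * \<Phi> l i) + mv N G v i - (\<Sum>l=1..k. ninner N (\<Phi> l) (mv N G v) * \<Phi> l i)"
  using assms
proof (induction k arbitrary: G)
  case (Suc k)
  let ?\<psi> = "\<Phi> (Suc k)" and ?w = "mv N G v"
  define R where "R = refresh N ?\<psi> (z (Suc k)) G"
  have o: "ninner N ?\<psi> v = 0" using Suc.prems(2) by simp
  have Rv: "mv N R v a = ?w a + (ninner N (z (Suc k)) v - ninner N ?\<psi> ?w) * ?\<psi> a" if "a \<in> {1..N}" for a
  proof -
    have "ninner N (pvec N ?\<psi> (z (Suc k))) v = ninner N (z (Suc k)) v"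
      unfolding pvec_def ninner_linear o by simp
    then show ?thesis unfolding R_def refresh_mv[OF N Phi_norm(1) that] mv_pvec_orth[OF o] o
      by (simp add: pvec_def algebra_simps)
  qed
  have in1: "ninner N (\<Phi> l) (mv N R v) = ninner N (\<Phi> l) ?w" if l: "l \<in> {1..k}" for l
  proof -
    have "ninner N (\<Phi> l) (mv N R v) = ninner N (\<Phi> l) (\<lambda>a. ?w a + (ninner N (z (Suc k)) v - ninner N ?\<psi> ?w) * ?\<psi> a)"
      by (rule ninner_cong) (auto simp: Rv)
    also have "\<dots> = ninner N (\<Phi> l) ?w + (ninner N (z (Suc k)) v - ninner N ?\<psi> ?w) * ninner N (\<Phi> l) ?\<psi>"
      by (simp only: ninner_linear)
    also have "ninner N (\<Phi> l) ?\<psi> = 0" using Suc.prems(1)[of l "Suc k"] l by simp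
    finally show ?thesis by simp
  qed
  have "mv N (T (Suc k) G) v i = mv N (T k R) v i" by (simp only: Tmat_Suc R_def)
  also have "\<dots> = (\<Sum>l=1..k. ninner N (z l) v * \<Phi> l i) + mv N R v i - (\<Sum>l=1..k. ninner N (\<Phi> l) (mv N R v) * \<Phi> l i)"
    by (rule Suc.IH) (use Suc.prems in auto)
  also have "(\<Sum>l=1..k. ninner N (\<Phi> l) (mv N R v) * \<Phi> l i) = (\<Sum>l=1..k. ninner N (\<Phi> l) ?w * \<Phi> l i)"
    by (intro sum.cong refl) (simp only: in1)
  finally show ?case unfolding Rv[OF Suc.prems(3)] by (simp add: algebra_simps)
qed (simp add: mv_def)

text \<open>The image of \<open>\<Phi> j\<close> found in \<open>Tmat_phi\<close>: the fresh vector
  \<open>z j\<close>, with its components along earlier directions exchanged for those that symmetry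
  prescribes, and its component along \<open>\<Phi> j\<close> scaled by
  \<open>sqrt 2\<close>.\<close>

definition yvec :: "nat \<Rightarrow> nat \<Rightarrow> real" where
  "yvec j i = z j i + (\<Sum>l=1..j - 1. (ninner N (z l) (\<Phi> j) - ninner N (\<Phi> l) (z j)) * \<Phi> l i)
     + (sqrt 2 - 1) * ninner N (\<Phi> j) (z j) * \<Phi> j i"

lemma Tmat_factor: "j \<le> k \<Longrightarrow> \<exists>G'. T k G = T j G'"
proof (induction k arbitrary: G)
  case (Suc k)
  show ?case
  proof (cases "j = Suc k")
    case False
    then show ?thesis using Suc.IH Suc.prems unfolding Tmat_Suc by auto
  qed auto
qed auto

text \<open>Replacements after the \<open>j\<close>-th act inside and are absorbed into the argument
  \<open>G'\<close>; the \<open>j\<close>-th one maps \<open>\<Phi> j\<close> to its fresh vector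
  whatever \<open>G'\<close> is, and \<open>Tmat_perp\<close> accounts for the earlier ones. So the
  result involves neither \<open>G\<close> nor \<open>k\<close>.\<close>

lemma Tmat_phi:
  assumes orth: "\<And>i l. i \<in> {1..j} \<Longrightarrow> l \<in> {1..j} \<Longrightarrow> i \<noteq> l \<Longrightarrow> ninner N (\<Phi> i) (\<Phi> l) = 0"
    and j: "1 \<le> j" "j \<le> k" and i: "i \<in> {1..N}"
  shows "mv N (T k G) (\<Phi> j) i = yvec j i"
proof -
  obtain G' where G': "T k G = T j G'" using Tmat_factor[OF j(2)] by blast
  let ?p = "\<Phi> j"
  define R where "R = refresh N ?p (z j) G'"
  have TR: "T k G = T (j - 1) R" unfolding G' R_def using j(1) Tmat_Suc[of \<beta> h q N z "j - 1" G'] by simp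
  have Rp: "mv N R ?p a = z j a + (sqrt 2 - 1) * ninner N ?p (z j) * ?p a" if "a \<in> {1..N}" for a
  proof -
    have p0: "pvec N ?p ?p = (\<lambda>_. 0)" by (simp add: pvec_def Phi_norm)
    have p1: "pvec N ?p (mv N G' (\<lambda>_. 0)) a = 0" by (simp add: pvec_def mv_def[abs_def])
    have p2: "ninner N (pvec N ?p (z j)) ?p = 0"
      unfolding pvec_def ninner_linear Phi_norm by (simp add: ninner_commute[of N "z j"])
    show ?thesis unfolding R_def refresh_mv[OF N Phi_norm(1) that] p0 p1 p2
      by (simp add: Phi_norm pvec_def algebra_simps)
  qed
  have in1: "ninner N (\<Phi> l) (mv N R ?p) = ninner N (\<Phi> l) (z j)" if l: "l \<in> {1..j - 1}" for l
  proof -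
    have "ninner N (\<Phi> l) (mv N R ?p) = ninner N (\<Phi> l) (\<lambda>a. z j a + (sqrt 2 - 1) * ninner N ?p (z j) * ?p a)"
      by (rule ninner_cong) (auto simp: Rp)
    also have "\<dots> = ninner N (\<Phi> l) (z j) + (sqrt 2 - 1) * ninner N ?p (z j) * ninner N (\<Phi> l) ?p"
      by (simp only: ninner_linear)
    also have "ninner N (\<Phi> l) ?p = 0" using orth[of l j] l j by auto
    finally show ?thesis by simp
  qed
  have "mv N (T k G) ?p i = (\<Sum>l=1..j - 1. ninner N (z l) ?p * \<Phi> l i) + mv N R ?p i - (\<Sum>l=1..j - 1. ninner N (\<Phi> l) (mv N R ?p) * \<Phi> l i)"
    unfolding TR
  proof (rule Tmat_perp[OF _ _ i])
    fix a b assume ab: "a \<in> {1..j - 1}" "b \<in> {1..j - 1}" "a \<noteq> b"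
    show "ninner N (\<Phi> a) (\<Phi> b) = 0" by (rule orth) (use ab j in auto)
  next
    fix l assume "l \<in> {1..j - 1}"
    then show "ninner N (\<Phi> l) ?p = 0" using orth[of l j] j by auto
  qed
  also have "(\<Sum>l=1..j - 1. ninner N (\<Phi> l) (mv N R ?p) * \<Phi> l i) = (\<Sum>l=1..j - 1. ninner N (\<Phi> l) (z j) * \<Phi> l i)"
    by (intro sum.cong refl) (simp only: in1)
  finally show ?thesis unfolding Rp[OF i] yvec_def left_diff_distrib sum_subtractf by simp
qed

context
  fixes G :: "nat \<Rightarrow> nat \<Rightarrow> real" and K n :: nat
  assumes nK: "n \<le> Suc K"
    and good: "\<And>j. j \<in> {1..n} \<Longrightarrow> nnorm N (sk_M \<beta> h q N (T K G) j) \<noteq> 0"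
begin

abbreviation "mm \<equiv> sk_m \<beta> h q N (T K G)"

lemma good': "j \<in> {1..n} \<Longrightarrow> nnorm N (gs_M N mm j) \<noteq> 0"
  using good by (simp add: sk_M_gs)

lemma sk_phi_orth: "i \<in> {1..n} \<Longrightarrow> j \<in> {1..n} \<Longrightarrow>
    ninner N (sk_phi \<beta> h q N (T K G) i) (sk_phi \<beta> h q N (T K G) j) = (if i = j then 1 else 0)"
  unfolding sk_phi_gs by (rule gs_phi_orth[OF N supp_sk_m good'])

text \<open>The iterates up to \<open>j\<close> use the matrix only through its action on the first
  \<open>j - 1\<close> directions. By \<open>Tmat_phi\<close> this action does not depend on
  \<open>G\<close>, so the full matrix and the one built from the zero matrix have the same
  \<open>j\<close>-th direction. Direction \<open>K + 1\<close> thus needs only \<open>K\<close>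
  replacements, whence the bound \<open>n \<le> Suc K\<close>.\<close>

lemma sk_phi_eq_Phi: "j \<in> {1..n} \<Longrightarrow> sk_phi \<beta> h q N (T K G) j = \<Phi> j"
proof (induction j rule: less_induct)
  case (less j)
  note jn = less.prems
  have eqP: "sk_phi \<beta> h q N (T K G) l = \<Phi> l" if "l \<in> {1..j - 1}" for l
    using less.IH[of l] less.prems that by auto
  have orth: "ninner N (\<Phi> a) (\<Phi> b) = 0" if "a \<in> {1..j - 1}" "b \<in> {1..j - 1}" "a \<noteq> b" for a b
    using sk_phi_orth[of a b] that less.prems unfolding eqP[OF that(1)] eqP[OF that(2)] by auto
  define G2 where "G2 = T (j - 1) (\<lambda>_ _. 0)"
  have y: "mv N (T K G) (\<Phi> l) a = mv N G2 (\<Phi> l) a" if l: "l \<in> {1..j - 1}" and a: "a \<in> {1..N}" for l a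
  proof -
    have o: "ninner N (\<Phi> x) (\<Phi> y) = 0" if "x \<in> {1..l}" "y \<in> {1..l}" "x \<noteq> y" for x y
      by (rule orth) (use that l in auto)
    have "mv N (T K G) (\<Phi> l) a = yvec l a" by (rule Tmat_phi[OF o]) (use l jn nK a in auto)
    moreover have "mv N G2 (\<Phi> l) a = yvec l a" unfolding G2_def by (rule Tmat_phi[OF o]) (use l a in auto)
    ultimately show ?thesis by simp
  qed
  \<comment> \<open>A second induction, over the iterates: expanding the preceding iterate in the
    common directions shows that both matrices map it alike.\<close>
  have m: "i \<le> j \<Longrightarrow> mm i = sk_m \<beta> h q N G2 i" for i
  proof (induction i rule: less_induct)
    case (less i)
    consider "i = 0" | "i = 1" | i' where "i = Suc (Suc i')" by (metis One_nat_def not0_implies_Suc)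
    then show ?case
    proof cases
      case 3
      have e1: "mm (Suc i') = sk_m \<beta> h q N G2 (Suc i')" "mm i' = sk_m \<beta> h q N G2 i'"
        using less 3 by auto
      have S: "Suc i' \<in> {1..n}" "Suc i' \<le> j - 1" using less.prems 3 jn by auto
      have ex: "mm (Suc i') = (\<lambda>a. \<Sum>l=1..Suc i'. ninner N (sk_phi \<beta> h q N (T K G) l) (mm (Suc i')) * \<Phi> l a)"
      proof -
        have "mm (Suc i') = (\<lambda>a. \<Sum>l=1..Suc i'. ninner N (gs_phi N mm l) (mm (Suc i')) * gs_phi N mm l a)"
          by (rule gs_expand[OF N supp_sk_m good' S(1)])
        also have "\<dots> = (\<lambda>a. \<Sum>l=1..Suc i'. ninner N (sk_phi \<beta> h q N (T K G) l) (mm (Suc i')) * \<Phi> l a)"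
          unfolding sk_phi_gs[symmetric] using S(2) eqP by (intro ext sum.cong refl) auto
        finally show ?thesis .
      qed
      have "mv N (T K G) (mm (Suc i')) a = mv N G2 (mm (Suc i')) a" if "a \<in> {1..N}" for a
      proof -
        have "mv N (T K G) (mm (Suc i')) a = (\<Sum>l=1..Suc i'. ninner N (sk_phi \<beta> h q N (T K G) l) (mm (Suc i')) * mv N (T K G) (\<Phi> l) a)"
          by (subst ex) (rule mv_lincomb)
        also have "\<dots> = (\<Sum>l=1..Suc i'. ninner N (sk_phi \<beta> h q N (T K G) l) (mm (Suc i')) * mv N G2 (\<Phi> l) a)"
          using S(2) y that by (intro sum.cong refl) auto
        also have "\<dots> = mv N G2 (\<lambda>a. \<Sum>l=1..Suc i'. ninner N (sk_phi \<beta> h q N (T K G) l) (mm (Suc i')) * \<Phi> l a) a"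
          by (rule mv_lincomb[symmetric])
        finally show ?thesis unfolding ex[symmetric] .
      qed
      then show ?thesis unfolding 3 sk_m_Suc e1[symmetric] by (auto simp: vec_of_def)
    qed simp_all
  qed
  have "sk_phi \<beta> h q N (T K G) j = sk_phi \<beta> h q N G2 j"
    unfolding sk_phi_gs by (rule gs_phi_cong) (use m jn in auto)
  then show ?case by (simp add: zphi_def G2_def)
qed

lemma Phi_orth: "i \<in> {1..n} \<Longrightarrow> j \<in> {1..n} \<Longrightarrow> ninner N (\<Phi> i) (\<Phi> j) = (if i = j then 1 else 0)"
  using sk_phi_orth[of i j] by (simp only: sk_phi_eq_Phi)

lemma mm_expand:
  assumes j: "j \<in> {1..n}" shows "mm j = (\<lambda>a. \<Sum>l=1..j. ninner N (\<Phi> l) (mm j) * \<Phi> l a)"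
proof -
  have "mm j = (\<lambda>a. \<Sum>l=1..j. ninner N (gs_phi N mm l) (mm j) * gs_phi N mm l a)"
    by (rule gs_expand[OF N supp_sk_m good' j])
  also have "\<dots> = (\<lambda>a. \<Sum>l=1..j. ninner N (\<Phi> l) (mm j) * \<Phi> l a)"
    using j unfolding sk_phi_gs[symmetric] by (intro ext sum.cong refl) (auto simp: sk_phi_eq_Phi)
  finally show ?thesis .
qed

text \<open>
  The middle sum is the mismatch between the Onsager term and the components of \<open>G m\<^sup>k\<close> along the earlier
  directions.
\<close>

lemma amp_error_bound:
  fixes c :: "nat \<Rightarrow> real"
  assumes k: "k \<in> {1..n}" "k \<le> K"
  defines "a \<equiv> \<lambda>j. ninner N (\<Phi> j) (mm k)"
  shows "nnorm N (\<lambda>i. mv N (T K G) (mm k) i - \<beta> * (1 - q) * mm (k - 1) i - (\<Sum>j=1..k. c j * z j i))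
    \<le> (\<Sum>j=1..k. \<bar>a j - c j\<bar> * nnorm N (z j))
      + (\<Sum>l=1..k - 1. \<bar>ninner N (z l) (mm k) - (\<Sum>j=1..l. a j * ninner N (z l) (\<Phi> j)) - \<beta> * (1 - q) * ninner N (\<Phi> l) (mm (k - 1))\<bar>)
      + (\<Sum>j=1..k. \<bar>a j\<bar> * (\<Sum>l=1..j. \<bar>ninner N (\<Phi> l) (z j)\<bar>))"
proof -
  define e where "e l = ninner N (z l) (mm k) - (\<Sum>j=1..l. a j * ninner N (z l) (\<Phi> j)) - \<beta> * (1 - q) * ninner N (\<Phi> l) (mm (k - 1))" for l
  define s where "s j i = (sqrt 2 - 1) * ninner N (\<Phi> j) (z j) * \<Phi> j i - (\<Sum>l=1..j - 1. ninner N (\<Phi> l) (z j) * \<Phi> l i)" for j i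
  have mk: "mm k = (\<lambda>i. \<Sum>l=1..k. a l * \<Phi> l i)" unfolding a_def by (rule mm_expand[OF k(1)])
  have Gm: "mv N (T K G) (mm k) i = (\<Sum>j=1..k. a j * yvec j i)" if i: "i \<in> {1..N}" for i
  proof -
    have "mv N (T K G) (mm k) i = (\<Sum>j=1..k. a j * mv N (T K G) (\<Phi> j) i)"
      by (subst mk) (rule mv_lincomb)
    also have "\<dots> = (\<Sum>j=1..k. a j * yvec j i)"
    proof (intro sum.cong refl arg_cong2[of _ _ _ _ "(*)"] Tmat_phi)
      fix j x y assume "j \<in> {1..k}" "x \<in> {1..j}" "y \<in> {1..j}" "x \<noteq> y"
      then show "ninner N (\<Phi> x) (\<Phi> y) = 0" using Phi_orth[of x y] k by auto
    qed (use k i in auto)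
    finally show ?thesis .
  qed
  have yv: "yvec j i = z j i + (\<Sum>l=1..j - 1. ninner N (z l) (\<Phi> j) * \<Phi> l i) + s j i" for j i
    by (simp add: yvec_def s_def left_diff_distrib sum_subtractf)
  have mk1: "mm (k - 1) i = (\<Sum>l=1..k - 1. ninner N (\<Phi> l) (mm (k - 1)) * \<Phi> l i)" for i
  proof (cases "k = 1")
    case False
    then have "k - 1 \<in> {1..n}" using k by auto
    from fun_cong[OF mm_expand[OF this]] show ?thesis .
  qed simp
  \<comment> \<open>Removing from \<open>ninner N (z l) (mm k)\<close> the terms with
    \<open>j \<le> l\<close> leaves the coefficient of \<open>\<Phi> l\<close> that the symmetry
    part of \<open>yvec\<close> produces; \<open>e l\<close> is its excess over the Onsager
    term.\<close>
  have e': "(\<Sum>j=Suc l..k. a j * ninner N (z l) (\<Phi> j)) = e l + \<beta> * (1 - q) * ninner N (\<Phi> l) (mm (k - 1))" if l: "l \<in> {1..k - 1}" for l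
  proof -
    have "ninner N (z l) (mm k) = (\<Sum>j=1..k. a j * ninner N (z l) (\<Phi> j))"
      by (subst mk) (simp only: ninner_linear)
    also have "\<dots> = (\<Sum>j=1..l. a j * ninner N (z l) (\<Phi> j)) + (\<Sum>j=Suc l..k. a j * ninner N (z l) (\<Phi> j))"
    proof -
      have "{1..k} = {1..l} \<union> {Suc l..k}" using l by auto
      then show ?thesis by (simp only:) (rule sum.union_disjoint, auto)
    qed
    finally show ?thesis by (simp add: e_def)
  qed
  have main: "mv N (T K G) (mm k) i - \<beta> * (1 - q) * mm (k - 1) i - (\<Sum>j=1..k. c j * z j i)
    = (\<Sum>j=1..k. (a j - c j) * z j i) + (\<Sum>l=1..k - 1. e l * \<Phi> l i) + (\<Sum>j=1..k. a j * s j i)" if i: "i \<in> {1..N}" for i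
  proof -
    have "(\<Sum>j=1..k. a j * yvec j i) = (\<Sum>j=1..k. a j * z j i) + (\<Sum>j=1..k. \<Sum>l=1..j - 1. a j * ninner N (z l) (\<Phi> j) * \<Phi> l i) + (\<Sum>j=1..k. a j * s j i)"
      unfolding yv by (simp add: distrib_left sum.distrib sum_distrib_left mult.assoc)
    also have "(\<Sum>j=1..k. \<Sum>l=1..j - 1. a j * ninner N (z l) (\<Phi> j) * \<Phi> l i) = (\<Sum>l=1..k - 1. (\<Sum>j=Suc l..k. a j * ninner N (z l) (\<Phi> j)) * \<Phi> l i)"
      unfolding sum_triangle_swap sum_distrib_right ..
    also have "\<dots> = (\<Sum>l=1..k - 1. (e l + \<beta> * (1 - q) * ninner N (\<Phi> l) (mm (k - 1))) * \<Phi> l i)"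
      by (intro sum.cong refl) (simp only: e')
    also have "\<dots> = (\<Sum>l=1..k - 1. e l * \<Phi> l i) + \<beta> * (1 - q) * mm (k - 1) i"
      by (simp only: distrib_right sum.distrib mult.assoc sum_distrib_left[symmetric] mk1[symmetric])
    finally show ?thesis unfolding Gm[OF i] left_diff_distrib sum_subtractf by simp
  qed
  \<comment> \<open>\<open>sqrt 2 - 1\<close> has modulus at most 1, so the diagonal correction is
    bounded like the other components.\<close>
  have sn: "nnorm N (s j) \<le> (\<Sum>l=1..j. \<bar>ninner N (\<Phi> l) (z j)\<bar>)" if j: "j \<in> {1..k}" for j
  proof -
    have 1: "nnorm N (s j) \<le> nnorm N (\<lambda>i. ((sqrt 2 - 1) * ninner N (\<Phi> j) (z j)) * \<Phi> j i) + nnorm N (\<lambda>i. \<Sum>l=1..j - 1. ninner N (\<Phi> l) (z j) * \<Phi> l i)"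
      unfolding s_def by (rule nnorm_diff)
    have 2: "nnorm N (\<lambda>i. \<Sum>l=1..j - 1. ninner N (\<Phi> l) (z j) * \<Phi> l i) \<le> (\<Sum>l=1..j - 1. nnorm N (\<lambda>i. ninner N (\<Phi> l) (z j) * \<Phi> l i))"
      by (rule nnorm_sum) simp
    have 3: "(\<Sum>l=1..j - 1. nnorm N (\<lambda>i. ninner N (\<Phi> l) (z j) * \<Phi> l i)) = (\<Sum>l=1..j - 1. \<bar>ninner N (\<Phi> l) (z j)\<bar>)"
      by (simp only: nnorm_cmult Phi_norm mult_1_right)
    have 4: "nnorm N (\<lambda>i. ((sqrt 2 - 1) * ninner N (\<Phi> j) (z j)) * \<Phi> j i) \<le> \<bar>ninner N (\<Phi> j) (z j)\<bar>"
    proof -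
      have "sqrt 2 \<le> sqrt 4" by (rule real_sqrt_le_mono) simp
      then have "\<bar>sqrt 2 - 1\<bar> \<le> 1" by simp
      then show ?thesis unfolding nnorm_cmult Phi_norm abs_mult by (simp add: mult_left_le_one_le)
    qed
    have 5: "\<bar>ninner N (\<Phi> j) (z j)\<bar> + (\<Sum>l=1..j - 1. \<bar>ninner N (\<Phi> l) (z j)\<bar>) = (\<Sum>l=1..j. \<bar>ninner N (\<Phi> l) (z j)\<bar>)"
    proof -
      have i: "{1..j} = insert j {1..j - 1}" "j \<notin> {1..j - 1}" using j by auto
      show ?thesis unfolding i(1) by (rule sum.insert[symmetric]) (use i(2) in auto)
    qed
    show ?thesis using 1 2 3 4 5 by linarith
  qed
  have "nnorm N (\<lambda>i. mv N (T K G) (mm k) i - \<beta> * (1 - q) * mm (k - 1) i - (\<Sum>j=1..k. c j * z j i))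
     = nnorm N (\<lambda>i. ((\<Sum>j=1..k. (a j - c j) * z j i) + (\<Sum>l=1..k - 1. e l * \<Phi> l i)) + (\<Sum>j=1..k. a j * s j i))"
    by (rule nnorm_cong) (rule main)
  also have "\<dots> \<le> (nnorm N (\<lambda>i. \<Sum>j=1..k. (a j - c j) * z j i) + nnorm N (\<lambda>i. \<Sum>l=1..k - 1. e l * \<Phi> l i)) + nnorm N (\<lambda>i. \<Sum>j=1..k. a j * s j i)"
    by (rule order_trans[OF nnorm_triangle]) (intro add_right_mono nnorm_triangle)
  also have "\<dots> \<le> ((\<Sum>j=1..k. nnorm N (\<lambda>i. (a j - c j) * z j i)) + (\<Sum>l=1..k - 1. nnorm N (\<lambda>i. e l * \<Phi> l i))) + (\<Sum>j=1..k. nnorm N (\<lambda>i. a j * s j i))"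
    by (intro add_mono nnorm_sum) simp_all
  also have "\<dots> = ((\<Sum>j=1..k. \<bar>a j - c j\<bar> * nnorm N (z j)) + (\<Sum>l=1..k - 1. \<bar>e l\<bar>)) + (\<Sum>j=1..k. \<bar>a j\<bar> * nnorm N (s j))"
    by (simp only: nnorm_cmult Phi_norm mult_1_right)
  also have "\<dots> \<le> ((\<Sum>j=1..k. \<bar>a j - c j\<bar> * nnorm N (z j)) + (\<Sum>l=1..k - 1. \<bar>e l\<bar>)) + (\<Sum>j=1..k. \<bar>a j\<bar> * (\<Sum>l=1..j. \<bar>ninner N (\<Phi> l) (z j)\<bar>))"
    by (intro add_left_mono sum_mono mult_left_mono sn) auto
  finally show ?thesis unfolding e_def .
qed

end

end

section \<open>Gaussian integrals\<close>

lemma measurable_id_borel: "(\<lambda>x. x) \<in> borel_measurable (borel :: real measure)"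
  by (rule measurable_ident_sets[OF refl])

lemma measurable_iexp: "iexp \<in> borel_measurable borel"
  by (intro borel_measurable_continuous_onI continuous_intros)

lemma Th_bound: "\<bar>Th \<beta> h x\<bar> \<le> 1"
  using tanh_real_bounds[of "h + \<beta> * x"] by (simp add: Th_def abs_le_iff)

lemma tanh_lipschitz: "\<bar>tanh x - tanh y\<bar> \<le> \<bar>x - y\<bar>" for x y :: real
proof -
  have "norm (tanh x - tanh y) \<le> 1 * norm (x - y)"
  proof (rule field_differentiable_bound[of UNIV])
    fix z :: real
    show "(tanh has_field_derivative 1 - tanh z ^ 2) (at z within UNIV)"
      by (auto intro!: derivative_eq_intros)
    have "tanh z ^ 2 \<le> 1" using tanh_real_bounds[of z] unfolding abs_square_le_1 by (simp add: abs_le_iff)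
    then show "norm (1 - tanh z ^ 2) \<le> 1" by simp
  qed auto
  then show ?thesis by simp
qed

lemma Th_lipschitz: "\<beta> > 0 \<Longrightarrow> \<bar>Th \<beta> h x - Th \<beta> h y\<bar> \<le> \<beta> * \<bar>x - y\<bar>"
  using tanh_lipschitz[of "h + \<beta> * x" "h + \<beta> * y"] by (simp add: Th_def abs_mult flip: right_diff_distrib)

lemma Th_inject: "\<beta> > 0 \<Longrightarrow> Th \<beta> h x = Th \<beta> h y \<Longrightarrow> x = y"
proof -
  assume b: "\<beta> > 0" and e: "Th \<beta> h x = Th \<beta> h y"
  have "h + \<beta> * x = h + \<beta> * y"
    using e strict_mono_eq[OF tanh_real_strict_mono, of "h + \<beta> * x" "h + \<beta> * y"] by (simp add: Th_def)
  then show "x = y" using b by simp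
qed

lemma integrable_gauss_bounded:
  fixes f :: "('i \<Rightarrow> real) \<Rightarrow> real"
  assumes "f \<in> borel_measurable (gauss I)" "\<And>x. \<bar>f x\<bar> \<le> B" shows "integrable (gauss I) f"
proof -
  interpret prob_space "gauss I" by (rule prob_space_gauss)
  show ?thesis by (rule integrable_const_bound[OF _ assms(1), where B=B]) (use assms(2) in simp)
qed

lemma borel_measurable_lin [intro]:
  assumes "J \<subseteq> I" shows "(\<lambda>x. \<Sum>i\<in>J. c i * x i) \<in> borel_measurable (gauss I)"
  using assms by (intro borel_measurable_sum borel_measurable_times borel_measurable_const measurable_gauss_component) auto

lemma borel_measurable_Th_lin: "(\<lambda>x. Th \<beta> h (\<Sum>i\<in>I. c i * x i)) \<in> borel_measurable (gauss I)"
  by (intro borel_measurable_Th borel_measurable_lin order_refl)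

text \<open>A centred Gaussian pair is determined by its three second moments. The pair is encoded
  as a family over \<open>bool\<close> so that \<open>distr_linear_gauss_eq\<close> applies.\<close>

lemma integral_pair_law:
  fixes F :: "real \<Rightarrow> real \<Rightarrow> real"
  assumes "finite I" "finite J" and F: "(\<lambda>p. F (fst p) (snd p)) \<in> borel_measurable (borel \<Otimes>\<^sub>M borel)"
    and "(\<Sum>i\<in>I. c i * c i) = (\<Sum>j\<in>J. c' j * c' j)" "(\<Sum>i\<in>I. c i * d i) = (\<Sum>j\<in>J. c' j * d' j)" "(\<Sum>i\<in>I. d i * d i) = (\<Sum>j\<in>J. d' j * d' j)"
  shows "(\<integral>x. F (\<Sum>i\<in>I. c i * x i) (\<Sum>i\<in>I. d i * x i) \<partial>gauss I) = (\<integral>x. F (\<Sum>j\<in>J. c' j * x j) (\<Sum>j\<in>J. d' j * x j) \<partial>gauss J)"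
proof -
  define L where "L b = (if b then c else d)" for b
  define L' where "L' b = (if b then c' else d')" for b
  have comm: "(\<Sum>i\<in>I. d i * c i) = (\<Sum>j\<in>J. d' j * c' j)" using assms(5) by (simp add: mult.commute)
  have eq: "distr (gauss I) (PiM UNIV (\<lambda>_. borel)) (\<lambda>x. \<lambda>b\<in>UNIV. \<Sum>i\<in>I. L b i * x i)
      = distr (gauss J) (PiM UNIV (\<lambda>_. borel)) (\<lambda>x. \<lambda>b\<in>UNIV. \<Sum>j\<in>J. L' b j * x j)"
  proof (rule distr_linear_gauss_eq[OF _ assms(1,2)])
    fix a b :: bool show "(\<Sum>i\<in>I. L a i * L b i) = (\<Sum>j\<in>J. L' a j * L' b j)"
      using assms(4-6) comm by (cases a; cases b) (simp_all add: L_def L'_def)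
  qed simp
  have m: "(\<lambda>y. (y True, y False)) \<in> measurable (PiM (UNIV :: bool set) (\<lambda>_. borel :: real measure)) (borel \<Otimes>\<^sub>M borel)"
    by (intro measurable_Pair measurable_component_singleton UNIV_I)
  have F': "(\<lambda>y. F (y True) (y False)) \<in> borel_measurable (PiM (UNIV :: bool set) (\<lambda>_. borel))"
    using measurable_compose[OF m F] by (simp only: fst_conv snd_conv)
  have "(\<integral>y. F (y True) (y False) \<partial>distr (gauss I) (PiM UNIV (\<lambda>_. borel)) (\<lambda>x. \<lambda>b\<in>UNIV. \<Sum>i\<in>I. L b i * x i))
     = (\<integral>y. F (y True) (y False) \<partial>distr (gauss J) (PiM UNIV (\<lambda>_. borel)) (\<lambda>x. \<lambda>b\<in>UNIV. \<Sum>j\<in>J. L' b j * x j))"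
    by (simp only: eq)
  then show ?thesis
    unfolding integral_distr[OF measurable_linear_gauss[OF assms(1)] F'] integral_distr[OF measurable_linear_gauss[OF assms(2)] F']
    by (simp add: L_def L'_def)
qed

lemma integral_single_law:
  fixes F :: "real \<Rightarrow> real"
  assumes "finite I" and F: "F \<in> borel_measurable borel" and "(\<Sum>i\<in>I. c i * c i) = v"
  shows "(\<integral>x. F (\<Sum>i\<in>I. c i * x i) \<partial>gauss I) = (\<integral>z. F (sqrt v * z) \<partial>std_normal_distribution)"
proof -
  have v: "v \<ge> 0" using assms(3) by (auto intro!: sum_nonneg)
  have "(\<integral>x. F (\<Sum>i\<in>I. c i * x i) \<partial>gauss I) = (\<integral>x. F (\<Sum>j\<in>{()}. sqrt v * x j) \<partial>gauss {()})"
  proof (rule integral_pair_law[of I "{()}" "\<lambda>a b. F a" c "\<lambda>_. sqrt v" "\<lambda>_. 0" "\<lambda>_. 0"])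
    show "(\<lambda>p. F (fst p)) \<in> borel_measurable (borel \<Otimes>\<^sub>M borel)"
      by (rule measurable_compose[OF measurable_fst F])
    show "(\<Sum>i\<in>I. c i * c i) = (\<Sum>j\<in>{()}. sqrt v * sqrt v)" using assms(3) v by simp
  qed (use assms(1) in simp_all)
  also have "\<dots> = (\<integral>z. F (sqrt v * z) \<partial>distr (gauss {()}) borel (\<lambda>x. x ()))"
  proof -
    have "(\<lambda>z. F (sqrt v * z)) \<in> borel_measurable borel"
      by (rule measurable_compose[OF _ F]) (intro borel_measurable_times borel_measurable_const measurable_id_borel)
    from integral_distr[OF measurable_gauss_component[of "()" "{()}"] this] show ?thesis by simp
  qed
  finally show ?thesis by (simp add: distr_gauss_component)
qed

section \<open>Properties of \<open>sk_psi\<close> and \<open>sk_alpha\<close>\<close>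

abbreviation "normal3 \<equiv> std_normal_distribution \<Otimes>\<^sub>M (std_normal_distribution \<Otimes>\<^sub>M std_normal_distribution)"

lemma prob_space_normal3: "prob_space normal3"
  by (intro prob_space_pair prob_space_std_normal)

lemma integral_normal3:
  fixes f :: "real \<times> real \<times> real \<Rightarrow> 'b :: {banach, second_countable_topology}"
  assumes f: "f \<in> borel_measurable (borel \<Otimes>\<^sub>M (borel \<Otimes>\<^sub>M borel))" and bd: "\<And>x. norm (f x) \<le> B"
  shows "(\<integral>p. f p \<partial>normal3) = (\<integral>z. \<integral>z'. \<integral>z''. f (z, z', z'') \<partial>std_normal_distribution \<partial>std_normal_distribution \<partial>std_normal_distribution)"
proof -
  interpret n: prob_space std_normal_distribution by (rule prob_space_std_normal)
  interpret n2: pair_prob_space std_normal_distribution std_normal_distribution ..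
  interpret n3: pair_prob_space std_normal_distribution "std_normal_distribution \<Otimes>\<^sub>M std_normal_distribution" ..
  have s2: "sets (std_normal_distribution \<Otimes>\<^sub>M std_normal_distribution) = sets (borel \<Otimes>\<^sub>M borel)"
    by (rule sets_pair_measure_cong) auto
  have s3: "sets normal3 = sets (borel \<Otimes>\<^sub>M (borel \<Otimes>\<^sub>M borel))"
    by (rule sets_pair_measure_cong[OF _ s2]) auto
  have f3: "f \<in> borel_measurable normal3" using f by (simp only: measurable_cong_sets[OF s3 refl])
  have f2: "(\<lambda>y. f (z, y)) \<in> borel_measurable (std_normal_distribution \<Otimes>\<^sub>M std_normal_distribution)" for z
    using measurable_compose[OF measurable_Pair1'[of z] f3] by simp
  have i3: "integrable normal3 f" by (rule n3.P.integrable_const_bound[OF AE_I2[OF bd] f3])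
  have i2: "integrable (std_normal_distribution \<Otimes>\<^sub>M std_normal_distribution) (\<lambda>y. f (z, y))" for z
    by (rule n2.P.integrable_const_bound[OF AE_I2[OF bd] f2])
  have "(\<integral>p. f p \<partial>normal3) = (\<integral>z. \<integral>y. f (z, y) \<partial>(std_normal_distribution \<Otimes>\<^sub>M std_normal_distribution) \<partial>std_normal_distribution)"
    by (rule n3.integral_fst'[OF i3, symmetric])
  also have "(\<lambda>z. \<integral>y. f (z, y) \<partial>(std_normal_distribution \<Otimes>\<^sub>M std_normal_distribution)) = (\<lambda>z. \<integral>z'. \<integral>z''. f (z, z', z'') \<partial>std_normal_distribution \<partial>std_normal_distribution)"
    by (intro ext n2.integral_fst'[OF i2, symmetric])
  finally show ?thesis .
qed

text \<open>The triple defining \<open>sk_psi\<close> yields a Gaussian pair with variances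
  \<open>q\<close> and covariance \<open>t\<close>, and any other pair with these moments has the
  same characteristic function.\<close>

lemma psi_eq:
  assumes t: "0 \<le> t" and I: "finite I" and c: "(\<Sum>i\<in>I. c i * c i) = q" "(\<Sum>i\<in>I. d i * d i) = q" "(\<Sum>i\<in>I. c i * d i) = t"
  shows "(\<integral>x. Th \<beta> h (\<Sum>i\<in>I. c i * x i) * Th \<beta> h (\<Sum>i\<in>I. d i * x i) \<partial>gauss I) = sk_psi \<beta> h q t"
proof -
  \<comment> \<open>Cauchy-Schwarz in the form of a nonnegative sum of squares; it is needed for
    \<open>sqrt (q - t)\<close> to square to \<open>q - t\<close>.\<close>
  have tq: "t \<le> q"
  proof -
    have "0 \<le> (\<Sum>i\<in>I. (c i - d i)\<^sup>2)" by (intro sum_nonneg) simp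
    also have "\<dots> = (\<Sum>i\<in>I. c i * c i) + (\<Sum>i\<in>I. d i * d i) - 2 * (\<Sum>i\<in>I. c i * d i)"
      by (simp add: power2_eq_square algebra_simps sum.distrib sum_subtractf sum_distrib_left)
    finally show ?thesis using c by simp
  qed
  define L where "L b i = (if b then c i else d i)" for b i
  define u where "u b p = (case p of (z, z', z'') \<Rightarrow> sqrt t * z + sqrt (q - t) * (if b then z' else z''))" for b and p :: "real \<times> real \<times> real"
  have s3: "sets normal3 = sets (borel \<Otimes>\<^sub>M (borel \<Otimes>\<^sub>M borel))"
    by (intro sets_pair_measure_cong) auto
  have pm: "fst \<in> measurable normal3 borel" "(\<lambda>p. fst (snd p)) \<in> measurable normal3 borel" "(\<lambda>p. snd (snd p)) \<in> measurable normal3 borel"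
    unfolding measurable_cong_sets[OF s3 refl]
    by (intro measurable_fst measurable_compose[OF measurable_snd measurable_fst] measurable_compose[OF measurable_snd measurable_snd])+
  have ub: "u b = (\<lambda>p. sqrt t * fst p + sqrt (q - t) * (if b then fst (snd p) else snd (snd p)))" for b
    by (auto simp: u_def fun_eq_iff)
  have mu: "u b \<in> borel_measurable normal3" for b
    unfolding ub by (cases b; simp only: if_True if_False; intro borel_measurable_add borel_measurable_times borel_measurable_const pm)
  have mU: "(\<lambda>p. \<lambda>b\<in>UNIV. u b p) \<in> measurable normal3 (PiM (UNIV :: bool set) (\<lambda>_. borel))"
    by (intro measurable_restrict mu)
  have eq: "distr (gauss I) (PiM UNIV (\<lambda>_. borel)) (\<lambda>x. \<lambda>b\<in>UNIV. \<Sum>i\<in>I. L b i * x i) = distr normal3 (PiM (UNIV :: bool set) (\<lambda>_. borel)) (\<lambda>p. \<lambda>b\<in>UNIV. u b p)"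
  proof (rule char_PiM_unique)
    show "prob_space (distr (gauss I) (PiM UNIV (\<lambda>_. borel)) (\<lambda>x. \<lambda>b\<in>UNIV. \<Sum>i\<in>I. L b i * x i))"
      by (rule prob_space.prob_space_distr[OF prob_space_gauss measurable_linear_gauss[OF I]])
    show "prob_space (distr normal3 (PiM (UNIV :: bool set) (\<lambda>_. borel)) (\<lambda>p. \<lambda>b\<in>UNIV. u b p))"
      by (rule prob_space.prob_space_distr[OF prob_space_normal3 mU])
    fix s :: "bool \<Rightarrow> real"
    let ?a = "sqrt t * (s True + s False)" and ?b = "sqrt (q - t) * s True" and ?c = "sqrt (q - t) * s False"
    have sb: "(\<Sum>b\<in>UNIV. f b) = f True + f False" for f :: "bool \<Rightarrow> real" by (simp add: UNIV_bool)
    have mi: "(\<lambda>y. iexp (\<Sum>b\<in>UNIV. s b * y b)) \<in> borel_measurable (PiM (UNIV :: bool set) (\<lambda>_. borel))"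
      by (rule measurable_compose[OF _ measurable_iexp])
         (intro borel_measurable_sum borel_measurable_times borel_measurable_const measurable_component_singleton UNIV_I)
    have chn: "(CLINT z|std_normal_distribution. iexp (r * z)) = exp (- r\<^sup>2 / 2)" for r
      using fun_cong[OF char_std_normal_distribution, of r] by (simp add: char_def)
    have "(CLINT y|distr normal3 (PiM (UNIV :: bool set) (\<lambda>_. borel)) (\<lambda>p. \<lambda>b\<in>UNIV. u b p). iexp (\<Sum>b\<in>UNIV. s b * y b))
       = (CLINT p|normal3. iexp (\<Sum>b\<in>UNIV. s b * u b p))"
      by (subst integral_distr[OF mU mi]) simp
    also have "\<dots> = (CLINT p|normal3. iexp (?a * fst p + (?b * fst (snd p) + ?c * snd (snd p))))"
      by (intro Bochner_Integration.integral_cong refl arg_cong[of _ _ iexp]) (simp add: ub sb algebra_simps)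
    also have "\<dots> = (CLINT z|std_normal_distribution. CLINT z'|std_normal_distribution. CLINT z''|std_normal_distribution. iexp (?a * z + (?b * z' + ?c * z'')))"
    proof (subst integral_normal3[where B=1])
      have "(\<lambda>p. ?a * fst p + (?b * fst (snd p) + ?c * snd (snd p))) \<in> borel_measurable normal3"
        by (intro borel_measurable_add borel_measurable_times borel_measurable_const pm)
      then have "(\<lambda>p. ?a * fst p + (?b * fst (snd p) + ?c * snd (snd p))) \<in> borel_measurable (borel \<Otimes>\<^sub>M (borel \<Otimes>\<^sub>M borel))"
        by (simp only: measurable_cong_sets[OF s3 refl])
      then show "(\<lambda>p. iexp (?a * fst p + (?b * fst (snd p) + ?c * snd (snd p)))) \<in> borel_measurable (borel \<Otimes>\<^sub>M (borel \<Otimes>\<^sub>M borel))"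
        by (rule measurable_compose[OF _ measurable_iexp])
    qed (simp_all only: fst_conv snd_conv norm_exp_i_times order_refl)
    also have "\<dots> = (CLINT z|std_normal_distribution. iexp (?a * z)) * ((CLINT z|std_normal_distribution. iexp (?b * z)) * (CLINT z|std_normal_distribution. iexp (?c * z)))"
    proof -
      have "iexp (?a * z + (?b * z' + ?c * z'')) = iexp (?a * z) * (iexp (?b * z') * iexp (?c * z''))" for z z' z''
        by (simp add: exp_add[symmetric] algebra_simps)
      then show ?thesis by (simp only: integral_mult_right_zero integral_mult_left_zero)
    qed
    also have "\<dots> = exp (- (?a\<^sup>2 + ?b\<^sup>2 + ?c\<^sup>2) / 2)"
      unfolding chn by (simp add: field_simps flip: of_real_mult exp_add)
    also have "?a\<^sup>2 + ?b\<^sup>2 + ?c\<^sup>2 = (\<Sum>a\<in>UNIV. \<Sum>b\<in>UNIV. s a * s b * (\<Sum>i\<in>I. L a i * L b i))"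
    proof -
      have dc: "(\<Sum>i\<in>I. d i * c i) = t" using c(3) by (simp add: mult.commute)
      have "?a\<^sup>2 = t * (s True + s False)\<^sup>2" "?b\<^sup>2 = (q - t) * (s True)\<^sup>2" "?c\<^sup>2 = (q - t) * (s False)\<^sup>2"
        using t tq by (simp_all add: power_mult_distrib)
      moreover have "(\<Sum>i\<in>I. L True i * L True i) = q" "(\<Sum>i\<in>I. L False i * L False i) = q" "(\<Sum>i\<in>I. L True i * L False i) = t" "(\<Sum>i\<in>I. L False i * L True i) = t"
        using c dc by (simp_all add: L_def)
      ultimately show ?thesis unfolding sb by (simp add: power2_eq_square algebra_simps)
    qed
    finally show "(CLINT y|distr (gauss I) (PiM UNIV (\<lambda>_. borel)) (\<lambda>x. \<lambda>b\<in>UNIV. \<Sum>i\<in>I. L b i * x i). iexp (\<Sum>b\<in>UNIV. s b * y b)) =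
      (CLINT y|distr normal3 (PiM (UNIV :: bool set) (\<lambda>_. borel)) (\<lambda>p. \<lambda>b\<in>UNIV. u b p). iexp (\<Sum>b\<in>UNIV. s b * y b))"
      by (simp only: char_linear_gauss[OF I finite])
  qed simp_all
  have F': "(\<lambda>y. Th \<beta> h (y True) * Th \<beta> h (y False)) \<in> borel_measurable (PiM (UNIV :: bool set) (\<lambda>_. borel))"
    by (intro borel_measurable_times borel_measurable_Th measurable_component_singleton UNIV_I)
  have "(\<integral>y. Th \<beta> h (y True) * Th \<beta> h (y False) \<partial>distr (gauss I) (PiM UNIV (\<lambda>_. borel)) (\<lambda>x. \<lambda>b\<in>UNIV. \<Sum>i\<in>I. L b i * x i))
     = (\<integral>y. Th \<beta> h (y True) * Th \<beta> h (y False) \<partial>distr normal3 (PiM (UNIV :: bool set) (\<lambda>_. borel)) (\<lambda>p. \<lambda>b\<in>UNIV. u b p))"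
    by (simp only: eq)
  then have "(\<integral>x. Th \<beta> h (\<Sum>i\<in>I. c i * x i) * Th \<beta> h (\<Sum>i\<in>I. d i * x i) \<partial>gauss I) = (\<integral>p. Th \<beta> h (u True p) * Th \<beta> h (u False p) \<partial>normal3)"
    unfolding integral_distr[OF measurable_linear_gauss[OF I] F'] integral_distr[OF mU F'] by (simp add: L_def)
  also have "\<dots> = sk_psi \<beta> h q t" unfolding sk_psi_def
    by (intro Bochner_Integration.integral_cong refl) (auto simp: u_def)
  finally show ?thesis .
qed

text \<open>Given the common variable, the two factors are independent with equal conditional means,
  so the value is the mean of a square.\<close>

lemma psi_nonneg: "0 \<le> sk_psi \<beta> h q t"
proof -
  let ?n = std_normal_distribution
  let ?f = "\<lambda>p. Th \<beta> h (sqrt t * fst p + sqrt (q - t) * fst (snd p)) * Th \<beta> h (sqrt t * fst p + sqrt (q - t) * snd (snd p))"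
  let ?g = "\<lambda>z. \<integral>z'. Th \<beta> h (sqrt t * z + sqrt (q - t) * z') \<partial>?n"
  have "sk_psi \<beta> h q t = (\<integral>p. ?f p \<partial>normal3)"
    unfolding sk_psi_def by (intro Bochner_Integration.integral_cong refl) auto
  also have "\<dots> = (\<integral>z. \<integral>z'. \<integral>z''. ?f (z, z', z'') \<partial>?n \<partial>?n \<partial>?n)"
  proof (rule integral_normal3[where B=1])
    show "?f \<in> borel_measurable (borel \<Otimes>\<^sub>M (borel \<Otimes>\<^sub>M borel))"
      by (intro borel_measurable_times borel_measurable_Th borel_measurable_add borel_measurable_const
         measurable_fst measurable_compose[OF measurable_snd measurable_fst] measurable_compose[OF measurable_snd measurable_snd])
    show "norm (?f x) \<le> 1" for x
      using mult_mono[OF Th_bound Th_bound, of \<beta> h _ \<beta> h] by (simp add: abs_mult)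
  qed
  also have "\<dots> = (\<integral>z. ?g z * ?g z \<partial>?n)"
    by (simp only: fst_conv snd_conv integral_mult_right_zero integral_mult_left_zero)
  also have "\<dots> \<ge> 0" by (intro Bochner_Integration.integral_nonneg) simp
  finally show ?thesis .
qed

text \<open>
  Equality in the inequality between arithmetic and geometric means would force the two arguments of
  the injective function \<^const>\<open>Th\<close> to agree almost surely.
\<close>

lemma psi_less:
  assumes b: "\<beta> > 0" and q: "sk_fixed_point \<beta> h q" and t: "0 \<le> t" "t < q"
  shows "sk_psi \<beta> h q t < q"
proof -
  interpret prob_space "gauss {0, 1, 2 :: nat}" by (rule prob_space_gauss)
  let ?I = "{0, 1, 2 :: nat}" and ?G = "gauss {0, 1, 2 :: nat}"
  \<comment> \<open>Coordinate 0 is common to both linear forms; 1 and 2 are private to one form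
    each.\<close>
  define c where "c = (\<lambda>i :: nat. if i = 0 then sqrt t else if i = 1 then sqrt (q - t) else 0)"
  define d where "d = (\<lambda>i :: nat. if i = 0 then sqrt t else if i = 2 then sqrt (q - t) else 0)"
  have sq: "sqrt t * sqrt t = t" "sqrt (q - t) * sqrt (q - t) = q - t" using t by simp_all
  have cd: "(\<Sum>i\<in>?I. c i * c i) = q" "(\<Sum>i\<in>?I. d i * d i) = q" "(\<Sum>i\<in>?I. c i * d i) = t"
    using t by (simp_all add: c_def d_def)
  define A where "A x = Th \<beta> h (\<Sum>i\<in>?I. c i * x i)" for x
  define B where "B x = Th \<beta> h (\<Sum>i\<in>?I. d i * x i)" for x
  have mA: "A \<in> borel_measurable ?G" "B \<in> borel_measurable ?G" unfolding A_def B_def by (rule borel_measurable_Th_lin)+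
  have AB: "\<bar>A x\<bar> \<le> 1" "\<bar>B x\<bar> \<le> 1" for x by (simp_all only: A_def B_def Th_bound)
  have bb: "\<bar>A x * A x\<bar> \<le> 1" "\<bar>B x * B x\<bar> \<le> 1" "\<bar>A x * B x\<bar> \<le> 1" for x
    using mult_mono[OF AB(1)[of x] AB(1)[of x]] mult_mono[OF AB(2)[of x] AB(2)[of x]] mult_mono[OF AB(1)[of x] AB(2)[of x]]
    by (simp_all only: abs_mult mult_1_right abs_ge_zero zero_le_one simp_thms)
  have int: "integrable ?G (\<lambda>x. A x * A x)" "integrable ?G (\<lambda>x. B x * B x)" "integrable ?G (\<lambda>x. A x * B x)"
    by (rule integrable_gauss_bounded[OF borel_measurable_times[OF mA(1) mA(1)] bb(1)]
      integrable_gauss_bounded[OF borel_measurable_times[OF mA(2) mA(2)] bb(2)]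
      integrable_gauss_bounded[OF borel_measurable_times[OF mA(1) mA(2)] bb(3)])+
  have qq: "q = (\<integral>z. Th \<beta> h (sqrt q * z) * Th \<beta> h (sqrt q * z) \<partial>std_normal_distribution)"
    using q unfolding sk_fixed_point_def Th_def power2_eq_square by (simp add: mult.assoc)
  have mT: "(\<lambda>y. Th \<beta> h y * Th \<beta> h y) \<in> borel_measurable borel"
    by (intro borel_measurable_times borel_measurable_Th measurable_id_borel)
  have eA: "(\<integral>x. A x * A x \<partial>?G) = q" unfolding A_def using integral_single_law[OF _ mT cd(1)] qq by simp
  have eB: "(\<integral>x. B x * B x \<partial>?G) = q" unfolding B_def using integral_single_law[OF _ mT cd(2)] qq by simp
  have eAB: "(\<integral>x. A x * B x \<partial>?G) = sk_psi \<beta> h q t" unfolding A_def B_def by (rule psi_eq[OF t(1) _ cd]) simp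
  have e: "(\<integral>x. A x * A x + B x * B x - 2 * (A x * B x) \<partial>?G) = 2 * (q - sk_psi \<beta> h q t)"
    using int eA eB eAB by simp
  have pos: "0 \<le> A x * A x + B x * B x - 2 * (A x * B x)" for x
    using zero_le_power2[of "A x - B x"] by (simp add: power2_eq_square algebra_simps)
  have inte: "integrable ?G (\<lambda>x. A x * A x + B x * B x - 2 * (A x * B x))" using int by simp
  have "0 \<le> 2 * (q - sk_psi \<beta> h q t)" unfolding e[symmetric] by (intro Bochner_Integration.integral_nonneg pos)
  moreover have "sk_psi \<beta> h q t \<noteq> q"
  proof
    assume "sk_psi \<beta> h q t = q"
    then have "(\<integral>x. A x * A x + B x * B x - 2 * (A x * B x) \<partial>?G) = 0" using e by simp
    then have ae: "AE x in ?G. A x * A x + B x * B x - 2 * (A x * B x) = 0"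
      using integral_nonneg_eq_0_iff_AE[OF inte] pos by simp
    \<comment> \<open>Almost sure equality of coordinates 1 and 2 would make the mean character of
      their difference equal to 1, but it is \<open>exp (- 1)\<close>.\<close>
    define s where "s = (\<lambda>i :: nat. if i = 1 then 1 else if i = 2 then - 1 else 0 :: real)"
    have "AE x in ?G. iexp (\<Sum>i\<in>?I. s i * x i) = 1"
      using ae
    proof (rule AE_mp, intro AE_I2 impI)
      fix x assume "A x * A x + B x * B x - 2 * (A x * B x) = 0"
      then have "(A x - B x)\<^sup>2 = 0" by (simp add: power2_eq_square algebra_simps)
      then have "Th \<beta> h (\<Sum>i\<in>?I. c i * x i) = Th \<beta> h (\<Sum>i\<in>?I. d i * x i)" by (simp add: A_def B_def)
      then have "(\<Sum>i\<in>?I. c i * x i) = (\<Sum>i\<in>?I. d i * x i)" by (rule Th_inject[OF b])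
      then have "sqrt (q - t) * x 1 = sqrt (q - t) * x 2" by (simp add: c_def d_def)
      then have "x 1 = x 2" using t by simp
      then show "iexp (\<Sum>i\<in>?I. s i * x i) = 1" by (simp add: s_def)
    qed
    then have c1: "(CLINT x|?G. iexp (\<Sum>i\<in>?I. s i * x i)) = (CLINT x|?G. 1)"
      by (rule integral_cong_AE[OF measurable_compose[OF borel_measurable_lin[OF order_refl] measurable_iexp] borel_measurable_const])
    have c2: "(CLINT x|?G. iexp (\<Sum>i\<in>?I. s i * x i)) = exp (- (\<Sum>i\<in>?I. (s i)\<^sup>2) / 2)"
      by (rule char_gauss) simp
    have sm: "(\<Sum>i\<in>?I. (s i)\<^sup>2) = 2" by (simp add: s_def)
    have c3: "(CLINT x|?G. 1) = complex_of_real 1" using prob_space by (simp add: scaleR_conv_of_real)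
    have "complex_of_real (exp (- 2 / 2)) = complex_of_real 1"
      using c1 unfolding c2 c3 sm .
    then have "exp (- 2 / 2 :: real) = 1" by (simp only: of_real_eq_iff)
    then show False by simp
  qed
  ultimately show ?thesis by simp
qed

text \<open>By the symmetry of the Gaussian law, \<open>tanh (h + y)\<close> may be averaged with
  \<open>tanh (h - y)\<close>, and their sum is nonnegative since \<open>tanh\<close> is odd and
  increasing and \<open>h > 0\<close>.\<close>

lemma alpha_nonneg:
  assumes "h > 0" shows "0 \<le> sk_alpha \<beta> h q"
proof -
  let ?n = std_normal_distribution
  let ?G = "gauss {()}"
  define f where "f y = Th \<beta> h (sqrt q * y)" for y
  have mf: "f \<in> borel_measurable borel"
    unfolding f_def by (intro borel_measurable_Th borel_measurable_times borel_measurable_const measurable_id_borel)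
  have e: "(\<integral>x. f (\<Sum>i\<in>{()}. c * x i) \<partial>?G) = sk_alpha \<beta> h q" if "c * c = 1" for c
    using integral_single_law[of "{()}" f "\<lambda>_. c" 1, OF _ mf] that by (simp add: sk_alpha_def f_def)
  have i: "integrable ?G (\<lambda>x. f (\<Sum>i\<in>{()}. c * x i))" for c
    by (intro integrable_gauss_bounded[where B=1] measurable_compose[OF borel_measurable_lin[OF order_refl] mf]) (simp add: f_def Th_bound)
  have "0 \<le> (\<integral>x. f (\<Sum>i\<in>{()}. 1 * x i) + f (\<Sum>i\<in>{()}. (-1) * x i) \<partial>?G)"
  proof (intro Bochner_Integration.integral_nonneg)
    fix x :: "unit \<Rightarrow> real"
    let ?y = "\<beta> * (sqrt q * x ())"
    have "tanh (?y - h) \<le> tanh (h + ?y)" using assms by (simp add: tanh_real_le_iff)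
    moreover have "tanh (?y - h) = - tanh (h + - ?y)" by (metis add.commute minus_diff_eq tanh_minus uminus_add_conv_diff)
    ultimately show "0 \<le> f (\<Sum>i\<in>{()}. 1 * x i) + f (\<Sum>i\<in>{()}. (-1) * x i)"
      by (simp add: f_def Th_def)
  qed
  also have "\<dots> = 2 * sk_alpha \<beta> h q"
    using e[of 1] e[of "-1"] i[of 1] i[of "-1"] by simp
  finally show ?thesis by simp
qed


lemma tendsto_std_normal_density_0:
  assumes "filterlim (\<lambda>x::real. x\<^sup>2) at_top F" shows "(std_normal_density \<longlongrightarrow> 0) F"
proof -
  have "filterlim (\<lambda>x::real. (1 / 2) * x\<^sup>2) at_top F"
    by (rule filterlim_tendsto_pos_mult_at_top[OF tendsto_const _ assms]) simp
  then have "filterlim (\<lambda>x::real. - ((1 / 2) * x\<^sup>2)) at_bot F" by (simp add: filterlim_uminus_at_bot)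
  from filterlim_compose[OF exp_at_bot this]
  have "((\<lambda>x. 1 / sqrt (2 * pi) * exp (- ((1 / 2) * x\<^sup>2))) \<longlongrightarrow> 1 / sqrt (2 * pi) * 0) F"
    by (intro tendsto_mult tendsto_const)
  then show ?thesis by (simp add: std_normal_density_def[abs_def])
qed

text \<open>Integration by parts without boundary terms: the difference of the two integrands, taken
  against the density, is up to sign the derivative of the density times \<open>Th\<close>, and this
  product vanishes at infinity.\<close>

lemma stein_Th:
  "(\<integral>z. z * Th \<beta> h (s * z) \<partial>std_normal_distribution) = (\<integral>z. s * \<beta> * (1 - (Th \<beta> h (s * z))\<^sup>2) \<partial>std_normal_distribution)"
proof -
  let ?p = std_normal_density and ?f = "\<lambda>z. Th \<beta> h (s * z)"
  let ?f' = "\<lambda>z. s * \<beta> * (1 - (?f z)\<^sup>2)"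
  define g where "g = (\<lambda>x. ?p x * ?f' x - ?p x * (x * ?f x))"
  have mf: "?f \<in> borel_measurable borel" by (intro borel_measurable_Th borel_measurable_times borel_measurable_const measurable_id_borel)
  have mf': "?f' \<in> borel_measurable borel" unfolding power2_eq_square
    by (intro borel_measurable_times borel_measurable_diff borel_measurable_const mf)
  have mp: "?p \<in> borel_measurable borel" by (rule borel_measurable_normal_density)
  have b2: "\<bar>1 - (?f z)\<^sup>2\<bar> \<le> 1" for z
  proof -
    have "(?f z)\<^sup>2 \<le> 1" using Th_bound unfolding abs_square_le_1 .
    then show ?thesis by simp
  qed
  have i1: "integrable lborel (\<lambda>x. ?p x * ?f' x)"
  proof (rule Bochner_Integration.integrable_bound)
    show "integrable lborel (\<lambda>x. \<bar>s * \<beta>\<bar> * ?p x)" by (intro integrable_mult_right integrable_normal_density) simp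
    show "(\<lambda>x. ?p x * ?f' x) \<in> borel_measurable lborel" using borel_measurable_times[OF mp mf'] by (simp only: measurable_cong_sets[OF sets_lborel refl])
    show "AE x in lborel. norm (?p x * ?f' x) \<le> norm (\<bar>s * \<beta>\<bar> * ?p x)"
    proof (rule AE_I2)
      fix x
      have "norm (?p x * ?f' x) = ?p x * \<bar>s * \<beta>\<bar> * \<bar>1 - (?f x)\<^sup>2\<bar>" by (simp add: abs_mult)
      also have "\<dots> \<le> ?p x * \<bar>s * \<beta>\<bar> * 1" by (intro mult_left_mono b2) simp
      finally show "norm (?p x * ?f' x) \<le> norm (\<bar>s * \<beta>\<bar> * ?p x)" by (simp add: abs_mult mult_ac)
    qed
  qed
  have i2: "integrable lborel (\<lambda>x. ?p x * (x * ?f x))"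
  proof (rule Bochner_Integration.integrable_bound)
    show "integrable lborel (\<lambda>x. ?p x * \<bar>x - 0\<bar> ^ 1)" by (rule integrable_normal_moment_abs) simp
    show "(\<lambda>x. ?p x * (x * ?f x)) \<in> borel_measurable lborel"
      using borel_measurable_times[OF mp borel_measurable_times[OF measurable_id_borel mf]] by (simp only: measurable_cong_sets[OF sets_lborel refl])
    show "AE x in lborel. norm (?p x * (x * ?f x)) \<le> norm (?p x * \<bar>x - 0\<bar> ^ 1)"
    proof (rule AE_I2)
      fix x
      have "norm (?p x * (x * ?f x)) = ?p x * \<bar>x\<bar> * \<bar>?f x\<bar>" by (simp add: abs_mult)
      also have "\<dots> \<le> ?p x * \<bar>x\<bar> * 1" by (intro mult_left_mono Th_bound) simp
      finally show "norm (?p x * (x * ?f x)) \<le> norm (?p x * \<bar>x - 0\<bar> ^ 1)" by simp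
    qed
  qed
  have der: "((\<lambda>x. ?p x * ?f x) has_real_derivative g x) (at x)" for x
  proof -
    have "(?p has_real_derivative - x * ?p x) (at x)"
    proof -
      define c where "c = 1 / sqrt (2 * pi)"
      have pe: "?p = (\<lambda>x. c * exp (- x\<^sup>2 / 2))" by (simp add: std_normal_density_def c_def fun_eq_iff)
      show ?thesis unfolding pe by (auto intro!: derivative_eq_intros)
    qed
    moreover have "(?f has_real_derivative ?f' x) (at x)"
      unfolding Th_def by (auto intro!: derivative_eq_intros simp: cosh_real_nonzero)
    ultimately show ?thesis unfolding g_def
      by (auto intro!: derivative_eq_intros)
  qed
  have cf: "isCont ?f x" for x
    unfolding Th_def using cosh_real_nonzero by (intro continuous_intros)
  have cont: "isCont g x" for x
    unfolding g_def std_normal_density_def by (intro continuous_intros cf) simp_all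
  have lim: "((\<lambda>x. ?p x * ?f x) \<longlongrightarrow> 0) F" if "filterlim (\<lambda>x::real. x\<^sup>2) at_top F" for F
  proof (rule Lim_null_comparison[OF _ tendsto_std_normal_density_0[OF that]])
    have "norm (?p x * ?f x) \<le> ?p x" for x
      using mult_left_mono[OF Th_bound, of "?p x" \<beta> h "s * x"] by (simp add: abs_mult)
    then show "\<forall>\<^sub>F x in F. norm (?p x * ?f x) \<le> ?p x" by simp
  qed
  have gi: "integrable lborel g" unfolding g_def by (rule Bochner_Integration.integrable_diff[OF i1 i2])
  have "(LBINT x=-\<infinity>..\<infinity>. g x) = 0 - 0"
  proof (rule interval_integral_FTC_integrable)
    show "((\<lambda>x. ?p x * ?f x) has_vector_derivative g x) (at x)" for x
      using der[of x] by (simp only: has_real_derivative_iff_has_vector_derivative)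
    show "set_integrable lborel (einterval (- \<infinity>) \<infinity>) g" using gi by (simp add: set_integrable_def einterval_eq_UNIV)
    show "(((\<lambda>x. ?p x * ?f x) \<circ> real_of_ereal) \<longlongrightarrow> 0) (at_right (- \<infinity>))"
      unfolding ereal_tendsto_simps by (rule lim) (rule filterlim_pow_at_bot_even[OF _ filterlim_ident], simp_all)
    show "(((\<lambda>x. ?p x * ?f x) \<circ> real_of_ereal) \<longlongrightarrow> 0) (at_left \<infinity>)"
      unfolding ereal_tendsto_simps by (rule lim) (rule filterlim_pow_at_top[OF _ filterlim_ident], simp)
  qed (simp_all add: cont)
  then have "integral\<^sup>L lborel g = 0"
    by (simp add: interval_lebesgue_integral_def einterval_eq_UNIV set_lebesgue_integral_def)
  then have eq: "(\<integral>x. ?p x * ?f' x \<partial>lborel) = (\<integral>x. ?p x * (x * ?f x) \<partial>lborel)"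
    unfolding g_def by (subst (asm) Bochner_Integration.integral_diff[OF i1 i2]) simp
  have den: "(\<integral>x. F x \<partial>std_normal_distribution) = (\<integral>x. ?p x * F x \<partial>lborel)" if "F \<in> borel_measurable borel" for F :: "real \<Rightarrow> real"
  proof -
    have "F \<in> borel_measurable lborel" "?p \<in> borel_measurable lborel"
      using that mp by (simp_all only: measurable_cong_sets[OF sets_lborel refl])
    from integral_density[OF this AE_I2[OF normal_density_nonneg]] show ?thesis by (simp only: real_scaleR_def)
  qed
  show ?thesis unfolding den[OF mf'] den[OF borel_measurable_times[OF measurable_id_borel mf]] by (rule eq[symmetric])
qed

section \<open>Random vectors\<close>

definition rvec :: "(nat \<Rightarrow> 'a measure) \<Rightarrow> (nat \<Rightarrow> 'a \<Rightarrow> nat \<Rightarrow> real) \<Rightarrow> bool" where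
  "rvec M u \<longleftrightarrow> (\<forall>N\<ge>1. \<forall>i\<in>{1..N}. (\<lambda>\<omega>. u N \<omega> i) \<in> borel_measurable (M N))"

lemma rvs_ninner: "rvec M u \<Longrightarrow> rvec M w \<Longrightarrow> rvs M (\<lambda>N \<omega>. ninner N (u N \<omega>) (w N \<omega>))"
  unfolding rvec_def rvs_def by (intro allI impI borel_measurable_ninner) blast+

lemma rvs_nnorm: "rvec M u \<Longrightarrow> rvs M (\<lambda>N \<omega>. nnorm N (u N \<omega>))"
  unfolding rvec_def rvs_def by (intro allI impI borel_measurable_nnorm) blast

lemma rvec_diff: "rvec M u \<Longrightarrow> rvec M w \<Longrightarrow> rvec M (\<lambda>N \<omega> i. u N \<omega> i - w N \<omega> i)"
  unfolding rvec_def by (intro allI impI ballI borel_measurable_diff) blast+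

context prob_family
begin

text \<open>Gram-Schmidt coefficients depend continuously on the inner products while the residual
  norms stay away from 0, which \<open>pos\<close> ensures in the limit. The test vector
  \<open>u\<close> is arbitrary because the directions are tested not only against iterates but also
  against the auxiliary mean in \<open>amp_inv_pos_next\<close>.\<close>

lemma conv_gram_schmidt:
  fixes r g :: "nat \<Rightarrow> real" and q :: real
  assumes supp: "\<And>N \<omega> l. supp N (v N \<omega> l)"
    and mv: "\<And>l. l \<in> {1..n} \<Longrightarrow> rvec M (\<lambda>N \<omega>. v N \<omega> l)"
    and diag: "\<And>i. i \<in> {1..n} \<Longrightarrow> conv M (\<lambda>N \<omega>. ninner N (v N \<omega> i) (v N \<omega> i)) q"
    and off: "\<And>i j. 1 \<le> i \<Longrightarrow> i < j \<Longrightarrow> j \<le> n \<Longrightarrow> conv M (\<lambda>N \<omega>. ninner N (v N \<omega> i) (v N \<omega> j)) (r i)"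
    and pos: "\<And>j. j \<in> {1..n} \<Longrightarrow> (\<Sum>l=1..j - 1. (g l)\<^sup>2) < q"
    and rel: "\<And>j. j \<in> {1..n} \<Longrightarrow> g j * sqrt (q - (\<Sum>l=1..j - 1. (g l)\<^sup>2)) = r j - (\<Sum>l=1..j - 1. (g l)\<^sup>2)"
    and j: "j \<in> {1..n}"
  shows "conv M (\<lambda>N \<omega>. nnorm N (gs_M N (v N \<omega>) j)) (sqrt (q - (\<Sum>l=1..j - 1. (g l)\<^sup>2))) \<and>
    (\<forall>u. rvec M u \<longrightarrow> (\<forall>i\<in>{1..j}. conv M (\<lambda>N \<omega>. ninner N (v N \<omega> i) (u N \<omega>)) (r i)) \<longrightarrow>
       conv M (\<lambda>N \<omega>. ninner N (gs_phi N (v N \<omega>) j) (u N \<omega>)) (g j))"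
  using j
proof (induction j rule: less_induct)
  case (less j)
  note jn = less.prems
  let ?G = "\<Sum>l=1..j - 1. (g l)\<^sup>2"
  have mgs: "rvec M (\<lambda>N \<omega>. gs_M N (v N \<omega>) l)" "rvec M (\<lambda>N \<omega>. gs_phi N (v N \<omega>) l)" "rvec M (\<lambda>N \<omega>. gs_b N (v N \<omega>) l)"
    if l: "l \<in> {1..n}" for l
  proof -
    have A: "\<forall>i\<in>{1..N}. (\<lambda>\<omega>. gs_M N (v N \<omega>) l i) \<in> borel_measurable (M N) \<and> (\<lambda>\<omega>. gs_phi N (v N \<omega>) l i) \<in> borel_measurable (M N)
      \<and> (\<lambda>\<omega>. gs_b N (v N \<omega>) l i) \<in> borel_measurable (M N)" if N: "N \<ge> 1" for N
    proof (rule borel_measurable_gs[of N n "v N" "M N", OF N supp _ l])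
      fix l i assume "l \<in> {1..n}" "i \<in> {1..N}"
      then show "(\<lambda>\<omega>. v N \<omega> l i) \<in> borel_measurable (M N)" using mv[of l] N unfolding rvec_def by blast
    qed
    show "rvec M (\<lambda>N \<omega>. gs_M N (v N \<omega>) l)" unfolding rvec_def
    proof (intro allI impI ballI)
      fix N i :: nat assume "1 \<le> N" "i \<in> {1..N}"
      from conjunct1[OF bspec[OF A[OF this(1)] this(2)]] show "(\<lambda>\<omega>. gs_M N (v N \<omega>) l i) \<in> borel_measurable (M N)" .
    qed
    show "rvec M (\<lambda>N \<omega>. gs_phi N (v N \<omega>) l)" unfolding rvec_def
    proof (intro allI impI ballI)
      fix N i :: nat assume "1 \<le> N" "i \<in> {1..N}"
      from conjunct1[OF conjunct2[OF bspec[OF A[OF this(1)] this(2)]]] show "(\<lambda>\<omega>. gs_phi N (v N \<omega>) l i) \<in> borel_measurable (M N)" .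
    qed
    show "rvec M (\<lambda>N \<omega>. gs_b N (v N \<omega>) l)" unfolding rvec_def
    proof (intro allI impI ballI)
      fix N i :: nat assume "1 \<le> N" "i \<in> {1..N}"
      from conjunct2[OF conjunct2[OF bspec[OF A[OF this(1)] this(2)]]] show "(\<lambda>\<omega>. gs_b N (v N \<omega>) l i) \<in> borel_measurable (M N)" .
    qed
  qed
  \<comment> \<open>The formulas for \<open>gs_M\<close> hold exactly with \<open>gs_b\<close>; with
    overwhelming probability the earlier steps do not degenerate, and \<open>gs_b\<close> is then
    \<open>gs_phi\<close>.\<close>
  have B: "conv M (\<lambda>N \<omega>. ninner N (gs_b N (v N \<omega>) l) (u N \<omega>)) (g l)"
    if l: "l \<in> {1..j - 1}" and u: "rvec M u" and uc: "\<And>i. i \<in> {1..j - 1} \<Longrightarrow> conv M (\<lambda>N \<omega>. ninner N (v N \<omega> i) (u N \<omega>)) (r i)" for l u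
  proof -
    have lj: "l < j" "l \<in> {1..n}" using l jn by auto
    have c1: "conv M (\<lambda>N \<omega>. ninner N (gs_phi N (v N \<omega>) l) (u N \<omega>)) (g l)"
    proof -
      have "\<forall>i\<in>{1..l}. conv M (\<lambda>N \<omega>. ninner N (v N \<omega> i) (u N \<omega>)) (r i)"
      proof
        fix i assume "i \<in> {1..l}"
        then have "i \<in> {1..j - 1}" using l by auto
        then show "conv M (\<lambda>N \<omega>. ninner N (v N \<omega> i) (u N \<omega>)) (r i)" by (rule uc)
      qed
      then show ?thesis using conjunct2[OF less.IH[OF lj]] u by (elim allE impE) assumption+
    qed
    have c2: "conv M (\<lambda>N \<omega>. nnorm N (gs_M N (v N \<omega>) l)) (sqrt (q - (\<Sum>l=1..l - 1. (g l)\<^sup>2)))"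
      by (rule conjunct1[OF less.IH[OF lj]])
    have "0 < sqrt (q - (\<Sum>l=1..l - 1. (g l)\<^sup>2))" using pos[OF lj(2)] by simp
    from conv_gt[OF c2 this] have w: "wop M (\<lambda>N \<omega>. ninner N (gs_b N (v N \<omega>) l) (u N \<omega>) = ninner N (gs_phi N (v N \<omega>) l) (u N \<omega>))"
      by (rule wop_mono) (simp add: gs_b_def)
    show ?thesis by (rule conv_cong_wop[OF rvs_ninner[OF mgs(3)[OF lj(2)] u] c1 w])
  qed
  have vj: "rvec M (\<lambda>N \<omega>. v N \<omega> j)" by (rule mv[OF jn])
  have Bv: "conv M (\<lambda>N \<omega>. ninner N (gs_b N (v N \<omega>) l) (v N \<omega> j)) (g l)" if "l \<in> {1..j - 1}" for l
  proof (rule B[OF that vj])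
    fix i assume "i \<in> {1..j - 1}"
    then have "1 \<le> i" "i < j" "j \<le> n" using jn by auto
    then show "conv M (\<lambda>N \<omega>. ninner N (v N \<omega> i) (v N \<omega> j)) (r i)" by (rule off)
  qed
  have n2: "conv M (\<lambda>N \<omega>. ninner N (v N \<omega> j) (v N \<omega> j) - (\<Sum>l=1..j - 1. (ninner N (gs_b N (v N \<omega>) l) (v N \<omega> j))\<^sup>2)) (q - ?G)"
    by (intro conv_diff diag[OF jn] conv_sum conv_power2 Bv finite_atLeastAtMost)
  have pj: "q - ?G > 0" using pos[OF jn] by simp
  have nn: "conv M (\<lambda>N \<omega>. nnorm N (gs_M N (v N \<omega>) j)) (sqrt (q - ?G))"
  proof (rule conv_cong_wop[OF rvs_nnorm[OF mgs(1)[OF jn]] conv_sqrt[OF n2 pj]])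
    show "wop M (\<lambda>N \<omega>. nnorm N (gs_M N (v N \<omega>) j) = sqrt (ninner N (v N \<omega> j) (v N \<omega> j) - (\<Sum>l=1..j - 1. (ninner N (gs_b N (v N \<omega>) l) (v N \<omega> j))\<^sup>2)))"
    proof (rule wop_True)
      fix N \<omega> assume N: "N \<ge> (1::nat)"
      show "nnorm N (gs_M N (v N \<omega>) j) = sqrt (ninner N (v N \<omega> j) (v N \<omega> j) - (\<Sum>l=1..j - 1. (ninner N (gs_b N (v N \<omega>) l) (v N \<omega> j))\<^sup>2))"
        unfolding gs_M_norm[of N n "v N \<omega>", OF N supp jn, symmetric] by (simp add: nnorm_nonneg)
    qed
  qed
  have sp: "sqrt (q - ?G) > 0" using pj by simp
  have "conv M (\<lambda>N \<omega>. ninner N (gs_phi N (v N \<omega>) j) (u N \<omega>)) (g j)"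
    if u: "rvec M u" and uc: "\<forall>i\<in>{1..j}. conv M (\<lambda>N \<omega>. ninner N (v N \<omega> i) (u N \<omega>)) (r i)" for u
  proof -
    have uc': "conv M (\<lambda>N \<omega>. ninner N (v N \<omega> i) (u N \<omega>)) (r i)" if "i \<in> {1..j - 1}" for i
    proof -
      have "i \<in> {1..j}" using that by auto
      then show ?thesis by (rule bspec[OF uc])
    qed
    have Bu: "conv M (\<lambda>N \<omega>. ninner N (gs_b N (v N \<omega>) l) (u N \<omega>)) (g l)" if "l \<in> {1..j - 1}" for l
      by (rule B[OF that u uc'])
    have jj: "j \<in> {1..j}" using jn by simp
    have c: "conv M (\<lambda>N \<omega>. (ninner N (v N \<omega> j) (u N \<omega>) - (\<Sum>l=1..j - 1. ninner N (gs_b N (v N \<omega>) l) (v N \<omega> j) * ninner N (gs_b N (v N \<omega>) l) (u N \<omega>)))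
        / nnorm N (gs_M N (v N \<omega>) j)) ((r j - (\<Sum>l=1..j - 1. g l * g l)) / sqrt (q - ?G))"
      by (intro conv_divide conv_diff bspec[OF uc jj] conv_sum conv_mult Bv Bu finite_atLeastAtMost nn sp)
    have val: "(r j - (\<Sum>l=1..j - 1. g l * g l)) / sqrt (q - ?G) = g j"
      using rel[OF jn] sp by (simp add: power2_eq_square field_simps)
    show ?thesis
    proof (rule conv_cong_wop[OF rvs_ninner[OF mgs(2)[OF jn] u] c[unfolded val]])
      show "wop M (\<lambda>N \<omega>. ninner N (gs_phi N (v N \<omega>) j) (u N \<omega>) = (ninner N (v N \<omega> j) (u N \<omega>) - (\<Sum>l=1..j - 1. ninner N (gs_b N (v N \<omega>) l) (v N \<omega> j) * ninner N (gs_b N (v N \<omega>) l) (u N \<omega>)))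
        / nnorm N (gs_M N (v N \<omega>) j))"
      proof (rule wop_mono[OF conv_gt[OF nn sp]])
        fix N \<omega> assume N: "N \<ge> (1::nat)" and p: "0 < nnorm N (gs_M N (v N \<omega>) j)"
        have "ninner N (gs_phi N (v N \<omega>) j) (u N \<omega>) = ninner N (gs_M N (v N \<omega>) j) (u N \<omega>) / nnorm N (gs_M N (v N \<omega>) j)"
          using p by (simp add: gs_phi_def ninner_divide_left)
        then show "ninner N (gs_phi N (v N \<omega>) j) (u N \<omega>) = (ninner N (v N \<omega> j) (u N \<omega>) - (\<Sum>l=1..j - 1. ninner N (gs_b N (v N \<omega>) l) (v N \<omega> j) * ninner N (gs_b N (v N \<omega>) l) (u N \<omega>)))
          / nnorm N (gs_M N (v N \<omega>) j)"
          unfolding gs_M_inner[of N n "v N \<omega>", OF N supp jn] .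
      qed
    qed
  qed
  then show ?case by (intro conjI nn allI impI) assumption
qed

lemma negl_inner:
  assumes u: "rvec M u" and w: "rvec M w" and n: "negl M (\<lambda>N \<omega>. nnorm N (u N \<omega>))" and b: "wop M (\<lambda>N \<omega>. nnorm N (w N \<omega>) \<le> b)"
  shows "negl M (\<lambda>N \<omega>. ninner N (u N \<omega>) (w N \<omega>))"
proof (rule negl_dom[OF rvs_ninner[OF u w] n])
  show "wop M (\<lambda>N \<omega>. \<bar>ninner N (u N \<omega>) (w N \<omega>)\<bar> \<le> b * \<bar>nnorm N (u N \<omega>)\<bar>)"
  proof (rule wop_mono[OF b])
    fix N \<omega> assume "nnorm N (w N \<omega>) \<le> b"
    then have "nnorm N (u N \<omega>) * nnorm N (w N \<omega>) \<le> nnorm N (u N \<omega>) * b" by (intro mult_left_mono nnorm_nonneg)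
    then show "\<bar>ninner N (u N \<omega>) (w N \<omega>)\<bar> \<le> b * \<bar>nnorm N (u N \<omega>)\<bar>"
      using ninner_cauchy_schwarz[of N "u N \<omega>" "w N \<omega>"] nnorm_nonneg[of N "u N \<omega>"] by (simp add: mult.commute)
  qed
qed

end

text \<open>The coordinate \<open>x l\<close> is its regression on the linear form plus an
  independent centred part, which contributes nothing. The regression part reduces to
  \<open>stein_Th\<close>, and the fixed point equation evaluates the mean of
  \<open>1 - Th\<^sup>2\<close> as \<open>1 - q\<close>: this is the origin of the Onsager
  coefficient.\<close>

lemma stein_gauss:
  assumes K: "finite I" "l \<in> I" and q: "q > 0" and c: "(\<Sum>j\<in>I. c j * c j) = q"
    and fp: "sk_fixed_point \<beta> h q"
  shows "(\<integral>x. x l * Th \<beta> h (\<Sum>j\<in>I. c j * x j) \<partial>gauss I) = \<beta> * (1 - q) * c l"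
proof -
  let ?n = std_normal_distribution
  interpret n: prob_space ?n by (rule prob_space_std_normal)
  have cl: "c l * c l \<le> q" unfolding c[symmetric] using K by (intro member_le_sum) auto
  \<comment> \<open>The correlation of \<open>x l\<close> with the linear form; \<open>s\<close>
    will be the weight of the independent remainder.\<close>
  define a where "a = c l / sqrt q"
  have a2: "a * a \<le> 1" using cl q by (simp add: a_def)
  define s where "s = sqrt (1 - a * a)"
  have s2: "s * s = 1 - a * a" using a2 by (simp add: s_def)
  let ?J = "UNIV :: bool set"
  define F where "F = (\<lambda>y. Th \<beta> h (sqrt q * y))"
  have mF: "F \<in> borel_measurable borel" unfolding F_def
    by (intro borel_measurable_Th borel_measurable_times borel_measurable_const measurable_id_borel)
  have mFn: "F \<in> borel_measurable ?n" "(\<lambda>x. x) \<in> borel_measurable ?n"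
    using mF measurable_id_borel by (simp_all only: measurable_cong_sets[OF sets_density refl] measurable_cong_sets[OF sets_lborel refl])
  have bF: "\<bar>F y\<bar> \<le> 1" for y by (simp only: F_def Th_bound)
  have iF: "integrable ?n F" by (rule n.integrable_const_bound[where B=1, OF AE_I2 mFn(1)]) (simp only: real_norm_def bF)
  have ix: "integrable ?n (\<lambda>x. x)" using integrable_std_normal_distribution_moment[of 1] by simp
  have ixF: "integrable ?n (\<lambda>x. x * F x)"
  proof (rule Bochner_Integration.integrable_bound[OF integrable_abs[OF ix]])
    show "(\<lambda>x. x * F x) \<in> borel_measurable ?n" by (rule borel_measurable_times[OF mFn(2,1)])
    show "AE x in ?n. norm (x * F x) \<le> norm \<bar>x\<bar>"
      using mult_left_mono[OF bF abs_ge_zero] by (intro AE_I2) (simp add: abs_mult)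
  qed
  have "(\<integral>x. x l * Th \<beta> h (\<Sum>j\<in>I. c j * x j) \<partial>gauss I) = (\<integral>x. (\<Sum>j\<in>I. (if j = l then 1 else 0) * x j) * Th \<beta> h (\<Sum>j\<in>I. c j * x j) \<partial>gauss I)"
    using K by (simp add: if_distrib[of "\<lambda>c. c * _"] cong: if_cong)
  also have "\<dots> = (\<integral>x. (\<Sum>j\<in>?J. (if j then a else s) * x j) * Th \<beta> h (\<Sum>j\<in>?J. (if j then sqrt q else 0) * x j) \<partial>gauss ?J)"
  proof (rule integral_pair_law[OF K(1) finite, of "\<lambda>a b. a * Th \<beta> h b"])
    show "(\<lambda>p. fst p * Th \<beta> h (snd p)) \<in> borel_measurable (borel \<Otimes>\<^sub>M borel)"
      by (intro borel_measurable_times borel_measurable_Th measurable_fst measurable_snd)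
    show "(\<Sum>i\<in>I. (if i = l then 1 else 0) * (if i = l then 1 else 0)) = (\<Sum>j\<in>?J. (if j then a else s) * (if j then a else s))"
      using K s2 by (simp add: UNIV_bool if_distrib[of "\<lambda>c. c * _"] cong: if_cong)
    show "(\<Sum>i\<in>I. (if i = l then 1 else 0) * c i) = (\<Sum>j\<in>?J. (if j then a else s) * (if j then sqrt q else 0))"
      using K q by (simp add: UNIV_bool a_def if_distrib[of "\<lambda>c. c * _"] cong: if_cong)
    show "(\<Sum>i\<in>I. c i * c i) = (\<Sum>j\<in>?J. (if j then sqrt q else 0) * (if j then sqrt q else 0))"
      using c q by (simp add: UNIV_bool)
  qed
  also have "\<dots> = (\<integral>x. a * (\<Prod>j\<in>?J. (if j then (\<lambda>y. y * F y) else (\<lambda>y. 1)) (x j)) + s * (\<Prod>j\<in>?J. (if j then F else (\<lambda>y. y)) (x j)) \<partial>gauss ?J)"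
    by (intro Bochner_Integration.integral_cong refl) (simp add: UNIV_bool F_def algebra_simps)
  also have "\<dots> = a * (\<integral>x. (\<Prod>j\<in>?J. (if j then (\<lambda>y. y * F y) else (\<lambda>y. 1)) (x j)) \<partial>gauss ?J) + s * (\<integral>x. (\<Prod>j\<in>?J. (if j then F else (\<lambda>y. y)) (x j)) \<partial>gauss ?J)"
  proof -
    have i: "integrable (gauss ?J) (\<lambda>x. \<Prod>j\<in>?J. f j (x j))" if "\<And>j. integrable ?n (f j)" for f :: "bool \<Rightarrow> real \<Rightarrow> real"
      unfolding gauss_def by (rule product_sigma_finite.product_integrable_prod[OF product_sigma_finite_std_normal finite that])
    have i1: "integrable (gauss ?J) (\<lambda>x. \<Prod>j\<in>?J. (if j then (\<lambda>y. y * F y) else (\<lambda>y. 1)) (x j))"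
      by (rule i[of "\<lambda>j. if j then (\<lambda>y. y * F y) else (\<lambda>y. 1)"]) (use ixF in simp)
    have i2: "integrable (gauss ?J) (\<lambda>x. \<Prod>j\<in>?J. (if j then F else (\<lambda>y. y)) (x j))"
      by (rule i[of "\<lambda>j. if j then F else (\<lambda>y. y)"]) (use ix iF in simp)
    show ?thesis by (simp only: Bochner_Integration.integral_add[OF integrable_mult_right[OF i1] integrable_mult_right[OF i2]] integral_mult_right_zero)
  qed
  also have "(\<integral>x. (\<Prod>j\<in>?J. (if j then (\<lambda>y. y * F y) else (\<lambda>y. 1)) (x j)) \<partial>gauss ?J) = (\<integral>y. y * F y \<partial>?n)"
  proof -
    have "(\<integral>x. (\<Prod>j\<in>?J. (if j then (\<lambda>y. y * F y) else (\<lambda>y. 1)) (x j)) \<partial>gauss ?J) = (\<Prod>j\<in>?J. integral\<^sup>L ?n (if j then (\<lambda>y. y * F y) else (\<lambda>y. 1)))"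
      by (rule integral_gauss_prod[OF finite, where f="\<lambda>j. if j then (\<lambda>y. y * F y) else (\<lambda>y. 1)"]) (use ixF in simp)
    also have "\<dots> = (\<integral>y. y * F y \<partial>?n) * (\<integral>y. 1 \<partial>?n)" by (simp add: UNIV_bool)
    finally show ?thesis using n.prob_space by simp
  qed
  also have "(\<integral>x. (\<Prod>j\<in>?J. (if j then F else (\<lambda>y. y)) (x j)) \<partial>gauss ?J) = 0"
  proof -
    have "(\<integral>x. (\<Prod>j\<in>?J. (if j then F else (\<lambda>y. y)) (x j)) \<partial>gauss ?J) = (\<Prod>j\<in>?J. integral\<^sup>L ?n (if j then F else (\<lambda>y. y)))"
      by (rule integral_gauss_prod[OF finite, where f="\<lambda>j. if j then F else (\<lambda>y. y)"]) (use ix iF in simp)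
    also have "\<dots> = integral\<^sup>L ?n F * (\<integral>y. y \<partial>?n)" by (simp add: UNIV_bool)
    also have "(\<integral>y. y \<partial>?n) = 0" using integral_std_normal_distribution_moment_odd[of 1] by simp
    finally show ?thesis by simp
  qed
  also have "(\<integral>y. y * F y \<partial>?n) = sqrt q * \<beta> * (1 - q)"
  proof -
    have m2: "(\<lambda>z. (F z)\<^sup>2) \<in> borel_measurable ?n" unfolding power2_eq_square by (rule borel_measurable_times[OF mFn(1) mFn(1)])
    have i2: "integrable ?n (\<lambda>z. (F z)\<^sup>2)"
    proof (rule n.integrable_const_bound[OF AE_I2 m2])
      fix z show "norm ((F z)\<^sup>2) \<le> 1" using bF[of z] unfolding abs_square_le_1[symmetric] by simp
    qed
    have "(\<integral>y. y * F y \<partial>?n) = (\<integral>z. sqrt q * \<beta> * (1 - (F z)\<^sup>2) \<partial>?n)" unfolding F_def by (rule stein_Th)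
    also have "\<dots> = sqrt q * \<beta> * (\<integral>z. 1 - (F z)\<^sup>2 \<partial>?n)" by (rule integral_mult_right_zero)
    also have "(\<integral>z. 1 - (F z)\<^sup>2 \<partial>?n) = (\<integral>z. 1 \<partial>?n) - (\<integral>z. (F z)\<^sup>2 \<partial>?n)"
      by (rule Bochner_Integration.integral_diff[OF n.integrable_const i2])
    also have "(\<integral>z. (F z)\<^sup>2 \<partial>?n) = q" using fp by (simp add: sk_fixed_point_def F_def Th_def mult.assoc)
    finally show ?thesis using n.prob_space by simp
  qed
  finally show ?thesis using q by (simp add: a_def)
qed

lemma measurable_Th_lin_PiM: "(\<lambda>x. Th \<beta> h (\<Sum>j\<in>I. c j * x j)) \<in> borel_measurable (PiM I (\<lambda>_. borel))"
  by (intro borel_measurable_Th borel_measurable_sum borel_measurable_times borel_measurable_const measurable_component_singleton)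

section \<open>The induction over the iterates\<close>

definition MK :: "nat \<Rightarrow> nat \<Rightarrow> (gidx \<Rightarrow> real) measure" where "MK K N = gauss (Zidx K N \<union> Xidx N)"

definition thv :: "real \<Rightarrow> real \<Rightarrow> nat \<Rightarrow> (nat \<Rightarrow> real) \<Rightarrow> (gidx \<Rightarrow> real) \<Rightarrow> nat \<Rightarrow> real" where
  "thv \<beta> h K c \<omega> i = Th \<beta> h (\<Sum>j=1..K. c j * zvec \<omega> j i)"

lemma prob_family_MK: "prob_family (MK K)"
  unfolding MK_def by (rule prob_family.intro) (rule prob_space_gauss)

lemma rvec_zvec: "l \<in> {1..K} \<Longrightarrow> rvec (MK K) (\<lambda>N \<omega>. zvec \<omega> l)"
  unfolding rvec_def MK_def by (intro allI impI ballI borel_measurable_zvec[of l K]) auto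

lemma rvec_thv: "rvec (MK K) (\<lambda>N. thv \<beta> h K c)"
  unfolding rvec_def MK_def thv_def
  by (intro allI impI ballI borel_measurable_Th borel_measurable_sum borel_measurable_times borel_measurable_const
      borel_measurable_zvec[of _ K]) auto

lemma nnorm_thv: "nnorm N (thv \<beta> h K c \<omega>) \<le> 1"
  by (rule nnorm_le_const) (simp_all add: thv_def Th_bound)

lemma conv_column:
  assumes f: "f \<in> borel_measurable (PiM {1..K} (\<lambda>_. borel))" and l: "l \<in> {1..K}" and bd: "\<And>x. \<bar>f x\<bar> \<le> 1 + (x l)\<^sup>2"
  shows "conv (MK K) (\<lambda>N \<omega>. 1 / real N * (\<Sum>i=1..N. f (\<lambda>k\<in>{1..K}. zvec \<omega> k i))) (\<integral>x. f x \<partial>gauss {1..K})"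
  unfolding MK_def zvec_def
  by (rule conv_column_average[where idx="\<lambda>k i. Inl (k, i)", OF _ _ f l bd]) (auto simp: inj_on_def Zidx_def)

lemma conv_thv_thv:
  assumes K: "K \<ge> 1"
  shows "conv (MK K) (\<lambda>N \<omega>. ninner N (thv \<beta> h K c \<omega>) (thv \<beta> h K d \<omega>))
    (\<integral>x. Th \<beta> h (\<Sum>j\<in>{1..K}. c j * x j) * Th \<beta> h (\<Sum>j\<in>{1..K}. d j * x j) \<partial>gauss {1..K})"
proof -
  have l: "1 \<in> {1..K}" using K by simp
  have bd: "\<bar>Th \<beta> h a * Th \<beta> h b\<bar> \<le> 1 + y\<^sup>2" for a b y
  proof -
    have "\<bar>Th \<beta> h a * Th \<beta> h b\<bar> \<le> 1 * 1" unfolding abs_mult by (intro mult_mono Th_bound) auto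
    then show ?thesis using zero_le_power2[of y] by linarith
  qed
  have "conv (MK K) (\<lambda>N \<omega>. 1 / real N * (\<Sum>i=1..N. Th \<beta> h (\<Sum>j\<in>{1..K}. c j * (\<lambda>k\<in>{1..K}. zvec \<omega> k i) j) * Th \<beta> h (\<Sum>j\<in>{1..K}. d j * (\<lambda>k\<in>{1..K}. zvec \<omega> k i) j)))
    (\<integral>x. Th \<beta> h (\<Sum>j\<in>{1..K}. c j * x j) * Th \<beta> h (\<Sum>j\<in>{1..K}. d j * x j) \<partial>gauss {1..K})"
    by (rule conv_column[OF _ l bd]) (intro borel_measurable_times measurable_Th_lin_PiM)
  then show ?thesis by (simp only: ninner_def thv_def restrict_apply' cong: sum.cong)
qed

lemma conv_one_thv:
  assumes K: "K \<ge> 1"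
  shows "conv (MK K) (\<lambda>N \<omega>. ninner N (\<lambda>_. 1) (thv \<beta> h K c \<omega>)) (\<integral>x. Th \<beta> h (\<Sum>j\<in>{1..K}. c j * x j) \<partial>gauss {1..K})"
proof -
  have l: "1 \<in> {1..K}" using K by simp
  have bd: "\<bar>Th \<beta> h a\<bar> \<le> 1 + y\<^sup>2" for a y
    using Th_bound[of \<beta> h a] by (simp add: add_increasing2)
  have "conv (MK K) (\<lambda>N \<omega>. 1 / real N * (\<Sum>i=1..N. Th \<beta> h (\<Sum>j\<in>{1..K}. c j * (\<lambda>k\<in>{1..K}. zvec \<omega> k i) j)))
    (\<integral>x. Th \<beta> h (\<Sum>j\<in>{1..K}. c j * x j) \<partial>gauss {1..K})"
    by (rule conv_column[OF measurable_Th_lin_PiM l bd])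
  then show ?thesis by (simp only: ninner_def thv_def restrict_apply' mult_1_left cong: sum.cong)
qed

lemma conv_z_thv:
  assumes l: "l \<in> {1..K}"
  shows "conv (MK K) (\<lambda>N \<omega>. ninner N (zvec \<omega> l) (thv \<beta> h K c \<omega>)) (\<integral>x. x l * Th \<beta> h (\<Sum>j\<in>{1..K}. c j * x j) \<partial>gauss {1..K})"
proof -
  have bd: "\<bar>y * Th \<beta> h a\<bar> \<le> 1 + y\<^sup>2" for a y
  proof -
    have "\<bar>y * Th \<beta> h a\<bar> \<le> \<bar>y\<bar> * 1" unfolding abs_mult by (intro mult_left_mono Th_bound) simp
    also have "2 * \<bar>y\<bar> \<le> 1 + y\<^sup>2" using zero_le_power2[of "\<bar>y\<bar> - 1"] by (simp add: power2_eq_square algebra_simps)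
    then have "\<bar>y\<bar> * 1 \<le> 1 + y\<^sup>2" by simp
    finally show ?thesis .
  qed
  have "conv (MK K) (\<lambda>N \<omega>. 1 / real N * (\<Sum>i=1..N. (\<lambda>k\<in>{1..K}. zvec \<omega> k i) l * Th \<beta> h (\<Sum>j\<in>{1..K}. c j * (\<lambda>k\<in>{1..K}. zvec \<omega> k i) j)))
    (\<integral>x. x l * Th \<beta> h (\<Sum>j\<in>{1..K}. c j * x j) \<partial>gauss {1..K})"
    by (rule conv_column[OF _ l bd]) (intro borel_measurable_times measurable_Th_lin_PiM measurable_component_singleton l)
  then show ?thesis using l by (simp only: ninner_def thv_def restrict_apply' cong: sum.cong)
qed

lemma zvec_bounded:
  assumes l: "l \<in> {1..K}"
  shows "\<exists>B. wop (MK K) (\<lambda>N \<omega>. nnorm N (zvec \<omega> l) \<le> B)"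
proof -
  interpret prob_family "MK K" by (rule prob_family_MK)
  have "conv (MK K) (\<lambda>N \<omega>. 1 / real N * (\<Sum>i=1..N. (\<lambda>k\<in>{1..K}. zvec \<omega> k i) l * (\<lambda>k\<in>{1..K}. zvec \<omega> k i) l)) (\<integral>x. x l * x l \<partial>gauss {1..K})"
    by (rule conv_column[OF _ l]) (intro borel_measurable_times measurable_component_singleton l, simp add: power2_eq_square)
  then have c: "conv (MK K) (\<lambda>N \<omega>. ninner N (zvec \<omega> l) (zvec \<omega> l)) (\<integral>x. x l * x l \<partial>gauss {1..K})"
    using l by (simp only: ninner_def restrict_apply' cong: sum.cong)
  show ?thesis
  proof (rule exI, rule wop_mono[OF conv_bdd[OF c]])
    fix N \<omega> assume "\<bar>ninner N (zvec \<omega> l) (zvec \<omega> l)\<bar> \<le> \<bar>\<integral>x. x l * x l \<partial>gauss {1..K}\<bar> + 1"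
    then show "nnorm N (zvec \<omega> l) \<le> sqrt (\<bar>\<integral>x. x l * x l \<partial>gauss {1..K}\<bar> + 1)"
      unfolding nnorm_def by (intro real_sqrt_le_mono) linarith
  qed
qed

text \<open>The direction involves only fresh vectors with index below \<open>j \<le> k\<close>.
  With all coordinates outside row \<open>k\<close> frozen, the inner product is a centred Gaussian
  of variance \<open>1 / N\<close>.\<close>

lemma zphi_zvec_tail:
  assumes N: "N \<ge> 1" and jk: "1 \<le> j" "j \<le> k" "k \<le> K" and t: "t > 0"
  shows "measure (MK K N) {\<omega> \<in> space (MK K N). t \<le> \<bar>ninner N (zphi \<beta> h q N (zvec \<omega>) j) (zvec \<omega> k)\<bar>} \<le> 2 * exp (- (t\<^sup>2 * real N / 2))"
proof -
  define S where "S = Zidx K N \<union> Xidx N"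
  define J where "J = (Inl ` ({k} \<times> {1..N}) :: gidx set)"
  define I where "I = S - J"
  have JS: "J \<subseteq> S" using jk by (auto simp: J_def S_def Zidx_def)
  have IJ: "I \<inter> J = {}" "finite I" "finite J" "I \<union> J = S" using JS by (auto simp: I_def S_def J_def)
  interpret prob_space "gauss S" by (rule prob_space_gauss)
  interpret GI: prob_space "gauss I" by (rule prob_space_gauss)
  interpret GJ: prob_space "gauss J" by (rule prob_space_gauss)
  define X where "X \<omega> = ninner N (zphi \<beta> h q N (zvec \<omega>) j) (zvec \<omega> k)" for \<omega>
  have kK: "k \<in> {1..K}" using jk by simp
  have mX: "X \<in> borel_measurable (gauss S)"
    unfolding X_def
  proof (rule borel_measurable_ninner)
    fix i assume i: "i \<in> {1..N}"
    show "(\<lambda>\<omega>. zvec \<omega> k i) \<in> borel_measurable (gauss S)"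
      by (rule borel_measurable_zvec[OF kK i]) (simp add: S_def)
    show "(\<lambda>\<omega>. zphi \<beta> h q N (zvec \<omega>) j i) \<in> borel_measurable (gauss S)"
    proof (rule borel_measurable_zphi[OF N jk(1) _ i])
      fix l i assume "l \<in> {1..j - 1}" "i \<in> {1..N}"
      then have "l \<in> {1..K}" "i \<in> {1..N}" using jk by auto
      then show "(\<lambda>\<omega>. zvec \<omega> l i) \<in> borel_measurable (gauss S)" by (rule borel_measurable_zvec) (simp add: S_def)
    qed
  qed
  define E where "E = {\<omega> \<in> space (gauss S). t \<le> \<bar>X \<omega>\<bar>}"
  have E: "E \<in> sets (gauss S)" unfolding E_def by (intro borel_measurable_le borel_measurable_const borel_measurable_abs mX)
  have inner: "(\<integral>\<^sup>+y. indicator E (merge I J (x, y)) \<partial>gauss J) \<le> ennreal (2 * exp (- (t\<^sup>2 * real N / 2)))"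
    if x: "x \<in> space (gauss I)" for x
  proof -
    define \<phi> where "\<phi> = zphi \<beta> h q N (zvec x) j"
    define c where "c p = (case p of Inl (a, i) \<Rightarrow> \<phi> i / real N | Inr _ \<Rightarrow> 0)" for p :: gidx
    have XE: "X (merge I J (x, y)) = (\<Sum>p\<in>J. c p * y p)" for y
    proof -
      have p: "zphi \<beta> h q N (zvec (merge I J (x, y))) j = \<phi>" unfolding \<phi>_def
      proof (rule zphi_cong)
        fix l i assume "l \<in> {1..j - 1}" "i \<in> {1..N}"
        then have "Inl (l, i) \<in> I" using jk by (auto simp: I_def S_def J_def Zidx_def)
        then show "zvec (merge I J (x, y)) l i = zvec x l i" by (simp add: zvec_def merge_def)
      qed
      have z: "zvec (merge I J (x, y)) k i = y (Inl (k, i))" if "i \<in> {1..N}" for i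
        using that IJ(1) by (auto simp: zvec_def merge_def J_def)
      have "X (merge I J (x, y)) = 1 / real N * (\<Sum>i=1..N. \<phi> i * y (Inl (k, i)))"
        unfolding X_def p ninner_def by (intro arg_cong2[of _ _ _ _ "(*)"] refl sum.cong) (simp only: z)
      also have "\<dots> = (\<Sum>p\<in>J. c p * y p)" unfolding J_def sum_row by (simp add: c_def sum_distrib_left)
      finally show ?thesis .
    qed
    have cv: "(\<Sum>p\<in>J. (c p)\<^sup>2) \<le> 1 / real N"
    proof -
      have "(\<Sum>p\<in>J. (c p)\<^sup>2) = (\<Sum>i=1..N. \<phi> i * \<phi> i) / (real N)\<^sup>2"
        unfolding J_def sum_row by (simp add: c_def power_divide power2_eq_square sum_divide_distrib)
      also have "(\<Sum>i=1..N. \<phi> i * \<phi> i) = real N" by (rule unit_sum[OF N]) (simp add: \<phi>_def nnorm_zphi[OF N])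
      finally show ?thesis using N by (simp add: power2_eq_square)
    qed
    have "(\<integral>\<^sup>+y. indicator E (merge I J (x, y)) \<partial>gauss J) \<le> (\<integral>\<^sup>+y. indicator {y \<in> space (gauss J). t \<le> \<bar>\<Sum>p\<in>J. c p * y p\<bar>} y \<partial>gauss J)"
      by (intro nn_integral_mono) (auto simp: indicator_def E_def XE)
    also have "\<dots> = emeasure (gauss J) {y \<in> space (gauss J). t \<le> \<bar>\<Sum>p\<in>J. c p * y p\<bar>}"
      by (intro nn_integral_indicator borel_measurable_le borel_measurable_const borel_measurable_abs borel_measurable_lin order_refl)
    also have "\<dots> = ennreal (measure (gauss J) {y \<in> space (gauss J). t \<le> \<bar>\<Sum>p\<in>J. c p * y p\<bar>})"
      by (rule GJ.emeasure_eq_measure)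
    also have "\<dots> \<le> ennreal (2 * exp (- (t\<^sup>2 / (2 * (1 / real N)))))"
      using N by (intro ennreal_leI gauss_linear_tail IJ(3) cv t) simp
    also have "t\<^sup>2 / (2 * (1 / real N)) = t\<^sup>2 * real N / 2" by simp
    finally show ?thesis .
  qed
  have "ennreal (measure (gauss S) E) = (\<integral>\<^sup>+\<omega>. indicator E \<omega> \<partial>gauss S)"
    unfolding nn_integral_indicator[OF E] by (rule emeasure_eq_measure[symmetric])
  also have "\<dots> = (\<integral>\<^sup>+x. \<integral>\<^sup>+y. indicator E (merge I J (x, y)) \<partial>gauss J \<partial>gauss I)"
    unfolding IJ(4)[symmetric] by (rule nn_integral_gauss_fold[OF IJ(1-3)]) (unfold IJ(4), rule borel_measurable_indicator[OF E])
  also have "\<dots> \<le> (\<integral>\<^sup>+x. ennreal (2 * exp (- (t\<^sup>2 * real N / 2))) \<partial>gauss I)"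
    by (rule nn_integral_mono) (rule inner)
  also have "\<dots> = ennreal (2 * exp (- (t\<^sup>2 * real N / 2)))" by (simp add: GI.emeasure_space_1)
  finally have "measure (gauss S) E \<le> 2 * exp (- (t\<^sup>2 * real N / 2))" by (subst (asm) ennreal_le_iff) simp_all
  then show ?thesis by (simp only: E_def X_def MK_def S_def)
qed

lemma rvec_zphi: "1 \<le> j \<Longrightarrow> j \<le> Suc K \<Longrightarrow> rvec (MK K) (\<lambda>N \<omega>. zphi \<beta> h q N (zvec \<omega>) j)"
  unfolding rvec_def MK_def
proof (intro allI impI ballI)
  fix N i :: nat assume jK: "1 \<le> j" "j \<le> Suc K" and N: "1 \<le> N" and i: "i \<in> {1..N}"
  show "(\<lambda>\<omega>. zphi \<beta> h q N (zvec \<omega>) j i) \<in> borel_measurable (gauss (Zidx K N \<union> Xidx N))"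
  proof (rule borel_measurable_zphi[OF N jK(1) _ i])
    fix l i assume "l \<in> {1..j - 1}" "i \<in> {1..N}"
    then have "l \<in> {1..K}" "i \<in> {1..N}" using jK by auto
    then show "(\<lambda>\<omega>. zvec \<omega> l i) \<in> borel_measurable (gauss (Zidx K N \<union> Xidx N))" by (rule borel_measurable_zvec) simp
  qed
qed

lemma negl_zphi_zvec:
  assumes jk: "1 \<le> j" "j \<le> k" "k \<le> K"
  shows "negl (MK K) (\<lambda>N \<omega>. ninner N (zphi \<beta> h q N (zvec \<omega>) j) (zvec \<omega> k))"
  unfolding negl_def
proof (intro conjI exI[of _ 2] allI impI)
  show "rvs (MK K) (\<lambda>N \<omega>. ninner N (zphi \<beta> h q N (zvec \<omega>) j) (zvec \<omega> k))"
    by (intro rvs_ninner rvec_zphi rvec_zvec) (use jk in auto)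
  fix N :: nat and t :: real assume "1 \<le> N" "0 < t \<and> t \<le> 1"
  then show "measure (MK K N) {\<omega> \<in> space (MK K N). t \<le> \<bar>ninner N (zphi \<beta> h q N (zvec \<omega>) j) (zvec \<omega> k)\<bar>} \<le> 2 * exp (- (t\<^sup>2 * real N / 2))"
    by (intro zphi_zvec_tail jk) auto
qed simp

section \<open>The constants and the covariances of the limiting Gaussian arguments\<close>

locale sk_system =
  fixes \<beta> h q :: real
  assumes h: "h > 0" and b: "\<beta> > 0" and fp: "sk_fixed_point \<beta> h q"
begin

abbreviation "\<rho> \<equiv> sk_rho \<beta> h q"
abbreviation "\<gamma> \<equiv> sk_gamma \<beta> h q"

definition G2 :: "nat \<Rightarrow> real" where "G2 k = (\<Sum>j=1..k. (\<gamma> j)\<^sup>2)"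

text \<open>
  \<open>\<Sum>j. cc k j * z\<^sup>j\<close> approximates the argument of \<^const>\<open>Th\<close> in the iterate \<open>k + 1\<close>. The coefficients \<open>cd k\<close>
  describe a copy of it whose last component uses another fresh vector; it serves to show
  \<open>G2 k < q\<close>.
\<close>

definition cc :: "nat \<Rightarrow> nat \<Rightarrow> real" where
  "cc k j = (if j < k then \<gamma> j else if j = k then sqrt (q - G2 (k - 1)) else 0)"

definition cd :: "nat \<Rightarrow> nat \<Rightarrow> real" where
  "cd k j = (if j < k then \<gamma> j else if j = Suc k then sqrt (q - G2 (k - 1)) else 0)"

lemma q0: "q > 0" using fp by (simp add: sk_fixed_point_def)

lemma G2_nonneg: "0 \<le> G2 k" unfolding G2_def by (intro sum_nonneg) simp

text \<open>Multiplied out, the recursion has no exception at \<open>j = 1\<close>, where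
  \<open>sk_gamma\<close> starts from \<open>sk_alpha\<close>, and \<open>\<rho> 1\<close> is
  \<open>sk_alpha\<close> times \<open>sqrt q\<close>.\<close>

lemma gamma_rel: "1 \<le> j \<Longrightarrow> G2 (j - 1) < q \<Longrightarrow> \<gamma> j * sqrt (q - G2 (j - 1)) = \<rho> j - G2 (j - 1)"
proof (cases "j = 1")
  case True
  then show ?thesis by (simp add: G2_def sk_gamma.simps[of \<beta> h q "Suc 0"])
next
  case False
  assume "1 \<le> j" "G2 (j - 1) < q"
  then show ?thesis using False by (subst sk_gamma.simps) (simp add: G2_def)
qed

lemma rho_nonneg: "0 \<le> \<rho> j"
proof -
  consider "j = 0" | "j = 1" | i where "j = Suc (Suc i)" by (metis One_nat_def not0_implies_Suc)
  then show ?thesis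
  proof cases
    case 2 then show ?thesis using alpha_nonneg[OF h] q0 by simp
  qed (simp_all add: psi_nonneg)
qed

lemma rho_Suc: "1 \<le> j \<Longrightarrow> \<rho> (Suc j) = sk_psi \<beta> h q (\<rho> j)"
  by (cases j) auto

lemma cc_sum:
  assumes "1 \<le> k" "k \<le> K"
  shows "(\<Sum>j=1..K. cc k j * w j) = (\<Sum>j=1..k - 1. \<gamma> j * w j) + sqrt (q - G2 (k - 1)) * w k"
proof -
  have "(\<Sum>j=1..K. cc k j * w j) = (\<Sum>j\<in>insert k {1..k - 1}. cc k j * w j)"
    using assms by (intro sum.mono_neutral_right) (auto simp: cc_def)
  also have "\<dots> = cc k k * w k + (\<Sum>j=1..k - 1. cc k j * w j)" using assms by (subst sum.insert) auto
  also have "(\<Sum>j=1..k - 1. cc k j * w j) = (\<Sum>j=1..k - 1. \<gamma> j * w j)" by (intro sum.cong) (auto simp: cc_def)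
  finally show ?thesis by (simp add: cc_def)
qed

lemma cd_sum:
  assumes "1 \<le> k" "Suc k \<le> K"
  shows "(\<Sum>j=1..K. cd k j * w j) = (\<Sum>j=1..k - 1. \<gamma> j * w j) + sqrt (q - G2 (k - 1)) * w (Suc k)"
proof -
  have "(\<Sum>j=1..K. cd k j * w j) = (\<Sum>j\<in>insert (Suc k) {1..k - 1}. cd k j * w j)"
    using assms by (intro sum.mono_neutral_right) (auto simp: cd_def)
  also have "\<dots> = cd k (Suc k) * w (Suc k) + (\<Sum>j=1..k - 1. cd k j * w j)" using assms by (subst sum.insert) auto
  also have "(\<Sum>j=1..k - 1. cd k j * w j) = (\<Sum>j=1..k - 1. \<gamma> j * w j)" by (intro sum.cong) (auto simp: cd_def)
  finally show ?thesis by (simp add: cd_def)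
qed

lemma gamma_sum_cc: "j \<le> k \<Longrightarrow> (\<Sum>l=1..j - 1. \<gamma> l * cc k l) = G2 (j - 1)"
  unfolding G2_def by (intro sum.cong) (auto simp: cc_def power2_eq_square)

lemma gamma_sum_cd: "j \<le> k \<Longrightarrow> (\<Sum>l=1..j - 1. \<gamma> l * cd k l) = G2 (j - 1)"
  unfolding G2_def by (intro sum.cong) (auto simp: cd_def power2_eq_square)

text \<open>Together with \<open>cov_cc_lt\<close> this identifies \<open>cc\<close> as the Cholesky
  factor of the matrix with \<open>q\<close> on the diagonal and \<open>\<rho> j\<close> in position
  \<open>(j, k)\<close> for \<open>j < k\<close>. So the \<gamma>s are also the Gram-Schmidt
  coefficients of the limiting Gaussian family.\<close>

lemma cov_cc_cc: "1 \<le> k \<Longrightarrow> k \<le> K \<Longrightarrow> G2 (k - 1) < q \<Longrightarrow> (\<Sum>j=1..K. cc k j * cc k j) = q"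
  using cc_sum[of k K "cc k"] gamma_sum_cc[of k k] by (simp add: cc_def[of k k])

lemma cov_cc_lt: "1 \<le> j \<Longrightarrow> j < k \<Longrightarrow> k \<le> K \<Longrightarrow> G2 (j - 1) < q \<Longrightarrow> (\<Sum>l=1..K. cc j l * cc k l) = \<rho> j"
  using gamma_rel[of j] cc_sum[of j K "cc k"] gamma_sum_cc[of j k] by (simp add: cc_def[of k j] mult.commute)

lemma cov_cd_cd: "1 \<le> k \<Longrightarrow> Suc k \<le> K \<Longrightarrow> G2 (k - 1) < q \<Longrightarrow> (\<Sum>j=1..K. cd k j * cd k j) = q"
  using cd_sum[of k K "cd k"] gamma_sum_cd[of k k] by (simp add: cd_def[of k "Suc k"])

lemma cov_cc_cd_lt: "1 \<le> j \<Longrightarrow> j < k \<Longrightarrow> Suc k \<le> K \<Longrightarrow> G2 (j - 1) < q \<Longrightarrow> (\<Sum>l=1..K. cc j l * cd k l) = \<rho> j"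
  using gamma_rel[of j] cc_sum[of j K "cd k"] gamma_sum_cd[of j k] by (simp add: cd_def[of k j] mult.commute)

text \<open>The two copies share their components below \<open>k\<close> and carry the last ones on
  different fresh vectors.\<close>

lemma cov_cc_cd: "1 \<le> k \<Longrightarrow> Suc k \<le> K \<Longrightarrow> (\<Sum>l=1..K. cc k l * cd k l) = G2 (k - 1)"
  using cc_sum[of k K "cd k"] gamma_sum_cd[of k k] by (simp add: cd_def[of k k])

lemma conv_thv_q:
  assumes K: "K \<ge> 1" and c: "(\<Sum>j=1..K. c j * c j) = q"
  shows "conv (MK K) (\<lambda>N \<omega>. ninner N (thv \<beta> h K c \<omega>) (thv \<beta> h K c \<omega>)) q"
proof -
  have "(\<integral>x. Th \<beta> h (\<Sum>j\<in>{1..K}. c j * x j) * Th \<beta> h (\<Sum>j\<in>{1..K}. c j * x j) \<partial>gauss {1..K}) =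
     (\<integral>z. Th \<beta> h (sqrt q * z) * Th \<beta> h (sqrt q * z) \<partial>std_normal_distribution)"
    by (rule integral_single_law[of "{1..K}" "\<lambda>y. Th \<beta> h y * Th \<beta> h y", OF _ _ c])
       (simp, intro borel_measurable_times borel_measurable_Th measurable_id_borel)
  also have "\<dots> = q" using fp by (simp add: sk_fixed_point_def Th_def power2_eq_square mult.assoc)
  finally show ?thesis using conv_thv_thv[OF K, of \<beta> h c c] by simp
qed

lemma conv_thv_psi:
  assumes K: "K \<ge> 1" and c: "(\<Sum>j=1..K. c j * c j) = q" "(\<Sum>j=1..K. d j * d j) = q" "(\<Sum>j=1..K. c j * d j) = t" and t: "0 \<le> t"
  shows "conv (MK K) (\<lambda>N \<omega>. ninner N (thv \<beta> h K c \<omega>) (thv \<beta> h K d \<omega>)) (sk_psi \<beta> h q t)"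
  using conv_thv_thv[OF K, of \<beta> h c d] unfolding psi_eq[OF t finite_atLeastAtMost c] .

lemma conv_thv_alpha:
  assumes K: "K \<ge> 1" and c: "(\<Sum>j=1..K. c j * c j) = q"
  shows "conv (MK K) (\<lambda>N \<omega>. ninner N (\<lambda>_. 1) (thv \<beta> h K c \<omega>)) (sk_alpha \<beta> h q)"
proof -
  have "(\<integral>x. Th \<beta> h (\<Sum>j\<in>{1..K}. c j * x j) \<partial>gauss {1..K}) = (\<integral>z. Th \<beta> h (sqrt q * z) \<partial>std_normal_distribution)"
    by (rule integral_single_law[of "{1..K}" "\<lambda>y. Th \<beta> h y", OF _ _ c])
       (simp, intro borel_measurable_Th measurable_id_borel)
  then show ?thesis using conv_one_thv[OF K, of \<beta> h c] by (simp only: sk_alpha_def)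
qed

lemma conv_thv_stein:
  assumes l: "l \<in> {1..K}" and c: "(\<Sum>j=1..K. c j * c j) = q"
  shows "conv (MK K) (\<lambda>N \<omega>. ninner N (zvec \<omega> l) (thv \<beta> h K c \<omega>)) (\<beta> * (1 - q) * c l)"
  using conv_z_thv[OF l, of \<beta> h c] unfolding stein_gauss[OF finite_atLeastAtMost l q0 c fp] .


lemma sk_m_bdd: "\<bar>sk_m \<beta> h q N G k i\<bar> \<le> max 1 (sqrt q)"
proof -
  consider "k = 0" | "k = 1" | l where "k = Suc (Suc l)" by (metis One_nat_def not0_implies_Suc)
  then show ?thesis
  proof cases
    case 3
    have "\<bar>Th \<beta> h y\<bar> \<le> max 1 (sqrt q)" for y using Th_bound[of \<beta> h y] by linarith
    moreover have "0 \<le> max 1 (sqrt q)" by (rule order_trans[OF zero_le_one max.cobounded1])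
    ultimately show ?thesis using 3 by (simp only: sk_m.simps vec_of_def abs_zero split: if_split) blast
  qed (use q0 in \<open>auto simp: vec_of_def\<close>)
qed

context
  fixes K :: nat
begin

interpretation prob_family "MK K" by (rule prob_family_MK)

definition GG :: "nat \<Rightarrow> (gidx \<Rightarrow> real) \<Rightarrow> nat \<Rightarrow> nat \<Rightarrow> real" where
  "GG N \<omega> = Tmat \<beta> h q N (zvec \<omega>) K (goe N \<omega>)"

definition mk :: "nat \<Rightarrow> (gidx \<Rightarrow> real) \<Rightarrow> nat \<Rightarrow> nat \<Rightarrow> real" where
  "mk N \<omega> = sk_m \<beta> h q N (GG N \<omega>)"

abbreviation Phi :: "nat \<Rightarrow> (gidx \<Rightarrow> real) \<Rightarrow> nat \<Rightarrow> nat \<Rightarrow> real" where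
  "Phi N \<omega> \<equiv> zphi \<beta> h q N (zvec \<omega>)"

text \<open>The strict bounds keep Gram-Schmidt nondegenerate in the limit. Closeness to
  \<open>thv\<close> belongs to the hypothesis because iterates must be tested against functions of
  the fresh vectors, not only against each other. \<open>K\<close> stays fixed throughout.\<close>

definition amp_inv :: "nat \<Rightarrow> bool" where
  "amp_inv k \<longleftrightarrow> (\<forall>j<k. G2 j < q)
    \<and> (\<forall>i\<in>{1..k}. conv (MK K) (\<lambda>N \<omega>. ninner N (mk N \<omega> i) (mk N \<omega> i)) q)
    \<and> (\<forall>i j. 1 \<le> i \<longrightarrow> i < j \<longrightarrow> j \<le> k \<longrightarrow> conv (MK K) (\<lambda>N \<omega>. ninner N (mk N \<omega> i) (mk N \<omega> j)) (\<rho> i))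
    \<and> (\<forall>j. 1 \<le> j \<longrightarrow> j < k \<longrightarrow> negl (MK K) (\<lambda>N \<omega>. nnorm N (\<lambda>i. mk N \<omega> (Suc j) i - thv \<beta> h K (cc j) \<omega> i)))"

lemma rvec_mk: "rvec (MK K) (\<lambda>N \<omega>. mk N \<omega> l)"
  unfolding rvec_def
proof (intro allI impI ballI)
  fix N i :: nat assume N: "1 \<le> N" and i: "i \<in> {1..N}"
  show "(\<lambda>\<omega>. mk N \<omega> l i) \<in> borel_measurable (MK K N)"
    unfolding mk_def GG_def MK_def
  proof (rule borel_measurable_sk_m[OF _ i])
    fix a b assume ab: "a \<in> {1..N}" "b \<in> {1..N}"
    show "(\<lambda>\<omega>. Tmat \<beta> h q N (zvec \<omega>) K (goe N \<omega>) a b) \<in> borel_measurable (gauss (Zidx K N \<union> Xidx N))"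
      by (rule borel_measurable_Tmat[OF N borel_measurable_zvec borel_measurable_goe ab]) auto
  qed
qed

lemma nnorm_mk: "nnorm N (mk N \<omega> l) \<le> max 1 (sqrt q)"
  unfolding mk_def by (rule nnorm_le_const[OF sk_m_bdd]) simp

section \<open>The induction step\<close>

context
  fixes k :: nat
  assumes amp_inv: "amp_inv k" and k1: "1 \<le> k"
begin

lemma amp_inv_pos: "j < k \<Longrightarrow> G2 j < q" using amp_inv by (simp add: amp_inv_def)
lemma amp_inv_diag: "i \<in> {1..k} \<Longrightarrow> conv (MK K) (\<lambda>N \<omega>. ninner N (mk N \<omega> i) (mk N \<omega> i)) q" using amp_inv unfolding amp_inv_def by blast
lemma amp_inv_off: "1 \<le> i \<Longrightarrow> i < j \<Longrightarrow> j \<le> k \<Longrightarrow> conv (MK K) (\<lambda>N \<omega>. ninner N (mk N \<omega> i) (mk N \<omega> j)) (\<rho> i)"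
  using amp_inv unfolding amp_inv_def by blast
lemma amp_inv_close: "1 \<le> j \<Longrightarrow> j < k \<Longrightarrow> negl (MK K) (\<lambda>N \<omega>. nnorm N (\<lambda>i. mk N \<omega> (Suc j) i - thv \<beta> h K (cc j) \<omega> i))"
  using amp_inv unfolding amp_inv_def by blast

lemma amp_inv_gs:
  assumes j: "j \<in> {1..k}"
  shows "conv (MK K) (\<lambda>N \<omega>. nnorm N (gs_M N (mk N \<omega>) j)) (sqrt (q - G2 (j - 1)))"
    and "rvec (MK K) u \<Longrightarrow> (\<And>i. i \<in> {1..j} \<Longrightarrow> conv (MK K) (\<lambda>N \<omega>. ninner N (mk N \<omega> i) (u N \<omega>)) (\<rho> i)) \<Longrightarrow>
       conv (MK K) (\<lambda>N \<omega>. ninner N (gs_phi N (mk N \<omega>) j) (u N \<omega>)) (\<gamma> j)"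
proof -
  have pos: "(\<Sum>l=1..j - 1. (\<gamma> l)\<^sup>2) < q" if "j \<in> {1..k}" for j
  proof -
    have "j - 1 < k" using that by auto
    from amp_inv_pos[OF this] show ?thesis by (simp only: G2_def)
  qed
  have rel: "\<gamma> j * sqrt (q - (\<Sum>l=1..j - 1. (\<gamma> l)\<^sup>2)) = \<rho> j - (\<Sum>l=1..j - 1. (\<gamma> l)\<^sup>2)" if "j \<in> {1..k}" for j
    using gamma_rel[of j] pos[OF that] that by (simp add: G2_def)
  have sp: "supp N (mk N \<omega> l)" for N \<omega> l unfolding mk_def by (rule supp_sk_m)
  note C = conv_gram_schmidt[where v=mk and n=k and r=\<rho> and g=\<gamma> and q=q, OF sp rvec_mk amp_inv_diag amp_inv_off pos rel j]
  show "conv (MK K) (\<lambda>N \<omega>. nnorm N (gs_M N (mk N \<omega>) j)) (sqrt (q - G2 (j - 1)))"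
    unfolding G2_def by (rule conjunct1[OF C])
  show "conv (MK K) (\<lambda>N \<omega>. ninner N (gs_phi N (mk N \<omega>) j) (u N \<omega>)) (\<gamma> j)"
    if "rvec (MK K) u" "\<And>i. i \<in> {1..j} \<Longrightarrow> conv (MK K) (\<lambda>N \<omega>. ninner N (mk N \<omega> i) (u N \<omega>)) (\<rho> i)"
    by (rule conjunct2[OF C, rule_format]) (assumption | rule that)+
qed

lemma amp_inv_good: "wop (MK K) (\<lambda>N \<omega>. \<forall>j\<in>{1..k}. nnorm N (gs_M N (mk N \<omega>) j) \<noteq> 0)"
proof (rule wop_ball[OF finite_atLeastAtMost])
  fix j assume j: "j \<in> {1..k}"
  have "0 < sqrt (q - G2 (j - 1))" using amp_inv_pos[of "j - 1"] j by auto
  from conv_gt[OF amp_inv_gs(1)[OF j] this] show "wop (MK K) (\<lambda>N \<omega>. nnorm N (gs_M N (mk N \<omega>) j) \<noteq> 0)"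
    by (rule wop_mono) simp
qed

lemma good_phi:
  assumes "k \<le> Suc K" "N \<ge> 1" "\<forall>j\<in>{1..k}. nnorm N (gs_M N (mk N \<omega>) j) \<noteq> 0" "j \<in> {1..k}"
  shows "gs_phi N (mk N \<omega>) j = Phi N \<omega> j"
proof -
  have "nnorm N (sk_M \<beta> h q N (Tmat \<beta> h q N (zvec \<omega>) K (goe N \<omega>)) l) \<noteq> 0" if "l \<in> {1..k}" for l
    using assms(3) that unfolding mk_def GG_def sk_M_gs by blast
  from sk_phi_eq_Phi[OF assms(2,1) this assms(4)] show ?thesis by (simp only: mk_def GG_def sk_phi_gs)
qed

text \<open>For \<open>j < i\<close> the limit is a \<gamma>, for \<open>j = i\<close> it is the
  limiting residual norm. These are the coefficients with which the fresh vectors enter the argument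
  of the next iterate.\<close>

lemma conv_Phi_mk:
  assumes kK: "k \<le> Suc K" and i: "i \<in> {1..k}" and j: "j \<in> {1..i}"
  shows "conv (MK K) (\<lambda>N \<omega>. ninner N (Phi N \<omega> j) (mk N \<omega> i)) (cc i j)"
proof -
  have jk: "j \<in> {1..k}" "1 \<le> j" "j \<le> Suc K" using i j kK by auto
  have rv: "rvs (MK K) (\<lambda>N \<omega>. ninner N (Phi N \<omega> j) (mk N \<omega> i))"
    by (rule rvs_ninner[OF rvec_zphi[OF jk(2,3)] rvec_mk])
  show ?thesis
  proof (cases "j = i")
    case False
    have c: "conv (MK K) (\<lambda>N \<omega>. ninner N (gs_phi N (mk N \<omega>) j) (mk N \<omega> i)) (\<gamma> j)"
      by (rule amp_inv_gs(2)[OF jk(1) rvec_mk], rule amp_inv_off) (use False i j in auto)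
    have "conv (MK K) (\<lambda>N \<omega>. ninner N (Phi N \<omega> j) (mk N \<omega> i)) (\<gamma> j)"
      by (rule conv_cong_wop[OF rv c], rule wop_mono[OF amp_inv_good]) (simp only: good_phi[OF kK _ _ jk(1)])
    then show ?thesis using False j by (simp add: cc_def)
  next
    case True
    have "conv (MK K) (\<lambda>N \<omega>. ninner N (Phi N \<omega> j) (mk N \<omega> i)) (sqrt (q - G2 (j - 1)))"
    proof (rule conv_cong_wop[OF rv amp_inv_gs(1)[OF jk(1)]], rule wop_mono[OF amp_inv_good])
      fix N \<omega> assume N: "N \<ge> (1::nat)" and g: "\<forall>j\<in>{1..k}. nnorm N (gs_M N (mk N \<omega>) j) \<noteq> 0"
      have sp: "supp N (mk N \<omega> l)" for l unfolding mk_def by (rule supp_sk_m)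
      have "ninner N (gs_phi N (mk N \<omega>) j) (mk N \<omega> j) = nnorm N (gs_M N (mk N \<omega>) j)"
        by (rule gs_phi_self[OF N sp _ jk(1)]) (use g in blast)
      then show "ninner N (Phi N \<omega> j) (mk N \<omega> i) = nnorm N (gs_M N (mk N \<omega>) j)"
        unfolding True[symmetric] good_phi[OF kK N g jk(1)] .
    qed
    then show ?thesis using True by (simp add: cc_def)
  qed
qed

text \<open>The coefficients \<open>c\<close> are kept general because both \<open>cc k\<close> and
  the copy \<open>cd k\<close> are inserted. The first iterate is constant and yields
  \<open>sk_alpha\<close>; a later one is replaced by its \<open>thv\<close>, and two of those give
  the value of \<open>sk_psi\<close> at \<open>\<rho> (i - 1)\<close>, that is
  \<open>\<rho> i\<close>.\<close>

lemma conv_mk_thv: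
  assumes kK: "k \<le> K" and c: "(\<Sum>j=1..K. c j * c j) = q" and cj: "\<And>j. 1 \<le> j \<Longrightarrow> j < k \<Longrightarrow> (\<Sum>l=1..K. cc j l * c l) = \<rho> j"
    and i: "i \<in> {1..k}"
  shows "conv (MK K) (\<lambda>N \<omega>. ninner N (mk N \<omega> i) (thv \<beta> h K c \<omega>)) (\<rho> i)"
proof (cases "i = 1")
  case True
  have K1: "K \<ge> 1" using kK k1 by simp
  have e: "ninner N (mk N \<omega> i) u = sqrt q * ninner N (\<lambda>_. 1) u" for N \<omega> u
    unfolding ninner_linear(3)[symmetric] using True by (intro ninner_cong) (auto simp: mk_def vec_of_def)
  have "conv (MK K) (\<lambda>N \<omega>. sqrt q * ninner N (\<lambda>_. 1) (thv \<beta> h K c \<omega>)) (sqrt q * sk_alpha \<beta> h q)"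
    by (rule conv_cmult[OF conv_thv_alpha[OF K1 c]])
  then show ?thesis unfolding e using True by (simp add: mult.commute)
next
  case False
  define j where "j = i - 1"
  have j: "i = Suc j" "1 \<le> j" "j < k" "j \<le> K" using False i kK by (auto simp: j_def)
  have K1: "K \<ge> 1" using kK k1 by simp
  have gj: "G2 (j - 1) < q" using amp_inv_pos[of "j - 1"] j by simp
  have c1: "conv (MK K) (\<lambda>N \<omega>. ninner N (thv \<beta> h K (cc j) \<omega>) (thv \<beta> h K c \<omega>)) (sk_psi \<beta> h q (\<rho> j))"
    by (rule conv_thv_psi[OF K1 cov_cc_cc[OF j(2,4) gj] c cj[OF j(2,3)] rho_nonneg])
  have n: "negl (MK K) (\<lambda>N \<omega>. ninner N (\<lambda>i. mk N \<omega> (Suc j) i - thv \<beta> h K (cc j) \<omega> i) (thv \<beta> h K c \<omega>))"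
    by (rule negl_inner[OF rvec_diff[OF rvec_mk rvec_thv] rvec_thv amp_inv_close[OF j(2,3)] wop_True]) (rule nnorm_thv)
  have "conv (MK K) (\<lambda>N \<omega>. ninner N (mk N \<omega> i) (thv \<beta> h K c \<omega>)) (sk_psi \<beta> h q (\<rho> j))"
    by (rule conv_negl_diff[OF c1]) (use n in \<open>simp only: ninner_diff_left j(1)\<close>)
  then show ?thesis unfolding j(1) rho_Suc[OF j(2)] .
qed

text \<open>
  Bessel's inequality for the mean \<open>u\<close> of the two copies: \<open>\<langle>\<phi>\<^sup>j, u\<rangle>\<close> tends to \<open>\<gamma>\<^sub>j\<close>, but \<open>\<langle>u, u\<rangle>\<close> tends to
  \<open>(q + \<psi> (G2 (k - 1))) / 2\<close>, which is smaller than \<open>q\<close>.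
\<close>

lemma amp_inv_pos_next:
  assumes kK: "Suc k \<le> K"
  shows "G2 k < q"
proof -
  have kK': "k \<le> K" "1 \<le> K" "k \<le> Suc K" using kK by auto
  have g: "G2 (k - 1) < q" using amp_inv_pos[of "k - 1"] k1 by simp
  define u where "u N \<omega> i = (1 / 2) * (thv \<beta> h K (cc k) \<omega> i + thv \<beta> h K (cd k) \<omega> i)" for N :: nat and \<omega> i
  have ru: "rvec (MK K) u" using rvec_thv[of K \<beta> h "cc k"] rvec_thv[of K \<beta> h "cd k"] unfolding rvec_def u_def
    by (intro allI impI ballI borel_measurable_times borel_measurable_const borel_measurable_add) blast+
  have "conv (MK K) (\<lambda>N \<omega>. ninner N (mk N \<omega> i) (u N \<omega>)) (\<rho> i)" if i: "i \<in> {1..k}" for i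
  proof -
    have "conv (MK K) (\<lambda>N \<omega>. (1 / 2) * (ninner N (mk N \<omega> i) (thv \<beta> h K (cc k) \<omega>) + ninner N (mk N \<omega> i) (thv \<beta> h K (cd k) \<omega>))) ((1 / 2) * (\<rho> i + \<rho> i))"
    proof (intro conv_cmult conv_add conv_mk_thv[OF kK'(1) _ _ i])
      show "(\<Sum>j=1..K. cc k j * cc k j) = q" by (rule cov_cc_cc[OF k1 kK'(1) g])
      show "(\<Sum>j=1..K. cd k j * cd k j) = q" by (rule cov_cd_cd[OF k1 kK g])
      fix j assume j: "1 \<le> j" "j < k"
      have gj: "G2 (j - 1) < q" using amp_inv_pos[of "j - 1"] j by simp
      show "(\<Sum>l=1..K. cc j l * cc k l) = \<rho> j" by (rule cov_cc_lt[OF j kK'(1) gj])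
      show "(\<Sum>l=1..K. cc j l * cd k l) = \<rho> j" by (rule cov_cc_cd_lt[OF j kK gj])
    qed
    then show ?thesis unfolding u_def ninner_linear by simp
  qed
  note cu = this
  have cphi: "conv (MK K) (\<lambda>N \<omega>. ninner N (gs_phi N (mk N \<omega>) j) (u N \<omega>)) (\<gamma> j)" if j: "j \<in> {1..k}" for j
    by (rule amp_inv_gs(2)[OF j ru]) (rule cu, use j in auto)
  have "conv (MK K) (\<lambda>N \<omega>. \<Sum>j=1..k. (ninner N (gs_phi N (mk N \<omega>) j) (u N \<omega>))\<^sup>2) (\<Sum>j=1..k. (\<gamma> j)\<^sup>2)"
    by (intro conv_sum conv_power2 cphi finite_atLeastAtMost)
  then have L: "conv (MK K) (\<lambda>N \<omega>. \<Sum>j=1..k. (ninner N (gs_phi N (mk N \<omega>) j) (u N \<omega>))\<^sup>2) (G2 k)" by (simp only: G2_def)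
  have R: "conv (MK K) (\<lambda>N \<omega>. (1 / 4) * (ninner N (thv \<beta> h K (cc k) \<omega>) (thv \<beta> h K (cc k) \<omega>) + ninner N (thv \<beta> h K (cd k) \<omega>) (thv \<beta> h K (cd k) \<omega>)
      + 2 * ninner N (thv \<beta> h K (cc k) \<omega>) (thv \<beta> h K (cd k) \<omega>))) ((1 / 4) * (q + q + 2 * sk_psi \<beta> h q (G2 (k - 1))))"
    by (intro conv_cmult conv_add conv_thv_q[OF kK'(2)] conv_thv_psi[OF kK'(2)] cov_cc_cc[OF k1 kK'(1) g] cov_cd_cd[OF k1 kK g] cov_cc_cd[OF k1 kK] G2_nonneg)
  have W: "wop (MK K) (\<lambda>N \<omega>. (\<Sum>j=1..k. (ninner N (gs_phi N (mk N \<omega>) j) (u N \<omega>))\<^sup>2) \<le>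
     (1 / 4) * (ninner N (thv \<beta> h K (cc k) \<omega>) (thv \<beta> h K (cc k) \<omega>) + ninner N (thv \<beta> h K (cd k) \<omega>) (thv \<beta> h K (cd k) \<omega>)
      + 2 * ninner N (thv \<beta> h K (cc k) \<omega>) (thv \<beta> h K (cd k) \<omega>)))"
  proof (rule wop_mono[OF amp_inv_good])
    fix N \<omega> assume N: "N \<ge> (1::nat)" and g: "\<forall>j\<in>{1..k}. nnorm N (gs_M N (mk N \<omega>) j) \<noteq> 0"
    have sp: "supp N (mk N \<omega> l)" for l unfolding mk_def by (rule supp_sk_m)
    have "(\<Sum>j=1..k. (ninner N (gs_phi N (mk N \<omega>) j) (u N \<omega>))\<^sup>2) \<le> ninner N (u N \<omega>) (u N \<omega>)"
      by (rule gs_bessel[OF N sp]) (use g in blast)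
    also have "\<dots> = (1 / 4) * (ninner N (thv \<beta> h K (cc k) \<omega>) (thv \<beta> h K (cc k) \<omega>) + ninner N (thv \<beta> h K (cd k) \<omega>) (thv \<beta> h K (cd k) \<omega>)
      + 2 * ninner N (thv \<beta> h K (cc k) \<omega>) (thv \<beta> h K (cd k) \<omega>))"
      unfolding u_def ninner_linear using ninner_commute[of N "thv \<beta> h K (cd k) \<omega>" "thv \<beta> h K (cc k) \<omega>"] by (simp add: field_simps)
    finally show "(\<Sum>j=1..k. (ninner N (gs_phi N (mk N \<omega>) j) (u N \<omega>))\<^sup>2) \<le>
     (1 / 4) * (ninner N (thv \<beta> h K (cc k) \<omega>) (thv \<beta> h K (cc k) \<omega>) + ninner N (thv \<beta> h K (cd k) \<omega>) (thv \<beta> h K (cd k) \<omega>)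
      + 2 * ninner N (thv \<beta> h K (cc k) \<omega>) (thv \<beta> h K (cd k) \<omega>))" .
  qed
  have "G2 k \<le> (1 / 4) * (q + q + 2 * sk_psi \<beta> h q (G2 (k - 1)))" by (rule conv_le[OF L R W])
  moreover have "sk_psi \<beta> h q (G2 (k - 1)) < q" by (rule psi_less[OF b fp G2_nonneg g])
  ultimately show ?thesis by simp
qed

text \<open>The three sums of \<open>amp_error_bound\<close> are negligible for different reasons:
  convergence of the coefficients (\<open>t1\<close>), cancellation of the Onsager term
  (\<open>t2\<close>), and independence of each fresh vector from the directions up to its own index
  (\<open>t3\<close>). The Lipschitz bound for \<open>Th\<close> carries the error over to the next
  iterate.\<close>

lemma amp_inv_close_next:
  assumes kK: "k \<le> K"
  shows "negl (MK K) (\<lambda>N \<omega>. nnorm N (\<lambda>i. mk N \<omega> (Suc k) i - thv \<beta> h K (cc k) \<omega> i))"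
proof -
  have kK': "k \<le> Suc K" and kk: "k \<in> {1..k}" using kK k1 by auto
  define A where "A N \<omega> j = ninner N (Phi N \<omega> j) (mk N \<omega> k)" for N \<omega> j
  define E where "E N \<omega> l = ninner N (zvec \<omega> l) (mk N \<omega> k) - (\<Sum>j=1..l. A N \<omega> j * ninner N (zvec \<omega> l) (Phi N \<omega> j))
      - \<beta> * (1 - q) * ninner N (Phi N \<omega> l) (mk N \<omega> (k - 1))" for N \<omega> l
  define X where "X N \<omega> = (\<Sum>j=1..k. \<bar>A N \<omega> j - cc k j\<bar> * nnorm N (zvec \<omega> j)) + (\<Sum>l=1..k - 1. \<bar>E N \<omega> l\<bar>)
      + (\<Sum>j=1..k. \<bar>A N \<omega> j\<bar> * (\<Sum>l=1..j. \<bar>ninner N (Phi N \<omega> l) (zvec \<omega> j)\<bar>))" for N \<omega>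
  have cA: "conv (MK K) (\<lambda>N \<omega>. A N \<omega> j) (cc k j)" if "j \<in> {1..k}" for j
    unfolding A_def by (rule conv_Phi_mk[OF kK' kk that])
  have small: "negl (MK K) (\<lambda>N \<omega>. ninner N (Phi N \<omega> l) (zvec \<omega> j))" if "1 \<le> l" "l \<le> j" "j \<le> k" for l j
    by (rule negl_zphi_zvec) (use that kK in auto)
  have t1: "negl (MK K) (\<lambda>N \<omega>. \<bar>A N \<omega> j - cc k j\<bar> * nnorm N (zvec \<omega> j))" if j: "j \<in> {1..k}" for j
  proof -
    have jK: "j \<in> {1..K}" using j kK by auto
    obtain B where B: "wop (MK K) (\<lambda>N \<omega>. nnorm N (zvec \<omega> j) \<le> B)" using zvec_bounded[OF jK] by blast
    show ?thesis by (rule negl_mult_bdd[OF negl_abs[OF cA[OF j]] rvs_nnorm[OF rvec_zvec[OF jK]] wop_mono[OF B]]) (simp add: nnorm_nonneg)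
  qed
  \<comment> \<open>By \<open>stein_gauss\<close> the inner product of \<open>z\<^sup>l\<close> with
    the iterate \<open>k\<close> tends to \<open>\<beta> * (1 - q) * cc (k - 1) l\<close>. The
    Onsager component has the same limit, since
    \<open>\<langle>\<phi>\<^sup>l, m\<^sup>k\<^sup>-\<^sup>1\<rangle>\<close> tends to
    \<open>cc (k - 1) l\<close>.\<close>
  have t2: "negl (MK K) (\<lambda>N \<omega>. \<bar>E N \<omega> l\<bar>)" if l: "l \<in> {1..k - 1}" for l
  proof -
    have lK: "l \<in> {1..K}" and k2: "1 \<le> k - 1" "k - 1 < k" "k - 1 \<le> K" "Suc (k - 1) = k" using l kK by auto
    have lk: "k - 1 \<in> {1..k}" "l \<in> {1..k - 1}" using l by auto
    have g: "G2 (k - 1 - 1) < q" using amp_inv_pos[of "k - 1 - 1"] k1 by simp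
    obtain B where B: "wop (MK K) (\<lambda>N \<omega>. nnorm N (zvec \<omega> l) \<le> B)" using zvec_bounded[OF lK] by blast
    have n: "negl (MK K) (\<lambda>N \<omega>. ninner N (\<lambda>i. mk N \<omega> (Suc (k - 1)) i - thv \<beta> h K (cc (k - 1)) \<omega> i) (zvec \<omega> l))"
      by (rule negl_inner[OF rvec_diff[OF rvec_mk rvec_thv] rvec_zvec[OF lK] amp_inv_close[OF k2(1,2)] B])
    have "conv (MK K) (\<lambda>N \<omega>. ninner N (zvec \<omega> l) (mk N \<omega> k)) (\<beta> * (1 - q) * cc (k - 1) l)"
    proof (rule conv_negl_diff[OF conv_thv_stein[OF lK cov_cc_cc[OF k2(1,3) g]]])
      show "negl (MK K) (\<lambda>N \<omega>. ninner N (zvec \<omega> l) (mk N \<omega> k) - ninner N (zvec \<omega> l) (thv \<beta> h K (cc (k - 1)) \<omega>))"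
        using n unfolding k2(4) ninner_diff_left by (simp only: ninner_commute[of _ "zvec _ l"])
    qed
    moreover have "conv (MK K) (\<lambda>N \<omega>. \<Sum>j=1..l. A N \<omega> j * ninner N (zvec \<omega> l) (Phi N \<omega> j)) (\<Sum>j=1..l. cc k j * 0)"
    proof (intro conv_sum conv_mult finite_atLeastAtMost)
      fix j assume j: "j \<in> {1..l}"
      show "conv (MK K) (\<lambda>N \<omega>. A N \<omega> j) (cc k j)" by (rule cA) (use j l in auto)
      have "negl (MK K) (\<lambda>N \<omega>. ninner N (Phi N \<omega> j) (zvec \<omega> l))" by (rule small) (use j l in auto)
      then show "conv (MK K) (\<lambda>N \<omega>. ninner N (zvec \<omega> l) (Phi N \<omega> j)) 0" by (simp add: ninner_commute)
    qed
    moreover have "conv (MK K) (\<lambda>N \<omega>. \<beta> * (1 - q) * ninner N (Phi N \<omega> l) (mk N \<omega> (k - 1))) (\<beta> * (1 - q) * cc (k - 1) l)"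
      by (rule conv_cmult[OF conv_Phi_mk[OF kK' lk]])
    ultimately have "conv (MK K) (\<lambda>N \<omega>. E N \<omega> l) (\<beta> * (1 - q) * cc (k - 1) l - (\<Sum>j=1..l. cc k j * 0) - \<beta> * (1 - q) * cc (k - 1) l)"
      unfolding E_def by (intro conv_diff)
    then have "negl (MK K) (\<lambda>N \<omega>. E N \<omega> l)" by simp
    then show ?thesis by (rule negl_abs)
  qed
  have t3: "negl (MK K) (\<lambda>N \<omega>. \<bar>A N \<omega> j\<bar> * (\<Sum>l=1..j. \<bar>ninner N (Phi N \<omega> l) (zvec \<omega> j)\<bar>))" if j: "j \<in> {1..k}" for j
  proof -
    have s: "negl (MK K) (\<lambda>N \<omega>. \<Sum>l=1..j. \<bar>ninner N (Phi N \<omega> l) (zvec \<omega> j)\<bar>)"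
      by (intro negl_sum negl_abs small finite_atLeastAtMost) (use j in auto)
    have "negl (MK K) (\<lambda>N \<omega>. (\<Sum>l=1..j. \<bar>ninner N (Phi N \<omega> l) (zvec \<omega> j)\<bar>) * \<bar>A N \<omega> j\<bar>)"
      by (rule negl_mult_bdd[OF s rvs_abs[OF conv_rvs[OF cA[OF j]]] wop_mono[OF conv_bdd[OF cA[OF j]]]]) simp
    then show ?thesis by (simp only: mult.commute)
  qed
  have nX: "negl (MK K) X" unfolding X_def by (intro negl_add negl_sum t1 t2 t3 finite_atLeastAtMost)
  show ?thesis
  proof (rule negl_dom[OF rvs_nnorm[OF rvec_diff[OF rvec_mk rvec_thv]] nX, where c=\<beta>], rule wop_mono[OF amp_inv_good])
    fix N \<omega> assume N: "N \<ge> (1::nat)" and g: "\<forall>j\<in>{1..k}. nnorm N (gs_M N (mk N \<omega>) j) \<noteq> 0"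
    have g': "nnorm N (sk_M \<beta> h q N (Tmat \<beta> h q N (zvec \<omega>) K (goe N \<omega>)) l) \<noteq> 0" if "l \<in> {1..k}" for l
      using g that unfolding mk_def GG_def sk_M_gs by blast
    let ?d = "\<lambda>i. mv N (GG N \<omega>) (mk N \<omega> k) i - \<beta> * (1 - q) * mk N \<omega> (k - 1) i - (\<Sum>j=1..k. cc k j * zvec \<omega> j i)"
    have bound: "nnorm N ?d \<le> X N \<omega>"
      unfolding X_def A_def E_def mk_def GG_def by (rule amp_error_bound[OF N kK' g' kk kK])
    have xs: "(\<Sum>j=1..K. cc k j * zvec \<omega> j i) = (\<Sum>j=1..k. cc k j * zvec \<omega> j i)" for i
      using kK by (intro sum.mono_neutral_right) (auto simp: cc_def)
    have "\<bar>mk N \<omega> (Suc k) i - thv \<beta> h K (cc k) \<omega> i\<bar> \<le> \<bar>\<beta> * ?d i\<bar>" if i: "i \<in> {1..N}" for i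
    proof -
      have "mk N \<omega> (Suc k) i = Th \<beta> h (mv N (GG N \<omega>) (mk N \<omega> k) i - \<beta> * (1 - q) * mk N \<omega> (k - 1) i)"
        using sk_m_Suc[of \<beta> h q N "GG N \<omega>" "k - 1"] k1 i by (simp add: mk_def vec_of_def del: sk_m.simps)
      moreover have "thv \<beta> h K (cc k) \<omega> i = Th \<beta> h (\<Sum>j=1..k. cc k j * zvec \<omega> j i)" by (simp only: thv_def xs)
      moreover have "\<bar>\<beta> * ?d i\<bar> = \<beta> * \<bar>?d i\<bar>" using b by (simp only: abs_mult abs_of_pos)
      ultimately show ?thesis by (simp only: Th_lipschitz[OF b])
    qed
    then have "nnorm N (\<lambda>i. mk N \<omega> (Suc k) i - thv \<beta> h K (cc k) \<omega> i) \<le> nnorm N (\<lambda>i. \<beta> * ?d i)" by (rule nnorm_mono)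
    also have "\<dots> = \<beta> * nnorm N ?d" unfolding nnorm_cmult using b by simp
    also have "\<dots> \<le> \<beta> * \<bar>X N \<omega>\<bar>" using b bound by (intro mult_left_mono) auto
    finally show "\<bar>nnorm N (\<lambda>i. mk N \<omega> (Suc k) i - thv \<beta> h K (cc k) \<omega> i)\<bar> \<le> \<beta> * \<bar>X N \<omega>\<bar>" by (simp add: nnorm_nonneg)
  qed
qed

lemma amp_inv_next:
  assumes kK: "Suc k \<le> K"
  shows "amp_inv (Suc k)"
proof -
  have kK': "k \<le> K" "1 \<le> K" using kK by auto
  have g: "G2 (k - 1) < q" using amp_inv_pos[of "k - 1"] k1 by simp
  note cl = amp_inv_close_next[OF kK'(1)]
  have bT: "wop (MK K) (\<lambda>N \<omega>. nnorm N (thv \<beta> h K (cc k) \<omega>) \<le> 1)" by (rule wop_True) (rule nnorm_thv)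
  have bm: "wop (MK K) (\<lambda>N \<omega>. nnorm N (mk N \<omega> l) \<le> max 1 (sqrt q))" for l by (rule wop_True) (rule nnorm_mk)
  have off: "conv (MK K) (\<lambda>N \<omega>. ninner N (mk N \<omega> i) (mk N \<omega> (Suc k))) (\<rho> i)" if i: "i \<in> {1..k}" for i
  proof (rule conv_negl_diff[OF conv_mk_thv[OF kK'(1) cov_cc_cc[OF k1 kK'(1) g] _ i]])
    fix j assume j: "1 \<le> j" "j < k"
    have gj: "G2 (j - 1) < q" using amp_inv_pos[of "j - 1"] j by simp
    show "(\<Sum>l=1..K. cc j l * cc k l) = \<rho> j" by (rule cov_cc_lt[OF j kK'(1) gj])
  next
    have "negl (MK K) (\<lambda>N \<omega>. ninner N (\<lambda>i. mk N \<omega> (Suc k) i - thv \<beta> h K (cc k) \<omega> i) (mk N \<omega> i))"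
      by (rule negl_inner[OF rvec_diff[OF rvec_mk rvec_thv] rvec_mk cl bm])
    then show "negl (MK K) (\<lambda>N \<omega>. ninner N (mk N \<omega> i) (mk N \<omega> (Suc k)) - ninner N (mk N \<omega> i) (thv \<beta> h K (cc k) \<omega>))"
      unfolding ninner_diff_left by (simp only: ninner_commute[of _ "mk _ _ i"])
  qed
  have diag: "conv (MK K) (\<lambda>N \<omega>. ninner N (mk N \<omega> (Suc k)) (mk N \<omega> (Suc k))) q"
  proof (rule conv_negl_diff[OF conv_thv_q[OF kK'(2) cov_cc_cc[OF k1 kK'(1) g]]])
    let ?d = "\<lambda>N \<omega> i. mk N \<omega> (Suc k) i - thv \<beta> h K (cc k) \<omega> i"
    have n: "negl (MK K) (\<lambda>N \<omega>. ninner N (?d N \<omega>) (mk N \<omega> (Suc k)) + ninner N (?d N \<omega>) (thv \<beta> h K (cc k) \<omega>))"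
      by (intro negl_add negl_inner[OF rvec_diff[OF rvec_mk rvec_thv] rvec_mk cl bm] negl_inner[OF rvec_diff[OF rvec_mk rvec_thv] rvec_thv cl bT])
    have e: "ninner N (mk N \<omega> (Suc k)) (mk N \<omega> (Suc k)) - ninner N (thv \<beta> h K (cc k) \<omega>) (thv \<beta> h K (cc k) \<omega>)
        = ninner N (?d N \<omega>) (mk N \<omega> (Suc k)) + ninner N (?d N \<omega>) (thv \<beta> h K (cc k) \<omega>)" for N \<omega>
      unfolding ninner_diff_left using ninner_commute[of N "mk N \<omega> (Suc k)" "thv \<beta> h K (cc k) \<omega>"] by simp
    show "negl (MK K) (\<lambda>N \<omega>. ninner N (mk N \<omega> (Suc k)) (mk N \<omega> (Suc k)) - ninner N (thv \<beta> h K (cc k) \<omega>) (thv \<beta> h K (cc k) \<omega>))"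
      unfolding e by (rule n)
  qed
  show ?thesis unfolding amp_inv_def
  proof (intro conjI allI impI ballI)
    show "G2 j < q" if "j < Suc k" for j
    proof (cases "j = k")
      case True then show ?thesis using amp_inv_pos_next[OF kK] by simp
    qed (use that amp_inv_pos in auto)
    show "conv (MK K) (\<lambda>N \<omega>. ninner N (mk N \<omega> i) (mk N \<omega> i)) q" if "i \<in> {1..Suc k}" for i
    proof (cases "i = Suc k")
      case False
      then have "i \<in> {1..k}" using that by auto
      then show ?thesis by (rule amp_inv_diag)
    qed (simp only: diag)
    show "conv (MK K) (\<lambda>N \<omega>. ninner N (mk N \<omega> i) (mk N \<omega> j)) (\<rho> i)" if "1 \<le> i" "i < j" "j \<le> Suc k" for i j
    proof (cases "j = Suc k")
      case True
      then have "i \<in> {1..k}" using that by auto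
      from off[OF this] show ?thesis by (simp only: True)
    next
      case False
      then have "j \<le> k" using that by auto
      from amp_inv_off[OF that(1,2) this] show ?thesis .
    qed
    show "negl (MK K) (\<lambda>N \<omega>. nnorm N (\<lambda>i. mk N \<omega> (Suc j) i - thv \<beta> h K (cc j) \<omega> i))" if "1 \<le> j" "j < Suc k" for j
    proof (cases "j = k")
      case False
      then have "j < k" using that by auto
      from amp_inv_close[OF that(1) this] show ?thesis .
    qed (simp only: cl)
  qed
qed

end

lemma amp_inv_1: "amp_inv 1"
proof -
  have e: "ninner N (mk N \<omega> 1) (mk N \<omega> 1) = q" if "N \<ge> 1" for N \<omega>
  proof -
    have "ninner N (mk N \<omega> 1) (mk N \<omega> 1) = ninner N (\<lambda>_. sqrt q) (\<lambda>_. sqrt q)"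
      by (intro ninner_cong) (auto simp: mk_def vec_of_def)
    then show ?thesis using that q0 by (simp add: ninner_def)
  qed
  have "conv (MK K) (\<lambda>N \<omega>. ninner N (mk N \<omega> 1) (mk N \<omega> 1)) q"
    by (rule conv_cong_wop[OF rvs_ninner[OF rvec_mk rvec_mk] conv_const wop_True]) (rule e)
  then show ?thesis using q0 by (simp add: amp_inv_def G2_def)
qed

lemma amp_inv_all: "1 \<le> k \<Longrightarrow> k \<le> K \<Longrightarrow> amp_inv k"
proof (induction k rule: nat_induct_at_least)
  case base show ?case by (rule amp_inv_1)
next
  case (Suc k)
  then show ?case by (intro amp_inv_next) auto
qed

end

text \<open>The bound is about constants, so \<open>K\<close> may be chosen freely; with
  \<open>k + 1\<close> fresh vectors the invariant at \<open>k + 1\<close> contains it.\<close>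

lemma G2_less: "G2 k < q"
proof -
  have "amp_inv (Suc k) (Suc k)" by (rule amp_inv_all) auto
  then show ?thesis by (simp add: amp_inv_def)
qed

end

section \<open>The operator norm\<close>

lemma mv_diff: "mv N G (\<lambda>i. v i - w i) = (\<lambda>i. mv N G v i - mv N G w i)"
  by (rule ext) (simp add: mv_def right_diff_distrib sum_subtractf)

lemma mv_cmult: "mv N G (\<lambda>i. c * v i) = (\<lambda>i. c * mv N G v i)"
  by (rule ext) (simp add: mv_def sum_distrib_left mult.left_commute)

lemma abs_le_nnorm:
  assumes "i \<in> {1..N}" shows "\<bar>x i\<bar> \<le> sqrt (real N) * nnorm N x"
proof -
  have "\<bar>x i\<bar> = L2_set x {i}" by (simp add: L2_set_def)
  also have "\<dots> \<le> L2_set x {1..N}" unfolding L2_set_def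
    using assms by (intro real_sqrt_le_mono sum_mono2) auto
  also have "\<dots> = sqrt (real N) * nnorm N x" using assms by (simp add: nnorm_L2)
  finally show ?thesis .
qed

lemma L2_sum_nnorm: "N \<ge> 1 \<Longrightarrow> (\<Sum>i=1..N. x i * x i) = real N * (nnorm N x)\<^sup>2"
  unfolding nnorm_square by (simp add: ninner_def)

definition op_bd :: "nat \<Rightarrow> (nat \<Rightarrow> nat \<Rightarrow> real) \<Rightarrow> real \<Rightarrow> bool" where
  "op_bd N G L \<longleftrightarrow> (\<forall>u v. \<bar>ninner N u (mv N G v)\<bar> \<le> L * (nnorm N u * nnorm N v))"

lemma op_bd_mono: "op_bd N G L \<Longrightarrow> L \<le> L' \<Longrightarrow> op_bd N G L'"
  unfolding op_bd_def by (meson mult_nonneg_nonneg mult_right_mono nnorm_nonneg order_trans)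

text \<open>Any finite bound will do as a start: \<open>op_bd_net\<close> improves it
  geometrically.\<close>

lemma op_bd_exists: "\<exists>L\<ge>0. op_bd N G L"
proof (intro exI conjI)
  let ?L = "\<Sum>j=1..N. sqrt (real N) * nnorm N (\<lambda>i. G i j)"
  show "0 \<le> ?L" by (intro sum_nonneg mult_nonneg_nonneg nnorm_nonneg) simp
  show "op_bd N G ?L" unfolding op_bd_def
  proof (intro allI)
    fix u v
    have "nnorm N (mv N G v) = nnorm N (\<lambda>i. \<Sum>j=1..N. v j * G i j)" by (simp add: mv_def[abs_def] mult.commute)
    also have "\<dots> \<le> (\<Sum>j=1..N. nnorm N (\<lambda>i. v j * G i j))" by (rule nnorm_sum) simp
    also have "\<dots> \<le> (\<Sum>j=1..N. (sqrt (real N) * nnorm N v) * nnorm N (\<lambda>i. G i j))"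
      unfolding nnorm_cmult by (intro sum_mono mult_right_mono abs_le_nnorm nnorm_nonneg)
    also have "\<dots> = ?L * nnorm N v" by (simp add: sum_distrib_left mult.assoc mult.left_commute mult.commute)
    finally have "nnorm N u * nnorm N (mv N G v) \<le> nnorm N u * (?L * nnorm N v)" by (intro mult_left_mono nnorm_nonneg)
    then show "\<bar>ninner N u (mv N G v)\<bar> \<le> ?L * (nnorm N u * nnorm N v)"
      using ninner_cauchy_schwarz[of N u "mv N G v"] by (simp only: mult.left_commute)
  qed
qed

text \<open>Divided by 4 these are the lattice points of normalised norm at most 5 / 4, since a sum
  of squares up to \<open>25 * N\<close> means a squared norm up to 25 / 16. For integers the box
  follows from this, and it makes the set visibly finite.\<close>

definition net :: "nat \<Rightarrow> (nat \<Rightarrow> int) set" where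
  "net N = {n \<in> {1..N} \<rightarrow>\<^sub>E {-25 * int N..25 * int N}. (\<Sum>i=1..N. n i * n i) \<le> 25 * int N}"

lemma finite_net: "finite (net N)"
  unfolding net_def by (rule finite_subset[of _ "{1..N} \<rightarrow>\<^sub>E {-25 * int N..25 * int N}"]) (auto intro: finite_PiE)

lemma net_approx:
  assumes N: "N \<ge> 1" and u: "nnorm N u = 1"
  obtains n where "n \<in> net N" "nnorm N (\<lambda>i. u i - real_of_int (n i) / 4) \<le> 1 / 4" "nnorm N (\<lambda>i. real_of_int (n i) / 4) \<le> 5 / 4"
proof -
  define n where "n = (\<lambda>i\<in>{1..N}. \<lfloor>4 * u i\<rfloor>)"
  let ?y = "\<lambda>i. real_of_int (n i) / 4"
  have d: "nnorm N (\<lambda>i. u i - ?y i) \<le> 1 / 4"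
  proof (rule nnorm_le_const)
    fix i assume "i \<in> {1..N}"
    then have "n i = \<lfloor>4 * u i\<rfloor>" by (simp add: n_def)
    then show "\<bar>u i - ?y i\<bar> \<le> 1 / 4" using of_int_floor_le[of "4 * u i"] real_of_int_floor_add_one_ge[of "4 * u i"]
      unfolding abs_le_iff by linarith
  qed simp
  have "nnorm N (\<lambda>i. u i - (u i - ?y i)) \<le> nnorm N u + nnorm N (\<lambda>i. u i - ?y i)" by (rule nnorm_diff)
  then have y: "nnorm N ?y \<le> 5 / 4" using u d by simp
  have "real_of_int (\<Sum>i=1..N. n i * n i) = 16 * (\<Sum>i=1..N. ?y i * ?y i)" by (simp add: sum_distrib_left)
  also have "\<dots> = 16 * (real N * (nnorm N ?y)\<^sup>2)" by (simp only: L2_sum_nnorm[OF N])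
  also have "\<dots> \<le> 16 * (real N * (5 / 4)\<^sup>2)" using y by (intro mult_left_mono power_mono nnorm_nonneg) simp_all
  also have "\<dots> = real_of_int (25 * int N)" by (simp add: power2_eq_square)
  finally have s: "(\<Sum>i=1..N. n i * n i) \<le> 25 * int N" by (simp only: of_int_le_iff)
  have "n i \<in> {-25 * int N..25 * int N}" if i: "i \<in> {1..N}" for i
  proof -
    have "\<bar>n i\<bar> * 1 \<le> \<bar>n i\<bar> * \<bar>n i\<bar>"
    proof (cases "n i = 0")
      case False
      then have "1 \<le> \<bar>n i\<bar>" by arith
      then show ?thesis by (rule mult_left_mono) simp
    qed simp
    also have "\<dots> = n i * n i" by simp
    also have "\<dots> \<le> (\<Sum>i=1..N. n i * n i)" by (rule member_le_sum[OF i]) auto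
    finally show ?thesis using s by auto
  qed
  then have "n \<in> net N" using s by (auto simp: net_def n_def)
  with d y that show ?thesis by blast
qed

text \<open>Passing from unit vectors to net points costs
  \<open>L * (1 / 4 * 5 / 4 + 1 / 4)\<close>, that is \<open>9 / 16 * L\<close>. A factor below 1
  makes it worthwhile to repeat the step.\<close>

lemma op_bd_net_step:
  assumes N: "N \<ge> 1" and L: "L \<ge> 0" "op_bd N G L"
    and net: "\<And>n n'. n \<in> net N \<Longrightarrow> n' \<in> net N \<Longrightarrow> \<bar>ninner N (\<lambda>i. real_of_int (n i) / 4) (mv N G (\<lambda>i. real_of_int (n' i) / 4))\<bar> \<le> t"
  shows "op_bd N G (t + 9 / 16 * L)"
  unfolding op_bd_def
proof (intro allI)
  fix u v
  have Lb: "\<bar>ninner N u (mv N G v)\<bar> \<le> L * (nnorm N u * nnorm N v)" for u v using L(2) by (simp add: op_bd_def)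
  have unit: "\<bar>ninner N u (mv N G v)\<bar> \<le> t + 9 / 16 * L" if u: "nnorm N u = 1" and v: "nnorm N v = 1" for u v
  proof -
    from net_approx[OF N u] obtain n where n: "n \<in> net N" "nnorm N (\<lambda>i. u i - real_of_int (n i) / 4) \<le> 1 / 4" "nnorm N (\<lambda>i. real_of_int (n i) / 4) \<le> 5 / 4" .
    from net_approx[OF N v] obtain n' where n': "n' \<in> net N" "nnorm N (\<lambda>i. v i - real_of_int (n' i) / 4) \<le> 1 / 4" "nnorm N (\<lambda>i. real_of_int (n' i) / 4) \<le> 5 / 4" .
    let ?y = "\<lambda>i. real_of_int (n i) / 4" and ?w = "\<lambda>i. real_of_int (n' i) / 4"
    have e: "ninner N u (mv N G v) = ninner N ?y (mv N G ?w) + ninner N (\<lambda>i. u i - ?y i) (mv N G ?w) + ninner N u (mv N G (\<lambda>i. v i - ?w i))"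
      unfolding mv_diff ninner_diff_left ninner_diff_right by simp
    have "\<bar>ninner N (\<lambda>i. u i - ?y i) (mv N G ?w)\<bar> \<le> L * (1 / 4 * (5 / 4))"
      by (rule order_trans[OF Lb]) (intro mult_left_mono mult_mono n n' nnorm_nonneg L(1), simp)
    moreover have "\<bar>ninner N u (mv N G (\<lambda>i. v i - ?w i))\<bar> \<le> L * (1 * (1 / 4))"
      by (rule order_trans[OF Lb]) (intro mult_left_mono mult_mono n' nnorm_nonneg L(1), simp_all add: u)
    ultimately show ?thesis unfolding e using net[OF n(1) n'(1)] by linarith
  qed
  show "\<bar>ninner N u (mv N G v)\<bar> \<le> (t + 9 / 16 * L) * (nnorm N u * nnorm N v)"
  proof (cases "nnorm N u = 0 \<or> nnorm N v = 0")
    case True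
    then show ?thesis using Lb[of u v] by auto
  next
    case False
    let ?a = "nnorm N u" and ?b = "nnorm N v"
    have p: "?a > 0" "?b > 0" using False nnorm_nonneg[of N u] nnorm_nonneg[of N v] by auto
    have "\<bar>ninner N (\<lambda>i. 1 / ?a * u i) (mv N G (\<lambda>i. 1 / ?b * v i))\<bar> \<le> t + 9 / 16 * L"
      by (rule unit; unfold nnorm_cmult) (use p in simp_all)
    then have "\<bar>1 / ?a * (1 / ?b * ninner N u (mv N G v))\<bar> \<le> t + 9 / 16 * L" unfolding mv_cmult ninner_cmult_left ninner_cmult_right .
    then show ?thesis using p by (simp add: abs_mult field_simps)
  qed
qed

lemma op_bd_net:
  assumes N: "N \<ge> 1"
    and net: "\<And>n n'. n \<in> net N \<Longrightarrow> n' \<in> net N \<Longrightarrow> \<bar>ninner N (\<lambda>i. real_of_int (n i) / 4) (mv N G (\<lambda>i. real_of_int (n' i) / 4))\<bar> \<le> 30"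
  shows "nnorm N (mv N G v) \<le> 70 * nnorm N v"
proof -
  obtain L where L: "L \<ge> 0" "op_bd N G L" using op_bd_exists by blast
  \<comment> \<open>\<open>480 / 7\<close> is the fixed point of
    \<open>L \<mapsto> 30 + 9 / 16 * L\<close>, and 70 exceeds it by more than 1.\<close>
  have it: "op_bd N G (480 / 7 + (9 / 16) ^ k * L)" for k
  proof (induction k)
    case 0 show ?case using op_bd_mono[OF L(2)] by simp
  next
    case (Suc k)
    have "op_bd N G (30 + 9 / 16 * (480 / 7 + (9 / 16) ^ k * L))"
      by (rule op_bd_net_step[OF N _ Suc net]) (use L in simp_all)
    then show ?case by (rule op_bd_mono) (simp add: field_simps)
  qed
  obtain k where k: "(9 / 16 :: real) ^ k < 1 / (L + 1)" using real_arch_pow_inv[of "1 / (L + 1)" "9 / 16"] L by auto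
  have "(9 / 16) ^ k * L \<le> 1 / (L + 1) * L" using k L by (intro mult_right_mono) auto
  also have "\<dots> \<le> 1" using L by (simp add: field_simps)
  finally have "op_bd N G 70" by (intro op_bd_mono[OF it[of k]]) simp
  then have "\<bar>ninner N (mv N G v) (mv N G v)\<bar> \<le> 70 * (nnorm N (mv N G v) * nnorm N v)" by (simp add: op_bd_def)
  then have "nnorm N (mv N G v) * nnorm N (mv N G v) \<le> nnorm N (mv N G v) * (70 * nnorm N v)"
    unfolding nnorm_square[symmetric] by (simp add: power2_eq_square mult.left_commute)
  then show ?thesis using nnorm_nonneg[of N "mv N G v"] nnorm_nonneg[of N v] by (cases "nnorm N (mv N G v) = 0") auto
qed

text \<open>Comparison with a geometric series: \<open>exp (- m * m) \<le> exp (- m)\<close> for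
  \<open>m \<ge> 1\<close>, and subtracting \<open>2 * exp (- M)\<close> closes the induction
  because \<open>exp 1 \<ge> 2\<close>.\<close>

lemma sum_exp_square_le: "(\<Sum>m\<in>{-int M..int M}. exp (- real_of_int (m * m))) \<le> 3"
proof -
  have "(\<Sum>m\<in>{-int M..int M}. exp (- real_of_int (m * m))) \<le> 3 - 2 * exp (- real M)"
  proof (induction M)
    case (Suc M)
    have "{-int (Suc M)..int (Suc M)} = insert (- int (Suc M)) (insert (int (Suc M)) {-int M..int M})" by auto
    then have "(\<Sum>m\<in>{-int (Suc M)..int (Suc M)}. exp (- real_of_int (m * m)))
      = 2 * exp (- real (Suc M * Suc M)) + (\<Sum>m\<in>{-int M..int M}. exp (- real_of_int (m * m)))" by (simp add: algebra_simps)
    also have "\<dots> \<le> 2 * exp (- real (Suc M)) + (3 - 2 * exp (- real M))"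
      by (intro add_mono Suc mult_left_mono) (simp_all del: of_nat_mult)
    also have "\<dots> \<le> 3 - 2 * exp (- real (Suc M))"
    proof -
      have "2 \<le> exp (1 :: real)" using exp_ge_add_one_self[of "1 :: real"] by simp
      then have "2 * exp (- real (Suc M)) \<le> exp 1 * exp (- real (Suc M))" by (intro mult_right_mono) auto
      also have "\<dots> = exp (- real M)" by (simp flip: exp_add)
      finally show ?thesis by simp
    qed
    finally show ?case .
  qed simp
  then show ?thesis using exp_gt_zero[of "- real M"] by linarith
qed

text \<open>The weight \<open>exp (25 * N - \<Sum> n\<^sup>2)\<close> is at least 1 on the net.
  Summed over the whole box these weights factorise over the coordinates, each coordinate sum being
  at most \<open>3 \<le> exp 2\<close>; so the exponent is 25 + 2.\<close>

lemma card_net_le: "real (card (net N)) \<le> exp (27 * real N)"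
proof -
  let ?R = "{-25 * int N..25 * int N}"
  have R: "?R = {-int (25 * N)..int (25 * N)}" by simp
  have "real (card (net N)) = (\<Sum>n\<in>net N. 1)" by simp
  also have "\<dots> \<le> (\<Sum>n\<in>net N. exp (25 * real N) * (\<Prod>i\<in>{1..N}. exp (- real_of_int (n i * n i))))"
  proof (rule sum_mono)
    fix n assume "n \<in> net N"
    then have "real_of_int (\<Sum>i=1..N. n i * n i) \<le> real_of_int (25 * int N)" unfolding net_def of_int_le_iff by blast
    then have "0 \<le> 25 * real N + (\<Sum>i=1..N. - real_of_int (n i * n i))" by (simp add: sum_negf)
    then have "1 \<le> exp (25 * real N + (\<Sum>i=1..N. - real_of_int (n i * n i)))" by simp
    then show "1 \<le> exp (25 * real N) * (\<Prod>i\<in>{1..N}. exp (- real_of_int (n i * n i)))" by (simp only: exp_add exp_sum finite_atLeastAtMost)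
  qed
  also have "\<dots> \<le> (\<Sum>n\<in>{1..N} \<rightarrow>\<^sub>E ?R. exp (25 * real N) * (\<Prod>i\<in>{1..N}. exp (- real_of_int (n i * n i))))"
    by (intro sum_mono2 finite_PiE) (auto simp: net_def intro!: mult_nonneg_nonneg prod_nonneg)
  also have "\<dots> = exp (25 * real N) * (\<Prod>i\<in>{1..N}. \<Sum>m\<in>?R. exp (- real_of_int (m * m)))"
    by (subst prod_sum_PiE) (auto simp: sum_distrib_left)
  also have "\<dots> \<le> exp (25 * real N) * (\<Prod>i\<in>{1..N}. exp 2)"
  proof (intro mult_left_mono prod_mono conjI)
    have "(3 :: real) \<le> exp 2" using exp_ge_add_one_self[of "2 :: real"] by simp
    then show "(\<Sum>m\<in>?R. exp (- real_of_int (m * m))) \<le> exp 2" unfolding R using sum_exp_square_le[of "25 * N"] by linarith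
  qed (auto intro: sum_nonneg)
  also have "\<dots> = exp (27 * real N)" by (simp add: flip: exp_of_nat_mult exp_add)
  finally show ?thesis .
qed

text \<open>The bilinear form is a centred Gaussian of variance at most
  \<open>2 * (25 / 16)\<^sup>2 / N \<le> 5 / N\<close>; the level 30 then gives the exponent
  \<open>900 * N / 10\<close>.\<close>

lemma goe_bilinear_tail:
  assumes N: "N \<ge> 1" and u: "nnorm N u \<le> 5 / 4" and v: "nnorm N v \<le> 5 / 4"
  shows "measure (gauss (Xidx N)) {x \<in> space (gauss (Xidx N)). 30 \<le> \<bar>ninner N u (mv N (goe N x) v)\<bar>} \<le> 2 * exp (- (90 * real N))"
proof -
  define c where "c p = (case p of Inl _ \<Rightarrow> 0 | Inr (i, j) \<Rightarrow> (u i * v j + u j * v i) / (real N * sqrt (2 * real N)))" for p :: gidx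
  have e: "ninner N u (mv N (goe N x) v) = (\<Sum>p\<in>Xidx N. c p * x p)" for x
  proof -
    let ?r = "real N * sqrt (2 * real N)"
    have "(\<Sum>p\<in>Xidx N. c p * x p) = (\<Sum>i=1..N. \<Sum>j=1..N. u i * v j * x (Inr (i, j)) / ?r) + (\<Sum>i=1..N. \<Sum>j=1..N. u j * v i * x (Inr (i, j)) / ?r)"
      unfolding sum_Xidx sum.distrib[symmetric] by (intro sum.cong refl) (simp add: c_def add_divide_distrib algebra_simps)
    also have "(\<Sum>i=1..N. \<Sum>j=1..N. u j * v i * x (Inr (i, j)) / ?r) = (\<Sum>j=1..N. \<Sum>i=1..N. u j * v i * x (Inr (i, j)) / ?r)" by (rule sum.swap)
    finally show ?thesis
      by (simp add: ninner_def mv_def goe_def sum_distrib_left add_divide_distrib algebra_simps flip: sum.distrib)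
  qed
  have uv: "(\<Sum>i=1..N. w i * w i) \<le> 25 / 16 * real N" if "nnorm N w \<le> 5 / 4" for w
  proof -
    have "(nnorm N w)\<^sup>2 \<le> (5 / 4)\<^sup>2" using that by (intro power_mono nnorm_nonneg)
    then have "real N * (nnorm N w)\<^sup>2 \<le> real N * (5 / 4)\<^sup>2" by (intro mult_left_mono) auto
    then show ?thesis unfolding L2_sum_nnorm[OF N] by (simp add: power2_eq_square)
  qed
  have "(\<Sum>p\<in>Xidx N. (c p)\<^sup>2) \<le> (\<Sum>i=1..N. \<Sum>j=1..N. ((u i * u i) * (v j * v j) + (v i * v i) * (u j * u j)) / (real N) ^ 3)"
    unfolding sum_Xidx
  proof (intro sum_mono)
    fix i j
    have "(u i * v j + u j * v i)\<^sup>2 \<le> 2 * ((u i * u i) * (v j * v j) + (v i * v i) * (u j * u j))"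
      using zero_le_power2[of "u i * v j - u j * v i"] by (simp add: power2_eq_square algebra_simps)
    then have "(u i * v j + u j * v i)\<^sup>2 / (2 * real N ^ 3) \<le> 2 * ((u i * u i) * (v j * v j) + (v i * v i) * (u j * u j)) / (2 * real N ^ 3)"
      by (intro divide_right_mono) auto
    also have "\<dots> = ((u i * u i) * (v j * v j) + (v i * v i) * (u j * u j)) / (real N) ^ 3" by (rule mult_divide_mult_cancel_left) simp
    finally have "(u i * v j + u j * v i)\<^sup>2 / (2 * real N ^ 3) \<le> ((u i * u i) * (v j * v j) + (v i * v i) * (u j * u j)) / (real N) ^ 3" .
    moreover have "(c (Inr (i, j)))\<^sup>2 = (u i * v j + u j * v i)\<^sup>2 / (2 * real N ^ 3)"
      by (simp add: c_def power_divide power_mult_distrib power3_eq_cube power2_eq_square)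
    ultimately show "(c (Inr (i, j)))\<^sup>2 \<le> ((u i * u i) * (v j * v j) + (v i * v i) * (u j * u j)) / (real N) ^ 3" by (simp only:)
  qed
  also have "\<dots> = 2 * ((\<Sum>i=1..N. u i * u i) * (\<Sum>j=1..N. v j * v j)) / real N ^ 3"
    unfolding sum_divide_distrib[symmetric] sum.distrib sum_product[symmetric] by simp
  also have "\<dots> \<le> 2 * ((25 / 16 * real N) * (25 / 16 * real N)) / real N ^ 3"
    using uv[OF u] uv[OF v] by (intro divide_right_mono mult_left_mono mult_mono sum_nonneg) auto
  also have "\<dots> \<le> 5 / real N" using N by (simp add: power3_eq_cube field_simps)
  finally have cv: "(\<Sum>p\<in>Xidx N. (c p)\<^sup>2) \<le> 5 / real N" .
  have "measure (gauss (Xidx N)) {x \<in> space (gauss (Xidx N)). 30 \<le> \<bar>\<Sum>p\<in>Xidx N. c p * x p\<bar>} \<le> 2 * exp (- (30\<^sup>2 / (2 * (5 / real N))))"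
    by (rule gauss_linear_tail[OF finite_Xidx cv]) (use N in auto)
  then show ?thesis unfolding e by simp
qed

text \<open>In the union bound over pairs of net points, 90 - 2 * 27 = 36 is left in the exponent.
  The failure event quantifies over all \<open>v\<close>; it is only covered by the finite union, as
  \<open>wop\<close> permits.\<close>

lemma goe_op_norm: "wop (\<lambda>N. gauss (Xidx N)) (\<lambda>N x. \<forall>v. nnorm N (mv N (goe N x) v) \<le> 70 * nnorm N v)"
  unfolding wop_def
proof (intro exI[of _ 2] conjI allI impI)
  fix N :: nat assume N: "1 \<le> N"
  let ?y = "\<lambda>n i. real_of_int (n i) / 4"
  define D where "D p = {x \<in> space (gauss (Xidx N)). 30 \<le> \<bar>ninner N (?y (fst p)) (mv N (goe N x) (?y (snd p)))\<bar>}" for p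
  interpret prob_space "gauss (Xidx N)" by (rule prob_space_gauss)
  have nn: "nnorm N (?y n) \<le> 5 / 4" if "n \<in> net N" for n
  proof -
    have "real_of_int (\<Sum>i=1..N. n i * n i) \<le> real_of_int (25 * int N)" using that unfolding net_def of_int_le_iff by blast
    then have "(\<Sum>i=1..N. ?y n i * ?y n i) \<le> 25 / 16 * real N" by (simp flip: sum_divide_distrib)
    then have "ninner N (?y n) (?y n) \<le> (5 / 4)\<^sup>2" using N by (simp add: ninner_def field_simps power2_eq_square)
    then show ?thesis unfolding nnorm_def using real_sqrt_le_mono[of _ "(5 / 4)\<^sup>2"] by simp
  qed
  have sD: "D p \<in> sets (gauss (Xidx N))" for p unfolding D_def
    by (intro borel_measurable_le borel_measurable_const borel_measurable_abs borel_measurable_ninner, unfold mv_def)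
       (intro borel_measurable_sum borel_measurable_times borel_measurable_goe borel_measurable_const order_refl; assumption)
  have "prob (\<Union>p\<in>net N \<times> net N. D p) \<le> (\<Sum>p\<in>net N \<times> net N. prob (D p))"
    by (intro finite_measure_subadditive_finite finite_cartesian_product finite_net) (use sD in auto)
  also have "\<dots> \<le> (\<Sum>p\<in>net N \<times> net N. 2 * exp (- (90 * real N)))"
    by (intro sum_mono) (auto simp: D_def intro!: goe_bilinear_tail[OF N] nn)
  also have "\<dots> = (real (card (net N)) * real (card (net N))) * (2 * exp (- (90 * real N)))" by (simp add: card_cartesian_product)
  also have "\<dots> \<le> (exp (27 * real N) * exp (27 * real N)) * (2 * exp (- (90 * real N)))"
    by (intro mult_right_mono mult_mono card_net_le) auto
  also have "\<dots> = 2 * exp (- (36 * real N))" by (simp flip: exp_add)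
  also have "\<dots> \<le> 2 * exp (- (real N / 2))" by simp
  finally show "\<exists>B\<in>sets (gauss (Xidx N)). prob B \<le> 2 * exp (- (real N / 2)) \<and>
     {x \<in> space (gauss (Xidx N)). \<not> (\<forall>v. nnorm N (mv N (goe N x) v) \<le> 70 * nnorm N v)} \<subseteq> B"
  proof (intro bexI[of _ "\<Union>p\<in>net N \<times> net N. D p"] conjI)
    show "(\<Union>p\<in>net N \<times> net N. D p) \<in> sets (gauss (Xidx N))" by (intro sets.finite_UN finite_cartesian_product finite_net sD)
    show "{x \<in> space (gauss (Xidx N)). \<not> (\<forall>v. nnorm N (mv N (goe N x) v) \<le> 70 * nnorm N v)} \<subseteq> (\<Union>p\<in>net N \<times> net N. D p)"
    proof (intro subsetI, rule ccontr)
      fix x assume x: "x \<in> {x \<in> space (gauss (Xidx N)). \<not> (\<forall>v. nnorm N (mv N (goe N x) v) \<le> 70 * nnorm N v)}"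
        and nx: "x \<notin> (\<Union>p\<in>net N \<times> net N. D p)"
      have "\<bar>ninner N (?y n) (mv N (goe N x) (?y n'))\<bar> \<le> 30" if "n \<in> net N" "n' \<in> net N" for n n'
      proof -
        have "x \<notin> D (n, n')" using nx that by blast
        then show ?thesis using x by (simp add: D_def)
      qed
      from op_bd_net[OF N this] show False using x by blast
    qed
  qed
qed simp

section \<open>Removing the diagonal\<close>

abbreviation GX :: "nat \<Rightarrow> (gidx \<Rightarrow> real) measure" where "GX N \<equiv> gauss (Xidx N)"

definition offdiag :: "(nat \<Rightarrow> nat \<Rightarrow> real) \<Rightarrow> nat \<Rightarrow> nat \<Rightarrow> real" where
  "offdiag G i j = (if i = j then 0 else G i j)"

lemma prob_family_GX: "prob_family GX"
  by (rule prob_family.intro) (rule prob_space_gauss)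

lemma measurable_sk_inner:
  "(\<lambda>y. ninner N (sk_m \<beta> h q N (mat_of y) i) (sk_m \<beta> h q N (mat_of y) j)) \<in> borel_measurable (PiM ({1..N} \<times> {1..N}) (\<lambda>_. borel))"
  by (intro borel_measurable_ninner borel_measurable_sk_m measurable_component_singleton) auto

lemma rvec_sk_m_goe: "rvec GX (\<lambda>N x. sk_m \<beta> h q N (goe N x) k)"
  and rvec_sk_m_offdiag: "rvec GX (\<lambda>N x. sk_m \<beta> h q N (offdiag (goe N x)) k)"
proof -
  show "rvec GX (\<lambda>N x. sk_m \<beta> h q N (goe N x) k)"
    unfolding rvec_def by (intro allI impI ballI borel_measurable_sk_m borel_measurable_goe order_refl)
  have m: "(\<lambda>x. offdiag (goe N x) a b) \<in> borel_measurable (GX N)" if "a \<in> {1..N}" "b \<in> {1..N}" for N a b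
    unfolding offdiag_def by (cases "a = b") (simp_all add: borel_measurable_goe[OF that order_refl] del: measurable_gauss_component)
  show "rvec GX (\<lambda>N x. sk_m \<beta> h q N (offdiag (goe N x)) k)"
    unfolding rvec_def by (intro allI impI ballI borel_measurable_sk_m m)
qed

context sk_system
begin

text \<open>\<open>Tmat_law\<close> is applied to the indicator of the deviation event, so the
  probabilities agree exactly and the constant \<open>C\<close> is kept. The conclusion no longer
  mentions \<open>K\<close>.\<close>

lemma conv_goe_transfer:
  assumes c: "conv (MK K) (\<lambda>N \<omega>. ninner N (mk K N \<omega> i) (mk K N \<omega> j)) a"
  shows "conv GX (\<lambda>N x. ninner N (sk_m \<beta> h q N (goe N x) i) (sk_m \<beta> h q N (goe N x) j)) a"
proof -
  let ?f = "\<lambda>N G. ninner N (sk_m \<beta> h q N G i) (sk_m \<beta> h q N G j) - a"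
  obtain C where C: "C > 0" "\<And>N t. N \<ge> 1 \<Longrightarrow> 0 < t \<and> t \<le> 1 \<Longrightarrow>
      measure (MK K N) {\<omega> \<in> space (MK K N). t \<le> \<bar>ninner N (mk K N \<omega> i) (mk K N \<omega> j) - a\<bar>} \<le> C * exp (- (t\<^sup>2 * real N / C))"
    using c unfolding negl_def by blast
  have rv: "rvs (MK K) (\<lambda>N \<omega>. ninner N (mk K N \<omega> i) (mk K N \<omega> j) - a)" using c by (rule negl_rvs)
  have rg: "rvs GX (\<lambda>N x. ?f N (goe N x))" by (intro rvs_diff rvs_ninner rvec_sk_m_goe rvs_const)
  show ?thesis unfolding negl_def
  proof (intro conjI exI[of _ C] allI impI C(1) rg)
    fix N :: nat and t :: real assume N: "1 \<le> N" and t: "0 < t \<and> t \<le> 1"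
    interpret A: prob_space "MK K N" unfolding MK_def by (rule prob_space_gauss)
    interpret B: prob_space "GX N" by (rule prob_space_gauss)
    define F where "F G = (indicator {r. t \<le> \<bar>r\<bar>} (?f N G) :: ennreal)" for G
    have s: "{r :: real. t \<le> \<bar>r\<bar>} \<in> sets borel" by (intro borel_closed closed_Collect_le continuous_intros)
    have mF: "(\<lambda>y. F (mat_of y)) \<in> borel_measurable (PiM ({1..N} \<times> {1..N}) (\<lambda>_. borel))" unfolding F_def
      by (rule measurable_compose[OF _ borel_measurable_indicator[OF s]]) (intro borel_measurable_diff measurable_sk_inner borel_measurable_const)
    have cF: "F G = F G'" if "mat_eq N G G'" for G G' unfolding F_def sk_m_cong[OF that] ..
    have L: "(\<integral>\<^sup>+\<omega>. F (GG K N \<omega>) \<partial>MK K N) = (\<integral>\<^sup>+x. F (goe N x) \<partial>GX N)"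
      unfolding GG_def MK_def by (rule Tmat_law[OF N mF cF])
    have m1: "(\<lambda>\<omega>. ?f N (GG K N \<omega>)) \<in> borel_measurable (MK K N)"
      using rv[unfolded rvs_def mk_def, rule_format, OF N] .
    have m2: "(\<lambda>x. ?f N (goe N x)) \<in> borel_measurable (GX N)"
      using rg[unfolded rvs_def, rule_format, OF N] .
    have E1: "{\<omega> \<in> space (MK K N). t \<le> \<bar>?f N (GG K N \<omega>)\<bar>} \<in> sets (MK K N)"
      by (intro borel_measurable_le borel_measurable_const borel_measurable_abs m1)
    have E2: "{x \<in> space (GX N). t \<le> \<bar>?f N (goe N x)\<bar>} \<in> sets (GX N)"
      by (intro borel_measurable_le borel_measurable_const borel_measurable_abs m2)
    have "(\<integral>\<^sup>+\<omega>. F (GG K N \<omega>) \<partial>MK K N) = (\<integral>\<^sup>+\<omega>. indicator {\<omega> \<in> space (MK K N). t \<le> \<bar>?f N (GG K N \<omega>)\<bar>} \<omega> \<partial>MK K N)"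
      by (intro nn_integral_cong) (simp add: F_def indicator_def)
    then have l: "(\<integral>\<^sup>+\<omega>. F (GG K N \<omega>) \<partial>MK K N) = emeasure (MK K N) {\<omega> \<in> space (MK K N). t \<le> \<bar>?f N (GG K N \<omega>)\<bar>}"
      by (simp only: nn_integral_indicator[OF E1])
    have "(\<integral>\<^sup>+x. F (goe N x) \<partial>GX N) = (\<integral>\<^sup>+x. indicator {x \<in> space (GX N). t \<le> \<bar>?f N (goe N x)\<bar>} x \<partial>GX N)"
      by (intro nn_integral_cong) (simp add: F_def indicator_def)
    then have r: "(\<integral>\<^sup>+x. F (goe N x) \<partial>GX N) = emeasure (GX N) {x \<in> space (GX N). t \<le> \<bar>?f N (goe N x)\<bar>}"
      by (simp only: nn_integral_indicator[OF E2])
    have "measure (GX N) {x \<in> space (GX N). t \<le> \<bar>?f N (goe N x)\<bar>} = measure (MK K N) {\<omega> \<in> space (MK K N). t \<le> \<bar>?f N (GG K N \<omega>)\<bar>}"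
      using L unfolding l r measure_def by simp
    also have "\<dots> \<le> C * exp (- (t\<^sup>2 * real N / C))" using C(2)[OF N t] by (simp only: mk_def)
    finally show "measure (GX N) {x \<in> space (GX N). t \<le> \<bar>?f N (goe N x)\<bar>} \<le> C * exp (- (t\<^sup>2 * real N / C))" .
  qed
qed

lemma conv_goe_diag: "i \<ge> 1 \<Longrightarrow> conv GX (\<lambda>N x. ninner N (sk_m \<beta> h q N (goe N x) i) (sk_m \<beta> h q N (goe N x) i)) q"
  by (rule conv_goe_transfer[of i], rule amp_inv_diag[OF amp_inv_all[of i i]]) auto

lemma conv_goe_off: "i \<ge> 1 \<Longrightarrow> i < j \<Longrightarrow> conv GX (\<lambda>N x. ninner N (sk_m \<beta> h q N (goe N x) i) (sk_m \<beta> h q N (goe N x) j)) (\<rho> i)"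
  by (rule conv_goe_transfer[of j], rule amp_inv_off[OF amp_inv_all[of j j]]) auto

lemma diag_entries_bounded: "\<exists>B. wop GX (\<lambda>N x. nnorm N (\<lambda>i. x (Inr (i, i))) \<le> B)"
proof -
  interpret prob_family GX by (rule prob_family_GX)
  \<comment> \<open>Columns of height one: the squares of the diagonal Gaussians themselves are
    averaged.\<close>
  have "conv GX (\<lambda>N \<omega>. 1 / real N * (\<Sum>i=1..N. (\<lambda>k\<in>{1..1::nat}. \<omega> (Inr (i, i))) 1 * (\<lambda>k\<in>{1..1::nat}. \<omega> (Inr (i, i))) 1)) (\<integral>x. x 1 * x 1 \<partial>gauss {1..1::nat})"
    by (rule conv_column_average[where idx="\<lambda>k i. Inr (i, i)" and f="\<lambda>x. x 1 * x 1" and l=1])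
       (auto simp: inj_on_def Xidx_def power2_eq_square intro!: borel_measurable_times measurable_component_singleton)
  then have c: "conv GX (\<lambda>N \<omega>. ninner N (\<lambda>i. \<omega> (Inr (i, i))) (\<lambda>i. \<omega> (Inr (i, i)))) (\<integral>x. x 1 * x 1 \<partial>gauss {1..1::nat})"
    by (simp add: ninner_def)
  show ?thesis
  proof (rule exI, rule wop_mono[OF conv_bdd[OF c]])
    fix N \<omega> assume "\<bar>ninner N (\<lambda>i. \<omega> (Inr (i, i))) (\<lambda>i. \<omega> (Inr (i, i)))\<bar> \<le> \<bar>\<integral>x. x 1 * x 1 \<partial>gauss {1..1::nat}\<bar> + 1"
    then show "nnorm N (\<lambda>i. \<omega> (Inr (i, i))) \<le> sqrt (\<bar>\<integral>x. x 1 * x 1 \<partial>gauss {1..1::nat}\<bar> + 1)"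
      unfolding nnorm_def by (intro real_sqrt_le_mono) linarith
  qed
qed

text \<open>Diagonal entries are standard Gaussians times \<open>sqrt (2 / N)\<close> and the
  iterates are bounded, so this vector has norm of order \<open>1 / sqrt N\<close>, and
  \<open>negl_rate\<close> applies.\<close>

lemma negl_diag_part:
  "negl GX (\<lambda>N x. nnorm N (\<lambda>i. goe N x i i * sk_m \<beta> h q N (offdiag (goe N x)) k i))"
proof -
  interpret prob_family GX by (rule prob_family_GX)
  obtain B where B: "wop GX (\<lambda>N x. nnorm N (\<lambda>i. x (Inr (i, i))) \<le> B)" using diag_entries_bounded by blast
  let ?c = "max 1 (sqrt q)"
  have rv: "rvec GX (\<lambda>N x i. goe N x i i * sk_m \<beta> h q N (offdiag (goe N x)) k i)"
    using rvec_sk_m_offdiag[of \<beta> h q k] unfolding rvec_def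
    by (intro allI impI ballI borel_measurable_times borel_measurable_goe order_refl) blast+
  show ?thesis
  proof (rule negl_rate[OF rvs_nnorm[OF rv]], rule wop_mono[OF B])
    fix N and x :: "gidx \<Rightarrow> real" assume N: "N \<ge> (1 :: nat)" and b: "nnorm N (\<lambda>i. x (Inr (i, i))) \<le> B"
    have g: "goe N x i i = (sqrt 2 / sqrt (real N)) * x (Inr (i, i))" for i
      using N by (simp add: goe_def real_sqrt_mult field_simps)
    have "nnorm N (\<lambda>i. goe N x i i * sk_m \<beta> h q N (offdiag (goe N x)) k i) \<le> nnorm N (\<lambda>i. (sqrt 2 * ?c / sqrt (real N)) * x (Inr (i, i)))"
    proof (rule nnorm_mono)
      fix i
      have "\<bar>goe N x i i * sk_m \<beta> h q N (offdiag (goe N x)) k i\<bar> \<le> \<bar>goe N x i i\<bar> * ?c"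
        unfolding abs_mult by (intro mult_left_mono sk_m_bdd) simp
      then show "\<bar>goe N x i i * sk_m \<beta> h q N (offdiag (goe N x)) k i\<bar> \<le> \<bar>(sqrt 2 * ?c / sqrt (real N)) * x (Inr (i, i))\<bar>"
        unfolding g by (simp add: abs_mult mult.commute mult.left_commute)
    qed
    also have "\<dots> = (sqrt 2 * ?c / sqrt (real N)) * nnorm N (\<lambda>i. x (Inr (i, i)))" unfolding nnorm_cmult by simp
    also have "\<dots> \<le> (sqrt 2 * ?c / sqrt (real N)) * B" using b by (intro mult_left_mono) simp_all
    finally show "\<bar>nnorm N (\<lambda>i. goe N x i i * sk_m \<beta> h q N (offdiag (goe N x)) k i)\<bar> \<le> (sqrt 2 * ?c * B) / sqrt (real N)"
      by (simp add: nnorm_nonneg)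
  qed
qed

lemma mv_offdiag: "i \<in> {1..N} \<Longrightarrow> mv N G v i = mv N (offdiag G) v i + G i i * v i"
proof -
  assume i: "i \<in> {1..N}"
  have "mv N G v i = (\<Sum>j=1..N. offdiag G i j * v j + (G i j * v j) * (if i = j then 1 else 0))"
    unfolding mv_def by (intro sum.cong refl) (simp add: offdiag_def)
  then show ?thesis unfolding sum.distrib sum_mult_delta(2)[OF finite_atLeastAtMost i] mv_def .
qed

text \<open>The recursion is Lipschitz in the two preceding iterates, with constants from the
  operator norm bound 70 and the Onsager coefficient. The diagonal enters each step as a negligible
  inhomogeneity.\<close>

lemma negl_offdiag_diff:
  "negl GX (\<lambda>N x. nnorm N (\<lambda>i. sk_m \<beta> h q N (goe N x) k i - sk_m \<beta> h q N (offdiag (goe N x)) k i))"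
proof (induction k rule: less_induct)
  case (less k)
  interpret prob_family GX by (rule prob_family_GX)
  let ?d = "\<lambda>k N x i. sk_m \<beta> h q N (goe N x) k i - sk_m \<beta> h q N (offdiag (goe N x)) k i"
  consider "k = 0" | "k = 1" | l where "k = Suc (Suc l)" by (metis One_nat_def not0_implies_Suc)
  then show ?case
  proof cases
    case (3 l)
    let ?D = "\<lambda>N x i. goe N x i i * sk_m \<beta> h q N (offdiag (goe N x)) (Suc l) i"
    have n: "negl GX (\<lambda>N x. 70 * nnorm N (?d (Suc l) N x) + nnorm N (?D N x) + \<bar>\<beta> * (1 - q)\<bar> * nnorm N (?d l N x))"
      by (intro negl_add negl_cmult less negl_diag_part) (use 3 in auto)
    show ?thesis
    proof (rule negl_dom[OF rvs_nnorm[OF rvec_diff[OF rvec_sk_m_goe rvec_sk_m_offdiag]] n, where c=\<beta>], rule wop_mono[OF goe_op_norm])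
      fix N x assume N: "N \<ge> (1 :: nat)" and op: "\<forall>v. nnorm N (mv N (goe N x) v) \<le> 70 * nnorm N v"
      let ?e = "\<lambda>i. mv N (goe N x) (?d (Suc l) N x) i + ?D N x i - (\<beta> * (1 - q)) * ?d l N x i"
      have "\<bar>?d k N x i\<bar> \<le> \<bar>\<beta> * ?e i\<bar>" if i: "i \<in> {1..N}" for i
      proof -
        let ?a = "mv N (goe N x) (sk_m \<beta> h q N (goe N x) (Suc l)) i - \<beta> * (1 - q) * sk_m \<beta> h q N (goe N x) l i"
        let ?b = "mv N (offdiag (goe N x)) (sk_m \<beta> h q N (offdiag (goe N x)) (Suc l)) i - \<beta> * (1 - q) * sk_m \<beta> h q N (offdiag (goe N x)) l i"
        have "?d k N x i = Th \<beta> h ?a - Th \<beta> h ?b" using i unfolding 3 sk_m_Suc vec_of_def by (simp only: if_True)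
        moreover have "?e i = ?a - ?b" unfolding mv_diff using mv_offdiag[OF i, of "goe N x" "sk_m \<beta> h q N (offdiag (goe N x)) (Suc l)"]
          by (simp add: algebra_simps)
        moreover have "\<bar>\<beta> * ?e i\<bar> = \<beta> * \<bar>?e i\<bar>" using b by (simp only: abs_mult abs_of_pos)
        ultimately show ?thesis by (simp only: Th_lipschitz[OF b])
      qed
      then have "nnorm N (?d k N x) \<le> nnorm N (\<lambda>i. \<beta> * ?e i)" by (rule nnorm_mono)
      also have "\<dots> = \<beta> * nnorm N ?e" unfolding nnorm_cmult using b by simp
      also have "\<dots> \<le> \<beta> * (70 * nnorm N (?d (Suc l) N x) + nnorm N (?D N x) + \<bar>\<beta> * (1 - q)\<bar> * nnorm N (?d l N x))"
      proof (rule mult_left_mono)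
        have "nnorm N ?e \<le> nnorm N (\<lambda>i. mv N (goe N x) (?d (Suc l) N x) i + ?D N x i) + nnorm N (\<lambda>i. (\<beta> * (1 - q)) * ?d l N x i)" by (rule nnorm_diff)
        also have "nnorm N (\<lambda>i. mv N (goe N x) (?d (Suc l) N x) i + ?D N x i) \<le> nnorm N (mv N (goe N x) (?d (Suc l) N x)) + nnorm N (?D N x)" by (rule nnorm_triangle)
        also have "nnorm N (mv N (goe N x) (?d (Suc l) N x)) \<le> 70 * nnorm N (?d (Suc l) N x)" using op by blast
        also have "nnorm N (\<lambda>i. (\<beta> * (1 - q)) * ?d l N x i) = \<bar>\<beta> * (1 - q)\<bar> * nnorm N (?d l N x)" by (rule nnorm_cmult)
        finally show "nnorm N ?e \<le> 70 * nnorm N (?d (Suc l) N x) + nnorm N (?D N x) + \<bar>\<beta> * (1 - q)\<bar> * nnorm N (?d l N x)" by simp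
      qed (use b in simp)
      also have "\<dots> \<le> \<beta> * \<bar>70 * nnorm N (?d (Suc l) N x) + nnorm N (?D N x) + \<bar>\<beta> * (1 - q)\<bar> * nnorm N (?d l N x)\<bar>"
        using b by (intro mult_left_mono) auto
      finally show "\<bar>nnorm N (?d k N x)\<bar> \<le> \<beta> * \<bar>70 * nnorm N (?d (Suc l) N x) + nnorm N (?D N x) + \<bar>\<beta> * (1 - q)\<bar> * nnorm N (?d l N x)\<bar>"
        by (simp only: abs_of_nonneg nnorm_nonneg)
    qed
  qed (simp_all add: negl_zero)
qed

lemma conv_offdiag_transfer:
  assumes c: "conv GX (\<lambda>N x. ninner N (sk_m \<beta> h q N (goe N x) i) (sk_m \<beta> h q N (goe N x) j)) a"
  shows "conv GX (\<lambda>N x. ninner N (sk_m \<beta> h q N (offdiag (goe N x)) i) (sk_m \<beta> h q N (offdiag (goe N x)) j)) a"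
proof -
  interpret prob_family GX by (rule prob_family_GX)
  let ?m = "\<lambda>k N x. sk_m \<beta> h q N (goe N x) k" and ?o = "\<lambda>k N x. sk_m \<beta> h q N (offdiag (goe N x)) k"
  have bm: "wop GX (\<lambda>N x. nnorm N (?m k N x) \<le> max 1 (sqrt q))" "wop GX (\<lambda>N x. nnorm N (?o k N x) \<le> max 1 (sqrt q))" for k
    by (rule wop_True, rule nnorm_le_const, simp_all add: sk_m_bdd)+
  have n: "negl GX (\<lambda>N x. (-1) * (ninner N (\<lambda>l. ?m i N x l - ?o i N x l) (?m j N x) + ninner N (\<lambda>l. ?m j N x l - ?o j N x l) (?o i N x)))"
    by (intro negl_cmult negl_add negl_inner[OF rvec_diff[OF rvec_sk_m_goe rvec_sk_m_offdiag] _ negl_offdiag_diff bm(1)] negl_inner[OF rvec_diff[OF rvec_sk_m_goe rvec_sk_m_offdiag] _ negl_offdiag_diff bm(2)] rvec_sk_m_goe rvec_sk_m_offdiag)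
  have e: "ninner N (?o i N x) (?o j N x) - ninner N (?m i N x) (?m j N x)
      = (-1) * (ninner N (\<lambda>l. ?m i N x l - ?o i N x l) (?m j N x) + ninner N (\<lambda>l. ?m j N x l - ?o j N x l) (?o i N x))" for N x
    unfolding ninner_diff_left using ninner_commute[of N "?m j N x" "?o i N x"] ninner_commute[of N "?o j N x" "?o i N x"] by simp
  show ?thesis by (rule conv_negl_diff[OF c], unfold e, rule n)
qed

end

section \<open>The law of the disorder\<close>

definition Uidx :: "nat \<Rightarrow> (nat \<times> nat) set" where "Uidx N = {(i, j). 1 \<le> i \<and> i < j \<and> j \<le> N}"

definition sym_mat :: "(nat \<times> nat \<Rightarrow> real) \<Rightarrow> nat \<Rightarrow> nat \<Rightarrow> real" where
  "sym_mat y i j = (if i < j then y (i, j) else if j < i then y (j, i) else 0)"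

lemma finite_Uidx: "finite (Uidx N)"
  by (rule finite_subset[of _ "{1..N} \<times> {1..N}"]) (auto simp: Uidx_def)

lemma UidxD: "p \<in> Uidx N \<Longrightarrow> fst p \<in> {1..N} \<and> snd p \<in> {1..N} \<and> fst p < snd p"
  by (auto simp: Uidx_def)

lemma gauss_upper_law:
  assumes N: "N \<ge> 1"
  shows "distr (gauss (Uidx N)) (PiM (Uidx N) (\<lambda>_. borel)) (\<lambda>y. \<lambda>p\<in>Uidx N. y p / sqrt (real N))
    = distr (GX N) (PiM (Uidx N) (\<lambda>_. borel)) (\<lambda>x. \<lambda>p\<in>Uidx N. goe N x (fst p) (snd p))"
proof -
  let ?U = "Uidx N"
  define L where "L a i = (1 / sqrt (real N)) * (if a = i then 1 else 0)" for a i :: "nat \<times> nat"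
  let ?p = "\<lambda>(a :: nat) c. if a = c then 1 else (0 :: real)"
  have Ls: "(\<Sum>i\<in>?U. L a i * y i) = y a / sqrt (real N)" if "a \<in> ?U" for a and y :: "nat \<times> nat \<Rightarrow> real"
    using sum_mult_delta(2)[OF finite_Uidx that, of "\<lambda>i. y i / sqrt (real N)"] by (simp add: L_def mult.commute)
  have Ks: "(\<Sum>i\<in>Xidx N. goe_coef N ?p a i * x i) = goe N x (fst a) (snd a)" if "a \<in> ?U" for a x
    using goe_coef_delta[of "fst a" N "snd a" x] UidxD[OF that] by simp
  have pp: "(\<Sum>c=1..N. ?p a c * ?p e c) = ?p a e" if "e \<in> {1..N}" for a e
    using sum_mult_delta(2)[OF finite_atLeastAtMost that, of "?p a"] .
  have cov: "(\<Sum>i\<in>?U. L a i * L b i) = (\<Sum>j\<in>Xidx N. goe_coef N ?p a j * goe_coef N ?p b j)" if a: "a \<in> ?U" and b: "b \<in> ?U" for a b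
  proof -
    have "(\<Sum>i\<in>?U. L a i * L b i) = L b a / sqrt (real N)" by (rule Ls[OF a])
    also have "\<dots> = (if a = b then 1 else 0) / real N" using N by (simp add: L_def)
    \<comment> \<open>For two pairs that are both increasing the transposed term of the covariance
      is zero, which leaves variance \<open>1 / N\<close> without the diagonal factor 2.\<close>
    also have "\<dots> = (?p (fst a) (fst b) * ?p (snd a) (snd b) + ?p (fst a) (snd b) * ?p (snd a) (fst b)) / real N"
      using UidxD[OF a] UidxD[OF b] by (auto simp: prod_eq_iff)
    also have "\<dots> = (\<Sum>j\<in>Xidx N. goe_coef N ?p a j * goe_coef N ?p b j)"
      unfolding goe_coef_cov[OF N] using UidxD[OF b] by (simp only: pp)
    finally show ?thesis .
  qed
  have "distr (gauss ?U) (PiM ?U (\<lambda>_. borel)) (\<lambda>y. \<lambda>p\<in>?U. \<Sum>i\<in>?U. L p i * y i)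
    = distr (GX N) (PiM ?U (\<lambda>_. borel)) (\<lambda>x. \<lambda>p\<in>?U. \<Sum>i\<in>Xidx N. goe_coef N ?p p i * x i)"
    by (rule distr_linear_gauss_eq[OF finite_Uidx finite_Uidx finite_Xidx cov])
  moreover have "(\<lambda>y. \<lambda>p\<in>?U. \<Sum>i\<in>?U. L p i * y i) = (\<lambda>y. \<lambda>p\<in>?U. y p / sqrt (real N))"
    by (rule ext, rule restrict_ext, rule Ls)
  moreover have "(\<lambda>x. \<lambda>p\<in>?U. \<Sum>i\<in>Xidx N. goe_coef N ?p p i * x i) = (\<lambda>x. \<lambda>p\<in>?U. goe N x (fst p) (snd p))"
    by (rule ext, rule restrict_ext, rule Ks)
  ultimately show ?thesis by (simp only:)
qed

context
  fixes N :: nat and P :: "'a measure" and g :: "'a \<Rightarrow> nat \<Rightarrow> nat \<Rightarrow> real"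
  assumes N: "N \<ge> 1" and sk: "sk_disorder N P g"
begin

interpretation P: prob_space P using sk by (simp add: sk_disorder_def)

lemma disorder_distributed: "p \<in> Uidx N \<Longrightarrow> distributed P lborel (\<lambda>\<omega>. g \<omega> (fst p) (snd p)) (normal_density 0 (sqrt (1 / real N)))"
  using sk by (auto simp: sk_disorder_def Uidx_def)

lemma borel_measurable_disorder:
  assumes ab: "a \<in> {1..N}" "b \<in> {1..N}" shows "(\<lambda>\<omega>. g \<omega> a b) \<in> borel_measurable P"
proof -
  have up: "(\<lambda>\<omega>. g \<omega> a b) \<in> borel_measurable P" if "a \<in> {1..N}" "b \<in> {1..N}" "a < b" for a b
  proof -
    have "(a, b) \<in> Uidx N" using that by (simp add: Uidx_def)
    from distributed_measurable[OF disorder_distributed[OF this]] show ?thesis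
      unfolding measurable_lborel1 by (simp only: fst_conv snd_conv)
  qed
  consider "a < b" | "a = b" | "b < a" by linarith
  then show ?thesis
  proof cases
    case 1 show ?thesis by (rule up[OF ab 1])
  next
    case 2
    have "(\<lambda>\<omega>. g \<omega> a b) \<in> borel_measurable P \<longleftrightarrow> (\<lambda>\<omega>. 0 :: real) \<in> borel_measurable P"
      by (rule measurable_cong) (use sk ab 2 in \<open>auto simp: sk_disorder_def\<close>)
    then show ?thesis by (simp only: borel_measurable_const)
  next
    case 3
    have "(\<lambda>\<omega>. g \<omega> a b) \<in> borel_measurable P \<longleftrightarrow> (\<lambda>\<omega>. g \<omega> b a) \<in> borel_measurable P"
      by (rule measurable_cong) (use sk ab in \<open>auto simp: sk_disorder_def\<close>)
    then show ?thesis using up[OF ab(2,1) 3] by blast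
  qed
qed

lemma measurable_disorder_upper: "(\<lambda>\<omega>. \<lambda>p\<in>Uidx N. c * g \<omega> (fst p) (snd p)) \<in> measurable P (PiM (Uidx N) (\<lambda>_. borel))"
  by (rule measurable_restrict) (intro borel_measurable_times borel_measurable_const borel_measurable_disorder, auto simp: Uidx_def)

lemma disorder_scaled_law:
  "distr P (PiM (Uidx N) (\<lambda>_. borel)) (\<lambda>\<omega>. \<lambda>p\<in>Uidx N. sqrt (real N) * g \<omega> (fst p) (snd p)) = gauss (Uidx N)"
proof (cases "Uidx N = {}")
  \<comment> \<open>This is \<open>N = 1\<close>, with no entry above the diagonal: both sides are
    the probability measure on a one-point space. The independence criterion used in the other case
    asks for a nonempty index set.\<close>
  case True
  show ?thesis
  proof (rule char_PiM_unique[OF finite_Uidx])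
    show "prob_space (distr P (PiM (Uidx N) (\<lambda>_. borel)) (\<lambda>\<omega>. \<lambda>p\<in>Uidx N. sqrt (real N) * g \<omega> (fst p) (snd p)))"
      by (rule P.prob_space_distr[OF measurable_disorder_upper])
    then interpret D: prob_space "distr P (PiM (Uidx N) (\<lambda>_. borel)) (\<lambda>\<omega>. \<lambda>p\<in>Uidx N. sqrt (real N) * g \<omega> (fst p) (snd p))" .
    interpret G: prob_space "gauss (Uidx N)" by (rule prob_space_gauss)
    fix s :: "nat \<times> nat \<Rightarrow> real"
    show "(\<integral>x. iexp (\<Sum>p\<in>Uidx N. s p * x p) \<partial>distr P (PiM (Uidx N) (\<lambda>_. borel)) (\<lambda>\<omega>. \<lambda>p\<in>Uidx N. sqrt (real N) * g \<omega> (fst p) (snd p)))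
       = (\<integral>x. iexp (\<Sum>p\<in>Uidx N. s p * x p) \<partial>gauss (Uidx N))"
      unfolding True sum.empty using D.prob_space G.prob_space unfolding True by simp
  qed (simp_all only: prob_space_gauss sets_distr sets_gauss)
next
  case False
  let ?Y = "\<lambda>p \<omega>. sqrt (real N) * g \<omega> (fst p) (snd p)"
  have "P.indep_vars (\<lambda>_. borel) (\<lambda>p \<omega>. g \<omega> (fst p) (snd p)) (Uidx N)"
    using sk by (simp add: sk_disorder_def Uidx_def case_prod_unfold)
  then have ind: "P.indep_vars (\<lambda>_. borel) ?Y (Uidx N)"
    by (rule P.indep_vars_compose2) (intro borel_measurable_times borel_measurable_const measurable_id_borel)
  have rv: "?Y p \<in> borel_measurable P" if "p \<in> Uidx N" for p
    using UidxD[OF that] by (intro borel_measurable_times borel_measurable_const borel_measurable_disorder) auto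
  have std: "distr P borel (?Y p) = std_normal_distribution" if p: "p \<in> Uidx N" for p
  proof -
    have pos: "0 < sqrt (1 / real N)" using N by simp
    have "distributed P lborel (\<lambda>\<omega>. (g \<omega> (fst p) (snd p) - 0) / sqrt (1 / real N)) std_normal_density"
      using disorder_distributed[OF p] unfolding P.normal_standard_normal_convert[OF pos] .
    moreover have "(\<lambda>\<omega>. (g \<omega> (fst p) (snd p) - 0) / sqrt (1 / real N)) = ?Y p"
      by (rule ext) (simp add: real_sqrt_divide)
    ultimately have "distributed P lborel (?Y p) std_normal_density" by (simp only:)
    then have "distr P lborel (?Y p) = std_normal_distribution" by (rule distributed_distr_eq_density)
    moreover have "distr P borel (?Y p) = distr P lborel (?Y p)" by (rule distr_cong) auto
    ultimately show ?thesis by (simp only:)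
  qed
  have "distr P (PiM (Uidx N) (\<lambda>_. borel)) (\<lambda>\<omega>. \<lambda>p\<in>Uidx N. ?Y p \<omega>) = PiM (Uidx N) (\<lambda>p. distr P borel (?Y p))"
    using ind P.indep_vars_iff_distr_eq_PiM'[OF False rv, of "\<lambda>p. p"] by simp
  also have "\<dots> = gauss (Uidx N)" unfolding gauss_def by (intro PiM_cong refl std)
  finally show ?thesis .
qed

lemma disorder_law:
  "distr P (PiM (Uidx N) (\<lambda>_. borel)) (\<lambda>\<omega>. \<lambda>p\<in>Uidx N. g \<omega> (fst p) (snd p))
    = distr (GX N) (PiM (Uidx N) (\<lambda>_. borel)) (\<lambda>x. \<lambda>p\<in>Uidx N. goe N x (fst p) (snd p))"
proof -
  let ?B = "PiM (Uidx N) (\<lambda>_. borel :: real measure)"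
  have m: "(\<lambda>y. \<lambda>p\<in>Uidx N. y p / sqrt (real N)) \<in> measurable ?B ?B"
    by (rule measurable_restrict) (intro borel_measurable_divide borel_measurable_const measurable_component_singleton)
  have "distr (distr P ?B (\<lambda>\<omega>. \<lambda>p\<in>Uidx N. sqrt (real N) * g \<omega> (fst p) (snd p))) ?B (\<lambda>y. \<lambda>p\<in>Uidx N. y p / sqrt (real N))
    = distr P ?B ((\<lambda>y. \<lambda>p\<in>Uidx N. y p / sqrt (real N)) \<circ> (\<lambda>\<omega>. \<lambda>p\<in>Uidx N. sqrt (real N) * g \<omega> (fst p) (snd p)))"
    by (rule distr_distr[OF m measurable_disorder_upper])
  also have "(\<lambda>y. \<lambda>p\<in>Uidx N. y p / sqrt (real N)) \<circ> (\<lambda>\<omega>. \<lambda>p\<in>Uidx N. sqrt (real N) * g \<omega> (fst p) (snd p)) = (\<lambda>\<omega>. \<lambda>p\<in>Uidx N. g \<omega> (fst p) (snd p))"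
    using N by (intro ext) (simp add: restrict_def)
  finally show ?thesis unfolding disorder_scaled_law gauss_upper_law[OF N] by (rule sym)
qed

text \<open>Both matrices are rebuilt by \<open>sym_mat\<close> from their strict upper triangles,
  which have the same law by \<open>disorder_law\<close>. So the two deviation events are preimages
  of one and the same set of triangles.\<close>

lemma measure_disorder_eq:
  assumes F: "(\<lambda>y. F (mat_of y)) \<in> borel_measurable (PiM ({1..N} \<times> {1..N}) (\<lambda>_. borel))"
    and cong: "\<And>G G'. mat_eq N G G' \<Longrightarrow> F G = F G'"
  shows "measure P {\<omega> \<in> space P. t \<le> \<bar>F (g \<omega>) :: real\<bar>} = measure (GX N) {x \<in> space (GX N). t \<le> \<bar>F (offdiag (goe N x))\<bar>}"
proof -
  let ?B = "PiM (Uidx N) (\<lambda>_. borel :: real measure)"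
  let ?E = "{y \<in> space ?B. t \<le> \<bar>F (sym_mat y)\<bar>}"
  have mF: "(\<lambda>y. F (sym_mat y)) \<in> borel_measurable ?B"
  proof -
    have "(\<lambda>y. sym_mat y a b) \<in> borel_measurable ?B" if "a \<in> {1..N}" "b \<in> {1..N}" for a b
    proof -
      consider "a < b" | "a = b" | "b < a" by linarith
      then show ?thesis
      proof cases
        case 1
        then have e: "(\<lambda>y. sym_mat y a b) = (\<lambda>y. y (a, b))" and p: "(a, b) \<in> Uidx N" using that by (auto simp: sym_mat_def Uidx_def)
        show ?thesis unfolding e by (rule measurable_component_singleton[OF p])
      next
        case 2
        then have e: "(\<lambda>y. sym_mat y a b) = (\<lambda>y. 0)" by (simp add: sym_mat_def)
        show ?thesis unfolding e by (rule borel_measurable_const)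
      next
        case 3
        then have e: "(\<lambda>y. sym_mat y a b) = (\<lambda>y. y (b, a))" and p: "(b, a) \<in> Uidx N" using that by (auto simp: sym_mat_def Uidx_def)
        show ?thesis unfolding e by (rule measurable_component_singleton[OF p])
      qed
    qed
    from measurable_mat_fun[OF F cong this] show ?thesis .
  qed
  have E: "?E \<in> sets ?B" by (intro borel_measurable_le borel_measurable_const borel_measurable_abs mF)
  have u1: "(\<lambda>\<omega>. \<lambda>p\<in>Uidx N. g \<omega> (fst p) (snd p)) \<in> measurable P ?B" using measurable_disorder_upper[of 1] by (simp only: mult_1_left)
  have u2: "(\<lambda>x. \<lambda>p\<in>Uidx N. goe N x (fst p) (snd p)) \<in> measurable (GX N) ?B"
    by (rule measurable_restrict, rule borel_measurable_goe) (auto simp: Uidx_def)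
  have "F (g \<omega>) = F (sym_mat (\<lambda>p\<in>Uidx N. g \<omega> (fst p) (snd p)))" if "\<omega> \<in> space P" for \<omega>
    by (rule cong) (use that sk in \<open>auto simp: mat_eq_def sym_mat_def Uidx_def sk_disorder_def\<close>)
  then have "{\<omega> \<in> space P. t \<le> \<bar>F (g \<omega>)\<bar>} = (\<lambda>\<omega>. \<lambda>p\<in>Uidx N. g \<omega> (fst p) (snd p)) -` ?E \<inter> space P"
    using measurable_space[OF u1] by auto
  then have l: "measure P {\<omega> \<in> space P. t \<le> \<bar>F (g \<omega>)\<bar>} = measure (distr P ?B (\<lambda>\<omega>. \<lambda>p\<in>Uidx N. g \<omega> (fst p) (snd p))) ?E"
    by (simp only: measure_distr[OF u1 E])
  have "F (offdiag (goe N x)) = F (sym_mat (\<lambda>p\<in>Uidx N. goe N x (fst p) (snd p)))" for x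
    by (rule cong) (auto simp: mat_eq_def sym_mat_def Uidx_def offdiag_def goe_def add.commute)
  then have "{x \<in> space (GX N). t \<le> \<bar>F (offdiag (goe N x))\<bar>} = (\<lambda>x. \<lambda>p\<in>Uidx N. goe N x (fst p) (snd p)) -` ?E \<inter> space (GX N)"
    using measurable_space[OF u2] by auto
  then show ?thesis unfolding l disorder_law by (simp only: measure_distr[OF u2 E])
qed

end

theorem proposition2p5:
  fixes \<beta> h q :: real
    and P :: "nat \<Rightarrow> 'a measure"
    and g :: "nat \<Rightarrow> 'a \<Rightarrow> nat \<Rightarrow> nat \<Rightarrow> real"
  assumes "h > 0" and "\<beta> > 0"
    and "sk_fixed_point \<beta> h q"
    and "\<And>N. N \<ge> 1 \<Longrightarrow> sk_disorder N (P N) (g N)"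
  shows "(\<forall>k\<ge>1. exp_equiv P (\<lambda>N \<omega>. (nnorm N (sk_m \<beta> h q N (g N \<omega>) k))\<^sup>2) (\<lambda>N \<omega>. q)) \<and>
         (\<forall>j k. 1 \<le> j \<and> j < k \<longrightarrow>
            exp_equiv P (\<lambda>N \<omega>. ninner N (sk_m \<beta> h q N (g N \<omega>) j) (sk_m \<beta> h q N (g N \<omega>) k))
                        (\<lambda>N \<omega>. sk_rho \<beta> h q j) \<and>
            exp_equiv P (\<lambda>N \<omega>. ninner N (sk_phi \<beta> h q N (g N \<omega>) j) (sk_m \<beta> h q N (g N \<omega>) k))
                        (\<lambda>N \<omega>. sk_gamma \<beta> h q j))"
proof -
  interpret sk_system \<beta> h q by (rule sk_system.intro) (use assms in auto)
  have sk: "N \<ge> 1 \<Longrightarrow> sk_disorder N (P N) (g N)" for N by (rule assms(4))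
  interpret prob_family P
    by (rule prob_family.intro) (use sk in \<open>simp add: sk_disorder_def\<close>)
  let ?m = "\<lambda>N \<omega>. sk_m \<beta> h q N (g N \<omega>)"
  have mm: "rvec P (\<lambda>N \<omega>. ?m N \<omega> k)" for k
    unfolding rvec_def
    by (intro allI impI ballI borel_measurable_sk_m borel_measurable_disorder[OF _ sk])
  \<comment> \<open>Only inner products of iterates are carried from the Gaussian model to the given
    disorder.\<close>
  have tr: "conv P (\<lambda>N \<omega>. ninner N (?m N \<omega> i) (?m N \<omega> j)) a"
    if c: "conv GX (\<lambda>N x. ninner N (sk_m \<beta> h q N (goe N x) i) (sk_m \<beta> h q N (goe N x) j)) a" for i j a
  proof -
    let ?F = "\<lambda>N G. ninner N (sk_m \<beta> h q N G i) (sk_m \<beta> h q N G j) - a"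
    from conv_offdiag_transfer[OF c] obtain C where C: "C > 0" "\<And>N t. N \<ge> 1 \<Longrightarrow> 0 < t \<and> t \<le> 1 \<Longrightarrow>
        measure (GX N) {x \<in> space (GX N). t \<le> \<bar>?F N (offdiag (goe N x))\<bar>} \<le> C * exp (- (t\<^sup>2 * real N / C))"
      unfolding negl_def by blast
    show ?thesis unfolding negl_def
    proof (intro conjI exI[of _ C] allI impI C(1) rvs_diff rvs_ninner mm rvs_const)
      fix N :: nat and t :: real assume N: "1 \<le> N" and t: "0 < t \<and> t \<le> 1"
      have F: "(\<lambda>y. ?F N (mat_of y)) \<in> borel_measurable (PiM ({1..N} \<times> {1..N}) (\<lambda>_. borel))"
        by (intro borel_measurable_diff measurable_sk_inner borel_measurable_const)
      have "?F N G = ?F N G'" if "mat_eq N G G'" for G G' by (simp only: sk_m_cong[OF that])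
      from measure_disorder_eq[OF N sk[OF N] F this] C(2)[OF N t]
      show "measure (P N) {\<omega> \<in> space (P N). t \<le> \<bar>?F N (g N \<omega>)\<bar>} \<le> C * exp (- (t\<^sup>2 * real N / C))" by (simp only:)
    qed
  qed
  have diag: "conv P (\<lambda>N \<omega>. ninner N (?m N \<omega> k) (?m N \<omega> k)) q" if "k \<ge> 1" for k by (rule tr[OF conv_goe_diag[OF that]])
  have off: "conv P (\<lambda>N \<omega>. ninner N (?m N \<omega> j) (?m N \<omega> k)) (\<rho> j)" if "1 \<le> j" "j < k" for j k by (rule tr[OF conv_goe_off[OF that]])
  have pos: "(\<Sum>l=1..j - 1. (\<gamma> l)\<^sup>2) < q" for j using G2_less[of "j - 1"] by (simp only: G2_def)
  have rel: "\<gamma> j * sqrt (q - (\<Sum>l=1..j - 1. (\<gamma> l)\<^sup>2)) = \<rho> j - (\<Sum>l=1..j - 1. (\<gamma> l)\<^sup>2)" if "1 \<le> j" for j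
    using gamma_rel[OF that G2_less] by (simp only: G2_def)
  \<comment> \<open>The directions are not transferred: under \<open>P\<close> their inner products
    follow from those of the iterates by Gram-Schmidt.\<close>
  have phi: "conv P (\<lambda>N \<omega>. ninner N (gs_phi N (?m N \<omega>) j) (?m N \<omega> k)) (\<gamma> j)" if j: "1 \<le> j" "j < k" for j k
  proof -
    have jj: "j \<in> {1..j}" using j by simp
    have diag': "conv P (\<lambda>N \<omega>. ninner N (?m N \<omega> i) (?m N \<omega> i)) q" if "i \<in> {1..j}" for i
      by (rule diag) (use that in simp)
    have rel': "\<gamma> i * sqrt (q - (\<Sum>l=1..i - 1. (\<gamma> l)\<^sup>2)) = \<rho> i - (\<Sum>l=1..i - 1. (\<gamma> l)\<^sup>2)" if "i \<in> {1..j}" for i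
      by (rule rel) (use that in simp)
    have off': "conv P (\<lambda>N \<omega>. ninner N (?m N \<omega> i) (?m N \<omega> k)) (\<rho> i)" if "i \<in> {1..j}" for i
      by (rule off) (use that j in auto)
    note C = conv_gram_schmidt[where v="?m" and n=j and r=\<rho> and g=\<gamma> and q=q, OF supp_sk_m mm diag' off pos rel' jj]
    show ?thesis by (rule conjunct2[OF C, rule_format]) (assumption | rule mm off')+
  qed
  show ?thesis
  proof (intro conjI allI impI)
    fix k :: nat assume "1 \<le> k"
    then show "exp_equiv P (\<lambda>N \<omega>. (nnorm N (?m N \<omega> k))\<^sup>2) (\<lambda>N \<omega>. q)"
      unfolding nnorm_square by (subst exp_equiv_iff_negl) (rule rvs_ninner[OF mm mm], rule rvs_const, rule diag)
  next
    fix j k :: nat assume jk: "1 \<le> j \<and> j < k"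
    then have jk': "1 \<le> j" "j < k" by auto
    show "exp_equiv P (\<lambda>N \<omega>. ninner N (?m N \<omega> j) (?m N \<omega> k)) (\<lambda>N \<omega>. \<rho> j)"
      by (subst exp_equiv_iff_negl) (rule rvs_ninner[OF mm mm], rule rvs_const, rule off[OF jk'])
    show "exp_equiv P (\<lambda>N \<omega>. ninner N (sk_phi \<beta> h q N (g N \<omega>) j) (?m N \<omega> k)) (\<lambda>N \<omega>. \<gamma> j)"
      unfolding sk_phi_gs by (subst exp_equiv_iff_negl) (rule conv_rvs[OF phi[OF jk']], rule rvs_const, rule phi[OF jk'])
  qed
qed

end
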